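(* Let the magnetic permeability $\mu=\mu_0$ be constant and let the electric permittivity $\epsilon:\mathbb{R}^3\to\mathbb{R}$ be periodic with respect to a three-dimensional lattice $\mathcal{K}$, i.e. $\epsilon(\mathbf{x}+\mathbf{k})=\epsilon(\mathbf{x})$ for all $\mathbf{x}\in\mathbb{R}^3$, $\mathbf{k}\in\mathcal{K}$, and satisfy $$\epsilon>0,\quad \epsilon\in \mathrm{L}^\infty(\mathbb{R}^3),\quad \epsilon^{-1}\in \mathrm{L}^\infty(\mathbb{R}^3).$$ Let $n>0$ be given by $\epsilon=\epsilon_0n^2$ ($\epsilon_0>0$ constant). Then for any $\boldsymbol{\xi}$ in the first Brillouin zone $\mathcal{B}$ of $\mathcal{K}$, the space $$\mathbf{V}_{\boldsymbol{\xi}}:=\{\mathbf{v}\in \mathbb{L}^2_{\mathrm{per}}:\ \nabla_{\boldsymbol{\xi}}\times\mathbf{v}\in \mathbb{L}^2_{\mathrm{per}},\ \nabla_{\boldsymbol{\xi}}\cdot\mathbf{v}=0\}$$ is contained in the Sobolev space $\mathbb{H}^1_{\mathrm{per}}$. Moreover the sesquilinear form $$a_{\boldsymbol{\xi}}(\mathbf{u},\mathbf{v}):=\int_Q\tfrac{1}{n^2}\,\nabla_{\boldsymbol{\xi}}\times\mathbf{u}\cdot\overline{\nabla_{\boldsymbol{\xi}}\times\mathbf{v}}\;dx\,dy\,dz,\qquad \mathbf{u},\mathbf{v}\in\mathbf{V}_{\boldsymbol{\xi}},$$ satisfies a Gårding inequality on $\mathbf{V}_{\boldsymbol{\xi}}$: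 for any $\boldsymbol{\xi}\in\mathcal{B}$ and $\mathbf{v}\in\mathbf{V}_{\boldsymbol{\xi}}$, $$\|n\|^2_{\mathrm{L}^\infty_{\mathrm{per}}}\,a_{\boldsymbol{\xi}}(\mathbf{v},\mathbf{v})+(3|\boldsymbol{\xi}|^2+1)\|\mathbf{v}\|^2_{\mathbb{L}^2_{\mathrm{per}}}\ \ge\ \tfrac12\|\mathbf{v}\|^2_{\mathbb{H}^1_{\mathrm{per}}}.$$ The spectrum of $L_{\boldsymbol{\xi}}$, the self-adjoint operator $\nabla_{\boldsymbol{\xi}}\times(\tfrac{1}{n^2}\nabla_{\boldsymbol{\xi}}\times\cdot)$ associated with $a_{\boldsymbol{\xi}}$ on the form domain $\mathbf{V}_{\boldsymbol{\xi}}$, is discrete and formed by a sequence of nonnegative eigenvalues.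
   Context: Lattice: $\mathcal{K}=\{k_1\mathbf{a}_1+k_2\mathbf{a}_2+k_3\mathbf{a}_3:\ k_1,k_2,k_3\in\mathbb{Z}\}$ with $\mathbf{a}_1,\mathbf{a}_2,\mathbf{a}_3\in\mathbb{R}^3$ linearly independent; $Q=\mathbb{R}^3/\mathcal{K}$ is the period cell (torus). The first Brillouin zone $\mathcal{B}$ is the Wigner-Seitz cell (points at least as close to $0$ as to any other lattice point) of the reciprocal lattice $\{\mathbf{g}\in\mathbb{R}^3:\mathbf{g}\cdot\mathbf{k}\in2\pi\mathbb{Z}\ \forall\mathbf{k}\in\mathcal{K}\}$. $\nabla_{\boldsymbol{\xi}}:=(\partial_x,\partial_y,\partial_z)+i\boldsymbol{\xi}$, acting through formal cross and dot products in the sense of distributions: $\nabla_{\boldsymbol{\xi}}\times\mathbf{v}=\nabla\times\mathbf{v}+i\boldsymbol{\xi}\times\mathbf{v}$, $\nabla_{\boldsymbol{\xi}}\cdot\mathbf{v}=\nabla\cdot\mathbf{v}+i\boldsymbol{\xi}\cdot\mathbf{v}$. $\mathbb{L}^2_{\mathrm{per}}$ (resp. $\mathbb{H}^1_{\mathrm{per}}$) is the space of $\mathbb{C}^3$-valued fields in $\mathrm{L}^2_{\mathrm{loc}}(\mathbb{R}^3)^3$ (resp. $\mathrm{H}^1_{\mathrm{loc}}(\mathbb{R}^3)^3$) periodic with respect to $\mathcal{K}$, identified with $\mathrm{L}^2(Q)^3$ (resp. $\mathrm{H}^1(Q)^3$) with the corresponding norms, $\|\mathbf{v}\|^2_{\mathbb{H}^1_{\mathrm{per}}}=\|\mathbf{v}\|^2_{\mathbb{L}^2_{\mathrm{per}}}+\|\nabla\mathbf{v}\|^2_{\mathbb{L}^2_{\mathrm{per}}}$;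 $\mathrm{L}^\infty_{\mathrm{per}}$ is the space of $\mathcal{K}$-periodic $\mathrm{L}^\infty$ functions. The operator $L_{\boldsymbol{\xi}}$ is considered on the Hilbert space $\{\mathbf{v}\in\mathbb{L}^2_{\mathrm{per}}:\nabla_{\boldsymbol{\xi}}\cdot\mathbf{v}=0\}$ with form domain $\mathbf{V}_{\boldsymbol{\xi}}$. *)

theory Defs
  imports "HOL-Analysis.Analysis" "HOL-Probability.Essential_Supremum"
begin

(* Elements of the Lebesgue and Sobolev spaces are represented by functions; all notions below
   respect equality almost everywhere, which plays the role of equality in these spaces. *)

type_synonym r3 = "real^3"
type_synonym field = "real^3 \<Rightarrow> complex^3"
type_synonym distrib = "(real^3 \<Rightarrow> complex) \<Rightarrow> complex"


section \<open>Lattice, period cell, Brillouin zone\<close>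

definition lattice :: "(3 \<Rightarrow> r3) \<Rightarrow> r3 set" where
  "lattice a = {\<Sum>i\<in>UNIV. of_int (k i) *\<^sub>R a i | k :: 3 \<Rightarrow> int. True}"

(* A fundamental domain of the torus Q = R^3 / K; integrals of K-periodic functions over Q
   are integrals over this set. *)
definition cell :: "(3 \<Rightarrow> r3) \<Rightarrow> r3 set" where
  "cell a = {\<Sum>i\<in>UNIV. t i *\<^sub>R a i | t :: 3 \<Rightarrow> real. \<forall>i. 0 \<le> t i \<and> t i < 1}"

definition reciprocal_lattice :: "(3 \<Rightarrow> r3) \<Rightarrow> r3 set" where
  "reciprocal_lattice a = {g. \<forall>k\<in>lattice a. \<exists>m::int. g \<bullet> k = 2 * pi * of_int m}"

definition brillouin :: "(3 \<Rightarrow> r3) \<Rightarrow> r3 set" where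
  "brillouin a = {\<xi>. \<forall>g\<in>reciprocal_lattice a. dist \<xi> 0 \<le> dist \<xi> g}"


section \<open>Distributions on three-dimensional space\<close>

definition pd :: "3 \<Rightarrow> (r3 \<Rightarrow> complex) \<Rightarrow> r3 \<Rightarrow> complex" where
  "pd j f x = frechet_derivative f (at x) (axis j 1)"

primrec Ck :: "nat \<Rightarrow> (r3 \<Rightarrow> complex) \<Rightarrow> bool" where
  "Ck 0 f \<longleftrightarrow> continuous_on UNIV f"
| "Ck (Suc k) f \<longleftrightarrow> (\<forall>x. f differentiable (at x)) \<and> (\<forall>j. Ck k (pd j f))"

definition test_functions :: "(r3 \<Rightarrow> complex) set" where
  "test_functions = {\<phi>. (\<forall>k. Ck k \<phi>) \<and> compact (closure {x. \<phi> x \<noteq> 0})}"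

(* Distributions are only compared on test functions (they arise here from locally integrable
   functions by differentiation, so linearity and continuity need not be imposed). *)
definition distrib_eq :: "distrib \<Rightarrow> distrib \<Rightarrow> bool" (infix \<open>\<simeq>\<close> 50) where
  "T \<simeq> S \<longleftrightarrow> (\<forall>\<phi>\<in>test_functions. T \<phi> = S \<phi>)"

definition reg :: "field \<Rightarrow> 3 \<Rightarrow> distrib" where
  "reg v i \<phi> = (LINT x|lebesgue. v x $ i * \<phi> x)"

(* The j-th component of \<nabla> + i\<xi> as an operator on distributions. *)
definition nabla :: "r3 \<Rightarrow> 3 \<Rightarrow> distrib \<Rightarrow> distrib" where
  "nabla \<xi> j T = (\<lambda>\<phi>. - T (pd j \<phi>) + \<i> * complex_of_real (\<xi> $ j) * T \<phi>)"

(* The index type 3 is cyclic (3 + 1 = 1), so that the first component is D2 T3 - D3 T2 and so on. *)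
definition nabla_cross :: "r3 \<Rightarrow> (3 \<Rightarrow> distrib) \<Rightarrow> 3 \<Rightarrow> distrib" where
  "nabla_cross \<xi> T j = (\<lambda>\<phi>. nabla \<xi> (j + 1) (T (j + 2)) \<phi> - nabla \<xi> (j + 2) (T (j + 1)) \<phi>)"

definition nabla_dot :: "r3 \<Rightarrow> (3 \<Rightarrow> distrib) \<Rightarrow> distrib" where
  "nabla_dot \<xi> T = (\<lambda>\<phi>. \<Sum>j\<in>UNIV. nabla \<xi> j (T j) \<phi>)"


section \<open>Function spaces\<close>

definition Linf :: "(r3 \<Rightarrow> real) set" where
  "Linf = {f \<in> borel_measurable lebesgue. esssup lebesgue (\<lambda>x. ereal \<bar>f x\<bar>) < \<infinity>}"

definition Linf_norm :: "(r3 \<Rightarrow> real) \<Rightarrow> real" where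
  "Linf_norm f = real_of_ereal (esssup lebesgue (\<lambda>x. ereal \<bar>f x\<bar>))"

definition L2_loc :: "field set" where
  "L2_loc = {v \<in> borel_measurable lebesgue.
     \<forall>C. compact C \<longrightarrow> set_integrable lebesgue C (\<lambda>x. (norm (v x))\<^sup>2)}"

definition L2_per :: "(3 \<Rightarrow> r3) \<Rightarrow> field set" where
  "L2_per a = {v \<in> L2_loc. \<forall>k\<in>lattice a. AE x in lebesgue. v (x + k) = v x}"

definition hdot :: "complex^3 \<Rightarrow> complex^3 \<Rightarrow> complex" where
  "hdot z w = (\<Sum>i\<in>UNIV. z $ i * cnj (w $ i))"

definition L2_inner :: "(3 \<Rightarrow> r3) \<Rightarrow> field \<Rightarrow> field \<Rightarrow> complex" where
  "L2_inner a u v = (LINT x:cell a|lebesgue. hdot (u x) (v x))"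

definition L2_norm :: "(3 \<Rightarrow> r3) \<Rightarrow> field \<Rightarrow> real" where
  "L2_norm a v = sqrt (LINT x:cell a|lebesgue. (norm (v x))\<^sup>2)"

definition is_weak_pd :: "3 \<Rightarrow> field \<Rightarrow> field \<Rightarrow> bool" where
  "is_weak_pd j v w \<longleftrightarrow> (\<forall>i. nabla 0 j (reg v i) \<simeq> reg w i)"

definition H1_loc :: "field set" where
  "H1_loc = {v \<in> L2_loc. \<forall>j. \<exists>w\<in>L2_loc. is_weak_pd j v w}"

definition H1_per :: "(3 \<Rightarrow> r3) \<Rightarrow> field set" where
  "H1_per a = {v \<in> H1_loc. \<forall>k\<in>lattice a. AE x in lebesgue. v (x + k) = v x}"

(* Unique up to equality almost everywhere, if it exists; similarly for wcurl. *)
definition weak_pd :: "3 \<Rightarrow> field \<Rightarrow> field" where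
  "weak_pd j v = (SOME w. w \<in> L2_loc \<and> is_weak_pd j v w)"

definition H1_norm :: "(3 \<Rightarrow> r3) \<Rightarrow> field \<Rightarrow> real" where
  "H1_norm a v = sqrt ((L2_norm a v)\<^sup>2 + (\<Sum>j\<in>UNIV. (L2_norm a (weak_pd j v))\<^sup>2))"

definition is_wcurl :: "r3 \<Rightarrow> field \<Rightarrow> field \<Rightarrow> bool" where
  "is_wcurl \<xi> v w \<longleftrightarrow> (\<forall>i. nabla_cross \<xi> (reg v) i \<simeq> reg w i)"

definition wcurl :: "r3 \<Rightarrow> field \<Rightarrow> field" where
  "wcurl \<xi> v = (SOME w. w \<in> L2_loc \<and> is_wcurl \<xi> v w)"

definition H_space :: "(3 \<Rightarrow> r3) \<Rightarrow> r3 \<Rightarrow> field set" where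
  "H_space a \<xi> = {v \<in> L2_per a. nabla_dot \<xi> (reg v) \<simeq> (\<lambda>\<phi>. 0)}"

definition V_space :: "(3 \<Rightarrow> r3) \<Rightarrow> r3 \<Rightarrow> field set" where
  "V_space a \<xi> = {v \<in> L2_per a. (\<exists>w\<in>L2_per a. is_wcurl \<xi> v w) \<and>
                                 nabla_dot \<xi> (reg v) \<simeq> (\<lambda>\<phi>. 0)}"

definition a_form :: "(3 \<Rightarrow> r3) \<Rightarrow> (r3 \<Rightarrow> real) \<Rightarrow> r3 \<Rightarrow> field \<Rightarrow> field \<Rightarrow> complex" where
  "a_form a n \<xi> u v =
     (LINT x:cell a|lebesgue. complex_of_real (1 / (n x)\<^sup>2) * hdot (wcurl \<xi> u x) (wcurl \<xi> v x))"


section \<open>Unbounded operators on subspaces of \<open>L2_per\<close>\<close>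

(* An operator on a closed subspace H of L2_per is given by its graph, a set of pairs (u, Lu) of
   representatives. *)
type_synonym oper = "(field \<times> field) set"

definition form_operator :: "(3 \<Rightarrow> r3) \<Rightarrow> field set \<Rightarrow> field set \<Rightarrow> (field \<Rightarrow> field \<Rightarrow> complex) \<Rightarrow> oper" where
  "form_operator a H V b = {(u, f). u \<in> V \<and> f \<in> H \<and> (\<forall>v\<in>V. b u v = L2_inner a f v)}"

definition linear_operator :: "field set \<Rightarrow> oper \<Rightarrow> bool" where
  "linear_operator H G \<longleftrightarrow>
     G \<subseteq> H \<times> H \<and> ((\<lambda>x. 0), (\<lambda>x. 0)) \<in> G \<and>
     (\<forall>(u, f)\<in>G. \<forall>(v, g)\<in>G. \<forall>c. ((\<lambda>x. c *s u x + v x), (\<lambda>x. c *s f x + g x)) \<in> G) \<and>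
     (\<forall>(u, f)\<in>G. \<forall>(v, g)\<in>G. (AE x in lebesgue. u x = v x) \<longrightarrow> (AE x in lebesgue. f x = g x))"

definition densely_defined :: "(3 \<Rightarrow> r3) \<Rightarrow> field set \<Rightarrow> oper \<Rightarrow> bool" where
  "densely_defined a H G \<longleftrightarrow> (\<forall>h\<in>H. \<forall>e>0. \<exists>(u, f)\<in>G. L2_norm a (\<lambda>x. h x - u x) < e)"

definition adjoint_op :: "(3 \<Rightarrow> r3) \<Rightarrow> field set \<Rightarrow> oper \<Rightarrow> oper" where
  "adjoint_op a H G =
     {(v, g). v \<in> H \<and> g \<in> H \<and> (\<forall>(u, f)\<in>G. L2_inner a f v = L2_inner a u g)}"

definition self_adjoint :: "(3 \<Rightarrow> r3) \<Rightarrow> field set \<Rightarrow> oper \<Rightarrow> bool" where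
  "self_adjoint a H G \<longleftrightarrow> linear_operator H G \<and> densely_defined a H G \<and> adjoint_op a H G = G"

(* G - z is a bijection from its domain onto H with bounded inverse. *)
definition resolvent_set :: "(3 \<Rightarrow> r3) \<Rightarrow> field set \<Rightarrow> oper \<Rightarrow> complex set" where
  "resolvent_set a H G = {z.
     (\<forall>h\<in>H. \<exists>(u, f)\<in>G. AE x in lebesgue. f x - z *s u x = h x) \<and>
     (\<exists>C. \<forall>(u, f)\<in>G. L2_norm a u \<le> C * L2_norm a (\<lambda>x. f x - z *s u x))}"

definition op_spectrum :: "(3 \<Rightarrow> r3) \<Rightarrow> field set \<Rightarrow> oper \<Rightarrow> complex set" where
  "op_spectrum a H G = - resolvent_set a H G"

definition eigenspace :: "oper \<Rightarrow> complex \<Rightarrow> field set" where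
  "eigenspace G z = {u. \<exists>f. (u, f) \<in> G \<and> (AE x in lebesgue. f x = z *s u x)}"

definition is_eigenvalue :: "oper \<Rightarrow> complex \<Rightarrow> bool" where
  "is_eigenvalue G z \<longleftrightarrow> (\<exists>u\<in>eigenspace G z. \<not> (AE x in lebesgue. u x = 0))"

definition finite_multiplicity :: "oper \<Rightarrow> complex \<Rightarrow> bool" where
  "finite_multiplicity G z \<longleftrightarrow>
     (\<exists>S. finite S \<and> S \<subseteq> eigenspace G z \<and>
        (\<forall>u\<in>eigenspace G z. \<exists>c. AE x in lebesgue. u x = (\<Sum>s\<in>S. c s *s s x)))"

definition discrete_spectrum :: "(3 \<Rightarrow> r3) \<Rightarrow> field set \<Rightarrow> oper \<Rightarrow> bool" where
  "discrete_spectrum a H G \<longleftrightarrow>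
     discrete (op_spectrum a H G) \<and>
     (\<forall>z\<in>op_spectrum a H G. is_eigenvalue G z \<and> finite_multiplicity G z)"

definition L_op :: "(3 \<Rightarrow> r3) \<Rightarrow> (r3 \<Rightarrow> real) \<Rightarrow> r3 \<Rightarrow> oper" where
  "L_op a n \<xi> = form_operator a (H_space a \<xi>) (V_space a \<xi>) (a_form a n \<xi>)"

end

theory Submission
  imports Defs "HOL-Library.Function_Algebras"
begin

text \<open>
The theorem is proved by Fourier series, which turn all differential operators into multiplications,
combined with the abstract theory of a closed nonnegative form whose domain is compactly embedded.

Let \<open>g\<close> range over the reciprocal lattice and let \<open>v\<^sub>g\<close> denote the Fourier coefficients of a periodic
field \<open>v\<close>. The components of \<open>\<nabla> + \<i> \<xi>\<close> act as multiplication by those of \<open>\<i> (g + \<xi>)\<close>. If \<open>v\<close> is free of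
divergence, then \<open>v\<^sub>g\<close> is orthogonal to \<open>g + \<xi>\<close>, so that the coefficients of its curl have length
\<open>|g + \<xi>| |v\<^sub>g|\<close> (\<open>crossc_norm\<close>). Together with \<open>|g|\<^sup>2 \<le> 2 |g + \<xi>|\<^sup>2 + 2 |\<xi>|\<^sup>2\<close> and Parseval's identity this
gives the regularity of the form domain (\<open>V_subset_H1\<close>) and the inequality of Garding (\<open>garding\<close>). As
\<open>|g + \<xi>|\<close> tends to infinity, sets that are bounded in the form norm are precompact (\<open>rellich\<close>).

The differential operators are defined through test functions on the whole space, the Fourier
coefficients through integrals over a period cell. The two are linked by \<open>fourier_rep\<close>: a periodic field,
as a distribution, pairs with a test function \<open>\<phi>\<close> as the series of its Fourier coefficients
with the values of the Fourier transform of \<open>\<phi>\<close> on the reciprocal lattice (\<open>fourier_rep_reg\<close>). Test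
functions of the form \<open>\<chi> exp (- \<i> g \<bullet> x)\<close>, where the lattice translates of \<open>\<chi>\<close> sum to 1, recover the single
coefficients, so that an equation between distributions is the same as an equation between coefficients
(\<open>fourier_rep_eq\<close>). The completeness of the plane waves, proved from the theorem of Stone and Weierstrass on the
torus (\<open>E_total\<close>), gives Parseval's identity and also the fact that a locally square integrable field
is determined by its distribution (\<open>distributions_determine\<close>); the latter makes weak derivatives and
curls unique.

On the abstract side (\<open>compact_form\<close>), the representation theorem of Riesz in the form domain shows
that the operator plus the identity is onto (\<open>G_onto\<close>), and a symmetric operator with this property is self-adjoint
(\<open>G_adjoint\<close>). Compactness of the embedding implies that a number which is not an eigenvalue belongs to the
resolvent set (\<open>resolvent_bounded\<close>, \<open>resolvent_onto\<close>) and that orthonormal sets of bounded energy are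
finite (\<open>maximal_orthonormal\<close>); hence eigenvalues have finite multiplicity and do not accumulate.
Minimising the Rayleigh quotient orthogonally to finitely many eigenvectors always produces another one
(\<open>eigenvector_orthogonal_to\<close>), so there are infinitely many eigenvalues.
\<close>

section \<open>Semi-inner product spaces\<close>

text \<open>Elements of Lebesgue spaces are functions here, and equality in the space is equality almost
everywhere. Instead of passing to a quotient, the Hilbert space theory is developed for a
semi-inner product: equality of \<^term>\<open>x\<close> and \<^term>\<open>y\<close> in the Hilbert space is
replaced by \<open>nrm (x - y) = 0\<close>. The carrier is a set because the \<open>L\<^sup>2\<close> product is
additive on square integrable fields only, and because a Hilbert space of fields and the form domain
inside it are to live on the same type.\<close>

locale semi_inner = vector_space scale
  for scale :: "complex \<Rightarrow> 'v::ab_group_add \<Rightarrow> 'v" (infixr \<open>\<odot>\<close> 75) +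
  fixes H :: "'v set" and ip :: "'v \<Rightarrow> 'v \<Rightarrow> complex"
  assumes subspace_H: "subspace H"
    and ip_add: "\<lbrakk>x \<in> H; y \<in> H; z \<in> H\<rbrakk> \<Longrightarrow> ip (x + y) z = ip x z + ip y z"
    and ip_scale: "\<lbrakk>x \<in> H; z \<in> H\<rbrakk> \<Longrightarrow> ip (c \<odot> x) z = c * ip x z"
    and ip_sym: "\<lbrakk>x \<in> H; y \<in> H\<rbrakk> \<Longrightarrow> ip y x = cnj (ip x y)"
    and ip_nonneg: "x \<in> H \<Longrightarrow> 0 \<le> Re (ip x x)"
begin

definition nrm :: "'v \<Rightarrow> real" where "nrm x = sqrt (Re (ip x x))"

definition lim_to :: "(nat \<Rightarrow> 'v) \<Rightarrow> 'v \<Rightarrow> bool" where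
  "lim_to X x \<longleftrightarrow> (\<lambda>n. nrm (X n - x)) \<longlonglongrightarrow> 0"

definition cauchy :: "(nat \<Rightarrow> 'v) \<Rightarrow> bool" where
  "cauchy X \<longleftrightarrow> (\<forall>e>0. \<exists>N. \<forall>m\<ge>N. \<forall>n\<ge>N. nrm (X m - X n) < e)"

lemma H_zero [simp, intro]: "0 \<in> H"
  using subspace_H by (rule subspace_0)
lemma H_add [simp, intro]: "x \<in> H \<Longrightarrow> y \<in> H \<Longrightarrow> x + y \<in> H"
  using subspace_H by (rule subspace_add)
lemma H_diff [simp, intro]: "x \<in> H \<Longrightarrow> y \<in> H \<Longrightarrow> x - y \<in> H"
  using subspace_H by (rule subspace_diff)
lemma H_scale [simp, intro]: "x \<in> H \<Longrightarrow> c \<odot> x \<in> H"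
  using subspace_H by (rule subspace_scale)
lemma H_sum [intro]: "(\<And>i. i \<in> A \<Longrightarrow> f i \<in> H) \<Longrightarrow> sum f A \<in> H"
  using subspace_H by (rule subspace_sum)

lemma ip_add_right: "\<lbrakk>x \<in> H; y \<in> H; z \<in> H\<rbrakk> \<Longrightarrow> ip z (x + y) = ip z x + ip z y"
  by (metis H_add complex_cnj_add ip_add ip_sym)

lemma ip_scale_right: "\<lbrakk>x \<in> H; z \<in> H\<rbrakk> \<Longrightarrow> ip z (c \<odot> x) = cnj c * ip z x"
  by (metis H_scale complex_cnj_mult ip_scale ip_sym)

lemma ip_diff: "\<lbrakk>x \<in> H; y \<in> H; z \<in> H\<rbrakk> \<Longrightarrow> ip (x - y) z = ip x z - ip y z"
  by (metis H_diff add_diff_cancel_right' diff_add_cancel ip_add)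

lemma ip_diff_right: "\<lbrakk>x \<in> H; y \<in> H; z \<in> H\<rbrakk> \<Longrightarrow> ip z (x - y) = ip z x - ip z y"
  by (metis H_diff add_diff_cancel_right' diff_add_cancel ip_add_right)

lemma ip_zero [simp]: "x \<in> H \<Longrightarrow> ip 0 x = 0" "x \<in> H \<Longrightarrow> ip x 0 = 0"
  using ip_diff[of x x x] ip_diff_right[of x x x] by auto

lemma ip_sum: "(\<And>i. i \<in> A \<Longrightarrow> f i \<in> H) \<Longrightarrow> z \<in> H \<Longrightarrow> ip (sum f A) z = (\<Sum>i\<in>A. ip (f i) z)"
  by (induction A rule: infinite_finite_induct) (auto simp: ip_add H_sum)

lemma ip_sum_right: "(\<And>i. i \<in> A \<Longrightarrow> f i \<in> H) \<Longrightarrow> z \<in> H \<Longrightarrow> ip z (sum f A) = (\<Sum>i\<in>A. ip z (f i))"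
  by (induction A rule: infinite_finite_induct) (auto simp: ip_add_right H_sum)

lemma nrm_nonneg [simp]: "x \<in> H \<Longrightarrow> 0 \<le> nrm x"
  by (simp add: nrm_def ip_nonneg)

lemma nrm_sq: "x \<in> H \<Longrightarrow> (nrm x)\<^sup>2 = Re (ip x x)"
  by (simp add: nrm_def ip_nonneg)

lemma ip_self: "x \<in> H \<Longrightarrow> ip x x = complex_of_real ((nrm x)\<^sup>2)"
  using ip_sym[of x x] by (simp add: nrm_sq complex_eq_iff)

lemma nrm_zero [simp]: "nrm 0 = 0"
  by (simp add: nrm_def)

lemma nrm_add_sq: "\<lbrakk>x \<in> H; y \<in> H\<rbrakk> \<Longrightarrow> (nrm (x + y))\<^sup>2 = (nrm x)\<^sup>2 + (nrm y)\<^sup>2 + 2 * Re (ip x y)"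
  using ip_sym[of x y] by (simp add: nrm_sq ip_add ip_add_right)

lemma nrm_diff_sq: "\<lbrakk>x \<in> H; y \<in> H\<rbrakk> \<Longrightarrow> (nrm (x - y))\<^sup>2 = (nrm x)\<^sup>2 + (nrm y)\<^sup>2 - 2 * Re (ip x y)"
  using ip_sym[of x y] by (simp add: nrm_sq ip_diff ip_diff_right)

lemma parallelogram:
  "\<lbrakk>x \<in> H; y \<in> H\<rbrakk> \<Longrightarrow> (nrm (x - y))\<^sup>2 = 2 * (nrm x)\<^sup>2 + 2 * (nrm y)\<^sup>2 - (nrm (x + y))\<^sup>2"
  by (simp add: nrm_add_sq nrm_diff_sq)

lemma nrm_scale: "x \<in> H \<Longrightarrow> nrm (c \<odot> x) = cmod c * nrm x"
proof -
  assume x: "x \<in> H"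
  have "(nrm (c \<odot> x))\<^sup>2 = (cmod c * nrm x)\<^sup>2"
  proof -
    have "ip (c \<odot> x) (c \<odot> x) = (c * cnj c) * ip x x"
      using x by (simp add: ip_scale ip_scale_right)
    also have "\<dots> = complex_of_real ((cmod c)\<^sup>2 * (nrm x)\<^sup>2)"
      using x by (simp only: ip_self complex_norm_square[symmetric] of_real_mult)
    finally show ?thesis using x by (simp only: nrm_sq H_scale Re_complex_of_real power_mult_distrib)
  qed
  then show ?thesis using x by (simp add: power2_eq_iff_nonneg)
qed

lemma nrm_minus_commute: "\<lbrakk>x \<in> H; y \<in> H\<rbrakk> \<Longrightarrow> nrm (x - y) = nrm (y - x)"
proof -
  assume "x \<in> H" "y \<in> H"
  then have "(nrm (x - y))\<^sup>2 = (nrm (y - x))\<^sup>2" using ip_sym[of x y] by (simp add: nrm_diff_sq)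
  then show ?thesis using \<open>x \<in> H\<close> \<open>y \<in> H\<close> by (simp add: power2_eq_iff_nonneg)
qed

text \<open>For real \<open>r\<close>, the square of \<open>nrm (x - r p y)\<close> with \<open>p = ip x y\<close> is a nonnegative quadratic
polynomial in \<open>r\<close>. Testing it at one point suffices; if \<open>nrm y = 0\<close> it is affine, and then \<open>p\<close>
has to vanish.\<close>

lemma cauchy_schwarz:
  assumes x: "x \<in> H" and y: "y \<in> H"
  shows "cmod (ip x y) \<le> nrm x * nrm y"
proof -
  define p where "p = ip x y"
  have *: "0 \<le> (nrm x)\<^sup>2 - 2 * r * (cmod p)\<^sup>2 + r\<^sup>2 * (cmod p)\<^sup>2 * (nrm y)\<^sup>2" for r :: real
  proof -
    have pp: "Re (p * cnj p) = (cmod p)\<^sup>2" by (simp only: complex_norm_square[symmetric] Re_complex_of_real)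
    have "(nrm (x - (of_real r * p) \<odot> y))\<^sup>2 =
        (nrm x)\<^sup>2 + (cmod (of_real r * p) * nrm y)\<^sup>2 - 2 * Re (ip x ((of_real r * p) \<odot> y))"
      using x y by (simp add: nrm_diff_sq nrm_scale)
    also have "Re (ip x ((of_real r * p) \<odot> y)) = r * Re (p * cnj p)"
      using x y by (simp add: ip_scale_right p_def[symmetric] algebra_simps)
    also have "(cmod (of_real r * p) * nrm y)\<^sup>2 = r\<^sup>2 * (cmod p)\<^sup>2 * (nrm y)\<^sup>2"
      by (simp add: norm_mult power_mult_distrib)
    finally have "(nrm (x - (of_real r * p) \<odot> y))\<^sup>2 =
      (nrm x)\<^sup>2 + r\<^sup>2 * (cmod p)\<^sup>2 * (nrm y)\<^sup>2 - 2 * (r * (cmod p)\<^sup>2)" unfolding pp .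
    then show ?thesis using zero_le_power2[of "nrm (x - (of_real r * p) \<odot> y)"] by linarith
  qed
  have "(cmod p)\<^sup>2 \<le> (nrm x * nrm y)\<^sup>2"
  proof (cases "nrm y = 0")
    case True
    have "p = 0"
    proof (rule ccontr)
      assume "p \<noteq> 0"
      then have "(cmod p)\<^sup>2 > 0" by simp
      then show False using *[of "((nrm x)\<^sup>2 + 1) / (2 * (cmod p)\<^sup>2)"] True by (simp add: field_simps)
    qed
    then show ?thesis by simp
  next
    case False
    then have pos: "(nrm y)\<^sup>2 > 0" by simp
    have "0 \<le> (nrm x)\<^sup>2 - (cmod p)\<^sup>2 / (nrm y)\<^sup>2"
    proof -
      have "(1 / (nrm y)\<^sup>2)\<^sup>2 * (cmod p)\<^sup>2 * (nrm y)\<^sup>2 = (cmod p)\<^sup>2 / (nrm y)\<^sup>2"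
        using pos by (simp add: power2_eq_square)
      then show ?thesis using *[of "1 / (nrm y)\<^sup>2"] by simp
    qed
    then show ?thesis using pos by (simp add: field_simps power_mult_distrib)
  qed
  then show ?thesis unfolding p_def using x y by (simp add: power2_le_iff_abs_le abs_mult)
qed

lemma nrm_triangle: "\<lbrakk>x \<in> H; y \<in> H\<rbrakk> \<Longrightarrow> nrm (x + y) \<le> nrm x + nrm y"
proof -
  assume x: "x \<in> H" and y: "y \<in> H"
  have "Re (ip x y) \<le> nrm x * nrm y"
    using cauchy_schwarz[OF x y] complex_Re_le_cmod order_trans by blast
  then have "(nrm (x + y))\<^sup>2 \<le> (nrm x + nrm y)\<^sup>2"
    using x y by (simp add: nrm_add_sq power2_sum)
  then show ?thesis using x y by (meson add_nonneg_nonneg nrm_nonneg power2_le_imp_le)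
qed

lemma nrm_triangle_diff: "\<lbrakk>x \<in> H; y \<in> H; z \<in> H\<rbrakk> \<Longrightarrow> nrm (x - z) \<le> nrm (x - y) + nrm (y - z)"
  using nrm_triangle[of "x - y" "y - z"] by simp

lemma nrm_diff_bound: "\<lbrakk>x \<in> H; y \<in> H\<rbrakk> \<Longrightarrow> \<bar>nrm x - nrm y\<bar> \<le> nrm (x - y)"
  using nrm_triangle_diff[of x y 0] nrm_triangle_diff[of y x 0] nrm_minus_commute[of x y] by auto

lemma null_ip: "\<lbrakk>x \<in> H; y \<in> H; nrm x = 0\<rbrakk> \<Longrightarrow> ip x y = 0" "\<lbrakk>x \<in> H; y \<in> H; nrm x = 0\<rbrakk> \<Longrightarrow> ip y x = 0"
  using cauchy_schwarz[of x y] cauchy_schwarz[of y x] by auto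

lemma null_ip_diff: "\<lbrakk>x \<in> H; x' \<in> H; y \<in> H; nrm (x - x') = 0\<rbrakk> \<Longrightarrow> ip x y = ip x' y"
  using null_ip(1)[of "x - x'" y] by (simp add: ip_diff)

lemma null_ip_diff_right: "\<lbrakk>x \<in> H; x' \<in> H; y \<in> H; nrm (x - x') = 0\<rbrakk> \<Longrightarrow> ip y x = ip y x'"
  using null_ip(2)[of "x - x'" y] by (simp add: ip_diff_right)

lemma lim_ip:
  assumes "\<And>n. X n \<in> H" "x \<in> H" "y \<in> H" "lim_to X x"
  shows "(\<lambda>n. ip (X n) y) \<longlonglongrightarrow> ip x y"
proof (rule LIM_zero_cancel, rule Lim_null_comparison)
  show "\<forall>\<^sub>F n in sequentially. norm (ip (X n) y - ip x y) \<le> nrm (X n - x) * nrm y"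
    using assms cauchy_schwarz[of "X _ - x" y] by (auto simp: ip_diff)
  show "(\<lambda>n. nrm (X n - x) * nrm y) \<longlonglongrightarrow> 0"
    using assms tendsto_mult_left_zero unfolding lim_to_def by blast
qed

lemma lim_ip_right:
  assumes "\<And>n. X n \<in> H" "x \<in> H" "y \<in> H" "lim_to X x"
  shows "(\<lambda>n. ip y (X n)) \<longlonglongrightarrow> ip y x"
proof -
  have "(\<lambda>n. cnj (ip (X n) y)) \<longlonglongrightarrow> cnj (ip x y)"
    using lim_ip[OF assms] tendsto_cnj by blast
  then show ?thesis using assms ip_sym[of _ y] by simp
qed

lemma lim_nrm:
  assumes "\<And>n. X n \<in> H" "x \<in> H" "lim_to X x"
  shows "(\<lambda>n. nrm (X n)) \<longlonglongrightarrow> nrm x"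
proof (rule LIM_zero_cancel, rule Lim_null_comparison)
  show "\<forall>\<^sub>F n in sequentially. norm (nrm (X n) - nrm x) \<le> nrm (X n - x)"
    using assms nrm_diff_bound[of "X _" x] by auto
  show "(\<lambda>n. nrm (X n - x)) \<longlonglongrightarrow> 0" using assms unfolding lim_to_def by blast
qed

lemma convergent_cauchy:
  assumes "\<And>n. X n \<in> H" "x \<in> H" "lim_to X x"
  shows "cauchy X"
  unfolding cauchy_def
proof (intro allI impI)
  fix e :: real assume "e > 0"
  then obtain N where N: "\<And>n. n \<ge> N \<Longrightarrow> norm (nrm (X n - x) - 0) < e / 2"
    using assms(3) unfolding lim_to_def LIMSEQ_iff by (meson half_gt_zero)
  have "nrm (X m - X n) < e" if "m \<ge> N" "n \<ge> N" for m n
    using N[OF that(1)] N[OF that(2)] nrm_triangle_diff[of "X m" x "X n"] nrm_minus_commute[of x "X n"] assms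
    by auto
  then show "\<exists>N. \<forall>m\<ge>N. \<forall>n\<ge>N. nrm (X m - X n) < e" by blast
qed

text \<open>The three facts about finite orthonormal families from which Bessel's inequality and, in the limit,
Parseval's identity follow.\<close>

lemma bessel_identity:
  assumes fin: "finite F" and e: "\<And>i. i \<in> F \<Longrightarrow> e i \<in> H"
    and on: "\<And>i j. i \<in> F \<Longrightarrow> j \<in> F \<Longrightarrow> ip (e i) (e j) = (if i = j then 1 else 0)"
  shows "i \<in> F \<Longrightarrow> ip (\<Sum>j\<in>F. c j \<odot> e j) (e i) = c i"
    and "(nrm (\<Sum>j\<in>F. c j \<odot> e j))\<^sup>2 = (\<Sum>j\<in>F. (cmod (c j))\<^sup>2)"
    and "x \<in> H \<Longrightarrow> (\<Sum>j\<in>F. (cmod (ip x (e j)))\<^sup>2) \<le> (nrm x)\<^sup>2"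
proof -
  have S: "(\<Sum>j\<in>F. c j \<odot> e j) \<in> H" for c using e by auto
  show A: "ip (\<Sum>j\<in>F. c j \<odot> e j) (e i) = c i" if "i \<in> F" for i c
  proof -
    have "ip (\<Sum>j\<in>F. c j \<odot> e j) (e i) = (\<Sum>j\<in>F. c j * (if j = i then 1 else 0))"
      using e that on by (subst ip_sum) (auto simp: ip_scale intro!: sum.cong)
    also have "\<dots> = c i" using fin that by (simp add: if_distrib sum.delta cong: if_cong)
    finally show ?thesis .
  qed
  show B: "(nrm (\<Sum>j\<in>F. c j \<odot> e j))\<^sup>2 = (\<Sum>j\<in>F. (cmod (c j))\<^sup>2)" for c
  proof -
    have "ip (\<Sum>j\<in>F. c j \<odot> e j) (\<Sum>j\<in>F. c j \<odot> e j) = (\<Sum>j\<in>F. cnj (c j) * c j)"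
      using e A S by (subst ip_sum_right) (auto simp: ip_scale_right intro!: sum.cong)
    also have "\<dots> = complex_of_real (\<Sum>j\<in>F. (cmod (c j))\<^sup>2)"
      by (simp only: complex_norm_square of_real_sum mult.commute)
    finally show ?thesis using S by (metis nrm_sq Re_complex_of_real)
  qed
  show "(\<Sum>j\<in>F. (cmod (ip x (e j)))\<^sup>2) \<le> (nrm x)\<^sup>2" if x: "x \<in> H"
  proof -
    let ?s = "\<Sum>j\<in>F. ip x (e j) \<odot> e j"
    have "ip x ?s = (\<Sum>j\<in>F. cnj (ip x (e j)) * ip x (e j))"
      using e x by (subst ip_sum_right) (auto simp: ip_scale_right intro!: sum.cong)
    also have "\<dots> = complex_of_real (\<Sum>j\<in>F. (cmod (ip x (e j)))\<^sup>2)"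
      by (simp only: complex_norm_square of_real_sum mult.commute)
    finally have "Re (ip x ?s) = (\<Sum>j\<in>F. (cmod (ip x (e j)))\<^sup>2)" by (simp only: Re_complex_of_real)
    then have "(nrm (x - ?s))\<^sup>2 = (nrm x)\<^sup>2 - (\<Sum>j\<in>F. (cmod (ip x (e j)))\<^sup>2)"
      using x S B by (simp add: nrm_diff_sq)
    then show ?thesis using zero_le_power2[of "nrm (x - ?s)"] by linarith
  qed
qed

end

locale semi_hilbert = semi_inner +
  assumes complete: "\<lbrakk>\<And>n. X n \<in> H; cauchy X\<rbrakk> \<Longrightarrow> \<exists>x\<in>H. lim_to X x"
begin

text \<open>A minimising sequence for the distance from \<open>h\<close> to \<open>M\<close> is a Cauchy sequence by the parallelogram
law. The foot of the perpendicular lies in the closure of \<open>M\<close>, so that the lemma also serves as a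
density criterion.\<close>

lemma projection:
  assumes M: "subspace M" "M \<subseteq> H" and h: "h \<in> H"
  obtains X y where "\<And>n::nat. X n \<in> M" "y \<in> H" "lim_to X y" "\<And>m. m \<in> M \<Longrightarrow> ip (h - y) m = 0"
proof -
  define D where "D = (\<lambda>m. (nrm (h - m))\<^sup>2) ` M"
  define \<delta> where "\<delta> = Inf D"
  have ne: "D \<noteq> {}" unfolding D_def using subspace_0[OF M(1)] by auto
  have bb: "bdd_below D" unfolding D_def by (auto intro!: bdd_belowI2[where m = 0])
  have low: "\<delta> \<le> (nrm (h - m))\<^sup>2" if "m \<in> M" for m
    unfolding \<delta>_def D_def using that bb by (intro cInf_lower) (auto simp: D_def)
  have "\<exists>m\<in>M. (nrm (h - m))\<^sup>2 < \<delta> + 1 / (real n + 1)" for n :: nat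
  proof -
    have "Inf D < \<delta> + 1 / (real n + 1)" unfolding \<delta>_def by simp
    then show ?thesis using cInf_lessD[OF ne, of "\<delta> + 1 / (real n + 1)"] unfolding D_def by blast
  qed
  then obtain X where X: "\<And>n. X n \<in> M" "\<And>n. (nrm (h - X n))\<^sup>2 < \<delta> + 1 / (real n + 1)" by metis
  have XH: "X n \<in> H" for n using X M by auto
  have close: "(nrm (X m - X n))\<^sup>2 \<le> 2 / (real m + 1) + 2 / (real n + 1)" for m n
  proof -
    have mid: "(1/2) \<odot> (X m + X n) \<in> M" using X M by (auto intro: subspace_scale subspace_add)
    \<comment> \<open>The midpoint of two competitors is a competitor, hence at distance at least the infimum.\<close>
    have "(h - X m) + (h - X n) = 2 \<odot> (h - (1/2) \<odot> (X m + X n))"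
    proof -
      have "2 \<odot> h = h + h" using scale_left_distrib[of 1 1 h] by simp
      moreover have "2 \<odot> (1/2) \<odot> (X m + X n) = X m + X n" by simp
      ultimately show ?thesis by (simp add: scale_right_diff_distrib)
    qed
    then have "(nrm ((h - X m) + (h - X n)))\<^sup>2 = 4 * (nrm (h - (1/2) \<odot> (X m + X n)))\<^sup>2"
      using h XH by (simp add: nrm_scale power_mult_distrib)
    then have "4 * \<delta> \<le> (nrm ((h - X m) + (h - X n)))\<^sup>2" using low[OF mid] by simp
    moreover have "X n - X m = (h - X m) - (h - X n)" by simp
    then have "(nrm (X n - X m))\<^sup>2 = 2 * (nrm (h - X m))\<^sup>2 + 2 * (nrm (h - X n))\<^sup>2 - (nrm ((h - X m) + (h - X n)))\<^sup>2"
      using parallelogram[of "h - X m" "h - X n"] h XH by simp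
    ultimately show ?thesis using X(2)[of m] X(2)[of n] nrm_minus_commute[OF XH[of m] XH[of n]] by simp
  qed
  have "cauchy X" unfolding cauchy_def
  proof (intro allI impI)
    fix e :: real assume e: "e > 0"
    then obtain N :: nat where N: "real N > 4 / e\<^sup>2" using reals_Archimedean2 by blast
    have Np: "real N > 0" using N e by (meson divide_pos_pos less_trans zero_less_numeral zero_less_power)
    have "nrm (X m - X n) < e" if mn: "m \<ge> N" "n \<ge> N" for m n
    proof -
      have "2 / (real m + 1) < 2 / real N" "2 / (real n + 1) < 2 / real N"
        using mn Np by (auto intro!: divide_strict_left_mono mult_pos_pos)
      then have "(nrm (X m - X n))\<^sup>2 < 4 / real N" using close[of m n] by simp
      also have "\<dots> < e\<^sup>2" using N Np e by (simp add: field_simps)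
      finally show ?thesis using e by (simp add: power2_less_imp_less)
    qed
    then show "\<exists>N. \<forall>m\<ge>N. \<forall>n\<ge>N. nrm (X m - X n) < e" by blast
  qed
  then obtain y where y: "y \<in> H" "lim_to X y" using complete XH by blast
  have nl: "(\<lambda>n. nrm (h - X n)) \<longlonglongrightarrow> nrm (h - y)"
  proof (rule LIM_zero_cancel, rule Lim_null_comparison)
    show "(\<lambda>n. nrm (X n - y)) \<longlonglongrightarrow> 0" using y(2) unfolding lim_to_def .
    have "\<bar>nrm (h - X n) - nrm (h - y)\<bar> \<le> nrm (X n - y)" for n
      using nrm_diff_bound[of "h - X n" "h - y"] nrm_minus_commute[of "X n" y] h XH y by simp
    then show "\<forall>\<^sub>F n in sequentially. norm (nrm (h - X n) - nrm (h - y)) \<le> nrm (X n - y)" by simp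
  qed
  have d: "(nrm (h - y))\<^sup>2 \<le> \<delta>"
  proof (rule LIMSEQ_le)
    show "(\<lambda>n. (nrm (h - X n))\<^sup>2) \<longlonglongrightarrow> (nrm (h - y))\<^sup>2" using nl by (intro tendsto_power)
    have "(\<lambda>n. \<delta> + 1 / (real n + 1)) \<longlonglongrightarrow> \<delta> + 0"
      using LIMSEQ_inverse_real_of_nat by (intro tendsto_add tendsto_const) (simp add: inverse_eq_divide add.commute)
    then show "(\<lambda>n. \<delta> + 1 / (real n + 1)) \<longlonglongrightarrow> \<delta>" by simp
    show "\<exists>N. \<forall>n\<ge>N. (nrm (h - X n))\<^sup>2 \<le> \<delta> + 1 / (real n + 1)" using X(2) less_imp_le by blast
  qed
  have orth: "ip (h - y) m = 0" if m: "m \<in> M" for m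
  proof -
    have mH: "m \<in> H" using m M by auto
    define p where "p = ip (h - y) m"
    have *: "2 * r * (cmod p)\<^sup>2 \<le> r\<^sup>2 * (cmod p)\<^sup>2 * (nrm m)\<^sup>2" for r :: real
    proof -
      let ?v = "(of_real r * p) \<odot> m"
      have "\<delta> \<le> (nrm ((h - y) - ?v))\<^sup>2"
      proof (rule LIMSEQ_le_const)
        have "(\<lambda>n. nrm ((h - X n) - ?v)) \<longlonglongrightarrow> nrm ((h - y) - ?v)"
        proof (rule LIM_zero_cancel, rule Lim_null_comparison)
          show "(\<lambda>n. nrm (X n - y)) \<longlonglongrightarrow> 0" using y(2) unfolding lim_to_def .
          have "\<bar>nrm (h - X n - ?v) - nrm (h - y - ?v)\<bar> \<le> nrm (X n - y)" for n
            using nrm_diff_bound[of "h - X n - ?v" "h - y - ?v"] nrm_minus_commute[of "X n" y] h XH y mH by simp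
          then show "\<forall>\<^sub>F n in sequentially. norm (nrm (h - X n - ?v) - nrm (h - y - ?v)) \<le> nrm (X n - y)" by simp
        qed
        then show "(\<lambda>n. (nrm ((h - X n) - ?v))\<^sup>2) \<longlonglongrightarrow> (nrm ((h - y) - ?v))\<^sup>2" by (intro tendsto_power)
        have "\<delta> \<le> (nrm ((h - X n) - ?v))\<^sup>2" for n
          using low[of "X n + ?v"] X(1)[of n] m M by (simp add: subspace_add subspace_scale diff_diff_eq)
        then show "\<exists>N. \<forall>n\<ge>N. \<delta> \<le> (nrm ((h - X n) - ?v))\<^sup>2" by blast
      qed
      moreover have "(nrm ((h - y) - ?v))\<^sup>2 = (nrm (h - y))\<^sup>2 + r\<^sup>2 * (cmod p)\<^sup>2 * (nrm m)\<^sup>2 - 2 * Re (ip (h - y) ?v)"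
        using h y mH by (subst nrm_diff_sq) (auto simp: nrm_scale norm_mult power_mult_distrib)
      moreover have "Re (ip (h - y) ?v) = r * (cmod p)\<^sup>2"
      proof -
        have "ip (h - y) ?v = of_real r * (p * cnj p)"
          using h y mH by (simp add: ip_scale_right p_def[symmetric] algebra_simps)
        then show ?thesis
          by (simp only: complex_norm_square[symmetric] Re_complex_of_real of_real_mult[symmetric])
      qed
      ultimately show ?thesis using d by linarith
    qed
    have "p = 0"
    proof (rule ccontr)
      assume "p \<noteq> 0"
      then have pp: "(cmod p)\<^sup>2 > 0" by simp
      \<comment> \<open>Moving from the foot a little in the direction of a non-orthogonal element would shorten the distance.\<close>
      define r where "r = 1 / ((nrm m)\<^sup>2 + 1)"
      have rp: "r > 0" "r * (nrm m)\<^sup>2 \<le> 1" 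
      proof -
        have "(nrm m)\<^sup>2 + 1 > 0" using zero_le_power2[of "nrm m"] by linarith
        then show "r > 0" "r * (nrm m)\<^sup>2 \<le> 1" unfolding r_def by simp_all
      qed
      have "(cmod p)\<^sup>2 * (2 * r) \<le> (cmod p)\<^sup>2 * (r * (r * (nrm m)\<^sup>2))"
        using *[of r] unfolding power2_eq_square[of r] by (simp only: ac_simps)
      then have "2 * r \<le> r * (r * (nrm m)\<^sup>2)" using pp by (simp only: mult_le_cancel_left_pos)
      then have "r * 2 \<le> r * (r * (nrm m)\<^sup>2)" by (simp only: ac_simps)
      then have "2 \<le> r * (nrm m)\<^sup>2" using rp by (simp only: mult_le_cancel_left_pos)
      then show False using rp by linarith
    qed
    then show ?thesis unfolding p_def .
  qed
  show thesis using that X(1) y orth by blast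
qed

lemma dense_if_orthogonal_trivial:
  assumes M: "subspace M" "M \<subseteq> H" and triv: "\<And>h. h \<in> H \<Longrightarrow> (\<And>m. m \<in> M \<Longrightarrow> ip h m = 0) \<Longrightarrow> nrm h = 0"
    and h: "h \<in> H" and e: "e > 0"
  shows "\<exists>m\<in>M. nrm (h - m) < e"
proof -
  obtain X y where X: "\<And>n::nat. X n \<in> M" and y: "y \<in> H" "lim_to X y" and o: "\<And>m. m \<in> M \<Longrightarrow> ip (h - y) m = 0"
    using projection[OF M h] by blast
  have n0: "nrm (h - y) = 0" using triv[of "h - y"] o h y by blast
  have "\<exists>n. norm (nrm (X n - y) - 0) < e"
    using y(2) e unfolding lim_to_def LIMSEQ_iff by blast
  then obtain n where n: "norm (nrm (X n - y) - 0) < e" ..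
  then have "nrm (X n - y) < e" by simp
  moreover have "nrm (h - X n) \<le> nrm (h - y) + nrm (y - X n)"
    using nrm_triangle_diff[of h y "X n"] h y X M by auto
  ultimately have "nrm (h - X n) < e" using n0 nrm_minus_commute[OF y(1), of "X n"] subsetD[OF M(2) X] by simp
  then show ?thesis using X by blast
qed

text \<open>The perpendicular \<open>z\<close> from a point to the kernel of \<open>T\<close> spans the complement of the kernel:
\<open>T z x - T x z\<close> lies in the kernel, and its product with \<open>z\<close> vanishes.\<close>

lemma riesz:
  assumes add: "\<And>x y. x \<in> H \<Longrightarrow> y \<in> H \<Longrightarrow> T (x + y) = T x + T y"
    and sc: "\<And>c x. x \<in> H \<Longrightarrow> T (c \<odot> x) = c * T x"
    and bd: "\<And>x. x \<in> H \<Longrightarrow> cmod (T x) \<le> C * nrm x"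
  shows "\<exists>y\<in>H. \<forall>x\<in>H. T x = ip x y"
proof (cases "\<forall>x\<in>H. T x = 0")
  case True
  then show ?thesis by (intro bexI[of _ 0]) auto
next
  case False
  then obtain h where h: "h \<in> H" "T h \<noteq> 0" by auto
  have T0: "T 0 = 0" using sc[of 0 0] by simp
  have dif: "T (x - y) = T x - T y" if "x \<in> H" "y \<in> H" for x y
    using add[of "x - y" y] that by simp
  define M where "M = {x\<in>H. T x = 0}"
  have M: "subspace M" "M \<subseteq> H"
    unfolding M_def by (auto intro!: subspaceI simp: T0 add sc)
  obtain X y where X: "\<And>n::nat. X n \<in> M" and y: "y \<in> H" "lim_to X y" and o: "\<And>m. m \<in> M \<Longrightarrow> ip (h - y) m = 0"
    using projection[OF M h(1)] by blast
  have XH: "X n \<in> H" for n using X M by auto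
  have "T y = 0"
  proof -
    have "(\<lambda>n. C * nrm (X n - y)) \<longlonglongrightarrow> 0" using y(2) unfolding lim_to_def by (intro tendsto_mult_right_zero)
    moreover have "cmod (T y) \<le> C * nrm (X n - y)" for n
      using bd[of "X n - y"] dif[of "X n" y] XH[of n] X[of n] y unfolding M_def by simp
    ultimately have "cmod (T y) \<le> 0" by (intro LIMSEQ_le_const) auto
    then show ?thesis by simp
  qed
  define z where "z = h - y"
  have z: "z \<in> H" "T z = T h" unfolding z_def using h y \<open>T y = 0\<close> by (auto simp: dif)
  have zz: "ip z z \<noteq> 0"
  proof
    assume "ip z z = 0"
    then have "nrm z = 0" by (simp add: nrm_def)
    then show False using bd[OF z(1)] z h by simp
  qed
  show ?thesis
  proof (intro bexI ballI)
    fix x assume x: "x \<in> H"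
    have "T z \<odot> x - T x \<odot> z \<in> M" unfolding M_def using x z by (simp add: dif sc)
    then have "ip z (T z \<odot> x - T x \<odot> z) = 0" using o unfolding z_def by blast
    then have "cnj (T z) * ip z x = cnj (T x) * ip z z" using x z by (simp add: ip_diff_right ip_scale_right)
    then have "T z * ip x z = T x * ip z z"
      using ip_sym[OF x z(1)] ip_sym[OF z(1) z(1)] by (metis complex_cnj_cnj complex_cnj_mult)
    then show "T x = ip x ((cnj (T z) / ip z z) \<odot> z)"
      using x z zz ip_sym[OF z(1) z(1)] by (simp add: ip_scale_right field_simps)
  next
    show "(cnj (T z) / ip z z) \<odot> z \<in> H" using z by simp
  qed
qed

end

section \<open>Orthonormal bases\<close>

locale orthonormal_basis = semi_hilbert scale H ip
  for scale :: "complex \<Rightarrow> 'v::ab_group_add \<Rightarrow> 'v" (infixr \<open>\<odot>\<close> 75) and H ip +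
  fixes e :: "'i::countable \<Rightarrow> 'v"
  assumes e_H: "e i \<in> H"
    and e_on: "ip (e i) (e j) = (if i = j then 1 else 0)"
    and total: "\<lbrakk>x \<in> H; \<And>i. ip x (e i) = 0\<rbrakk> \<Longrightarrow> nrm x = 0"
begin

text \<open>Partial sums along an enumeration of the index type; they form a sequence, so that sequential
completeness applies, and they are cofinal among the finite sets of indices.\<close>

definition below :: "nat \<Rightarrow> 'i set" where "below n = {i. to_nat i < n}"

lemma finite_below: "finite (below n)"
proof (rule finite_imageD)
  show "finite (to_nat ` below n)" by (rule finite_subset[of _ "{..<n}"]) (auto simp: below_def)
  show "inj_on to_nat (below n)" by (rule inj_on_subset[OF inj_to_nat]) auto
qed

lemma below_filterlim: "filterlim below (finite_subsets_at_top UNIV) sequentially"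
proof (subst filterlim_finite_subsets_at_top, intro allI impI)
  fix X :: "'i set" assume X: "finite X \<and> X \<subseteq> UNIV"
  have "X \<subseteq> below n" if n: "n \<ge> Suc (Max (to_nat ` X))" for n
  proof
    fix i assume "i \<in> X"
    then have "to_nat i \<le> Max (to_nat ` X)" using X by (intro Max_ge) auto
    then show "i \<in> below n" using n by (simp add: below_def)
  qed
  then show "\<forall>\<^sub>F n in sequentially. finite (below n) \<and> X \<subseteq> below n \<and> below n \<subseteq> UNIV"
    unfolding eventually_sequentially using finite_below by blast
qed

lemma partial_sum_H: "(\<Sum>i\<in>F. c i \<odot> e i) \<in> H"
  using e_H by auto

text \<open>The partial sums of \<open>c i \<odot> e i\<close> are a Cauchy sequence since their differences have the norms of
differences of the partial sums of the numerical series.\<close>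

lemma riesz_fischer:
  assumes c: "(\<lambda>i. (cmod (c i))\<^sup>2) summable_on UNIV"
  obtains x where "x \<in> H" "\<And>i. ip x (e i) = c i" "lim_to (\<lambda>n. \<Sum>i\<in>below n. c i \<odot> e i) x"
proof -
  define X where "X n = (\<Sum>i\<in>below n. c i \<odot> e i)" for n
  have XH: "X n \<in> H" for n unfolding X_def by (rule partial_sum_H)
  define s where "s n = (\<Sum>i\<in>below n. (cmod (c i))\<^sup>2)" for n
  have "s \<longlonglongrightarrow> infsum (\<lambda>i. (cmod (c i))\<^sup>2) UNIV"
    using has_sum_infsum[OF c] below_filterlim unfolding has_sum_def s_def
    by (rule filterlim_compose)
  then have sC: "Cauchy s" by (meson LIMSEQ_imp_Cauchy)
  have diff: "(nrm (X m - X n))\<^sup>2 = s m - s n" if "n \<le> m" for m n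
  proof -
    have sub: "below n \<subseteq> below m" using that by (auto simp: below_def)
    have "X m - X n = (\<Sum>i\<in>below m - below n. c i \<odot> e i)"
      unfolding X_def by (simp add: sum_diff[OF finite_below sub])
    moreover have "s m - s n = (\<Sum>i\<in>below m - below n. (cmod (c i))\<^sup>2)"
      unfolding s_def by (simp add: sum_diff[OF finite_below sub])
    ultimately show ?thesis
      using bessel_identity(2)[of "below m - below n" e c] e_H e_on finite_below by auto
  qed
  have "cauchy X" unfolding cauchy_def
  proof (intro allI impI)
    fix \<epsilon> :: real assume \<epsilon>: "\<epsilon> > 0"
    then obtain N where N: "\<And>m n. m \<ge> N \<Longrightarrow> n \<ge> N \<Longrightarrow> norm (s m - s n) < \<epsilon>\<^sup>2"
      using sC unfolding Cauchy_iff by (meson zero_less_power)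
    have "nrm (X m - X n) < \<epsilon>" if mn: "m \<ge> N" "n \<ge> N" for m n
    proof -
      have "(nrm (X m - X n))\<^sup>2 < \<epsilon>\<^sup>2"
      proof (cases "n \<le> m")
        case True then show ?thesis using diff[OF True] N[OF mn] by simp
      next
        case False then show ?thesis
          using diff[of m n] N[OF mn] nrm_minus_commute[OF XH[of m] XH[of n]] by simp
      qed
      then show ?thesis using \<epsilon> by (simp add: power2_less_imp_less)
    qed
    then show "\<exists>N. \<forall>m\<ge>N. \<forall>n\<ge>N. nrm (X m - X n) < \<epsilon>" by blast
  qed
  then obtain x where x: "x \<in> H" "lim_to X x" using complete XH by blast
  have "ip x (e i) = c i" for i
  proof (rule LIMSEQ_unique)
    show "(\<lambda>n. ip (X n) (e i)) \<longlonglongrightarrow> ip x (e i)" using lim_ip[OF XH x(1) e_H x(2)] .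
    have "ip (X n) (e i) = c i" if "n > to_nat i" for n
      unfolding X_def using that e_H e_on
      by (intro bessel_identity(1)[OF finite_below]) (auto simp: below_def)
    then have "\<forall>\<^sub>F n in sequentially. ip (X n) (e i) = c i"
      unfolding eventually_sequentially by (intro exI[of _ "Suc (to_nat i)"]) auto
    then show "(\<lambda>n. ip (X n) (e i)) \<longlonglongrightarrow> c i" by (rule tendsto_eventually)
  qed
  then show thesis using that x unfolding X_def by blast
qed

lemma coeffs_square_summable:
  assumes x: "x \<in> H" shows "(\<lambda>i. (cmod (ip x (e i)))\<^sup>2) summable_on UNIV"
  by (rule nonneg_bdd_above_summable_on)
     (use bessel_identity(3)[OF _ _ _ x, of _ e] e_H e_on in \<open>auto intro!: bdd_aboveI2[where M = "(nrm x)\<^sup>2"]\<close>)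

text \<open>The limit of the Fourier series exists by \<open>riesz_fischer\<close> and has the coefficients of \<open>x\<close>, so that
it can differ from \<open>x\<close> by a null vector only.\<close>

lemma fourier_expansion:
  assumes x: "x \<in> H" shows "lim_to (\<lambda>n. \<Sum>i\<in>below n. ip x (e i) \<odot> e i) x"
proof -
  let ?X = "\<lambda>n. \<Sum>i\<in>below n. ip x (e i) \<odot> e i"
  obtain y where y: "y \<in> H" "\<And>i. ip y (e i) = ip x (e i)" "lim_to ?X y"
    using riesz_fischer[OF coeffs_square_summable[OF x]] by blast
  have "nrm (y - x) = 0" using total[of "y - x"] x y e_H by (simp add: ip_diff)
  have "lim_to ?X x" unfolding lim_to_def
  proof (rule Lim_null_comparison)
    show "(\<lambda>n. nrm (?X n - y)) \<longlonglongrightarrow> 0" using y(3) unfolding lim_to_def .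
    have "nrm (?X n - x) \<le> nrm (?X n - y) + nrm (y - x)" for n
      by (rule nrm_triangle_diff) (use x y partial_sum_H in auto)
    then show "\<forall>\<^sub>F n in sequentially. norm (nrm (?X n - x)) \<le> nrm (?X n - y)"
      using \<open>nrm (y - x) = 0\<close> x partial_sum_H by (auto intro!: always_eventually)
  qed
  then show ?thesis .
qed

lemma parseval:
  assumes x: "x \<in> H" and y: "y \<in> H"
  shows "((\<lambda>i. ip x (e i) * cnj (ip y (e i))) has_sum ip x y) UNIV"
proof -
  let ?f = "\<lambda>i. ip x (e i) * cnj (ip y (e i))"
  have "(\<lambda>i. (cmod (ip x (e i)))\<^sup>2 + (cmod (ip y (e i)))\<^sup>2) summable_on UNIV"
    using coeffs_square_summable x y by (intro summable_on_add) auto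
  then have "(\<lambda>i. norm (?f i)) summable_on UNIV"
  proof (rule summable_on_comparison_test)
    fix i
    have "2 * (cmod (ip x (e i)) * cmod (ip y (e i))) \<le> (cmod (ip x (e i)))\<^sup>2 + (cmod (ip y (e i)))\<^sup>2"
      using sum_squares_bound[of "cmod (ip x (e i))" "cmod (ip y (e i))"] by simp
    moreover have "0 \<le> cmod (ip x (e i)) * cmod (ip y (e i))" by simp
    ultimately show "norm (?f i) \<le> (cmod (ip x (e i)))\<^sup>2 + (cmod (ip y (e i)))\<^sup>2"
      unfolding norm_mult complex_mod_cnj by linarith
  qed simp
  then have s: "?f summable_on UNIV" by (rule abs_summable_summable)
  have "(\<lambda>n. sum ?f (below n)) \<longlonglongrightarrow> infsum ?f UNIV"
    using has_sum_infsum[OF s] below_filterlim unfolding has_sum_def by (rule filterlim_compose)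
  moreover have "(\<lambda>n. sum ?f (below n)) \<longlonglongrightarrow> ip x y"
  proof -
    have "(\<lambda>n. ip (\<Sum>i\<in>below n. ip x (e i) \<odot> e i) y) \<longlonglongrightarrow> ip x y"
      using lim_ip[OF partial_sum_H x y fourier_expansion[OF x]] .
    moreover have "ip (\<Sum>i\<in>below n. ip x (e i) \<odot> e i) y = sum ?f (below n)" for n
      using e_H y ip_sym[OF y e_H] by (subst ip_sum) (auto simp: ip_scale)
    ultimately show ?thesis by simp
  qed
  ultimately have "infsum ?f UNIV = ip x y" by (rule LIMSEQ_unique)
  then show ?thesis using has_sum_infsum[OF s] by simp
qed

lemma null_iff_coeffs: "x \<in> H \<Longrightarrow> nrm x = 0 \<longleftrightarrow> (\<forall>i. ip x (e i) = 0)"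
  using total null_ip(1) e_H by blast

end

section \<open>Closed forms with compactly embedded domain\<close>

text \<open>The setting of the representation theorem for forms: \<open>V\<close> is complete for the form norm, embedded
compactly and densely into \<open>H\<close>; density is expressed by \<open>V_total\<close>. The assumption \<open>V_null\<close> says
that membership in \<open>V\<close> and the form do not distinguish representatives of an element of the
Hilbert space.\<close>

locale compact_form = semi_hilbert scale H ip + V: semi_hilbert scale V "\<lambda>u v. b u v + ip u v"
  for scale :: "complex \<Rightarrow> 'v::ab_group_add \<Rightarrow> 'v" (infixr \<open>\<odot>\<close> 75)
    and H ip V b +
  assumes V_H: "V \<subseteq> H"
    and b_nonneg: "u \<in> V \<Longrightarrow> 0 \<le> Re (b u u)"
    and compact: "\<lbrakk>\<And>k. X k \<in> V; \<And>k. V.nrm (X k) \<le> C\<rbrakk> \<Longrightarrow> \<exists>r. strict_mono (r :: nat \<Rightarrow> nat) \<and> cauchy (X \<circ> r)"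
    and V_null: "\<lbrakk>x \<in> V; y \<in> H; nrm (x - y) = 0\<rbrakk> \<Longrightarrow> y \<in> V \<and> V.nrm (x - y) = 0"
    and V_total: "\<lbrakk>h \<in> H; \<And>v. v \<in> V \<Longrightarrow> ip h v = 0\<rbrakk> \<Longrightarrow> nrm h = 0"
    and infinite_dim: "\<exists>f. (\<forall>k::nat. f k \<in> V \<and> nrm (f k) \<noteq> 0) \<and> (\<forall>j k. j \<noteq> k \<longrightarrow> ip (f j) (f k) = 0)"
begin

lemma VH [simp, intro]: "v \<in> V \<Longrightarrow> v \<in> H" using V_H by auto

lemma b_add: "\<lbrakk>x \<in> V; y \<in> V; z \<in> V\<rbrakk> \<Longrightarrow> b (x + y) z = b x z + b y z"
  using V.ip_add[of x y z] ip_add[of x y z] by simp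
lemma b_scale: "\<lbrakk>x \<in> V; z \<in> V\<rbrakk> \<Longrightarrow> b (c \<odot> x) z = c * b x z"
  using V.ip_scale[of x z c] ip_scale[of x z c] by (simp add: algebra_simps)
lemma b_sym: "\<lbrakk>x \<in> V; y \<in> V\<rbrakk> \<Longrightarrow> b y x = cnj (b x y)"
  using V.ip_sym[of x y] ip_sym[of x y] by simp
lemma b_add_right: "\<lbrakk>x \<in> V; y \<in> V; z \<in> V\<rbrakk> \<Longrightarrow> b z (x + y) = b z x + b z y"
  using V.ip_add_right[of x y z] ip_add_right[of x y z] by simp
lemma b_scale_right: "\<lbrakk>x \<in> V; z \<in> V\<rbrakk> \<Longrightarrow> b z (c \<odot> x) = cnj c * b z x"
  using V.ip_scale_right[of x z c] ip_scale_right[of x z c] by (simp add: algebra_simps)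

lemma V_nrm_sq: "u \<in> V \<Longrightarrow> (V.nrm u)\<^sup>2 = Re (b u u) + (nrm u)\<^sup>2"
  by (simp add: V.nrm_sq nrm_sq)

lemma b_self: "u \<in> V \<Longrightarrow> b u u = of_real (Re (b u u))"
  using b_sym[of u u] by (simp add: complex_eq_iff)

lemma nrm_le_V: "u \<in> V \<Longrightarrow> nrm u \<le> V.nrm u"
  by (rule power2_le_imp_le[OF _ V.nrm_nonneg]) (simp_all add: V_nrm_sq b_nonneg)

lemma b_null: "\<lbrakk>x \<in> V; y \<in> H; z \<in> V; nrm (x - y) = 0\<rbrakk> \<Longrightarrow> b x z = b y z"
proof -
  assume a: "x \<in> V" "y \<in> H" "z \<in> V" "nrm (x - y) = 0"
  then have y: "y \<in> V" "V.nrm (x - y) = 0" using V_null[OF a(1,2,4)] by blast+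
  have "b x z + ip x z = b y z + ip y z" by (rule V.null_ip_diff[OF a(1) y(1) a(3) y(2)])
  moreover have "ip x z = ip y z" using a by (intro null_ip_diff) auto
  ultimately show "b x z = b y z" by (simp only: add_right_cancel)
qed

text \<open>A relation rather than a function, since \<open>f\<close> is determined by \<open>u\<close> up to null vectors only.\<close>

definition G :: "('v \<times> 'v) set" where
  "G = {(u, f). u \<in> V \<and> f \<in> H \<and> (\<forall>v\<in>V. b u v = ip f v)}"

definition eig :: "complex \<Rightarrow> 'v set" where
  "eig z = {u \<in> V. \<forall>v\<in>V. b u v = z * ip u v}"

lemma eig_G: "u \<in> eig z \<longleftrightarrow> (u, z \<odot> u) \<in> G"
  by (auto simp: eig_def G_def ip_scale)

lemma eig_G': "u \<in> eig z \<longleftrightarrow> (\<exists>f. (u, f) \<in> G \<and> nrm (f - z \<odot> u) = 0)"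
proof
  assume "u \<in> eig z" then show "\<exists>f. (u, f) \<in> G \<and> nrm (f - z \<odot> u) = 0"
    unfolding eig_G by (intro exI[of _ "z \<odot> u"]) simp
next
  assume "\<exists>f. (u, f) \<in> G \<and> nrm (f - z \<odot> u) = 0"
  then obtain f where "(u, f) \<in> G" "nrm (f - z \<odot> u) = 0" by blast
  then show "u \<in> eig z" unfolding G_def eig_def
    using null_ip_diff[of f "z \<odot> u"] by (auto simp: ip_scale)
qed

lemma b_zero: "v \<in> V \<Longrightarrow> b 0 v = 0"
  using V.ip_zero(1)[of v] ip_zero(1)[of v] by simp

lemma eig_subspace: "subspace (eig z)"
proof (rule subspaceI)
  show "0 \<in> eig z" by (auto simp: eig_def b_zero)
  show "x + y \<in> eig z" if "x \<in> eig z" "y \<in> eig z" for x y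
    using that by (auto simp: eig_def b_add ip_add distrib_left)
  show "c \<odot> x \<in> eig z" if "x \<in> eig z" for c x
    using that by (auto simp: eig_def b_scale ip_scale)
qed

lemma G_mem: "(u, f) \<in> G \<Longrightarrow> u \<in> V" "(u, f) \<in> G \<Longrightarrow> f \<in> H"
  by (auto simp: G_def)

lemma G_zero: "(0, 0) \<in> G" by (auto simp: G_def b_zero)

lemma G_linear: "\<lbrakk>(u, f) \<in> G; (v, g) \<in> G\<rbrakk> \<Longrightarrow> (c \<odot> u + v, c \<odot> f + g) \<in> G"
  by (auto simp: G_def b_add b_scale ip_add ip_scale)

lemma G_functional: "\<lbrakk>(u, f) \<in> G; (v, g) \<in> G; nrm (u - v) = 0\<rbrakk> \<Longrightarrow> nrm (f - g) = 0"
proof -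
  assume a: "(u, f) \<in> G" "(v, g) \<in> G" "nrm (u - v) = 0"
  then have "ip (f - g) w = 0" if "w \<in> V" for w
    using that b_null[of u v w] unfolding G_def by (auto simp: ip_diff)
  then show ?thesis using a V_total[of "f - g"] unfolding G_def by auto
qed

text \<open>The representation theorem of Riesz in \<open>V\<close> with the form inner product, applied to the functional
\<open>v \<mapsto> ip v h\<close>, solves \<open>(G + 1) u = h\<close>.\<close>

lemma G_onto: assumes h: "h \<in> H" shows "\<exists>u f. (u, f) \<in> G \<and> f + u = h"
proof -
  have "\<exists>u\<in>V. \<forall>v\<in>V. ip v h = b v u + ip v u"
  proof (rule V.riesz[where C = "nrm h"])
    fix v assume v: "v \<in> V"
    have "cmod (ip v h) \<le> nrm v * nrm h" using v h by (intro cauchy_schwarz) auto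
    also have "\<dots> \<le> nrm h * V.nrm v" using nrm_le_V[OF v] h by (simp add: mult.commute mult_left_mono)
    finally show "cmod (ip v h) \<le> nrm h * V.nrm v" .
  qed (use h in \<open>auto simp: ip_add ip_scale\<close>)
  then obtain u where u: "u \<in> V" "\<And>v. v \<in> V \<Longrightarrow> ip v h = b v u + ip v u" by auto
  have "b u v = ip (h - u) v" if v: "v \<in> V" for v
  proof -
    have "cnj (ip v h) = cnj (b v u) + cnj (ip v u)" using u(2)[OF v] by simp
    then show ?thesis using ip_sym[of v h] ip_sym[of v u] b_sym[of v u] u v h by (simp add: ip_diff)
  qed
  then have "(u, h - u) \<in> G" using u h by (auto simp: G_def)
  then show ?thesis by (intro exI[of _ u] exI[of _ "h - u"]) simp
qed

lemma G_symmetric: "\<lbrakk>(u, f) \<in> G; (v, g) \<in> G\<rbrakk> \<Longrightarrow> ip f v = ip u g"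
  using b_sym[of u v] ip_sym[of g u] unfolding G_def by auto

text \<open>If \<open>k\<close> is orthogonal to the domain, solve \<open>(G + 1) u = k\<close>: then \<open>0 = ip k u\<close> is the square of
the form norm of \<open>u\<close>, so that \<open>u\<close> and \<open>k\<close> are null.\<close>

lemma G_domain_dense: assumes h: "h \<in> H" and e: "e > 0" shows "\<exists>u f. (u, f) \<in> G \<and> nrm (h - u) < e"
proof -
  have "\<exists>m\<in>Domain G. nrm (h - m) < e"
  proof (rule dense_if_orthogonal_trivial)
    show "subspace (Domain G)"
    proof (rule subspaceI)
      show "0 \<in> Domain G" using G_zero by auto
      show "x + y \<in> Domain G" if "x \<in> Domain G" "y \<in> Domain G" for x y
        using that G_linear[of x _ y _ 1] by fastforce
      show "c \<odot> x \<in> Domain G" if "x \<in> Domain G" for c x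
        using that G_linear[OF _ G_zero, of x _ c] by fastforce
    qed
    show "Domain G \<subseteq> H" by (auto simp: G_def)
    fix k assume k: "k \<in> H" and o: "\<And>m. m \<in> Domain G \<Longrightarrow> ip k m = 0"
    obtain u f where uf: "(u, f) \<in> G" "f + u = k" using G_onto[OF k] by blast
    have u: "u \<in> V" "f \<in> H" using G_mem uf(1) by auto
    have "ip k u = 0" using o uf by auto
    then have "b u u + ip u u = 0" using uf u by (auto simp: ip_add G_def)
    then have "V.nrm u = 0" by (simp add: V.nrm_def)
    then have "nrm u = 0" using nrm_le_V[OF u(1)] nrm_nonneg[OF VH[OF u(1)]] by linarith
    then have "nrm (f - 0) = 0" using G_functional[OF uf(1) G_zero] by simp
    then show "nrm k = 0" using \<open>nrm u = 0\<close> uf u nrm_triangle[of f u] nrm_nonneg[OF k] by auto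
  qed (use h e in auto)
  then show ?thesis by auto
qed

text \<open>A symmetric operator for which \<open>G + 1\<close> is onto has no proper symmetric extension: compare \<open>v\<close> with
the solution \<open>u0\<close> of \<open>(G + 1) u0 = g + v\<close>; the difference is orthogonal to the range of \<open>G + 1\<close>,
that is, to the whole space. Below this also serves to see that \<open>G\<close> is closed.\<close>

lemma G_adjoint:
  assumes v: "v \<in> H" and g: "g \<in> H" and adj: "\<And>u f. (u, f) \<in> G \<Longrightarrow> ip f v = ip u g"
  shows "(v, g) \<in> G"
proof -
  obtain u0 f0 where G0: "(u0, f0) \<in> G" "f0 + u0 = g + v" using G_onto[of "g + v"] v g by blast
  have m0: "u0 \<in> V" "f0 \<in> H" using G_mem G0 by auto
  define w where "w = v - u0"
  have w: "w \<in> H" unfolding w_def using v m0 by auto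
  obtain u f where uf: "(u, f) \<in> G" "f + u = w" using G_onto[OF w] by blast
  have m: "u \<in> H" "f \<in> H" using G_mem uf by auto
  have eqg: "g - f0 = - w"
    using G0(2) unfolding w_def by (simp add: algebra_simps)
  have "ip w w = ip f w + ip u w" using uf m w by (metis ip_add)
  also have "ip f w = ip u g - ip u f0"
    unfolding w_def using adj[OF uf(1)] G_symmetric[OF uf(1) G0(1)] m v m0 by (simp add: ip_diff_right)
  also have "\<dots> = ip u (g - f0)" using m g m0 by (simp add: ip_diff_right)
  also have "\<dots> = - ip u w" unfolding eqg using ip_diff_right[of 0 w u] m w by simp
  finally have "ip w w = 0" by simp
  then have nw: "nrm w = 0" by (simp add: nrm_def)
  then have n1: "nrm (u0 - v) = 0" using nrm_minus_commute[of u0 v] m0 v unfolding w_def by auto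
  have vV: "v \<in> V" using V_null[OF m0(1) v n1] by auto
  have "nrm (f0 - g) = nrm w" using eqg by (metis minus_diff_eq minus_minus)
  then have n2: "nrm (f0 - g) = 0" using nw by simp
  have "b v x = ip g x" if x: "x \<in> V" for x
    using b_null[OF m0(1) v x n1] null_ip_diff[of f0 g x] n2 G0(1) x m0 g unfolding G_def by auto
  then show ?thesis using vV g by (auto simp: G_def)
qed

lemma eig_real: assumes u: "u \<in> eig z" "nrm u \<noteq> 0"
  shows "z = of_real (Re z)" "Re z \<ge> 0"
proof -
  have uV: "u \<in> V" using u by (auto simp: eig_def)
  have "b u u = z * ip u u" using u uV by (auto simp: eig_def)
  then have *: "of_real (Re (b u u)) = z * of_real ((nrm u)\<^sup>2)"
    using b_self[OF uV] ip_self[OF VH[OF uV]] by metis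
  have p: "(nrm u)\<^sup>2 > 0" using u by simp
  have "complex_of_real ((nrm u)\<^sup>2) \<noteq> 0" using p by (simp only: of_real_eq_0_iff)
  then have "z = of_real (Re (b u u)) / of_real ((nrm u)\<^sup>2)" using * by (metis nonzero_mult_div_cancel_right)
  then have zr: "z = of_real (Re (b u u) / (nrm u)\<^sup>2)" by (simp only: of_real_divide)
  then have "Re z = Re (b u u) / (nrm u)\<^sup>2" by (metis Re_complex_of_real)
  then show "z = of_real (Re z)" "Re z \<ge> 0" using zr b_nonneg[OF uV] p by auto
qed

lemma eig_orthogonal:
  assumes "u \<in> eig (of_real r)" "v \<in> eig (of_real s)" "r \<noteq> s" shows "ip u v = 0"
proof -
  have V: "u \<in> V" "v \<in> V" using assms by (auto simp: eig_def)
  have "b u v = of_real r * ip u v" "b v u = of_real s * ip v u" using assms V by (auto simp: eig_def)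
  moreover have "ip v u = cnj (ip u v)" "b v u = cnj (b u v)"
    using b_sym[of u v] ip_sym[of u v] V by auto
  ultimately have "cnj (of_real r * ip u v) = of_real s * cnj (ip u v)" by metis
  then have "of_real r * cnj (ip u v) = of_real s * cnj (ip u v)" by simp
  then show ?thesis using assms by simp
qed

lemma normalise: assumes "u \<in> H" "nrm u \<noteq> 0" shows "nrm (of_real (1 / nrm u) \<odot> u) = 1"
  using assms nrm_nonneg[of u] by (simp add: nrm_scale norm_divide)

text \<open>Members of an orthonormal sequence keep the distance \<open>sqrt 2\<close>, so no subsequence is a Cauchy sequence.\<close>

lemma no_infinite_orthonormal:
  assumes f: "\<And>k::nat. f k \<in> V" and bd: "\<And>k. Re (b (f k) (f k)) \<le> R"
    and on: "\<And>j k. ip (f j) (f k) = (if j = k then 1 else 0)"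
  shows False
proof -
  have n1: "(nrm (f k))\<^sup>2 = 1" for k using nrm_sq[of "f k"] f on[of k k] by simp
  have "V.nrm (f k) \<le> sqrt (R + 1)" for k
    using V_nrm_sq[OF f, of k] bd[of k] n1[of k] f[of k] by (intro real_le_rsqrt) simp
  then obtain r :: "nat \<Rightarrow> nat" where r: "strict_mono r" "cauchy (f \<circ> r)" using compact[of f] f by blast
  then obtain N where N: "\<And>m n. m \<ge> N \<Longrightarrow> n \<ge> N \<Longrightarrow> nrm (f (r m) - f (r n)) < 1"
    unfolding cauchy_def by (metis comp_apply zero_less_one)
  have "r N \<noteq> r (Suc N)" using strict_monoD[OF r(1), of N "Suc N"] by simp
  then have "(nrm (f (r N) - f (r (Suc N))))\<^sup>2 = 2"
    using f n1 on by (simp add: nrm_diff_sq)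
  moreover have "(nrm (f (r N) - f (r (Suc N))))\<^sup>2 < 1\<^sup>2"
    using N[of N "Suc N"] f by (intro power_strict_mono) auto
  ultimately show False by simp
qed

text \<open>Otherwise dependent choice would produce an infinite orthonormal sequence of bounded energy. All
finiteness assertions about the spectrum are instances of this lemma.\<close>

lemma maximal_orthonormal:
  assumes X: "X \<subseteq> V" and bd: "\<And>x. x \<in> X \<Longrightarrow> Re (b x x) \<le> R" and n1: "\<And>x. x \<in> X \<Longrightarrow> nrm x = 1"
  shows "\<exists>S. finite S \<and> S \<subseteq> X \<and> (\<forall>s\<in>S. \<forall>t\<in>S. ip s t = (if s = t then 1 else 0)) \<and>
    (\<forall>x\<in>X. \<exists>s\<in>S. ip x s \<noteq> 0)"
proof -
  define P where "P f k x \<longleftrightarrow> x \<in> X \<and> (\<forall>j<k. ip x (f j) = 0)" for f :: "nat \<Rightarrow> 'v" and k x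
  have "\<not> (\<forall>k f. (\<forall>j<k. P f j (f j)) \<longrightarrow> (\<exists>x. P f k x))"
  proof
    assume *: "\<forall>k f. (\<forall>j<k. P f j (f j)) \<longrightarrow> (\<exists>x. P f k x)"
    have "\<exists>f. \<forall>k. P f k (f k)"
    proof (rule dependent_wellorder_choice)
      show "P f x r = P g x r" if "\<And>y. y < x \<Longrightarrow> f y = g y" for r f g x
        using that by (auto simp: P_def)
      show "\<exists>r. P f x r" if "\<And>y. y < x \<Longrightarrow> P f y (f y)" for x f using *[rule_format, of x f] that by blast
    qed
    then obtain f where "\<forall>k. P f k (f k)" ..
    then have f: "\<And>k. f k \<in> X" "\<And>k j. j < k \<Longrightarrow> ip (f k) (f j) = 0" unfolding P_def by blast+
    have fV: "f k \<in> V" for k using f X by auto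
    have "ip (f j) (f k) = (if j = k then 1 else 0)" for j k
    proof (cases j k rule: linorder_cases)
      case less then show ?thesis using f(2)[of j k] ip_sym[of "f k" "f j"] fV by simp
    next
      case equal then show ?thesis using n1[OF f(1)] ip_self[of "f k"] fV by simp
    next
      case greater then show ?thesis using f(2)[of k j] by simp
    qed
    then show False using no_infinite_orthonormal[of f R] fV bd f(1) by blast
  qed
  then obtain k f where k: "\<And>j. j < k \<Longrightarrow> P f j (f j)" and no: "\<And>x. \<not> P f k x" by blast
  have fX: "f j \<in> X" if "j < k" for j using k[OF that] by (simp add: P_def)
  have fV: "f j \<in> V" if "j < k" for j using fX[OF that] X by auto
  have on: "ip (f i) (f j) = (if i = j then 1 else 0)" if "i < k" "j < k" for i j
  proof (cases i j rule: linorder_cases)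
    case less then show ?thesis using k[OF that(2)] ip_sym[of "f j" "f i"] fV that by (simp add: P_def)
  next
    case equal then show ?thesis using n1[OF fX[OF that(2)]] ip_self[of "f j"] fV that by simp
  next
    case greater then show ?thesis using k[OF that(1)] by (simp add: P_def)
  qed
  have fin: "finite (f ` {..<k})" and sub: "f ` {..<k} \<subseteq> X" using fX by auto
  have orth: "ip s t = (if s = t then 1 else 0)" if st: "s \<in> f ` {..<k}" "t \<in> f ` {..<k}" for s t
  proof -
    obtain i j where ij: "s = f i" "t = f j" "i < k" "j < k" using st by auto
    have "f i = f j \<longleftrightarrow> i = j" using on[OF ij(3) ij(4)] on[OF ij(4) ij(4)] by (auto split: if_splits)
    then show ?thesis using on ij by auto
  qed
  have "\<exists>s\<in>f ` {..<k}. ip x s \<noteq> 0" if "x \<in> X" for x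
    using no[of x] that by (auto simp: P_def)
  then show ?thesis using fin sub orth by (intro exI[of _ "f ` {..<k}"] conjI ballI)
qed

text \<open>A maximal orthonormal set of eigenvectors is a basis of the eigenspace.\<close>

lemma finite_multiplicity_abs:
  obtains S where "finite S" "S \<subseteq> eig z" "\<And>u. u \<in> eig z \<Longrightarrow> \<exists>c. nrm (u - (\<Sum>s\<in>S. c s \<odot> s)) = 0"
proof -
  define X where "X = {u \<in> eig z. nrm u = 1}"
  have XV: "X \<subseteq> V" unfolding X_def eig_def by auto
  have bX: "Re (b x x) \<le> Re z" if "x \<in> X" for x
  proof -
    have "b x x = z * ip x x" "x \<in> V" using that unfolding X_def eig_def by auto
    then show ?thesis using that ip_self[of x] unfolding X_def by simp
  qed
  have nX: "nrm x = 1" if "x \<in> X" for x using that unfolding X_def by auto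
  obtain S where "finite S \<and> S \<subseteq> X \<and> (\<forall>s\<in>S. \<forall>t\<in>S. ip s t = (if s = t then 1 else 0)) \<and>
    (\<forall>x\<in>X. \<exists>s\<in>S. ip x s \<noteq> 0)"
    using maximal_orthonormal[OF XV bX nX] ..
  then have S: "finite S" "S \<subseteq> X" "\<And>s t. s \<in> S \<Longrightarrow> t \<in> S \<Longrightarrow> ip s t = (if s = t then 1 else 0)"
    "\<And>x. x \<in> X \<Longrightarrow> \<exists>s\<in>S. ip x s \<noteq> 0"
    by blast+
  have Se: "S \<subseteq> eig z" using S(2) unfolding X_def by auto
  have SH: "s \<in> H" if "s \<in> S" for s using that S(2) XV by auto
  show thesis
  proof (rule that[OF S(1) Se])
    fix u assume u: "u \<in> eig z"
    define w where "w = u - (\<Sum>s\<in>S. ip u s \<odot> s)"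
    have uH: "u \<in> H" using u by (auto simp: eig_def)
    have w: "w \<in> eig z" unfolding w_def using u Se eig_subspace
      by (intro subspace_diff subspace_sum subspace_scale) auto
    have wH: "w \<in> H" using w by (auto simp: eig_def)
    have o: "ip w s = 0" if "s \<in> S" for s
      unfolding w_def using that uH SH bessel_identity(1)[of S "\<lambda>s. s" s "\<lambda>s. ip u s"] S(1,3)
      by (subst ip_diff) auto
    have "nrm w = 0"
    proof (rule ccontr)
      assume nz: "nrm w \<noteq> 0"
      let ?x = "of_real (1 / nrm w) \<odot> w"
      have "?x \<in> X" unfolding X_def using w eig_subspace normalise[OF wH nz] by (auto intro: subspace_scale)
      then obtain s where "s \<in> S" "ip ?x s \<noteq> 0" using S(4) by blast
      then show False using o wH SH by (simp add: ip_scale)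
    qed
    then show "\<exists>c. nrm (u - (\<Sum>s\<in>S. c s \<odot> s)) = 0" unfolding w_def by blast
  qed
qed

definition eigenvalues :: "real set" where
  "eigenvalues = {r. \<exists>u\<in>eig (of_real r). nrm u \<noteq> 0}"

lemma eigenvalues_unit: assumes "r \<in> eigenvalues" obtains u where "u \<in> eig (of_real r)" "nrm u = 1" "Re (b u u) = r"
proof -
  obtain u where u: "u \<in> eig (of_real r)" "nrm u \<noteq> 0" using assms unfolding eigenvalues_def by auto
  have uH: "u \<in> H" using u by (auto simp: eig_def)
  let ?x = "of_real (1 / nrm u) \<odot> u"
  have x: "?x \<in> eig (of_real r)" "nrm ?x = 1"
    using u eig_subspace normalise[OF uH] by (auto intro: subspace_scale)
  moreover have "Re (b ?x ?x) = r"
  proof -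
    have "?x \<in> V" using x by (auto simp: eig_def)
    then have "b ?x ?x = of_real r * of_real ((nrm ?x)\<^sup>2)"
      using x(1) ip_self[of ?x] by (auto simp: eig_def)
    then show ?thesis using x(2) by simp
  qed
  ultimately show thesis using that by blast
qed

text \<open>Eigenvectors to different eigenvalues are orthogonal; a maximal orthonormal set of eigenvectors
with eigenvalues up to \<open>R\<close> therefore meets every eigenspace in question.\<close>

lemma finite_eigenvalues_below: "finite {r \<in> eigenvalues. r \<le> R}"
proof -
  define X where "X = {u. \<exists>r\<in>eigenvalues. r \<le> R \<and> u \<in> eig (of_real r) \<and> nrm u = 1 \<and> Re (b u u) = r}"
  have XV: "X \<subseteq> V" unfolding X_def eig_def by auto
  have bX: "Re (b x x) \<le> R" and nX: "nrm x = 1" if "x \<in> X" for x using that unfolding X_def by auto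
  obtain S where "finite S \<and> S \<subseteq> X \<and> (\<forall>s\<in>S. \<forall>t\<in>S. ip s t = (if s = t then 1 else 0)) \<and>
    (\<forall>x\<in>X. \<exists>s\<in>S. ip x s \<noteq> 0)"
    using maximal_orthonormal[OF XV bX nX] ..
  then have S: "finite S" "S \<subseteq> X" "\<And>s t. s \<in> S \<Longrightarrow> t \<in> S \<Longrightarrow> ip s t = (if s = t then 1 else 0)"
    "\<And>x. x \<in> X \<Longrightarrow> \<exists>s\<in>S. ip x s \<noteq> 0"
    by blast+
  have "{r \<in> eigenvalues. r \<le> R} \<subseteq> (\<lambda>s. Re (b s s)) ` S"
  proof
    fix r assume r: "r \<in> {r \<in> eigenvalues. r \<le> R}"
    then obtain u where u: "u \<in> eig (of_real r)" "nrm u = 1" "Re (b u u) = r" using eigenvalues_unit by blast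
    then have "u \<in> X" using r unfolding X_def by auto
    then obtain s where s: "s \<in> S" "ip u s \<noteq> 0" using S by blast
    then obtain t where "s \<in> eig (of_real t)" "Re (b s s) = t" using S(2) unfolding X_def by auto
    then have "r = t" using eig_orthogonal[OF u(1)] s by blast
    then show "r \<in> (\<lambda>s. Re (b s s)) ` S" using s \<open>Re (b s s) = t\<close> by auto
  qed
  then show ?thesis using S(1) finite_surj by blast
qed

text \<open>Each additional condition \<open>ip (f k) s = 0\<close> is met by combining disjoint pairs of members of the
sequence, which keeps it orthogonal.\<close>

lemma orthogonal_sequence:
  assumes "finite S" "S \<subseteq> V"
  shows "\<exists>f. (\<forall>k::nat. f k \<in> V \<and> nrm (f k) \<noteq> 0) \<and> (\<forall>j k. j \<noteq> k \<longrightarrow> ip (f j) (f k) = 0) \<and> (\<forall>k. \<forall>s\<in>S. ip (f k) s = 0)"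
  using assms
proof (induction S)
  case empty then show ?case using infinite_dim by simp
next
  case (insert s S)
  then obtain f where f: "\<And>k::nat. f k \<in> V" "\<And>k. nrm (f k) \<noteq> 0" "\<And>j k. j \<noteq> k \<Longrightarrow> ip (f j) (f k) = 0"
    "\<And>k t. t \<in> S \<Longrightarrow> ip (f k) t = 0" by (metis insert_subset)
  have sV: "s \<in> V" and SV: "S \<subseteq> V" using insert by auto
  define g where "g k = (if ip (f (2*k)) s = 0 then f (2*k)
     else ip (f (2*k+1)) s \<odot> f (2*k) - ip (f (2*k)) s \<odot> f (2*k+1))" for k
  have gV: "g k \<in> V" for k unfolding g_def using f by auto
  have o: "ip (g j) (f i) = 0" if "i \<noteq> 2*j" "i \<noteq> 2*j+1" for i j
    unfolding g_def using that f by (auto simp: ip_diff ip_scale)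
  have "ip (g j) (g k) = 0" if "j \<noteq> k" for j k
  proof -
    have a: "ip (g j) (f (2*k)) = 0" using that by (intro o) presburger+
    have b: "ip (g j) (f (2*k+1)) = 0" using that by (intro o) presburger+
    have gH: "g j \<in> H" using gV by auto
    show ?thesis
      using a b gH f(1) by (subst (2) g_def) (auto simp: ip_diff_right ip_scale_right)
  qed
  moreover have "nrm (g k) \<noteq> 0" for k
  proof (cases "ip (f (2*k)) s = 0")
    case True then show ?thesis unfolding g_def using f by simp
  next
    case False
    have "ip (g k) (f (2*k+1)) = - ip (f (2*k)) s * ip (f (2*k+1)) (f (2*k+1))"
      unfolding g_def using False f by (simp add: ip_diff ip_scale)
    moreover have "ip (f (2*k+1)) (f (2*k+1)) \<noteq> 0"
      using f(2)[of "2*k+1"] ip_self[of "f (2*k+1)"] f(1) by simp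
    ultimately have "ip (g k) (f (2*k+1)) \<noteq> 0" using False by simp
    then show ?thesis using null_ip(1)[of "g k" "f (2*k+1)"] gV f by auto
  qed
  moreover have "ip (g k) t = 0" if "t \<in> insert s S" for k t
  proof (cases "t = s")
    case True then show ?thesis unfolding g_def using f sV by (auto simp: ip_diff ip_scale)
  next
    case False
    then have "t \<in> S" "t \<in> V" using that SV by auto
    then show ?thesis unfolding g_def using f by (auto simp: ip_diff ip_scale)
  qed
  ultimately show ?case using gV by (intro exI[of _ g]) auto
qed

end

context compact_form
begin

text \<open>If the estimate failed, there would be unit vectors \<open>U k\<close> with \<open>(G - z) U k \<longlonglongrightarrow> 0\<close>. Their energies
are bounded, so a subsequence converges, and since \<open>G\<close> is closed the limit is an eigenvector.\<close>

lemma resolvent_bounded: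
  assumes ne: "\<And>u. u \<in> eig z \<Longrightarrow> nrm u = 0"
  shows "\<exists>C\<ge>0. \<forall>u f. (u, f) \<in> G \<longrightarrow> nrm u \<le> C * nrm (f - z \<odot> u)"
proof (rule ccontr)
  assume "\<not> ?thesis"
  then have *: "\<And>C. C \<ge> 0 \<Longrightarrow> \<exists>u f. (u, f) \<in> G \<and> C * nrm (f - z \<odot> u) < nrm u" by (meson not_le)
  \<comment> \<open>Failure of the estimate with the constant k + 1, normalised to unit length.\<close>
  have "\<exists>u f. (u, f) \<in> G \<and> nrm u = 1 \<and> nrm (f - z \<odot> u) < 1 / (real k + 1)" for k :: nat
  proof -
    obtain u f where uf: "(u, f) \<in> G" "(real k + 1) * nrm (f - z \<odot> u) < nrm u"
      using *[of "real k + 1"] by auto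
    have m: "u \<in> H" "f \<in> H" using G_mem[OF uf(1)] by auto
    have "0 \<le> (real k + 1) * nrm (f - z \<odot> u)" using m by auto
    then have pos: "nrm u > 0" using uf(2) by linarith
    let ?c = "complex_of_real (1 / nrm u)"
    have G: "(?c \<odot> u, ?c \<odot> f) \<in> G" using G_linear[OF uf(1) G_zero, of ?c] by simp
    have n1: "nrm (?c \<odot> u) = 1" using normalise m pos by auto
    have "?c \<odot> f - z \<odot> ?c \<odot> u = ?c \<odot> (f - z \<odot> u)"
      by (simp add: scale_right_diff_distrib scale_left_commute)
    then have "nrm (?c \<odot> f - z \<odot> ?c \<odot> u) = nrm (f - z \<odot> u) / nrm u"
      using m pos by (simp add: nrm_scale norm_divide)
    also have "\<dots> < 1 / (real k + 1)" using uf(2) pos by (simp add: field_simps)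
    finally show ?thesis using G n1 by blast
  qed
  then obtain U F where UF: "\<And>k. (U k, F k) \<in> G" "\<And>k. nrm (U k) = 1"
    "\<And>k. nrm (F k - z \<odot> U k) < 1 / (real k + 1)" by metis
  have UV: "U k \<in> V" "F k \<in> H" for k using G_mem[OF UF(1)] by auto
  have "V.nrm (U k) \<le> sqrt (cmod z + 2)" for k
  proof -
    have "nrm (F k) \<le> nrm (F k - z \<odot> U k) + nrm (z \<odot> U k)"
      using nrm_triangle[of "F k - z \<odot> U k" "z \<odot> U k"] UV by auto
    also have "nrm (F k - z \<odot> U k) \<le> 1"
      using UF(3)[of k] by (smt (verit) divide_le_eq_1_pos of_nat_0_le_iff)
    finally have nF: "nrm (F k) \<le> 1 + cmod z" using UV UF(2) by (simp add: nrm_scale)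
    have "Re (b (U k) (U k)) = Re (ip (F k) (U k))" using UF(1)[of k] UV unfolding G_def by auto
    also have "\<dots> \<le> nrm (F k) * nrm (U k)"
      using cauchy_schwarz[of "F k" "U k"] UV complex_Re_le_cmod order_trans by blast
    finally have "(V.nrm (U k))\<^sup>2 \<le> cmod z + 2" using V_nrm_sq[OF UV(1), of k] nF UF(2)[of k] by simp
    then show ?thesis by (rule real_le_rsqrt)
  qed
  then obtain r :: "nat \<Rightarrow> nat" where r: "strict_mono r" "cauchy (U \<circ> r)" using compact[of U] UV by blast
  then obtain u where u: "u \<in> H" "lim_to (U \<circ> r) u" using complete[of "U \<circ> r"] UV by auto
  have "(\<lambda>k. nrm ((U \<circ> r) k)) \<longlonglongrightarrow> nrm u" by (rule lim_nrm[OF _ u]) (use UV in auto)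
  then have nu: "nrm u = 1" using UF(2) by (simp add: LIMSEQ_const_iff)
  have err: "(\<lambda>k. nrm (F (r k) - z \<odot> U (r k))) \<longlonglongrightarrow> 0"
  proof (rule Lim_null_comparison)
    show "\<forall>\<^sub>F k in sequentially. norm (nrm (F (r k) - z \<odot> U (r k))) \<le> inverse (real (Suc (r k)))"
      using UF(3) UV by (auto simp: inverse_eq_divide add.commute less_imp_le)
    show "(\<lambda>k. inverse (real (Suc (r k)))) \<longlonglongrightarrow> 0"
      using LIMSEQ_subseq_LIMSEQ[OF LIMSEQ_inverse_real_of_nat r(1)] by (simp add: o_def)
  qed
  have "(u, z \<odot> u) \<in> G"
  proof (rule G_adjoint)
    fix x y assume xy: "(x, y) \<in> G"
    have xyH: "x \<in> H" "y \<in> H" using G_mem[OF xy] by auto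
    have l1: "(\<lambda>k. ip y ((U \<circ> r) k)) \<longlonglongrightarrow> ip y u" by (rule lim_ip_right) (use UV u xyH in \<open>auto simp: o_def\<close>)
    have "lim_to (\<lambda>k. F (r k)) (z \<odot> u)" unfolding lim_to_def
    proof (rule Lim_null_comparison)
      have "nrm (F (r k) - z \<odot> u) \<le> nrm (F (r k) - z \<odot> U (r k)) + cmod z * nrm (U (r k) - u)" for k
        using nrm_triangle_diff[of "F (r k)" "z \<odot> U (r k)" "z \<odot> u"] nrm_scale[of "U (r k) - u" z] UV u
        by (auto simp: scale_right_diff_distrib)
      then show "\<forall>\<^sub>F k in sequentially. norm (nrm (F (r k) - z \<odot> u)) \<le> nrm (F (r k) - z \<odot> U (r k)) + cmod z * nrm ((U \<circ> r) k - u)"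
        using UV u by auto
      show "(\<lambda>k. nrm (F (r k) - z \<odot> U (r k)) + cmod z * nrm ((U \<circ> r) k - u)) \<longlonglongrightarrow> 0"
        using tendsto_add[OF err tendsto_mult_right_zero[OF u(2)[unfolded lim_to_def], of "cmod z"]] by simp
    qed
    then have l2: "(\<lambda>k. ip x (F (r k))) \<longlonglongrightarrow> ip x (z \<odot> u)" using UV u xyH by (intro lim_ip_right) auto
    have "ip y (U (r k)) = ip x (F (r k))" for k using G_symmetric[OF xy UF(1)] .
    then show "ip y u = ip x (z \<odot> u)" using LIMSEQ_unique[OF l1] l2 by simp
  qed (use u in auto)
  then have "u \<in> eig z" by (simp add: eig_G)
  then show False using ne nu by fastforce
qed

text \<open>By \<open>resolvent_bounded\<close> the range of \<open>G - z\<close> is closed. Its orthogonal complement is the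
eigenspace for \<open>cnj z\<close>, which is trivial: eigenvalues are real, so \<open>cnj z\<close> is one only if \<open>z\<close> is.\<close>

lemma resolvent_onto:
  assumes ne: "\<And>u. u \<in> eig z \<Longrightarrow> nrm u = 0" and h: "h \<in> H"
  shows "\<exists>u f. (u, f) \<in> G \<and> f - z \<odot> u = h"
proof -
  obtain C where C: "C \<ge> 0" "\<And>u f. (u, f) \<in> G \<Longrightarrow> nrm u \<le> C * nrm (f - z \<odot> u)"
    using resolvent_bounded[OF ne] by blast
  define M where "M = {f - z \<odot> u | u f. (u, f) \<in> G}"
  have Mc: "c \<odot> x + y \<in> M" if xy: "x \<in> M" "y \<in> M" for c x y
  proof -
    obtain u f v g where a: "(u, f) \<in> G" "(v, g) \<in> G" "x = f - z \<odot> u" "y = g - z \<odot> v"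
      using xy unfolding M_def by blast
    have "c \<odot> x + y = (c \<odot> f + g) - z \<odot> (c \<odot> u + v)"
      unfolding a by (simp add: scale_right_diff_distrib scale_right_distrib scale_left_commute)
    then show ?thesis using G_linear[OF a(1,2), of c] unfolding M_def by blast
  qed
  have M0: "0 \<in> M" unfolding M_def using G_zero by (intro CollectI exI[of _ 0]) simp
  have sM: "subspace M"
    by (rule subspaceI) (use M0 Mc[of _ _ 1] Mc[OF _ M0] in auto)
  have MH: "M \<subseteq> H" unfolding M_def using G_mem by blast
  obtain Y y where Y: "\<And>n::nat. Y n \<in> M" and y: "y \<in> H" "lim_to Y y" and o: "\<And>m. m \<in> M \<Longrightarrow> ip (h - y) m = 0"
    using projection[OF sM MH h] by blast
  define w where "w = h - y"
  have w: "w \<in> H" unfolding w_def using h y by auto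
  have "(w, cnj z \<odot> w) \<in> G"
  proof (rule G_adjoint[OF w])
    fix u f assume uf: "(u, f) \<in> G"
    have m: "u \<in> H" "f \<in> H" using G_mem[OF uf] by auto
    have "ip w (f - z \<odot> u) = 0" using o uf unfolding w_def M_def by blast
    then have "ip (f - z \<odot> u) w = 0" using ip_sym[of w "f - z \<odot> u"] w m by simp
    then show "ip f w = ip u (cnj z \<odot> w)" using m w by (simp add: ip_diff ip_scale ip_scale_right)
  qed (use w in auto)
  then have we: "w \<in> eig (cnj z)" by (simp add: eig_G)
  have nw: "nrm w = 0"
  proof (rule ccontr)
    assume nz: "nrm w \<noteq> 0"
    have "cnj z = z" using eig_real(1)[OF we nz] by (metis complex_cnj_cnj complex_cnj_complex_of_real)
    then show False using we ne nz by simp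
  qed
  have "\<exists>u f. (u, f) \<in> G \<and> Y n = f - z \<odot> u" for n using Y[of n] unfolding M_def by blast
  then obtain U F where UF: "\<And>n. (U n, F n) \<in> G" "\<And>n. Y n = F n - z \<odot> U n" by metis
  have UV: "U n \<in> H" "F n \<in> H" for n using G_mem[OF UF(1)] by auto
  have YH: "Y n \<in> H" for n using Y MH by auto
  have lh: "lim_to Y h" unfolding lim_to_def
  proof (rule Lim_null_comparison)
    show "(\<lambda>n. nrm (Y n - y)) \<longlonglongrightarrow> 0" using y(2) unfolding lim_to_def .
    have "nrm (Y n - h) \<le> nrm (Y n - y)" for n
      using nrm_triangle_diff[of "Y n" y h] nw nrm_minus_commute[of h y] h y YH[of n] unfolding w_def by simp
    then show "\<forall>\<^sub>F n in sequentially. norm (nrm (Y n - h)) \<le> nrm (Y n - y)" using YH h by auto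
  qed
  have "cauchy Y" using convergent_cauchy[OF YH h lh] .
  have "cauchy U" unfolding cauchy_def
  proof (intro allI impI)
    fix e :: real assume e: "e > 0"
    have "e / (C + 1) > 0" using e C by simp
    then obtain N where N: "\<And>m n. m \<ge> N \<Longrightarrow> n \<ge> N \<Longrightarrow> nrm (Y m - Y n) < e / (C + 1)"
      using \<open>cauchy Y\<close> unfolding cauchy_def by blast
    have "nrm (U m - U n) < e" if "m \<ge> N" "n \<ge> N" for m n
    proof -
      have "((-1) \<odot> U n + U m, (-1) \<odot> F n + F m) \<in> G" using G_linear[OF UF(1) UF(1)] .
      then have "(U m - U n, F m - F n) \<in> G" by (simp add: add.commute)
      then have "nrm (U m - U n) \<le> C * nrm ((F m - F n) - z \<odot> (U m - U n))" by (rule C(2))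
      also have "(F m - F n) - z \<odot> (U m - U n) = Y m - Y n" unfolding UF(2) by (simp add: scale_right_diff_distrib)
      also have "C * nrm (Y m - Y n) \<le> (C + 1) * nrm (Y m - Y n)" using YH by (intro mult_right_mono) auto
      also have "\<dots> < e" using N[OF that] C by (simp add: field_simps)
      finally show ?thesis .
    qed
    then show "\<exists>N. \<forall>m\<ge>N. \<forall>n\<ge>N. nrm (U m - U n) < e" by blast
  qed
  then obtain u where u: "u \<in> H" "lim_to U u" using complete UV by blast
  have "(u, h + z \<odot> u) \<in> G"
  proof (rule G_adjoint)
    fix x f assume xf: "(x, f) \<in> G"
    have m: "x \<in> H" "f \<in> H" using G_mem[OF xf] by auto
    have l1: "(\<lambda>k. ip f (U k)) \<longlonglongrightarrow> ip f u" using UV u m by (intro lim_ip_right) auto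
    have l2: "(\<lambda>k. ip x (Y k) + cnj z * ip x (U k)) \<longlonglongrightarrow> ip x h + cnj z * ip x u"
      using YH h lh UV u m by (intro tendsto_add tendsto_mult tendsto_const lim_ip_right) auto
    have "ip x (Y k) + cnj z * ip x (U k) = ip f (U k)" for k
      using G_symmetric[OF xf UF(1)[of k]] UF(2)[of k] m UV by (simp add: ip_diff_right ip_scale_right)
    then have "ip f u = ip x h + cnj z * ip x u" using LIMSEQ_unique[OF l1] l2 by simp
    then show "ip f u = ip x (h + z \<odot> u)" using m h u by (simp add: ip_add_right ip_scale_right)
  qed (use u h in auto)
  then show ?thesis by (intro exI[of _ u] exI[of _ "h + z \<odot> u"]) simp
qed

text \<open>The Rayleigh quotient attains its minimum \<open>\<kappa>\<close> on the orthogonal complement \<open>W\<close> of \<open>S\<close> in \<open>V\<close>: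
a minimising sequence has a subsequence that converges in \<open>H\<close>, and by the parallelogram law for the
form it converges in the form norm, too. The form \<open>b - \<kappa> ip\<close> is nonnegative on \<open>W\<close> and vanishes at
the minimiser, hence by the Cauchy-Schwarz inequality the minimiser is a weak eigenvector with
respect to \<open>W\<close>; as \<open>S\<close> consists of eigenvectors, this extends to all of \<open>V\<close>.\<close>

lemma eigenvector_orthogonal_to:
  assumes S: "finite S" "S \<subseteq> V" and Seig: "\<And>s. s \<in> S \<Longrightarrow> \<exists>r::real. s \<in> eig (of_real r)"
    and on: "\<And>s t. s \<in> S \<Longrightarrow> t \<in> S \<Longrightarrow> ip s t = (if s = t then 1 else 0)"
  shows "\<exists>r u. u \<in> eig (of_real r) \<and> nrm u = 1 \<and> (\<forall>s\<in>S. ip u s = 0)"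
proof -
  define W where "W = {v \<in> V. \<forall>s\<in>S. ip v s = 0}"
  have WV: "v \<in> V" if "v \<in> W" for v using that by (auto simp: W_def)
  have sW: "subspace W"
    unfolding W_def using S(2) by (intro subspaceI) (auto simp: ip_add ip_scale subset_iff)
  have W1: "\<exists>v\<in>W. nrm v = 1"
  proof -
    obtain f where f: "\<And>k::nat. f k \<in> V" "\<And>k. nrm (f k) \<noteq> 0" "\<And>k t. t \<in> S \<Longrightarrow> ip (f k) t = 0"
      using orthogonal_sequence[OF S] by blast
    have "f 0 \<in> W" using f by (auto simp: W_def)
    then show ?thesis using normalise[of "f 0"] f sW by (meson VH subspace_scale)
  qed
  define D where "D = (\<lambda>v. Re (b v v)) ` {v \<in> W. nrm v = 1}"
  define \<kappa> where "\<kappa> = Inf D"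
  have ne: "D \<noteq> {}" unfolding D_def using W1 by auto
  have bb: "bdd_below D" unfolding D_def using b_nonneg WV by (auto intro!: bdd_belowI2[where m = 0])
  have l0: "\<kappa> \<ge> 0" unfolding \<kappa>_def using ne b_nonneg WV by (intro cInf_greatest) (auto simp: D_def)
  have low: "\<kappa> * (nrm v)\<^sup>2 \<le> Re (b v v)" if v: "v \<in> W" for v
  proof (cases "nrm v = 0")
    case True then show ?thesis using b_nonneg[OF WV[OF v]] by simp
  next
    case False
    let ?x = "of_real (1 / nrm v) \<odot> v"
    have "?x \<in> W" "nrm ?x = 1" using v sW normalise[of v] False WV by (auto intro: subspace_scale)
    then have "\<kappa> \<le> Re (b ?x ?x)" unfolding \<kappa>_def by (intro cInf_lower bb) (auto simp: D_def)
    also have "b ?x ?x = of_real ((1 / nrm v)\<^sup>2) * b v v"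
      using WV[OF v] by (simp add: b_scale b_scale_right power2_eq_square)
    also have "Re \<dots> = Re (b v v) / (nrm v)\<^sup>2" by (simp add: power_one_over Re_divide_of_real flip: of_real_power)
    finally show ?thesis using False by (simp add: field_simps)
  qed
  have "\<exists>v\<in>W. nrm v = 1 \<and> Re (b v v) < \<kappa> + 1 / (real k + 1)" for k :: nat
  proof -
    have "Inf D < \<kappa> + 1 / (real k + 1)" unfolding \<kappa>_def by simp
    then show ?thesis using cInf_lessD[OF ne, of "\<kappa> + 1 / (real k + 1)"] unfolding D_def by blast
  qed
  then obtain X where X: "\<And>k. X k \<in> W" "\<And>k. nrm (X k) = 1" "\<And>k. Re (b (X k) (X k)) < \<kappa> + 1 / (real k + 1)"
    by metis
  have XV: "X k \<in> V" for k using X WV by auto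
  have "V.nrm (X k) \<le> sqrt (\<kappa> + 2)" for k
  proof -
    have "1 / (real k + 1) \<le> 1" by simp
    moreover have "(V.nrm (X k))\<^sup>2 = Re (b (X k) (X k)) + 1" using V_nrm_sq[OF XV, of k] X(2)[of k] by simp
    ultimately have "(V.nrm (X k))\<^sup>2 \<le> \<kappa> + 2" using X(3)[of k] by linarith
    then show ?thesis by (rule real_le_rsqrt)
  qed
  then obtain r :: "nat \<Rightarrow> nat" where r: "strict_mono r" "cauchy (X \<circ> r)" using compact[of X] XV by blast
  define Y where "Y = X \<circ> r"
  have Y: "Y k \<in> W" "Y k \<in> V" "nrm (Y k) = 1" for k using X XV by (auto simp: Y_def)
  have bY: "(\<lambda>k. Re (b (Y k) (Y k))) \<longlonglongrightarrow> \<kappa>"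
  proof (rule LIM_zero_cancel, rule Lim_null_comparison)
    have "norm (Re (b (Y k) (Y k)) - \<kappa>) \<le> inverse (real (Suc (r k)))" for k
      using X(3)[of "r k"] low[OF Y(1), of k] Y(3)[of k] by (simp add: Y_def inverse_eq_divide add.commute)
    then show "\<forall>\<^sub>F k in sequentially. norm (Re (b (Y k) (Y k)) - \<kappa>) \<le> inverse (real (Suc (r k)))" by simp
    show "(\<lambda>k. inverse (real (Suc (r k)))) \<longlonglongrightarrow> 0"
      using LIMSEQ_subseq_LIMSEQ[OF LIMSEQ_inverse_real_of_nat r(1)] by (simp add: o_def)
  qed
  have est: "(V.nrm (Y m - Y n))\<^sup>2 \<le> 2 * (Re (b (Y m) (Y m)) - \<kappa>) + 2 * (Re (b (Y n) (Y n)) - \<kappa>) + (\<kappa> + 1) * (nrm (Y m - Y n))\<^sup>2" for m n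
  proof -
    have "(V.nrm (Y m - Y n))\<^sup>2 = 2 * (V.nrm (Y m))\<^sup>2 + 2 * (V.nrm (Y n))\<^sup>2 - (V.nrm (Y m + Y n))\<^sup>2"
      by (rule V.parallelogram[OF Y(2) Y(2)])
    moreover have PQ: "(nrm (Y m - Y n))\<^sup>2 = 4 - (nrm (Y m + Y n))\<^sup>2"
      using parallelogram[of "Y m" "Y n"] Y by simp
    moreover have "\<kappa> * (nrm (Y m - Y n))\<^sup>2 = \<kappa> * 4 - \<kappa> * (nrm (Y m + Y n))\<^sup>2"
      unfolding PQ by (rule right_diff_distrib)
    moreover have "(V.nrm (Y m + Y n))\<^sup>2 = Re (b (Y m + Y n) (Y m + Y n)) + (nrm (Y m + Y n))\<^sup>2"
      using Y by (intro V_nrm_sq) auto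
    moreover have "\<kappa> * (nrm (Y m + Y n))\<^sup>2 \<le> Re (b (Y m + Y n) (Y m + Y n))"
      using Y sW by (intro low subspace_add)
    moreover have "(V.nrm (Y m))\<^sup>2 = Re (b (Y m) (Y m)) + 1" "(V.nrm (Y n))\<^sup>2 = Re (b (Y n) (Y n)) + 1"
      using V_nrm_sq[OF Y(2)] Y(3) by simp_all
    ultimately show ?thesis using Y(3)[of m] Y(3)[of n] by (simp add: algebra_simps)
  qed
  have "V.cauchy Y" unfolding V.cauchy_def
  proof (intro allI impI)
    fix e :: real assume e: "e > 0"
    obtain N1 where N1: "\<And>k. k \<ge> N1 \<Longrightarrow> norm (Re (b (Y k) (Y k)) - \<kappa>) < e\<^sup>2 / 8"
      using bY e unfolding LIMSEQ_iff by (meson divide_pos_pos zero_less_numeral zero_less_power)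
    have dp: "e / (2 * sqrt (\<kappa> + 1)) > 0" using e l0 by simp
    obtain N2 where N2: "\<And>m n. m \<ge> N2 \<Longrightarrow> n \<ge> N2 \<Longrightarrow> nrm (Y m - Y n) < e / (2 * sqrt (\<kappa> + 1))"
      using r(2) dp unfolding cauchy_def Y_def by blast
    have "V.nrm (Y m - Y n) < e" if mn: "m \<ge> max N1 N2" "n \<ge> max N1 N2" for m n
    proof -
      have "(nrm (Y m - Y n))\<^sup>2 < (e / (2 * sqrt (\<kappa> + 1)))\<^sup>2"
        using mn Y by (intro power_strict_mono N2) auto
      then have "(\<kappa> + 1) * (nrm (Y m - Y n))\<^sup>2 < e\<^sup>2 / 4"
        using l0 by (simp add: power_divide power_mult_distrib field_simps)
      moreover have "Re (b (Y k) (Y k)) - \<kappa> < e\<^sup>2 / 8" if "k \<ge> N1" for k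
        using N1[OF that] unfolding real_norm_def by (rule le_less_trans[OF abs_ge_self])
      then have "Re (b (Y m) (Y m)) - \<kappa> < e\<^sup>2 / 8" "Re (b (Y n) (Y n)) - \<kappa> < e\<^sup>2 / 8"
        using mn by auto
      moreover have "e\<^sup>2 > 0" using e by simp
      moreover have "v < E" if "v \<le> 2 * p + 2 * q + w" "w < E / 4" "p < E / 8" "q < E / 8" "0 < E"
        for v p q w E :: real using that by linarith
      ultimately have "(V.nrm (Y m - Y n))\<^sup>2 < e\<^sup>2" using est[of m n] by blast
      then show ?thesis using e by (simp add: power2_less_imp_less)
    qed
    then show "\<exists>N. \<forall>m\<ge>N. \<forall>n\<ge>N. V.nrm (Y m - Y n) < e" by blast
  qed
  then obtain u where u: "u \<in> V" "V.lim_to Y u" using V.complete Y by blast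
  have lu: "lim_to Y u" unfolding lim_to_def
  proof (rule Lim_null_comparison)
    show "(\<lambda>n. V.nrm (Y n - u)) \<longlonglongrightarrow> 0" using u(2) unfolding V.lim_to_def .
    show "\<forall>\<^sub>F n in sequentially. norm (nrm (Y n - u)) \<le> V.nrm (Y n - u)"
      using Y u nrm_le_V[of "Y _ - u"] by auto
  qed
  have nu: "nrm u = 1"
  proof -
    have "(\<lambda>n. nrm (Y n)) \<longlonglongrightarrow> nrm u" using Y u lu by (intro lim_nrm) auto
    then show ?thesis using Y(3) by (simp add: LIMSEQ_const_iff)
  qed
  have uW: "u \<in> W" unfolding W_def
  proof (intro CollectI conjI ballI u(1))
    fix s assume s: "s \<in> S"
    have "(\<lambda>n. ip (Y n) s) \<longlonglongrightarrow> ip u s" using Y u lu s S by (intro lim_ip) auto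
    moreover have "ip (Y n) s = 0" for n using Y(1)[of n] s by (simp add: W_def)
    ultimately show "ip u s = 0" by (simp add: LIMSEQ_const_iff)
  qed
  have bu: "Re (b u u) = \<kappa>"
  proof (rule LIMSEQ_unique)
    have "(\<lambda>n. (V.nrm (Y n))\<^sup>2 - 1) \<longlonglongrightarrow> (V.nrm u)\<^sup>2 - 1"
      by (intro tendsto_intros V.lim_nrm Y u)
    then show "(\<lambda>n. Re (b (Y n) (Y n))) \<longlonglongrightarrow> Re (b u u)" using V_nrm_sq Y u nu by simp
    show "(\<lambda>n. Re (b (Y n) (Y n))) \<longlonglongrightarrow> \<kappa>" by (rule bY)
  qed
  interpret Q: semi_inner scale W "\<lambda>u v. b u v - of_real \<kappa> * ip u v"
  proof
    show "subspace W" by (rule sW)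
    show "0 \<le> Re (b x x - of_real \<kappa> * ip x x)" if "x \<in> W" for x
      using low[OF that] nrm_sq[of x] WV[OF that] by auto
    show "b y x - complex_of_real \<kappa> * ip y x = cnj (b x y - complex_of_real \<kappa> * ip x y)"
      if "x \<in> W" "y \<in> W" for x y
      using WV[OF that(1)] WV[OF that(2)] b_sym[of x y] ip_sym[of x y] by simp
  qed (use WV in \<open>auto simp: b_add b_scale ip_add ip_scale algebra_simps\<close>)
  have Qn: "Q.nrm u = 0" unfolding Q.nrm_def using bu nrm_sq[of u] nu u by simp
  have "u \<in> eig (of_real \<kappa>)" unfolding eig_def
  proof (intro CollectI conjI ballI u(1))
    fix v assume v: "v \<in> V"
    \<comment> \<open>Split the test vector into its projection to the span of S and a remainder in W.\<close>
    define p where "p = (\<Sum>s\<in>S. ip v s \<odot> s)"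
    have pV: "p \<in> V" unfolding p_def using S(2) by auto
    have o: "ip (v - p) s = 0" if "s \<in> S" for s
    proof -
      have "ip p s = ip v s" unfolding p_def
        using that S on by (intro bessel_identity(1)[where e = "\<lambda>s. s"]) auto
      then show ?thesis using that v pV S by (subst ip_diff) auto
    qed
    then have "v - p \<in> W" unfolding W_def using v pV by auto
    then have 1: "b u (v - p) = of_real \<kappa> * ip u (v - p)" using Q.null_ip(1)[OF uW _ Qn] by simp
    have us: "ip u s = 0 \<and> b u s = 0" if s: "s \<in> S" for s
    proof -
      have sV: "s \<in> V" using s S by auto
      obtain t :: real where t: "s \<in> eig (of_real t)" using Seig s by blast
      have "b s u = of_real t * ip s u" using t u(1) by (auto simp: eig_def)
      moreover have "ip u s = 0" using uW s by (auto simp: W_def)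
      ultimately show ?thesis using ip_sym[of u s] b_sym[of s u] sV u by simp
    qed
    have SV: "s \<in> V" if "s \<in> S" for s using S(2) that by auto
    have "ip u p = (\<Sum>s\<in>S. ip u (ip v s \<odot> s))"
      unfolding p_def using SV u by (intro ip_sum_right) auto
    also have "\<dots> = 0" using SV us u by (intro sum.neutral) (simp add: ip_scale_right)
    finally have ipp: "ip u p = 0" .
    have "b u p + ip u p = (\<Sum>s\<in>S. b u (ip v s \<odot> s) + ip u (ip v s \<odot> s))"
      unfolding p_def using S(2) u by (intro V.ip_sum_right) auto
    also have "\<dots> = 0"
    proof (rule sum.neutral, rule ballI)
      fix s assume s: "s \<in> S"
      then have "s \<in> V" using S by auto
      then show "b u (ip v s \<odot> s) + ip u (ip v s \<odot> s) = 0"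
        using us[OF s] u(1) by (simp add: ip_scale_right b_scale_right)
    qed
    finally have "b u p + ip u p = 0" .
    then have bp: "b u p = 0" using ipp by simp
    have "b u v = b u (v - p) + b u p" using b_add_right[of "v - p" p u] v pV u by simp
    also have "\<dots> = of_real \<kappa> * ip u v" using 1 bp ipp v pV u by (simp add: ip_diff_right)
    finally show "b u v = of_real \<kappa> * ip u v" .
  qed
  then show ?thesis using nu uW unfolding W_def by blast
qed

lemma eigenvalues_nonneg: "r \<in> eigenvalues \<Longrightarrow> r \<ge> 0"
  unfolding eigenvalues_def using eig_real(2) by fastforce

text \<open>If there were finitely many eigenvalues, all eigenvectors together would admit a finite maximal
orthonormal set, and \<open>eigenvector_orthogonal_to\<close> would contradict its maximality.\<close>

lemma infinite_eigenvalues: "infinite eigenvalues"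
proof
  assume fin: "finite eigenvalues"
  then obtain R where R: "\<And>r. r \<in> eigenvalues \<Longrightarrow> r \<le> R" using bdd_above_finite[OF fin] unfolding bdd_above_def by blast
  define X where "X = {u. \<exists>r\<in>eigenvalues. u \<in> eig (of_real r) \<and> nrm u = 1 \<and> Re (b u u) = r}"
  have XV: "X \<subseteq> V" unfolding X_def eig_def by auto
  have bX: "Re (b x x) \<le> R" and nX: "nrm x = 1" if "x \<in> X" for x using that R unfolding X_def by auto
  obtain S where "finite S \<and> S \<subseteq> X \<and> (\<forall>s\<in>S. \<forall>t\<in>S. ip s t = (if s = t then 1 else 0)) \<and>
    (\<forall>x\<in>X. \<exists>s\<in>S. ip x s \<noteq> 0)"
    using maximal_orthonormal[OF XV bX nX] ..
  then have S: "finite S" "S \<subseteq> X" "\<And>s t. s \<in> S \<Longrightarrow> t \<in> S \<Longrightarrow> ip s t = (if s = t then 1 else 0)"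
    "\<And>x. x \<in> X \<Longrightarrow> \<exists>s\<in>S. ip x s \<noteq> 0"
    by blast+
  have "\<exists>r u. u \<in> eig (of_real r) \<and> nrm u = 1 \<and> (\<forall>s\<in>S. ip u s = 0)"
    by (rule eigenvector_orthogonal_to) (use S XV in \<open>auto simp: X_def\<close>)
  then obtain r u where u: "u \<in> eig (of_real r)" "nrm u = 1" "\<And>s. s \<in> S \<Longrightarrow> ip u s = 0" by blast
  have uV: "u \<in> V" using u by (auto simp: eig_def)
  have "b u u = of_real r * ip u u" using u uV by (auto simp: eig_def)
  then have "Re (b u u) = r" using ip_self[of u] u uV by simp
  moreover have "r \<in> eigenvalues" unfolding eigenvalues_def using u(1,2) by (auto intro!: bexI[of _ u])
  ultimately have "u \<in> X" unfolding X_def using u by auto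
  then show False using S(4) u(3) by blast
qed

lemma eigenvalues_enumeration: obtains ev :: "nat \<Rightarrow> real" where "inj ev" "range ev = eigenvalues"
proof -
  have "eigenvalues = (\<Union>k::nat. {r \<in> eigenvalues. r \<le> real k})" using real_arch_simple by auto
  moreover have "countable (\<Union>k::nat. {r \<in> eigenvalues. r \<le> real k})"
    by (rule countable_UN[OF countableI_type countable_finite[OF finite_eigenvalues_below]])
  ultimately have ce: "countable eigenvalues" by metis
  then have "bij_betw (from_nat_into eigenvalues) UNIV eigenvalues" using infinite_eigenvalues by (rule bij_betw_from_nat_into)
  then show thesis using that unfolding bij_betw_def by blast
qed

end

section \<open>Smooth functions\<close>

text \<open>The counterpart in one variable of \<^const>\<open>Ck\<close>. Test functions in three variables are built as
products of smooth functions of a linear form, so that smoothness is decided in one variable.\<close>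

primrec smooth1 :: "nat \<Rightarrow> (real \<Rightarrow> 'a::real_normed_field) \<Rightarrow> bool" where
  "smooth1 0 f \<longleftrightarrow> continuous_on UNIV f"
| "smooth1 (Suc k) f \<longleftrightarrow> (\<exists>f'. (\<forall>t. (f has_vector_derivative f' t) (at t)) \<and> smooth1 k f')"

lemma smooth1_SucI:
  "\<lbrakk>\<And>t. (f has_vector_derivative f' t) (at t); smooth1 k f'\<rbrakk> \<Longrightarrow> smooth1 (Suc k) f"
  by auto

lemma smooth1_continuous: "smooth1 k f \<Longrightarrow> continuous_on UNIV f"
proof (cases k)
  case (Suc j)
  assume "smooth1 k f"
  then obtain f' where "\<And>t. (f has_vector_derivative f' t) (at t)" using Suc by auto
  then show ?thesis
    by (meson continuous_at_imp_continuous_on has_vector_derivative_continuous)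
qed simp

lemma smooth1_Suc_imp: "smooth1 (Suc k) f \<Longrightarrow> smooth1 k f"
proof (induction k arbitrary: f)
  case 0 then show ?case by (metis smooth1_continuous smooth1.simps(1))
next
  case (Suc k)
  then obtain f' where "\<forall>t. (f has_vector_derivative f' t) (at t)" "smooth1 (Suc k) f'" by (meson smooth1.simps(2))
  then show ?case using Suc.IH[of f'] by auto
qed

lemma smooth1_add: "\<lbrakk>smooth1 k f; smooth1 k g\<rbrakk> \<Longrightarrow> smooth1 k (\<lambda>t. f t + g t)"
proof (induction k arbitrary: f g)
  case 0 then show ?case by (auto intro: continuous_intros)
next
  case (Suc k)
  then obtain f' g' where "\<And>t. (f has_vector_derivative f' t) (at t)" "smooth1 k f'"
    "\<And>t. (g has_vector_derivative g' t) (at t)" "smooth1 k g'" by auto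
  then show ?case using Suc.IH[of f' g'] by (auto intro!: exI[of _ "\<lambda>t. f' t + g' t"] derivative_intros)
qed

lemma smooth1_const: "smooth1 k (\<lambda>t. c)"
  by (induction k arbitrary: c) (auto intro!: exI[of _ "\<lambda>t. 0"] derivative_intros)

lemma smooth1_mult: "\<lbrakk>smooth1 k f; smooth1 k g\<rbrakk> \<Longrightarrow> smooth1 k (\<lambda>t. f t * g t)"
proof (induction k arbitrary: f g)
  case 0 then show ?case by (auto intro: continuous_intros)
next
  case (Suc k)
  then obtain f' g' where *: "\<And>t. (f has_vector_derivative f' t) (at t)" "smooth1 k f'"
    "\<And>t. (g has_vector_derivative g' t) (at t)" "smooth1 k g'" by auto
  have "smooth1 k f" "smooth1 k g" using Suc.prems smooth1_Suc_imp by blast+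
  then have "smooth1 k (\<lambda>t. f t * g' t + f' t * g t)"
    by (intro smooth1_add Suc.IH *)
  then show ?case by (rule smooth1_SucI[OF has_vector_derivative_mult[OF *(1) *(3)]])
qed

lemma smooth1_minus: "smooth1 k f \<Longrightarrow> smooth1 k (\<lambda>t. - f t)"
  using smooth1_mult[OF smooth1_const[of k "-1"]] by simp

lemma smooth1_diff: "\<lbrakk>smooth1 k f; smooth1 k g\<rbrakk> \<Longrightarrow> smooth1 k (\<lambda>t. f t - g t)"
  using smooth1_add[OF _ smooth1_minus] by fastforce

lemma smooth1_inverse:
  fixes f :: "real \<Rightarrow> real"
  assumes "\<And>t. f t \<noteq> 0"
  shows "smooth1 k f \<Longrightarrow> smooth1 k (\<lambda>t. inverse (f t))"
proof (induction k)
  case 0 then show ?case using assms by (auto intro: continuous_intros)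
next
  case (Suc k)
  then obtain f' where *: "\<And>t. (f has_vector_derivative f' t) (at t)" "smooth1 k f'" by auto
  have "smooth1 k (\<lambda>t. inverse (f t))" using Suc smooth1_Suc_imp by blast
  then have s: "smooth1 k (\<lambda>t. - (inverse (f t) * f' t * inverse (f t)))"
    using * smooth1_mult smooth1_minus by blast
  have "((\<lambda>t. inverse (f t)) has_vector_derivative - (inverse (f t) * f' t * inverse (f t))) (at t)" for t
    using DERIV_inverse'[of f "f' t" t UNIV] *(1)[of t] assms
    by (simp add: has_real_derivative_iff_has_vector_derivative)
  then show ?case using s by (rule smooth1_SucI)
qed

lemma smooth1_affine: "smooth1 k f \<Longrightarrow> smooth1 k (\<lambda>t. f (\<alpha> * t + \<beta>))"
proof (induction k arbitrary: f)
  case 0 then show ?case by (auto intro!: continuous_on_compose2[of UNIV f] continuous_intros)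
next
  case (Suc k)
  then obtain f' where *: "\<And>t. (f has_vector_derivative f' t) (at t)" "smooth1 k f'" by auto
  have "((\<lambda>t. f (\<alpha> * t + \<beta>)) has_vector_derivative \<alpha> *\<^sub>R f' (\<alpha> * t + \<beta>)) (at t)" for t
  proof -
    have "((\<lambda>t. \<alpha> * t + \<beta>) has_vector_derivative \<alpha>) (at t)"
      by (auto intro!: derivative_eq_intros simp flip: has_real_derivative_iff_has_vector_derivative)
    from vector_diff_chain_at[OF this *(1)] show ?thesis by (simp add: o_def)
  qed
  moreover have "smooth1 k (\<lambda>t. \<alpha> *\<^sub>R f' (\<alpha> * t + \<beta>))"
    using smooth1_mult[OF smooth1_const[of k "of_real \<alpha>"] Suc.IH[OF *(2)]] by (simp add: scaleR_conv_of_real)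
  ultimately show ?case by (rule smooth1_SucI)
qed

lemma smooth1_of_real: "smooth1 k f \<Longrightarrow> smooth1 k (\<lambda>t. complex_of_real (f t))"
proof (induction k arbitrary: f)
  case 0 then show ?case by (auto intro: continuous_intros)
next
  case (Suc k)
  then obtain f' where *: "\<And>t. (f has_vector_derivative f' t) (at t)" "smooth1 k f'" by auto
  have "((\<lambda>t. complex_of_real (f t)) has_vector_derivative of_real (f' t)) (at t)" for t
    using *(1) by (intro has_vector_derivative_of_real) (simp add: has_real_derivative_iff_has_vector_derivative)
  then show ?case using Suc.IH[OF *(2)] by (rule smooth1_SucI)
qed

lemma smooth1_cis: "smooth1 k cis"
proof -
  have "smooth1 k (\<lambda>t. c * cis t)" for c
  proof (induction k arbitrary: c)
    case 0 then show ?case by (auto intro!: continuous_intros)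
  next
    case (Suc k)
    have "((\<lambda>t. c * cis t) has_vector_derivative c * \<i> * cis t) (at t)" for t
    proof -
      have "((\<lambda>t. c * exp (\<i> * of_real t)) has_vector_derivative c * \<i> * exp (\<i> * of_real t)) (at t)"
        by (rule has_vector_derivative_eq_rhs[OF has_vector_derivative_mult_right[OF
              has_vector_derivative_real_field[of "\<lambda>z. exp (\<i> * z)"]]])
           (auto intro!: derivative_eq_intros)
      then show ?thesis by (simp add: cis_conv_exp)
    qed
    then show ?case using Suc[of "c * \<i>"] by (rule smooth1_SucI)
  qed
  from this[of 1] show ?thesis by simp
qed

text \<open>The family of the functions \<open>(1/t) ^ n * exp (-1/t)\<close>, extended by 0, is closed under differentiation up to linear
combinations, which makes all derivatives of \<open>exp (-1/t)\<close> accessible by one induction.\<close>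

definition flat :: "nat \<Rightarrow> real \<Rightarrow> real" where
  "flat n t = (if t \<le> 0 then 0 else (1 / t) ^ n * exp (- (1 / t)))"

lemma flat_tendsto_0: "(flat n \<longlongrightarrow> 0) (at 0)"
proof -
  have "((\<lambda>t. (1 / t) ^ n / exp (1 / t)) \<longlongrightarrow> (0::real)) (at_right 0)"
    using filterlim_compose[OF tendsto_power_div_exp_0 filterlim_inverse_at_top_right]
    by (simp add: inverse_eq_divide)
  then have "(flat n \<longlongrightarrow> 0) (at_right 0)"
    by (rule Lim_transform_eventually)
       (auto simp: flat_def eventually_at_right_field exp_minus divide_inverse intro!: exI[of _ 1])
  moreover have "(flat n \<longlongrightarrow> 0) (at_left 0)"
    by (rule tendsto_eventually) (auto simp: flat_def eventually_at_left_field intro!: exI[of _ "-1"])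
  ultimately show ?thesis by (simp add: filterlim_split_at)
qed

lemma flat_deriv: "(flat n has_real_derivative (flat (n + 2) t - real n * flat (n + 1) t)) (at t)"
proof (cases t "0::real" rule: linorder_cases)
  case less
  have "((\<lambda>t. 0) has_real_derivative 0) (at t)" by simp
  moreover have "\<forall>\<^sub>F s in nhds t. flat n s = 0"
    using eventually_nhds_in_open[of "{..<0}" t] less by (auto elim!: eventually_mono simp: flat_def)
  ultimately show ?thesis using less DERIV_cong_ev[of t t "flat n" "\<lambda>t. 0" "flat (n + 2) t - real n * flat (n + 1) t" 0]
    by (simp add: flat_def)
next
  case equal
  have "((\<lambda>h. flat n h / h) \<longlongrightarrow> 0) (at 0)"
  proof (rule Lim_transform_eventually[OF flat_tendsto_0[of "Suc n"]])
    show "\<forall>\<^sub>F h in at 0. flat (Suc n) h = flat n h / h"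
      by (rule always_eventually) (auto simp: flat_def field_simps)
  qed
  then show ?thesis unfolding equal DERIV_def by (simp add: flat_def)
next
  case greater
  have i: "((\<lambda>t. 1 / t) has_real_derivative - ((1 / t)\<^sup>2)) (at t)"
    using greater by (auto intro!: derivative_eq_intros simp: power2_eq_square)
  have "((\<lambda>t. (1 / t) ^ n * exp (- (1 / t))) has_real_derivative
      (1 / t) ^ n * (exp (- (1 / t)) * (1 / t)\<^sup>2) + (real n * (1 / t) ^ (n - 1) * (- ((1 / t)\<^sup>2))) * exp (- (1 / t))) (at t)"
    by (rule DERIV_cong[OF DERIV_mult[OF DERIV_power[OF i, of n] DERIV_chain2[OF DERIV_exp DERIV_minus[OF i]]]])
       (simp add: algebra_simps)
  moreover have M: "real n * (1 / t) ^ (n - 1) * (1 / t)\<^sup>2 = real n * (1 / t) ^ (n + 1)"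
    by (cases n) (auto simp: power2_eq_square)
  moreover have "(1 / t) ^ n * (exp (- (1 / t)) * (1 / t)\<^sup>2) + (real n * (1 / t) ^ (n - 1) * (- ((1 / t)\<^sup>2))) * exp (- (1 / t))
     = (1 / t) ^ (n + 2) * exp (- (1 / t)) - (real n * (1 / t) ^ (n - 1) * (1 / t)\<^sup>2) * exp (- (1 / t))"
    unfolding power_add by algebra
  ultimately have "((\<lambda>t. (1 / t) ^ n * exp (- (1 / t))) has_real_derivative
      flat (n + 2) t - real n * flat (n + 1) t) (at t)"
    using greater by (simp only: M) (simp add: flat_def algebra_simps)
  moreover have "\<forall>\<^sub>F s in nhds t. flat n s = (1 / s) ^ n * exp (- (1 / s))"
    using eventually_nhds_in_open[of "{0<..}" t] greater by (auto elim!: eventually_mono simp: flat_def)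
  ultimately show ?thesis by (subst DERIV_cong_ev[OF refl _ refl]) auto
qed

lemma smooth1_flat: "smooth1 k (flat n)"
proof (induction k arbitrary: n)
  case 0
  show ?case using flat_deriv[of n] by (auto intro!: continuous_at_imp_continuous_on DERIV_isCont)
next
  case (Suc k)
  have "smooth1 k (\<lambda>t. flat (n + 2) t - real n * flat (n + 1) t)"
    by (intro smooth1_diff smooth1_mult smooth1_const Suc)
  then show ?case
    using flat_deriv[of n] unfolding has_real_derivative_iff_has_vector_derivative by (rule smooth1_SucI[rotated])
qed

lemma flat_pos: "flat n t > 0 \<longleftrightarrow> t > 0" and flat_nonneg: "flat n t \<ge> 0"
  by (auto simp: flat_def)

definition bump1 :: "real \<Rightarrow> real" where "bump1 t = flat 0 t * flat 0 (1 - t)"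

lemma bump1_pos: "bump1 t \<noteq> 0 \<longleftrightarrow> 0 < t \<and> t < 1"
  by (auto simp: bump1_def flat_def)

lemma smooth1_bump1: "smooth1 k bump1"
  unfolding bump1_def using smooth1_mult[OF smooth1_flat smooth1_affine[OF smooth1_flat, of k 0 "-1" 1]] by simp

definition step1 :: "real \<Rightarrow> real" where
  "step1 t = flat 0 t * inverse (flat 0 t + flat 0 (1 - t))"

lemma smooth1_step1: "smooth1 k step1"
proof -
  have 1: "smooth1 k (\<lambda>t. flat 0 (1 - t))" using smooth1_affine[OF smooth1_flat, of k 0 "-1" 1] by simp
  have "flat 0 t + flat 0 (1 - t) \<noteq> 0" for t
  proof -
    have "flat 0 t > 0 \<or> flat 0 (1 - t) > 0" by (auto simp: flat_pos)
    then show ?thesis using flat_nonneg[of 0 t] flat_nonneg[of 0 "1 - t"] by linarith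
  qed
  then have "smooth1 k (\<lambda>t. inverse (flat 0 t + flat 0 (1 - t)))"
    by (intro smooth1_inverse smooth1_add smooth1_flat 1)
  then show ?thesis unfolding step1_def by (intro smooth1_mult smooth1_flat)
qed

lemma step1_0: "t \<le> 0 \<Longrightarrow> step1 t = 0" and step1_1: "t \<ge> 1 \<Longrightarrow> step1 t = 1"
  by (auto simp: step1_def flat_def)

text \<open>The difference of two translates of a smooth step: its integer translates telescope to 1.\<close>

definition hat1 :: "real \<Rightarrow> real" where "hat1 t = step1 (t + 1) - step1 t"

lemma smooth1_hat1: "smooth1 k hat1"
  unfolding hat1_def
  using smooth1_diff[OF smooth1_affine[OF smooth1_step1, of k 1 1] smooth1_step1] by simp

lemma hat1_support: "hat1 t \<noteq> 0 \<Longrightarrow> - 1 < t \<and> t < 1"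
  using step1_0[of t] step1_0[of "t + 1"] step1_1[of t] step1_1[of "t + 1"]
  unfolding hat1_def by (smt (verit))

lemma hat1_partition: "0 \<le> t \<Longrightarrow> t \<le> 1 \<Longrightarrow> hat1 t + hat1 (t - 1) = 1"
  using step1_0[of "t - 1"] step1_1[of "t + 1"] by (simp add: hat1_def)

section \<open>Smooth functions of three variables\<close>

lemma pd_eq: "(f has_derivative f') (at x) \<Longrightarrow> pd j f x = f' (axis j 1)"
  unfolding pd_def using frechet_derivative_at by fastforce

lemma Ck_continuous: "Ck k f \<Longrightarrow> continuous_on UNIV f"
  by (cases k) (auto intro!: continuous_at_imp_continuous_on differentiable_imp_continuous_within)

lemma Ck_Suc_imp: "Ck (Suc k) f \<Longrightarrow> Ck k f"
proof (induction k arbitrary: f)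
  case 0 then show ?case using Ck_continuous by (metis Ck.simps(1))
next
  case (Suc k)
  have "Ck k (pd j f)" for j using Suc.prems by (intro Suc.IH) simp
  then show ?case using Suc.prems by simp
qed

lemma pd_mult:
  assumes "f differentiable (at x)" "g differentiable (at x)"
  shows "pd j (\<lambda>x. f x * g x) x = f x * pd j g x + pd j f x * g x"
proof -
  obtain f' g' where f: "(f has_derivative f') (at x)" and g: "(g has_derivative g') (at x)"
    using assms by (auto simp: differentiable_def)
  then show ?thesis by (simp add: pd_eq[OF has_derivative_mult[OF f g]] pd_eq[OF f] pd_eq[OF g])
qed

lemma pd_add:
  assumes "f differentiable (at x)" "g differentiable (at x)"
  shows "pd j (\<lambda>x. f x + g x) x = pd j f x + pd j g x"
proof -
  obtain f' g' where f: "(f has_derivative f') (at x)" and g: "(g has_derivative g') (at x)"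
    using assms by (auto simp: differentiable_def)
  then show ?thesis by (simp add: pd_eq[OF has_derivative_add[OF f g]] pd_eq[OF f] pd_eq[OF g])
qed

lemma Ck_add: "\<lbrakk>Ck k f; Ck k g\<rbrakk> \<Longrightarrow> Ck k (\<lambda>x. f x + g x)"
proof (induction k arbitrary: f g)
  case 0 then show ?case by (auto intro: continuous_intros)
next
  case (Suc k)
  have "pd j (\<lambda>x. f x + g x) = (\<lambda>x. pd j f x + pd j g x)" for j
    using Suc.prems by (auto simp: pd_add)
  then show ?case using Suc by (auto intro!: differentiable_add)
qed

lemma Ck_mult: "\<lbrakk>Ck k f; Ck k g\<rbrakk> \<Longrightarrow> Ck k (\<lambda>x. f x * g x)"
proof (induction k arbitrary: f g)
  case 0 then show ?case by (auto intro: continuous_intros)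
next
  case (Suc k)
  have eq: "pd j (\<lambda>x. f x * g x) = (\<lambda>x. f x * pd j g x + pd j f x * g x)" for j
    using Suc.prems by (auto simp: pd_mult)
  have "Ck k f" "Ck k g" using Suc.prems Ck_Suc_imp by blast+
  then have "Ck k (\<lambda>x. f x * pd j g x + pd j f x * g x)" for j
    using Suc.prems Suc.IH by (intro Ck_add) auto
  then show ?case using Suc.prems unfolding Ck.simps eq by (auto intro!: differentiable_mult)
qed

lemma has_derivative_ridge:
  fixes h :: "real \<Rightarrow> complex" and d :: r3
  assumes "\<And>t. (h has_vector_derivative h' t) (at t)"
  shows "((\<lambda>x. h (d \<bullet> x)) has_derivative (\<lambda>y. (d \<bullet> y) *\<^sub>R h' (d \<bullet> x))) (at x)"
proof -
  have "((\<lambda>x. d \<bullet> x) has_derivative (\<lambda>y. d \<bullet> y)) (at x)" by (auto intro!: derivative_eq_intros)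
  moreover have "(h has_derivative (\<lambda>s. s *\<^sub>R h' (d \<bullet> x))) (at (d \<bullet> x))"
    using assms by (simp add: has_vector_derivative_def)
  ultimately show ?thesis using has_derivative_compose by blast
qed

lemma pd_ridge:
  assumes "\<And>t. (h has_vector_derivative h' t) (at t)"
  shows "pd j (\<lambda>x. h (d \<bullet> x)) x = (d $ j) *\<^sub>R h' (d \<bullet> x)"
  using pd_eq[OF has_derivative_ridge[OF assms]] by (simp add: inner_axis)

lemma Ck_const: "Ck k (\<lambda>x. c)"
proof (induction k arbitrary: c)
  case (Suc k)
  have "pd j (\<lambda>x. c) = (\<lambda>x. 0)" for j by (intro ext) (simp add: pd_eq[OF has_derivative_const])
  then show ?case using Suc by simp
qed simp

text \<open>The source of all smooth functions on space used below: plane waves, cut-offs and bumps are products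
of functions of this form.\<close>

lemma Ck_ridge: "smooth1 k h \<Longrightarrow> Ck k (\<lambda>x. h (d \<bullet> x))"
proof (induction k arbitrary: h)
  case 0 then show ?case by (auto intro!: continuous_on_compose2[of UNIV h] continuous_intros)
next
  case (Suc k)
  then obtain h' where h': "\<And>t. (h has_vector_derivative h' t) (at t)" "smooth1 k h'" by auto
  have "pd j (\<lambda>x. h (d \<bullet> x)) = (\<lambda>x. of_real (d $ j) * h' (d \<bullet> x))" for j
    by (intro ext) (simp add: pd_ridge[OF h'(1)] scaleR_conv_of_real)
  then have "Ck k (pd j (\<lambda>x. h (d \<bullet> x)))" for j
    using Ck_mult[OF Ck_const Suc.IH[OF h'(2)]] by simp
  then show ?case using has_derivative_ridge[OF h'(1)] unfolding Ck.simps differentiable_def by blast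
qed

lemma Ck_prod: "(\<And>i. i \<in> I \<Longrightarrow> Ck k (f i)) \<Longrightarrow> Ck k (\<lambda>x. \<Prod>i\<in>I. f i x)"
  by (induction I rule: infinite_finite_induct) (auto intro: Ck_const Ck_mult)

lemma pd_support: 
  assumes "\<And>x. f differentiable (at x)" shows "pd j f x \<noteq> 0 \<Longrightarrow> x \<in> closure {x. f x \<noteq> 0}"
proof (rule ccontr)
  assume nz: "pd j f x \<noteq> 0" and "x \<notin> closure {x. f x \<noteq> 0}"
  then have "x \<in> - closure {x. f x \<noteq> 0}" by simp
  then have "\<forall>\<^sub>F y in nhds x. y \<in> - closure {x. f x \<noteq> 0}"
    by (intro eventually_nhds_in_open) (auto simp: open_Compl)
  then have ev: "\<forall>\<^sub>F y in nhds x. 0 = f y"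
    by (rule eventually_mono) (use closure_subset[of "{x. f x \<noteq> 0}"] in auto)
  have "(f has_derivative (\<lambda>h. 0)) (at x)"
  proof (rule has_derivative_transform_eventually[OF has_derivative_const])
    show "\<forall>\<^sub>F y in at x within UNIV. 0 = f y" using ev by (simp add: eventually_nhds_conv_at)
    show "0 = f x" using ev by (simp add: eventually_nhds_conv_at)
  qed simp
  then show False using nz by (simp add: pd_eq)
qed

section \<open>Integration over the whole space\<close>

lemma
  fixes c :: "'a::euclidean_space"
  shows translate_measurable: "(\<lambda>x. x + c) \<in> lebesgue \<rightarrow>\<^sub>M lebesgue"
    and distr_lebesgue_translate: "distr lebesgue lebesgue (\<lambda>x. x + c) = lebesgue"
proof -
  have T: "(\<lambda>x. c + (\<Sum>j\<in>Basis. (1 * (x \<bullet> j)) *\<^sub>R j)) = (\<lambda>x. x + c)"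
    by (auto simp: euclidean_representation add.commute)
  show "(\<lambda>x. x + c) \<in> lebesgue \<rightarrow>\<^sub>M lebesgue"
    using lebesgue_affine_measurable[of "\<lambda>_. 1" c] unfolding T by simp
  show "distr lebesgue lebesgue (\<lambda>x. x + c) = lebesgue"
    using lebesgue_affine_euclidean[of "\<lambda>_. 1" c] unfolding T by (simp add: density_1)
qed

lemma integral_translate:
  fixes f :: "'a::euclidean_space \<Rightarrow> 'b::{banach, second_countable_topology}"
  assumes "f \<in> borel_measurable lebesgue"
  shows "(LINT x|lebesgue. f (x + c)) = (LINT x|lebesgue. f x)"
  using integral_distr[OF translate_measurable[of c] assms] by (simp add: distr_lebesgue_translate)

lemma integrable_translate:
  fixes f :: "'a::euclidean_space \<Rightarrow> 'b::{banach, second_countable_topology}"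
  assumes "integrable lebesgue f"
  shows "integrable lebesgue (\<lambda>x. f (x + c))"
  using integrable_distr_eq[OF translate_measurable[of c] borel_measurable_integrable[OF assms]] assms
  by (simp add: distr_lebesgue_translate)

lemma AE_translate: "AE x in lebesgue. P x \<Longrightarrow> AE x in lebesgue. P (x + c :: r3)"
proof -
  assume "AE x in lebesgue. P x"
  then have "AE x in distr lebesgue lebesgue (\<lambda>x. x + c). P x" by (simp only: distr_lebesgue_translate)
  then show ?thesis by (rule AE_distrD[OF translate_measurable])
qed

lemma integrable_compact_support:
  fixes f :: "'a::euclidean_space \<Rightarrow> 'b::{banach, second_countable_topology}"
  assumes f: "continuous_on UNIV f" and K: "compact K" "\<And>x. f x \<noteq> 0 \<Longrightarrow> x \<in> K"
  shows "integrable lebesgue f"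
proof -
  have "integrable lborel (\<lambda>x. indicator K x *\<^sub>R f x)"
    using K(1) continuous_on_subset[OF f] by (intro borel_integrable_compact) auto
  moreover have "indicator K x *\<^sub>R f x = f x" for x using K(2)[of x] by (cases "x \<in> K") auto
  ultimately have "integrable lborel f" by simp
  then show ?thesis using integrable_completion borel_measurable_integrable by blast
qed

lemma bounded_compact_support:
  fixes f :: "'a::euclidean_space \<Rightarrow> 'b::real_normed_vector"
  assumes f: "continuous_on UNIV f" and K: "compact K" "\<And>x. f x \<noteq> 0 \<Longrightarrow> x \<in> K"
  obtains B where "B \<ge> 0" "\<And>x. norm (f x) \<le> B"
proof -
  have "bounded (f ` K)"
    using K(1) continuous_on_subset[OF f] by (intro compact_imp_bounded compact_continuous_image) auto
  then obtain B where B: "\<And>x. x \<in> K \<Longrightarrow> norm (f x) \<le> B" by (auto simp: bounded_iff)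
  have "norm (f x) \<le> max B 0" for x using B[of x] K(2)[of x] by (cases "f x = 0") auto
  then show thesis using that[of "max B 0"] by simp
qed

text \<open>The difference quotients in direction \<open>j\<close> have integral zero by translation invariance. They are
bounded by the maximum of the derivative and supported in a neighbourhood of the support, so that
dominated convergence applies.\<close>

lemma integral_pd_zero:
  assumes diff: "\<And>x. f differentiable (at x)" and cont: "continuous_on UNIV (pd j f)"
    and K: "compact K" "\<And>x. f x \<noteq> 0 \<Longrightarrow> x \<in> K"
  shows "(LINT x|lebesgue. pd j f x) = 0"
proof -
  have clK: "closure {x. f x \<noteq> 0} \<subseteq> K" using K by (intro closure_minimal) (auto simp: compact_imp_closed)
  have pK: "x \<in> K" if "pd j f x \<noteq> 0" for x using pd_support[OF diff that] clK by blast
  have fc: "continuous_on UNIV f"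
    using diff by (auto intro!: continuous_at_imp_continuous_on differentiable_imp_continuous_within)
  have fi: "integrable lebesgue f" using integrable_compact_support[OF fc K] .
  obtain B where B: "B \<ge> 0" "\<And>x. norm (pd j f x) \<le> B" using bounded_compact_support[OF cont K(1) pK] by blast
  define \<delta> where "\<delta> n = inverse (real (Suc n))" for n
  have \<delta>: "\<delta> n > 0" "\<delta> n \<le> 1" for n by (auto simp: \<delta>_def field_simps)
  have \<delta>0: "\<delta> \<longlonglongrightarrow> 0" unfolding \<delta>_def by (rule LIMSEQ_inverse_real_of_nat)
  let ?e = "axis j 1 :: r3"
  define D where "D n x = (f (x + \<delta> n *\<^sub>R ?e) - f x) /\<^sub>R \<delta> n" for n x
  have line: "((\<lambda>t. f (x + t *\<^sub>R ?e)) has_vector_derivative pd j f (x + t *\<^sub>R ?e)) (at t)" for x t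
  proof -
    obtain f' where f': "(f has_derivative f') (at (x + t *\<^sub>R ?e))" using diff by (auto simp: differentiable_def)
    have "((\<lambda>t. x + t *\<^sub>R ?e) has_derivative (\<lambda>s. s *\<^sub>R ?e)) (at t)" by (auto intro!: derivative_eq_intros)
    from has_derivative_compose[OF this f']
    show ?thesis unfolding has_vector_derivative_def pd_eq[OF f']
      using linear_cmul[OF has_derivative_linear[OF f']] by simp
  qed
  have Dlim: "(\<lambda>n. D n x) \<longlonglongrightarrow> pd j f x" for x
  proof -
    have "((\<lambda>h. (f (x + h *\<^sub>R ?e) - f x) /\<^sub>R h) \<longlongrightarrow> pd j f x) (at 0)"
    proof (rule LIM_zero_cancel, rule tendsto_norm_zero_cancel)
      have "((\<lambda>h. norm (f (x + h *\<^sub>R ?e) - f x - h *\<^sub>R pd j f x) / \<bar>h\<bar>) \<longlongrightarrow> 0) (at 0)"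
        using line[of x 0] by (simp add: has_vector_derivative_def has_derivative_at)
      then show "((\<lambda>h. norm ((f (x + h *\<^sub>R ?e) - f x) /\<^sub>R h - pd j f x)) \<longlongrightarrow> 0) (at 0)"
      proof (rule Lim_transform_eventually)
        have "norm (f (x + h *\<^sub>R ?e) - f x - h *\<^sub>R pd j f x) / \<bar>h\<bar> = norm ((f (x + h *\<^sub>R ?e) - f x) /\<^sub>R h - pd j f x)"
          if "h \<noteq> 0" for h
        proof -
          have "(f (x + h *\<^sub>R ?e) - f x) /\<^sub>R h - pd j f x = (f (x + h *\<^sub>R ?e) - f x - h *\<^sub>R pd j f x) /\<^sub>R h"
            using that by (simp add: scaleR_diff_right)
          then show ?thesis by (simp add: divide_inverse)
        qed
        then show "\<forall>\<^sub>F h in at 0. norm (f (x + h *\<^sub>R ?e) - f x - h *\<^sub>R pd j f x) / \<bar>h\<bar>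
           = norm ((f (x + h *\<^sub>R ?e) - f x) /\<^sub>R h - pd j f x)"
          by (auto simp: eventually_at_filter)
      qed
    qed
    moreover have "filterlim \<delta> (at 0) sequentially"
      using \<delta>0 \<delta>(1)[THEN less_imp_neq] by (auto simp: filterlim_at intro!: always_eventually)
    ultimately show ?thesis unfolding D_def by (rule filterlim_compose)
  qed
  have Dbound: "norm (D n x) \<le> B" for n x
  proof -
    have "norm (f (x + \<delta> n *\<^sub>R ?e) - f (x + 0 *\<^sub>R ?e)) \<le> B * norm (\<delta> n - 0)"
    proof (rule differentiable_bound[of UNIV "\<lambda>t. f (x + t *\<^sub>R ?e)" "\<lambda>t s. s *\<^sub>R pd j f (x + t *\<^sub>R ?e)"])
      show "((\<lambda>t. f (x + t *\<^sub>R ?e)) has_derivative (\<lambda>s. s *\<^sub>R pd j f (x + t *\<^sub>R ?e))) (at t within UNIV)" for t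
        using line[of x t] by (simp add: has_vector_derivative_def)
      show "onorm (\<lambda>s. s *\<^sub>R pd j f (x + t *\<^sub>R ?e)) \<le> B" for t
        using B by (intro onorm_bound) (auto simp: mult.commute[of B] intro!: mult_left_mono)
    qed auto
    then show ?thesis using \<delta>[of n] unfolding D_def by (simp add: divide_simps mult.commute)
  qed
  define K' where "K' = {x + y | x y. x \<in> K \<and> y \<in> cball (0::r3) 1}"
  have K': "compact K'" unfolding K'_def using K(1) by (intro compact_sums) auto
  have Dsupp: "D n x = 0" if "x \<notin> K'" for n x
  proof -
    have "x \<notin> K"
    proof
      assume "x \<in> K" then have "x + 0 \<in> K'" unfolding K'_def by force
      then show False using that by simp
    qed
    moreover have "x + \<delta> n *\<^sub>R ?e \<notin> K"
    proof
      assume a: "x + \<delta> n *\<^sub>R ?e \<in> K"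
      have "- (\<delta> n *\<^sub>R ?e) \<in> cball 0 1" using \<delta>[of n] by (simp add: norm_axis_1)
      then have "(x + \<delta> n *\<^sub>R ?e) + - (\<delta> n *\<^sub>R ?e) \<in> K'" unfolding K'_def using a by blast
      then show False using that by simp
    qed
    ultimately have "f x = 0" "f (x + \<delta> n *\<^sub>R ?e) = 0" using K(2) by blast+
    then show ?thesis unfolding D_def by simp
  qed
  have "(\<lambda>n. LINT x|lebesgue. D n x) \<longlonglongrightarrow> (LINT x|lebesgue. pd j f x)"
  proof (rule integral_dominated_convergence[where w = "\<lambda>x. B * indicator K' x"])
    show "pd j f \<in> borel_measurable lebesgue"
      by (rule borel_measurable_integrable, rule integrable_compact_support[OF cont K(1)]) (rule pK)
    show "D n \<in> borel_measurable lebesgue" for n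
      unfolding D_def using borel_measurable_integrable[OF integrable_translate[OF fi]] borel_measurable_integrable[OF fi]
      by measurable
    show "integrable lebesgue (\<lambda>x. B * indicator K' x)"
      using lmeasurable_compact[OF K'] by (intro integrable_mult_right) (auto simp: fmeasurable_def)
    show "AE x in lebesgue. (\<lambda>n. D n x) \<longlonglongrightarrow> pd j f x" using Dlim by simp
    show "AE x in lebesgue. norm (D n x) \<le> B * indicator K' x" for n
      using Dbound[of n] Dsupp[of _ n] by (intro AE_I2) (auto simp: indicator_def)
  qed
  moreover have "(LINT x|lebesgue. D n x) = 0" for n
    unfolding D_def using fi integrable_translate[OF fi] integral_translate[OF borel_measurable_integrable[OF fi]]
    by simp
  ultimately show ?thesis by (simp add: LIMSEQ_const_iff)
qed

section \<open>Cauchy sequences and subsequences\<close>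

context semi_inner
begin

lemma cauchy_fast_subsequence:
  assumes "cauchy X"
  obtains r :: "nat \<Rightarrow> nat" where "\<And>k. k \<le> r k" "mono r"
    "\<And>k m n. r k \<le> m \<Longrightarrow> r k \<le> n \<Longrightarrow> nrm (X m - X n) < (1/2) ^ k"
proof -
  have "\<forall>k::nat. \<exists>N. \<forall>m\<ge>N. \<forall>n\<ge>N. nrm (X m - X n) < (1/2) ^ k"
    using assms unfolding cauchy_def by simp
  then obtain N where N: "\<And>k m n. N k \<le> m \<Longrightarrow> N k \<le> n \<Longrightarrow> nrm (X m - X n) < (1/2) ^ k" by metis
  define r where "r k = (\<Sum>j\<le>k. N j) + k" for k :: nat
  have "N k \<le> r k" for k unfolding r_def by (metis atMost_iff finite_atMost le_add1 le_trans member_le_sum order_refl zero_le)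
  moreover have "mono r" unfolding r_def by (intro monoI add_mono sum_mono2) auto
  moreover have "k \<le> r k" for k by (simp add: r_def)
  ultimately show thesis using that N by (meson order_trans)
qed

lemma cauchy_subsequence_limit:
  assumes X: "\<And>n. X n \<in> H" "cauchy X" and x: "x \<in> H" and r: "\<And>k::nat. k \<le> r k" and l: "lim_to (X \<circ> r) x"
  shows "lim_to X x"
  unfolding lim_to_def LIMSEQ_iff
proof (intro allI impI)
  fix e :: real assume e: "e > 0"
  obtain N where N: "\<And>m n. m \<ge> N \<Longrightarrow> n \<ge> N \<Longrightarrow> nrm (X m - X n) < e / 2"
    using X(2) e unfolding cauchy_def by (meson half_gt_zero)
  obtain K where K: "\<And>n. n \<ge> K \<Longrightarrow> norm (nrm ((X \<circ> r) n - x) - 0) < e / 2"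
    using l e unfolding lim_to_def LIMSEQ_iff by (meson half_gt_zero)
  have "norm (nrm (X n - x) - 0) < e" if "n \<ge> N" for n
  proof -
    let ?k = "r (max N K)"
    have "nrm (X n - x) \<le> nrm (X n - X ?k) + nrm (X ?k - x)" using X x by (intro nrm_triangle_diff)
    moreover have "nrm (X n - X ?k) < e / 2" using that r[of "max N K"] by (intro N) auto
    moreover have "nrm (X ?k - x) < e / 2" using K[of "max N K"] X x by auto
    ultimately show ?thesis using X x by simp
  qed
  then show "\<exists>no. \<forall>n\<ge>no. norm (nrm (X n - x) - 0) < e" by blast
qed

end

section \<open>The lattice and its period cell\<close>

text \<open>The dual basis \<open>d\<close> supplies the lattice coordinates \<open>d i \<bullet> x\<close> of a point; the reciprocal lattice
is generated by \<open>2 pi d i\<close>.\<close>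

locale lattice_cell =
  fixes a d :: "3 \<Rightarrow> r3"
  assumes dual: "d i \<bullet> a j = (if i = j then 1 else 0)"
    and expand: "x = (\<Sum>i\<in>UNIV. (d i \<bullet> x) *\<^sub>R a i)"

text \<open>The linear map sending \<open>a i\<close> to the \<open>i\<close>-th unit vector has the dual basis as the rows of its matrix.\<close>

lemma dual_basis_exists:
  assumes "inj a" "independent (range a)"
  shows "\<exists>d. lattice_cell a d"
proof -
  obtain g :: "r3 \<Rightarrow> r3" where g: "linear g" "\<forall>x\<in>range a. g x = axis (inv a x) 1"
    using linear_independent_extend[OF assms(2), of "\<lambda>x. axis (inv a x) 1 :: r3"] by auto
  define d where "d i = adjoint g (axis i 1)" for i
  have dg: "d i \<bullet> x = g x $ i" for i x
    using adjoint_works[OF g(1), of x "axis i 1"] by (simp add: d_def inner_axis inner_commute)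
  have ga: "g (a j) = axis j 1" for j using g(2) assms(1) by simp
  have dual: "d i \<bullet> a j = (if i = j then 1 else 0)" for i j by (simp add: dg ga axis_def)
  have "card (range a) = 3" using card_image[OF assms(1)] by simp
  then have "dim (range a) = 3" using dim_eq_card_independent[OF assms(2)] by simp
  then have "span (range a) = UNIV" using dim_eq_full[of "range a"] by simp
  have "x = (\<Sum>i\<in>UNIV. (d i \<bullet> x) *\<^sub>R a i)" for x
  proof -
    have "x \<in> range (\<lambda>u. \<Sum>v\<in>range a. u v *\<^sub>R v)"
      using \<open>span (range a) = UNIV\<close> span_finite[of "range a"] by auto
    then obtain u where "x = (\<Sum>v\<in>range a. u v *\<^sub>R v)" by auto
    then have x: "x = (\<Sum>j\<in>UNIV. u (a j) *\<^sub>R a j)" by (simp add: sum.reindex[OF assms(1)])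
    have "d i \<bullet> x = u (a i)" for i
      unfolding x by (simp add: inner_sum_right dual if_distrib cong: if_cong)
    then show ?thesis using x by simp
  qed
  then show ?thesis using dual unfolding lattice_cell_def by blast
qed

definition cscale :: "complex \<Rightarrow> field \<Rightarrow> field" where "cscale c u = (\<lambda>x. c *s u x)"

interpretation cscale: vector_space cscale
  by standard (auto simp: cscale_def fun_eq_iff vec_eq_iff algebra_simps)

context lattice_cell
begin

definition lattice_vec :: "(3 \<Rightarrow> int) \<Rightarrow> r3" where "lattice_vec k = (\<Sum>i\<in>UNIV. of_int (k i) *\<^sub>R a i)"

lemma d_lattice_vec [simp]: "d i \<bullet> lattice_vec k = of_int (k i)"
  unfolding lattice_vec_def by (simp add: inner_sum_right dual if_distrib cong: if_cong)

lemma lattice_eq: "lattice a = range lattice_vec"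
  unfolding lattice_def lattice_vec_def by auto

definition cell_index :: "r3 \<Rightarrow> 3 \<Rightarrow> int" where "cell_index x = (\<lambda>i. \<lfloor>d i \<bullet> x\<rfloor>)"

lemma cell_eq: "cell a = {x. \<forall>i. 0 \<le> d i \<bullet> x \<and> d i \<bullet> x < 1}"
proof (intro equalityI subsetI)
  fix x assume "x \<in> cell a"
  then obtain t :: "3 \<Rightarrow> real" where t: "x = (\<Sum>i\<in>UNIV. t i *\<^sub>R a i)" "\<And>i. 0 \<le> t i \<and> t i < 1"
    unfolding cell_def by blast
  have "d i \<bullet> x = t i" for i
    unfolding t(1) by (simp add: inner_sum_right dual if_distrib cong: if_cong)
  then show "x \<in> {x. \<forall>i. 0 \<le> d i \<bullet> x \<and> d i \<bullet> x < 1}" using t by simp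
next
  fix x assume "x \<in> {x. \<forall>i. 0 \<le> d i \<bullet> x \<and> d i \<bullet> x < 1}"
  then show "x \<in> cell a" unfolding cell_def using expand[of x] by (intro CollectI exI[of _ "\<lambda>i. d i \<bullet> x"]) auto
qed

lemma cell_iff_cell_index: "x \<in> cell a \<longleftrightarrow> cell_index x = (\<lambda>i. 0)"
  unfolding cell_eq cell_index_def fun_eq_iff by (auto simp: floor_eq_iff)

lemma cell_index_add: "cell_index (x + lattice_vec k) = (\<lambda>i. cell_index x i + k i)"
  unfolding cell_index_def by (auto simp: inner_add_right)

lemma cell_index_diff: "cell_index (x - lattice_vec k) = (\<lambda>i. cell_index x i - k i)"
  unfolding cell_index_def by (auto simp: inner_diff_right)

lemma diff_lattice_vec_cell: "x - lattice_vec k \<in> cell a \<longleftrightarrow> cell_index x = k"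
  unfolding cell_iff_cell_index cell_index_diff by (auto simp: fun_eq_iff)

lemma lattice_vec_add: "lattice_vec (\<lambda>i. k i + l i) = lattice_vec k + lattice_vec l"
  unfolding lattice_vec_def by (simp add: scaleR_left_distrib sum.distrib)

lemma cell_borel: "cell a \<in> sets borel"
  unfolding cell_eq by measurable

lemma cell_lebesgue [measurable]: "cell a \<in> sets lebesgue"
  using cell_borel by simp

lemma bounded_cell: "bounded (cell a)"
proof (rule boundedI)
  fix x assume "x \<in> cell a"
  then have "norm ((d i \<bullet> x) *\<^sub>R a i) \<le> norm (a i)" for i
    unfolding cell_eq by (auto intro!: mult_left_le_one_le simp: less_imp_le)
  then have "norm (\<Sum>i\<in>UNIV. (d i \<bullet> x) *\<^sub>R a i) \<le> (\<Sum>i\<in>UNIV. norm (a i))"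
    by (intro order_trans[OF norm_sum] sum_mono)
  then show "norm x \<le> (\<Sum>i\<in>UNIV. norm (a i))" using expand[of x] by simp
qed

lemma cell_lmeasurable: "cell a \<in> lmeasurable"
  using bounded_cell cell_lebesgue by (rule bounded_set_imp_lmeasurable)

definition vol :: real where "vol = measure lebesgue (cell a)"

definition core :: "r3 set" where "core = {x. \<forall>i. 0 < d i \<bullet> x \<and> d i \<bullet> x < 1}"

lemma open_core: "open core"
proof -
  have "core = (\<Inter>i. {x. 0 < d i \<bullet> x} \<inter> {x. d i \<bullet> x < 1})" unfolding core_def by auto
  then show ?thesis by (auto intro!: open_INT open_Int open_Collect_less continuous_intros)
qed

lemma core_subset: "core \<subseteq> cell a" unfolding core_def cell_eq by (auto simp: less_imp_le)

lemma vol_pos: "vol > 0"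
proof -
  have "(\<Sum>j\<in>UNIV. (1/2) *\<^sub>R a j) \<in> core"
    unfolding core_def by (auto simp: inner_sum_right dual if_distrib cong: if_cong)
  then have "\<not> negligible core" using open_not_negligible[OF open_core] by blast
  then have "\<not> negligible (cell a)" using core_subset negligible_subset by blast
  then show ?thesis unfolding vol_def
    using cell_lmeasurable negligible_iff_measure[of "cell a"] by (simp add: zero_less_measure_iff)
qed

lemma AE_core: "AE x in lebesgue. x \<in> cell a \<longrightarrow> x \<in> core"
proof -
  have "negligible (\<Union>i. {x. d i \<bullet> x = 0})"
  proof (rule negligible_Union)
    have "d i \<noteq> 0" for i using dual[of i i] by auto
    then have "negligible {x. d i \<bullet> x = 0}" for i by (intro negligible_hyperplane) simp
    then show "negligible S" if "S \<in> range (\<lambda>i. {x. d i \<bullet> x = 0})" for S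
      using that by blast
  qed simp
  then have "(\<Union>i. {x. d i \<bullet> x = 0}) \<in> null_sets lebesgue" by (simp add: negligible_iff_null_sets)
  then show ?thesis
    by (rule AE_I'[of _ lebesgue]) (auto simp: core_def cell_eq order_less_le)
qed

lemma finite_cell_index: assumes "bounded K" shows "finite (cell_index ` K)"
proof -
  obtain B where B: "\<And>x. x \<in> K \<Longrightarrow> norm x \<le> B" using assms by (auto simp: bounded_iff)
  define N where "N = Max (range (\<lambda>i. \<lceil>norm (d i) * B\<rceil>)) + 1"
  have N: "norm (d i) * B + 1 \<le> of_int N" for i
  proof -
    have "\<lceil>norm (d i) * B\<rceil> \<le> Max (range (\<lambda>i. \<lceil>norm (d i) * B\<rceil>))" by (intro Max_ge) auto
    then show ?thesis unfolding N_def by linarith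
  qed
  have "cell_index ` K \<subseteq> {f. \<forall>i. (i \<in> UNIV \<longrightarrow> f i \<in> {-N..N}) \<and> (i \<notin> UNIV \<longrightarrow> f i = 0)}"
  proof
    fix k assume "k \<in> cell_index ` K"
    then obtain x where x: "x \<in> K" "k = cell_index x" by auto
    have "k i \<in> {-N..N}" for i
    proof -
      have "\<bar>d i \<bullet> x\<bar> \<le> norm (d i) * norm x" by (rule Cauchy_Schwarz_ineq2)
      also have "\<dots> \<le> norm (d i) * B" using B[OF x(1)] by (intro mult_left_mono) auto
      finally have "\<bar>d i \<bullet> x\<bar> + 1 \<le> of_int N" using N[of i] by linarith
      then show ?thesis unfolding x(2) cell_index_def by (auto simp: abs_le_iff) linarith+
    qed
    then show "k \<in> {f. \<forall>i. (i \<in> UNIV \<longrightarrow> f i \<in> {-N..N}) \<and> (i \<notin> UNIV \<longrightarrow> f i = 0)}" by auto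
  qed
  then show ?thesis by (rule finite_subset) (intro finite_set_of_finite_funs; simp)
qed

text \<open>Cut the space into translates of the cell and shift each piece back. In the applications \<open>F\<close> is the
product of a periodic field and a test function, and only finitely many cells contribute.\<close>

lemma unfold_integral:
  fixes F :: "r3 \<Rightarrow> 'b::{banach, second_countable_topology}"
  assumes S: "finite S" "\<And>x. F x \<noteq> 0 \<Longrightarrow> cell_index x \<in> S" and F: "integrable lebesgue F"
  shows "(LINT x|lebesgue. F x) = (\<Sum>k\<in>S. LINT x:cell a|lebesgue. F (x + lattice_vec k))"
proof -
  have tr: "set_integrable lebesgue ((\<lambda>x. x - lattice_vec k) -` cell a) F" for k
  proof -
    have "(\<lambda>x. x + (- lattice_vec k)) -` cell a \<inter> space lebesgue \<in> sets lebesgue"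
      by (rule measurable_sets[OF translate_measurable cell_lebesgue])
    then have "(\<lambda>x. x - lattice_vec k) -` cell a \<in> sets lebesgue" by simp
    then show ?thesis unfolding set_integrable_def using F by (rule integrable_mult_indicator)
  qed
  then have ti: "integrable lebesgue (\<lambda>x. indicator (cell a) (x - lattice_vec k) *\<^sub>R F x)" for k
    unfolding set_integrable_def by (simp add: indicator_def)
  have "F x = (\<Sum>k\<in>S. indicator (cell a) (x - lattice_vec k) *\<^sub>R F x)" for x
  proof (cases "F x = 0")
    case False
    have "(\<Sum>k\<in>S. indicator (cell a) (x - lattice_vec k) *\<^sub>R F x) = (\<Sum>k\<in>S. if k = cell_index x then F x else 0)"
      by (intro sum.cong) (auto simp: indicator_def diff_lattice_vec_cell)
    also have "\<dots> = F x" using S False by simp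
    finally show ?thesis by simp
  qed simp
  then have "(LINT x|lebesgue. F x) = (LINT x|lebesgue. (\<Sum>k\<in>S. indicator (cell a) (x - lattice_vec k) *\<^sub>R F x))" by metis
  also have "\<dots> = (\<Sum>k\<in>S. LINT x|lebesgue. indicator (cell a) (x - lattice_vec k) *\<^sub>R F x)"
    using ti by (rule Bochner_Integration.integral_sum)
  also have "\<dots> = (\<Sum>k\<in>S. LINT x:cell a|lebesgue. F (x + lattice_vec k))"
  proof (rule sum.cong[OF refl])
    fix k
    have "(LINT x|lebesgue. indicator (cell a) (x - lattice_vec k) *\<^sub>R F x) =
      (LINT x|lebesgue. indicator (cell a) (x + lattice_vec k - lattice_vec k) *\<^sub>R F (x + lattice_vec k))"
      by (rule integral_translate[OF borel_measurable_integrable[OF ti], symmetric])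
    then show "(LINT x|lebesgue. indicator (cell a) (x - lattice_vec k) *\<^sub>R F x) = (LINT x:cell a|lebesgue. F (x + lattice_vec k))"
      by (simp add: set_lebesgue_integral_def)
  qed
  finally show ?thesis .
qed

text \<open>Countably many translates of the cell cover the space.\<close>

lemma AE_all_cells:
  assumes "AE x in lebesgue. x \<in> cell a \<longrightarrow> P x" and per: "\<And>k. AE x in lebesgue. P (x + lattice_vec k) \<longleftrightarrow> P x"
  shows "AE x in lebesgue. P x"
proof -
  have "AE x in lebesgue. cell_index x = k \<longrightarrow> P x" for k
  proof -
    have "AE x in lebesgue. x + (- lattice_vec k) \<in> cell a \<longrightarrow> P (x + (- lattice_vec k))" using AE_translate[OF assms(1)] .
    moreover have "AE x in lebesgue. P (x + (- lattice_vec k) + lattice_vec k) \<longleftrightarrow> P (x + (- lattice_vec k))" using AE_translate[OF per] .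
    ultimately show ?thesis by eventually_elim (use diff_lattice_vec_cell[of _ k] in auto)
  qed
  then have "AE x in lebesgue. \<forall>k. cell_index x = k \<longrightarrow> P x" by (subst AE_all_countable) blast
  then show ?thesis by eventually_elim auto
qed

definition L2Q :: "field set" where
  "L2Q = {v \<in> borel_measurable lebesgue. set_integrable lebesgue (cell a) (\<lambda>x. (norm (v x))\<^sup>2)}"

lemma L2_per_L2Q: "L2_per a \<subseteq> L2Q"
proof
  fix v assume "v \<in> L2_per a"
  then have v: "v \<in> borel_measurable lebesgue" "set_integrable lebesgue (closure (cell a)) (\<lambda>x. (norm (v x))\<^sup>2)"
    using bounded_cell by (auto simp: L2_per_def L2_loc_def compact_closure)
  then show "v \<in> L2Q" unfolding L2Q_def
    using set_integrable_subset[OF v(2) cell_lebesgue closure_subset] by simp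
qed

text \<open>The periodic extension of the restriction to the cell. It turns limits of periodic fields in
\<open>L2Q\<close>, which are determined on the cell only, into periodic fields.\<close>

definition ext :: "field \<Rightarrow> field" where "ext v x = v (x - lattice_vec (cell_index x))"

lemma ext_cell: "x \<in> cell a \<Longrightarrow> ext v x = v x"
  by (simp add: ext_def cell_iff_cell_index lattice_vec_def)

lemma ext_periodic: "ext v (x + lattice_vec k) = ext v x"
  unfolding ext_def cell_index_add lattice_vec_add by simp

lemma measurable_cell_index: "cell_index \<in> measurable lebesgue (count_space UNIV)"
proof (rule measurable_count_space_eq_countable[THEN iffD2])
  show "countable (UNIV :: (3 \<Rightarrow> int) set)" by (rule countableI_type)
  have "(\<lambda>x. x - lattice_vec k) -` cell a \<in> sets lebesgue" for k
  proof -
    have "(\<lambda>x. x + (- lattice_vec k)) -` cell a \<inter> space lebesgue \<in> sets lebesgue"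
      by (rule measurable_sets[OF translate_measurable cell_lebesgue])
    then show ?thesis by simp
  qed
  moreover have "cell_index -` {k} = (\<lambda>x. x - lattice_vec k) -` cell a" for k using diff_lattice_vec_cell by auto
  ultimately show "cell_index \<in> space lebesgue \<rightarrow> UNIV \<and> (\<forall>k\<in>UNIV. cell_index -` {k} \<inter> space lebesgue \<in> sets lebesgue)" by simp
qed

lemma ext_L2_per: assumes v: "v \<in> L2Q" shows "ext v \<in> L2_per a"
proof -
  have vm: "v \<in> borel_measurable lebesgue" using v by (simp add: L2Q_def)
  have tm: "(\<lambda>x. v (x - c)) \<in> borel_measurable lebesgue" for c
    using measurable_compose[OF translate_measurable[of "- c"] vm] by simp
  have em: "ext v \<in> borel_measurable lebesgue"
    unfolding ext_def by (rule measurable_compose_countable'[OF _ measurable_cell_index]) (auto intro: tm countableI_type)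
  have "set_integrable lebesgue C (\<lambda>x. (norm (ext v x))\<^sup>2)" if C: "compact C" for C
  proof -
    have S: "finite (cell_index ` C)" using C compact_imp_bounded finite_cell_index by blast
    have i: "integrable lebesgue (\<lambda>x. indicator (cell a) x *\<^sub>R (norm (v x))\<^sup>2)"
      using v by (simp add: L2Q_def set_integrable_def)
    have g: "integrable lebesgue (\<lambda>x. \<Sum>k\<in>cell_index ` C. indicator (cell a) (x - lattice_vec k) *\<^sub>R (norm (v (x - lattice_vec k)))\<^sup>2)"
      using integrable_translate[OF i, of "- lattice_vec _"] by (intro Bochner_Integration.integrable_sum) simp
    show ?thesis unfolding set_integrable_def
    proof (rule Bochner_Integration.integrable_bound[OF g])
      have "C \<in> sets lebesgue" using C by (simp add: borel_compact)
      then show "(\<lambda>x. indicator C x *\<^sub>R (norm (ext v x))\<^sup>2) \<in> borel_measurable lebesgue" using em by measurable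
      show "AE x in lebesgue. norm (indicator C x *\<^sub>R (norm (ext v x))\<^sup>2) \<le>
        norm (\<Sum>k\<in>cell_index ` C. indicator (cell a) (x - lattice_vec k) *\<^sub>R (norm (v (x - lattice_vec k)))\<^sup>2)"
      proof (intro AE_I2)
        fix x
        show "norm (indicator C x *\<^sub>R (norm (ext v x))\<^sup>2) \<le>
          norm (\<Sum>k\<in>cell_index ` C. indicator (cell a) (x - lattice_vec k) *\<^sub>R (norm (v (x - lattice_vec k)))\<^sup>2)"
        proof (cases "x \<in> C")
          case True
          have "(\<Sum>k\<in>cell_index ` C. indicator (cell a) (x - lattice_vec k) *\<^sub>R (norm (v (x - lattice_vec k)))\<^sup>2)
            = (\<Sum>k\<in>cell_index ` C. if k = cell_index x then (norm (ext v x))\<^sup>2 else 0)"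
            by (intro sum.cong) (auto simp: indicator_def diff_lattice_vec_cell ext_def)
          also have "\<dots> = (norm (ext v x))\<^sup>2" using S True by simp
          finally show ?thesis using True by simp
        qed simp
      qed
    qed
  qed
  then show ?thesis using em ext_periodic by (auto simp: L2_per_def L2_loc_def lattice_eq)
qed

end

section \<open>Square integrable fields on the period cell\<close>

lemma norm_sq_vec: "(norm (z :: complex^3))\<^sup>2 = (\<Sum>i\<in>UNIV. (cmod (z $ i))\<^sup>2)"
  by (simp add: norm_vec_def L2_set_def sum_nonneg)

lemma hdot_self: "hdot z z = of_real ((norm z)\<^sup>2)"
  unfolding hdot_def norm_sq_vec of_real_sum by (simp only: complex_norm_square)

lemma hdot_bound: "cmod (hdot z w) \<le> (norm z)\<^sup>2 + (norm w)\<^sup>2"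
proof -
  have "cmod (hdot z w) \<le> (\<Sum>i\<in>UNIV. cmod (z $ i) * cmod (w $ i))"
    unfolding hdot_def by (rule order_trans[OF norm_sum]) (simp add: norm_mult)
  also have "\<dots> \<le> (\<Sum>i\<in>UNIV. (cmod (z $ i))\<^sup>2 + (cmod (w $ i))\<^sup>2)"
  proof (rule sum_mono)
    fix i
    have "2 * (cmod (z $ i) * cmod (w $ i)) \<le> (cmod (z $ i))\<^sup>2 + (cmod (w $ i))\<^sup>2"
      using sum_squares_bound[of "cmod (z $ i)" "cmod (w $ i)"] by simp
    moreover have "0 \<le> cmod (z $ i) * cmod (w $ i)" by simp
    ultimately show "cmod (z $ i) * cmod (w $ i) \<le> (cmod (z $ i))\<^sup>2 + (cmod (w $ i))\<^sup>2" by linarith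
  qed
  finally show ?thesis by (simp add: norm_sq_vec sum.distrib)
qed

lemma hdot_add: "hdot (x + y) z = hdot x z + hdot y z"
  by (simp add: hdot_def algebra_simps sum.distrib)
lemma hdot_scale: "hdot (c *s x) z = c * hdot x z"
  by (simp add: hdot_def sum_distrib_left mult.assoc)
lemma hdot_sym: "hdot y x = cnj (hdot x y)"
  by (simp add: hdot_def mult.commute)

lemma borel_measurable_component:
  "v \<in> borel_measurable M \<Longrightarrow> (\<lambda>x. (v x :: complex^3) $ i) \<in> borel_measurable M"
  by (rule borel_measurable_continuous_on[of "\<lambda>z. z $ i"]) (auto intro: continuous_intros)

lemma continuous_scale: "continuous_on UNIV (\<lambda>z :: complex^3. c *s z)"
proof (rule linear_continuous_on)
  show "bounded_linear (\<lambda>z :: complex^3. c *s z)"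
    unfolding linear_conv_bounded_linear[symmetric]
    by (rule linearI) (auto simp: vec_eq_iff algebra_simps)
qed

lemma borel_measurable_scale:
  "v \<in> borel_measurable M \<Longrightarrow> (\<lambda>x. c *s (v x :: complex^3)) \<in> borel_measurable M"
  using borel_measurable_continuous_on[OF continuous_scale] .

lemma norm_scale: "norm (c *s (z :: complex^3)) = cmod c * norm z"
proof -
  have "(norm (c *s z))\<^sup>2 = (cmod c * norm z)\<^sup>2"
    by (simp add: norm_sq_vec norm_mult power_mult_distrib sum_distrib_left)
  then show ?thesis by (simp add: power2_eq_iff_nonneg)
qed

lemma borel_measurable_hdot:
  "u \<in> borel_measurable M \<Longrightarrow> v \<in> borel_measurable M \<Longrightarrow> (\<lambda>x. hdot (u x) (v x)) \<in> borel_measurable M"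
  unfolding hdot_def
  by (intro borel_measurable_sum borel_measurable_times borel_measurable_component
      borel_measurable_continuous_on[of cnj] continuous_intros continuous_on_id)

context lattice_cell
begin

lemma L2Q_D: "v \<in> L2Q \<Longrightarrow> v \<in> borel_measurable lebesgue" 
  "v \<in> L2Q \<Longrightarrow> set_integrable lebesgue (cell a) (\<lambda>x. (norm (v x))\<^sup>2)"
  by (auto simp: L2Q_def)

lemma set_integrable_dominated:
  fixes f :: "r3 \<Rightarrow> 'b::{banach, second_countable_topology}"
  assumes "set_integrable lebesgue (cell a) g" "f \<in> borel_measurable lebesgue" "\<And>x. norm (f x) \<le> (g x :: real)"
  shows "set_integrable lebesgue (cell a) f"
  unfolding set_integrable_def
proof (rule Bochner_Integration.integrable_bound[OF assms(1)[unfolded set_integrable_def]])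
  show "(\<lambda>x. indicat_real (cell a) x *\<^sub>R f x) \<in> borel_measurable lebesgue" using assms(2) by measurable
  show "AE x in lebesgue. norm (indicat_real (cell a) x *\<^sub>R f x) \<le> norm (indicat_real (cell a) x *\<^sub>R g x)"
    using assms(3) by (intro AE_I2) (auto simp: indicator_def intro: order_trans[OF _ abs_ge_self])
qed

lemma L2Q_dominated:
  assumes "u \<in> L2Q" "v \<in> L2Q" "w \<in> borel_measurable lebesgue" "\<And>x. (norm (w x))\<^sup>2 \<le> C * (norm (u x))\<^sup>2 + D * (norm (v x))\<^sup>2"
  shows "w \<in> L2Q"
proof -
  have "set_integrable lebesgue (cell a) (\<lambda>x. C * (norm (u x))\<^sup>2 + D * (norm (v x))\<^sup>2)"
    using assms by (intro set_integral_add set_integrable_mult_right) (auto simp: L2Q_def)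
  then have "set_integrable lebesgue (cell a) (\<lambda>x. (norm (w x))\<^sup>2)"
    by (rule set_integrable_dominated) (use assms(3,4) in auto)
  then show ?thesis using assms(3) by (simp add: L2Q_def)
qed

lemma L2Q_add: assumes "u \<in> L2Q" "v \<in> L2Q" shows "(\<lambda>x. u x + v x) \<in> L2Q"
proof (rule L2Q_dominated[OF assms, where C = 2 and D = 2])
  fix x
  have "(norm (u x + v x))\<^sup>2 \<le> (norm (u x) + norm (v x))\<^sup>2" by (intro power_mono norm_triangle_ineq) auto
  also have "\<dots> \<le> 2 * (norm (u x))\<^sup>2 + 2 * (norm (v x))\<^sup>2"
    using sum_squares_bound[of "norm (u x)" "norm (v x)"] by (simp add: power2_sum)
  finally show "(norm (u x + v x))\<^sup>2 \<le> 2 * (norm (u x))\<^sup>2 + 2 * (norm (v x))\<^sup>2" .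
qed (use assms in \<open>auto dest!: L2Q_D(1)\<close>)

lemma L2Q_scale: assumes "u \<in> L2Q" shows "(\<lambda>x. c *s u x) \<in> L2Q"
  by (rule L2Q_dominated[OF assms assms, where C = "(cmod c)\<^sup>2" and D = 0])
     (use assms in \<open>auto simp: norm_scale power_mult_distrib intro: borel_measurable_scale dest!: L2Q_D(1)\<close>)

lemma hdot_integrable:
  assumes "u \<in> L2Q" "v \<in> L2Q" shows "set_integrable lebesgue (cell a) (\<lambda>x. hdot (u x) (v x))"
proof (rule set_integrable_dominated[where g = "\<lambda>x. (norm (u x))\<^sup>2 + (norm (v x))\<^sup>2"])
  show "set_integrable lebesgue (cell a) (\<lambda>x. (norm (u x))\<^sup>2 + (norm (v x))\<^sup>2)"
    using assms by (intro set_integral_add) (auto dest: L2Q_D)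
qed (use assms hdot_bound in \<open>auto intro: borel_measurable_hdot dest!: L2Q_D(1)\<close>)

lemma L2_inner_self: "L2_inner a u u = of_real (LINT x:cell a|lebesgue. (norm (u x))\<^sup>2)"
  unfolding L2_inner_def hdot_self by (rule set_integral_complex_of_real)

lemma set_integral_nonneg_sq: "0 \<le> (LINT x:cell a|lebesgue. (norm (u x))\<^sup>2)"
  unfolding set_lebesgue_integral_def by (rule integral_nonneg_AE) auto

sublocale Q: semi_inner cscale L2Q "L2_inner a"
proof -
  have [simp]: "u + v = (\<lambda>x. u x + v x)" for u v :: field by auto
  have [simp]: "(0 :: field) = (\<lambda>x. 0)" by auto
  have z: "(\<lambda>x. 0) \<in> L2Q" by (auto simp: L2Q_def set_integrable_def)
  show "semi_inner cscale L2Q (L2_inner a)"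
  proof
    show "module.subspace cscale L2Q"
      by (rule cscale.subspaceI) (auto simp: cscale_def L2Q_add L2Q_scale z simp del: fun_eq_iff)
    show "L2_inner a (u + v) w = L2_inner a u w + L2_inner a v w" if "u \<in> L2Q" "v \<in> L2Q" "w \<in> L2Q" for u v w
      unfolding L2_inner_def using set_integral_add(2)[OF hdot_integrable hdot_integrable, of u w v w] that
      by (simp add: hdot_add)
    show "L2_inner a (cscale c u) w = c * L2_inner a u w" for c u w
      unfolding L2_inner_def cscale_def hdot_scale by (rule set_integral_mult_right)
    show "L2_inner a v u = cnj (L2_inner a u v)" for u v
    proof -
      have "(\<lambda>x. indicat_real (cell a) x *\<^sub>R hdot (v x) (u x)) = (\<lambda>x. cnj (indicat_real (cell a) x *\<^sub>R hdot (u x) (v x)))"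
        by (auto simp: hdot_sym[of "v _" "u _"])
      then show ?thesis
        unfolding L2_inner_def set_lebesgue_integral_def by (simp only: Bochner_Integration.integral_cnj)
    qed
    show "0 \<le> Re (L2_inner a u u)" for u
      unfolding L2_inner_self using set_integral_nonneg_sq by simp
  qed
qed

lemma Qnrm: "Q.nrm u = L2_norm a u"
  unfolding Q.nrm_def L2_norm_def L2_inner_self by simp

lemma Qnrm_sq: "(Q.nrm u)\<^sup>2 = (LINT x:cell a|lebesgue. (norm (u x))\<^sup>2)"
  unfolding Qnrm L2_norm_def using set_integral_nonneg_sq by simp

lemma Qnull: assumes "u \<in> L2Q" shows "Q.nrm u = 0 \<longleftrightarrow> (AE x in lebesgue. x \<in> cell a \<longrightarrow> u x = 0)"
proof -
  have "Q.nrm u = 0 \<longleftrightarrow> (LINT x|lebesgue. indicat_real (cell a) x *\<^sub>R (norm (u x))\<^sup>2) = 0"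
    using Qnrm_sq[of u] unfolding set_lebesgue_integral_def by (metis power_eq_0_iff zero_power2)
  also have "\<dots> \<longleftrightarrow> (AE x in lebesgue. indicat_real (cell a) x *\<^sub>R (norm (u x))\<^sup>2 = 0)"
    using assms by (intro integral_nonneg_eq_0_iff_AE) (auto simp: L2Q_def set_integrable_def)
  also have "\<dots> \<longleftrightarrow> (AE x in lebesgue. x \<in> cell a \<longrightarrow> u x = 0)"
    by (intro AE_cong) (auto simp: indicator_def)
  finally show ?thesis .
qed

text \<open>Fatou's lemma identifies the pointwise limit of a Cauchy sequence as its limit in the norm.\<close>

lemma Q_fatou:
  assumes Y: "\<And>k. Y k \<in> L2Q" and L: "L \<in> borel_measurable lebesgue"
    and lim: "AE x in lebesgue. x \<in> cell a \<longrightarrow> (\<lambda>k. Y k x) \<longlonglongrightarrow> L x"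
    and bd: "\<And>k. k \<ge> m \<Longrightarrow> Q.nrm (Y k - Y m) \<le> e"
  shows "L - Y m \<in> L2Q \<and> Q.nrm (L - Y m) \<le> e"
proof -
  have e: "e \<ge> 0" using bd[of m] by simp
  have dL: "Y k - Y m \<in> L2Q" for k using Y by auto
  define F where "F w x = ennreal (indicat_real (cell a) x *\<^sub>R (norm (w x))\<^sup>2)" for w :: field and x
  have Fint: "(\<integral>\<^sup>+x. F w x \<partial>lebesgue) = ennreal ((Q.nrm w)\<^sup>2)" if "w \<in> L2Q" for w
    unfolding F_def Qnrm_sq set_lebesgue_integral_def using that
    by (intro nn_integral_eq_integral) (auto simp: L2Q_def set_integrable_def)
  have Fm: "F w \<in> borel_measurable lebesgue" if "w \<in> borel_measurable lebesgue" for w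
    unfolding F_def using that by measurable
  have Lm: "L - Y m \<in> borel_measurable lebesgue"
    using L L2Q_D(1)[OF Y, of m] unfolding fun_diff_def by (rule borel_measurable_diff)
  have "(\<integral>\<^sup>+x. F (L - Y m) x \<partial>lebesgue) \<le> (\<integral>\<^sup>+x. liminf (\<lambda>k. F (Y k - Y m) x) \<partial>lebesgue)"
  proof (rule nn_integral_mono_AE)
    show "AE x in lebesgue. F (L - Y m) x \<le> liminf (\<lambda>k. F (Y k - Y m) x)"
      using lim
    proof eventually_elim
      fix x assume a: "x \<in> cell a \<longrightarrow> (\<lambda>k. Y k x) \<longlonglongrightarrow> L x"
      have "(\<lambda>k. F (Y k - Y m) x) \<longlonglongrightarrow> F (L - Y m) x"
      proof (cases "x \<in> cell a")
        case True
        then show ?thesis unfolding F_def using a by (auto intro!: tendsto_intros)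
      qed (simp add: F_def)
      then show "F (L - Y m) x \<le> liminf (\<lambda>k. F (Y k - Y m) x)"
        using lim_imp_Liminf[of sequentially] by fastforce
    qed
  qed
  also have "\<dots> \<le> liminf (\<lambda>k. \<integral>\<^sup>+x. F (Y k - Y m) x \<partial>lebesgue)"
    using dL by (intro nn_integral_liminf Fm) (auto simp: L2Q_def)
  also have "\<dots> \<le> ennreal (e\<^sup>2)"
  proof (rule Liminf_le)
    have "(\<integral>\<^sup>+x. F (Y k - Y m) x \<partial>lebesgue) \<le> ennreal (e\<^sup>2)" if "k \<ge> m" for k
      unfolding Fint[OF dL] using bd[OF that] Q.nrm_nonneg[OF dL] by (intro ennreal_leI power_mono) auto
    then show "\<forall>\<^sub>F k in sequentially. (\<integral>\<^sup>+x. F (Y k - Y m) x \<partial>lebesgue) \<le> ennreal (e\<^sup>2)"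
      unfolding eventually_sequentially by blast
  qed simp
  finally have fin: "(\<integral>\<^sup>+x. F (L - Y m) x \<partial>lebesgue) \<le> ennreal (e\<^sup>2)" .
  have mem: "L - Y m \<in> L2Q"
  proof -
    have "integrable lebesgue (\<lambda>x. indicat_real (cell a) x *\<^sub>R (norm ((L - Y m) x))\<^sup>2)"
    proof (rule integrableI_nonneg)
      show "(\<lambda>x. indicat_real (cell a) x *\<^sub>R (norm ((L - Y m) x))\<^sup>2) \<in> borel_measurable lebesgue"
        using Lm by measurable
      show "(\<integral>\<^sup>+x. ennreal (indicat_real (cell a) x *\<^sub>R (norm ((L - Y m) x))\<^sup>2) \<partial>lebesgue) < \<infinity>"
        using le_less_trans[OF fin[unfolded F_def] ennreal_less_top] by simp
    qed auto
    then show ?thesis using Lm by (simp add: L2Q_def set_integrable_def)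
  qed
  have "(Q.nrm (L - Y m))\<^sup>2 \<le> e\<^sup>2" using fin unfolding Fint[OF mem] by simp
  then have "Q.nrm (L - Y m) \<le> e" using e by (rule power2_le_imp_le)
  then show ?thesis using mem by (rule conjI[rotated])
qed

text \<open>The cell has finite measure, so norms in \<open>L\<^sup>2\<close> dominate norms in \<open>L\<^sup>1\<close>. Along a sequence with
geometrically decreasing steps the sum of the absolute values of the increments is therefore
integrable, hence finite almost everywhere.\<close>

lemma Q_fast_cauchy_converges:
  assumes Y: "\<And>k. Y k \<in> L2Q" and fast: "\<And>k. Q.nrm (Y (Suc k) - Y k) < (1/2) ^ k"
  shows "AE x in lebesgue. x \<in> cell a \<longrightarrow> convergent (\<lambda>k. Y k x)"
proof -
  define T where "T k x = indicat_real (cell a) x * norm (Y (Suc k) x - Y k x)" for k x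
  have Ym: "Y k \<in> borel_measurable lebesgue" for k using Y by (auto simp: L2Q_def)
  have Tm: "T k \<in> borel_measurable lebesgue" for k unfolding T_def using Ym by measurable
  have Tn: "T k x \<ge> 0" for k x by (simp add: T_def)
  have "(\<integral>\<^sup>+x. ennreal (T k x) \<partial>lebesgue) \<le> ennreal ((1/2)^k * (1 + vol))" for k
  proof -
    let ?g = "\<lambda>x. 2^k * (indicat_real (cell a) x *\<^sub>R (norm ((Y (Suc k) - Y k) x))\<^sup>2) + (1/2)^k * indicat_real (cell a) x"
    have d: "Y (Suc k) - Y k \<in> L2Q" using Y by auto
    have i1: "integrable lebesgue (\<lambda>x. indicat_real (cell a) x *\<^sub>R (norm ((Y (Suc k) - Y k) x))\<^sup>2)"
      using d by (simp add: L2Q_def set_integrable_def)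
    have i2: "integrable lebesgue (indicat_real (cell a))" using cell_lmeasurable by (simp add: fmeasurable_def)
    have gi: "integrable lebesgue ?g" using i1 i2 by (intro Bochner_Integration.integrable_add integrable_mult_right)
    have "T k x \<le> ?g x" for x
    proof (cases "x \<in> cell a")
      case True
      let ?t = "norm (Y (Suc k) x - Y k x)"
      have p: "(2::real)^k > 0" "(1/2::real)^k = 1 / 2^k" by (auto simp: power_one_over)
      \<comment> \<open>The inequality between arithmetic and geometric mean, with weights matched to the rate of decrease.\<close>
      have "0 \<le> (2^k * ?t - 1)\<^sup>2" by simp
      then have "2^k * (2 * ?t) \<le> 2^k * (2^k * ?t\<^sup>2 + (1/2)^k)"
        using p by (simp add: power2_diff power_mult_distrib power2_eq_square algebra_simps)
      then have "2 * ?t \<le> 2^k * ?t\<^sup>2 + (1/2)^k" using p(1) by (simp only: mult_le_cancel_left_pos)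
      moreover have "0 \<le> ?t" by simp
      ultimately have "?t \<le> 2^k * ?t\<^sup>2 + (1/2)^k" by linarith
      then show ?thesis using True by (simp add: T_def)
    qed (simp add: T_def)
    then have "(\<integral>\<^sup>+x. ennreal (T k x) \<partial>lebesgue) \<le> (\<integral>\<^sup>+x. ennreal (?g x) \<partial>lebesgue)"
      by (intro nn_integral_mono ennreal_leI)
    also have "\<dots> = ennreal (integral\<^sup>L lebesgue ?g)" by (intro nn_integral_eq_integral gi) auto
    also have "integral\<^sup>L lebesgue ?g = 2^k * (Q.nrm (Y (Suc k) - Y k))\<^sup>2 + (1/2)^k * vol"
      using i1 i2 by (simp add: Qnrm_sq set_lebesgue_integral_def vol_def)
    also have "\<dots> \<le> (1/2)^k * (1 + vol)"
    proof -
      have "(Q.nrm (Y (Suc k) - Y k))\<^sup>2 \<le> ((1/2)^k)\<^sup>2"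
        using fast[of k] Q.nrm_nonneg[OF d] by (intro power_mono) auto
      then have "2^k * (Q.nrm (Y (Suc k) - Y k))\<^sup>2 \<le> 2^k * ((1/2)^k)\<^sup>2" by (intro mult_left_mono) auto
      also have "\<dots> = (1/2)^k" by (simp add: power2_eq_square power_one_over)
      finally show ?thesis by (simp add: algebra_simps)
    qed
    finally show ?thesis by (simp add: ennreal_leI)
  qed
  then have "(\<Sum>k. \<integral>\<^sup>+x. ennreal (T k x) \<partial>lebesgue) \<le> (\<Sum>k. ennreal ((1/2)^k * (1 + vol)))"
    by (intro suminf_le) auto
  also have "\<dots> < \<infinity>"
  proof -
    have "summable (\<lambda>k. (1/2::real)^k * (1 + vol))" by (intro summable_mult2 summable_geometric) simp
    then show ?thesis using vol_pos by (simp add: suminf_ennreal2 less_top)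
  qed
  finally have "(\<integral>\<^sup>+x. (\<Sum>k. ennreal (T k x)) \<partial>lebesgue) < \<infinity>"
    using Tm by (subst nn_integral_suminf) auto
  then have "AE x in lebesgue. (\<Sum>k. ennreal (T k x)) \<noteq> \<infinity>"
    using Tm by (intro nn_integral_PInf_AE) auto
  then show ?thesis
  proof eventually_elim
    fix x assume a: "(\<Sum>k. ennreal (T k x)) \<noteq> \<infinity>"
    show "x \<in> cell a \<longrightarrow> convergent (\<lambda>k. Y k x)"
    proof
      assume x: "x \<in> cell a"
      have "summable (\<lambda>k. T k x)" using a Tn by (intro summable_suminf_not_top) auto
      then have "summable (\<lambda>k. norm (Y (Suc k) x - Y k x))" using x by (simp add: T_def)
      then have "summable (\<lambda>k. Y (Suc k) x - Y k x)" by (rule summable_norm_cancel)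
      then have "convergent (\<lambda>n. \<Sum>k<n. Y (Suc k) x - Y k x)" by (simp add: summable_iff_convergent)
      then have "convergent (\<lambda>n. Y n x - Y 0 x)" by (simp only: sum_lessThan_telescope[of "\<lambda>k. Y k x"])
      then have "convergent (\<lambda>n. (Y n x - Y 0 x) + Y 0 x)" by (intro convergent_add convergent_const)
      then show "convergent (\<lambda>k. Y k x)" by simp
    qed
  qed
qed

text \<open>A subsequence with geometrically decreasing steps converges almost everywhere on the cell, and by
\<open>Q_fatou\<close> in the norm.\<close>

lemma Q_complete:
  assumes X: "\<And>n. X n \<in> L2Q" "Q.cauchy X"
  shows "\<exists>x\<in>L2Q. Q.lim_to X x"
proof -
  obtain r where r: "\<And>k. k \<le> r k" "mono r"
    "\<And>k m n. r k \<le> m \<Longrightarrow> r k \<le> n \<Longrightarrow> Q.nrm (X m - X n) < (1/2) ^ k"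
    using Q.cauchy_fast_subsequence[OF X(2)] by blast
  define Y where "Y = X \<circ> r"
  have Y: "Y k \<in> L2Q" for k using X by (auto simp: Y_def)
  have Ym: "Y k \<in> borel_measurable lebesgue" for k using Y by (auto simp: L2Q_def)
  have fast: "Q.nrm (Y k - Y m) < (1/2)^m" if "k \<ge> m" for k m
    unfolding Y_def o_def using r(3) monoD[OF r(2) that] by simp
  define L where "L x = lim (\<lambda>k. Y k x)" for x
  have Lm: "L \<in> borel_measurable lebesgue" unfolding L_def using Ym by (rule borel_measurable_lim_metric)
  have "AE x in lebesgue. x \<in> cell a \<longrightarrow> convergent (\<lambda>k. Y k x)"
    by (rule Q_fast_cauchy_converges[OF Y]) (rule fast, simp)
  then have lim: "AE x in lebesgue. x \<in> cell a \<longrightarrow> (\<lambda>k. Y k x) \<longlonglongrightarrow> L x"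
    by eventually_elim (auto simp: L_def convergent_LIMSEQ_iff)
  have d: "L - Y m \<in> L2Q \<and> Q.nrm (L - Y m) \<le> (1/2)^m" for m
    by (rule Q_fatou[OF Y Lm lim]) (use fast in \<open>simp add: less_imp_le\<close>)
  have "(L - Y 0) + Y 0 \<in> L2Q" using d[of 0] Y by (intro Q.H_add) auto
  then have L: "L \<in> L2Q" by simp
  have "Q.lim_to Y L" unfolding Q.lim_to_def
  proof (rule Lim_null_comparison)
    show "\<forall>\<^sub>F n in sequentially. norm (Q.nrm (Y n - L)) \<le> (1/2)^n"
      using d Q.nrm_minus_commute[OF Y L] Y L by auto
    show "(\<lambda>n. (1/2::real)^n) \<longlonglongrightarrow> 0" by (rule LIMSEQ_realpow_zero) auto
  qed
  then have "Q.lim_to X L" using Q.cauchy_subsequence_limit[OF X L r(1)] unfolding Y_def by simp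
  then show ?thesis using L by blast
qed

sublocale Q: semi_hilbert cscale L2Q "L2_inner a"
  by standard (rule Q_complete)

end

section \<open>Plane waves\<close>

context lattice_cell
begin

text \<open>The points of the reciprocal lattice, indexed by integer vectors.\<close>

definition dual_vec :: "(3 \<Rightarrow> int) \<Rightarrow> r3" where "dual_vec m = (2 * pi) *\<^sub>R (\<Sum>i\<in>UNIV. of_int (m i) *\<^sub>R d i)"

definition wave :: "(3 \<Rightarrow> int) \<Rightarrow> r3 \<Rightarrow> complex" where "wave m x = cis (dual_vec m \<bullet> x)"

lemma dual_vec_a: "dual_vec m \<bullet> a i = 2 * pi * of_int (m i)"
  unfolding dual_vec_def by (simp add: inner_sum_left dual if_distrib cong: if_cong)

lemma dual_vec_inj: "dual_vec m = dual_vec l \<longleftrightarrow> m = l"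
proof
  assume "dual_vec m = dual_vec l"
  then have "dual_vec m \<bullet> a i = dual_vec l \<bullet> a i" for i by simp
  then show "m = l" unfolding dual_vec_a by (auto simp: fun_eq_iff)
qed simp

lemma wave_add: "wave (\<lambda>i. m i + l i) x = wave m x * wave l x"
  unfolding wave_def dual_vec_def
  by (simp add: cis_mult scaleR_left_distrib sum.distrib inner_add_left scaleR_right_distrib)

lemma wave_minus: "wave (\<lambda>i. - m i) x = cnj (wave m x)"
proof -
  have "dual_vec (\<lambda>i. - m i) = - dual_vec m" unfolding dual_vec_def by (simp add: sum_negf)
  then show ?thesis by (simp add: wave_def cis_cnj)
qed

lemma wave_0 [simp]: "wave (\<lambda>i. 0) x = 1"
  by (simp add: wave_def dual_vec_def)

lemma norm_wave [simp]: "cmod (wave m x) = 1" by (simp add: wave_def)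

lemma dual_vec_lattice_vec: "dual_vec m \<bullet> lattice_vec k = 2 * pi * of_int (\<Sum>i\<in>UNIV. k i * m i)"
  unfolding lattice_vec_def by (simp add: inner_sum_right dual_vec_a sum_distrib_left algebra_simps)

lemma wave_periodic: "wave m (x + lattice_vec k) = wave m x"
proof -
  have 1: "cis (2 * pi * of_int n) = 1" for n by (rule cis_multiple_2pi) simp
  show ?thesis unfolding wave_def inner_add_right cis_mult[symmetric] dual_vec_lattice_vec by (simp only: 1 mult_1_right)
qed

lemma Ck_wave: "Ck k (wave m)"
  unfolding wave_def by (rule Ck_ridge[OF smooth1_cis])

lemma continuous_wave: "continuous_on UNIV (wave m)"
  using Ck_continuous[OF Ck_wave[of 0]] .

lemma pd_wave: "pd j (wave m) x = \<i> * of_real (dual_vec m $ j) * wave m x"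
proof -
  have "((\<lambda>t. cis t) has_vector_derivative \<i> * cis t) (at t)" for t
  proof -
    have "((\<lambda>t. exp (\<i> * of_real t)) has_vector_derivative \<i> * exp (\<i> * of_real t)) (at t)"
      by (rule has_vector_derivative_eq_rhs[OF has_vector_derivative_real_field[of "\<lambda>z. exp (\<i> * z)"]])
         (auto intro!: derivative_eq_intros)
    then show ?thesis by (simp add: cis_conv_exp)
  qed
  from pd_ridge[OF this, of j "dual_vec m" x] show ?thesis unfolding wave_def by (simp add: scaleR_conv_of_real)
qed

lemma wave_differentiable: "wave m differentiable (at x)"
  using Ck_wave[of "Suc 0" m] by simp

text \<open>A test function whose lattice translates sum to 1. Integrals of periodic functions over the cell
become integrals over the whole space against \<open>chi\<close>, where integration by parts leaves no boundary
terms.\<close>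

definition chi :: "r3 \<Rightarrow> complex" where "chi x = (\<Prod>i\<in>UNIV. of_real (hat1 (d i \<bullet> x)))"

text \<open>The cells that meet the support of \<open>chi\<close>. The support is closed and touches cells
with index 1, for which \<open>chi\<close> itself vanishes.\<close>

definition neighbours :: "(3 \<Rightarrow> int) set" where "neighbours = {k. \<forall>i. k i \<in> {-1, 0, 1}}"

lemma neighbours_PiE: "neighbours = PiE UNIV (\<lambda>_. {-1, 0, 1})"
  unfolding neighbours_def by auto

lemma finite_neighbours: "finite neighbours" unfolding neighbours_PiE by (rule finite_PiE) auto

definition slab :: "r3 set" where "slab = {x. \<forall>i. \<bar>d i \<bullet> x\<bar> \<le> 1}"

lemma compact_slab: "compact slab"
proof -
  have "closed slab"
  proof -
    have "slab = (\<Inter>i. {x. \<bar>d i \<bullet> x\<bar> \<le> 1})" unfolding slab_def by auto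
    then show ?thesis by (auto intro!: closed_INT closed_Collect_le continuous_intros)
  qed
  moreover have "bounded slab"
  proof (rule boundedI)
    fix x assume "x \<in> slab"
    then have "norm ((d i \<bullet> x) *\<^sub>R a i) \<le> norm (a i)" for i
      unfolding slab_def by (auto intro!: mult_left_le_one_le)
    then have "norm (\<Sum>i\<in>UNIV. (d i \<bullet> x) *\<^sub>R a i) \<le> (\<Sum>i\<in>UNIV. norm (a i))"
      by (intro order_trans[OF norm_sum] sum_mono)
    then show "norm x \<le> (\<Sum>i\<in>UNIV. norm (a i))" using expand[of x] by simp
  qed
  ultimately show ?thesis by (simp add: compact_eq_bounded_closed)
qed

lemma slab_cell_index: "x \<in> slab \<Longrightarrow> cell_index x \<in> neighbours"
proof -
  assume "x \<in> slab"
  then have "\<lfloor>d i \<bullet> x\<rfloor> \<in> {-1, 0, 1}" for i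
  proof -
    have "- 1 \<le> d i \<bullet> x" "d i \<bullet> x \<le> 1" using \<open>x \<in> slab\<close> unfolding slab_def by (auto simp: abs_le_iff)
    then have "-1 \<le> \<lfloor>d i \<bullet> x\<rfloor>" "\<lfloor>d i \<bullet> x\<rfloor> \<le> 1" by linarith+
    moreover have "n \<in> {-1, 0, 1}" if "-1 \<le> n" "n \<le> 1" for n :: int using that by auto
    ultimately show ?thesis by blast
  qed
  then show ?thesis unfolding neighbours_def cell_index_def by blast
qed

lemma chi_slab: "chi x \<noteq> 0 \<Longrightarrow> x \<in> slab"
proof -
  assume "chi x \<noteq> 0"
  then have "hat1 (d i \<bullet> x) \<noteq> 0" for i unfolding chi_def by (simp add: prod_zero_iff)
  then have "- 1 < d i \<bullet> x \<and> d i \<bullet> x < 1" for i by (rule hat1_support)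
  then show "x \<in> slab" unfolding slab_def by (simp add: abs_le_iff less_imp_le minus_le_iff)
qed

lemma Ck_chi: "Ck k chi"
  unfolding chi_def by (intro Ck_prod Ck_ridge smooth1_of_real smooth1_hat1)

lemma chi_differentiable: "chi differentiable (at x)"
  using Ck_chi[of "Suc 0"] by simp

text \<open>The sum of products is the product of the one-dimensional sums, each of which equals 1.\<close>

lemma chi_partition: assumes x: "x \<in> cell a" shows "(\<Sum>k\<in>neighbours. chi (x + lattice_vec k)) = 1"
proof -
  have "(\<Sum>k\<in>neighbours. chi (x + lattice_vec k)) = (\<Sum>k\<in>neighbours. \<Prod>i\<in>UNIV. complex_of_real (hat1 (d i \<bullet> x + of_int (k i))))"
    unfolding chi_def by (simp add: inner_add_right)
  also have "\<dots> = (\<Prod>i\<in>UNIV. \<Sum>n\<in>{-1,0,1::int}. complex_of_real (hat1 (d i \<bullet> x + of_int n)))"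
    unfolding neighbours_PiE by (rule prod_sum_PiE[symmetric]) auto
  also have "\<dots> = (\<Prod>i\<in>(UNIV :: 3 set). 1)"
  proof (rule prod.cong[OF refl])
    fix i :: 3
    have t: "0 \<le> d i \<bullet> x" "d i \<bullet> x < 1" using x by (auto simp: cell_eq)
    then have "hat1 (d i \<bullet> x + 1) = 0" using hat1_support[of "d i \<bullet> x + 1"] by fastforce
    then show "(\<Sum>n\<in>{-1,0,1::int}. complex_of_real (hat1 (d i \<bullet> x + of_int n))) = 1"
      using hat1_partition[of "d i \<bullet> x"] t by (simp flip: of_real_add add: add.commute)
  qed
  finally show ?thesis by simp
qed

lemma has_derivative_shift:
  assumes "(f has_derivative f') (at (x + c))" shows "((\<lambda>y. f (y + c)) has_derivative f') (at (x :: r3))"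
proof -
  have "((\<lambda>y. y + c) has_derivative (\<lambda>h. h)) (at x)" by (auto intro!: derivative_eq_intros)
  from has_derivative_compose[OF this assms] show ?thesis .
qed

lemma sum_pd_chi: assumes x: "x \<in> core" shows "(\<Sum>k\<in>neighbours. pd j chi (x + lattice_vec k)) = 0"
proof -
  obtain f' where f': "\<And>y. (chi has_derivative f' y) (at y)"
    using chi_differentiable unfolding differentiable_def by metis
  have 1: "((\<lambda>y. \<Sum>k\<in>neighbours. chi (y + lattice_vec k)) has_derivative (\<lambda>h. \<Sum>k\<in>neighbours. f' (x + lattice_vec k) h)) (at x)"
    by (intro has_derivative_sum has_derivative_shift f')
  have "\<forall>\<^sub>F y in nhds x. y \<in> core" using open_core x by (rule eventually_nhds_in_open)
  then have ev: "\<forall>\<^sub>F y in nhds x. (\<Sum>k\<in>neighbours. chi (y + lattice_vec k)) = 1"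
    by (rule eventually_mono) (use chi_partition core_subset in blast)
  have "((\<lambda>y. 1::complex) has_derivative (\<lambda>h. \<Sum>k\<in>neighbours. f' (x + lattice_vec k) h)) (at x)"
    by (rule has_derivative_transform_eventually[OF 1]) (use ev in \<open>auto simp: eventually_nhds_conv_at\<close>)
  then have "(\<lambda>h. \<Sum>k\<in>neighbours. f' (x + lattice_vec k) h) = (\<lambda>h. 0)"
    using has_derivative_unique has_derivative_const by blast
  then have "(\<Sum>k\<in>neighbours. f' (x + lattice_vec k) (axis j 1)) = 0" by (rule fun_cong)
  moreover have "pd j chi (x + lattice_vec k) = f' (x + lattice_vec k) (axis j 1)" for k by (rule pd_eq[OF f'])
  ultimately show ?thesis by simp
qed

lemma set_integrable_continuous:
  fixes f :: "r3 \<Rightarrow> complex"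
  assumes "continuous_on UNIV f" shows "set_integrable lebesgue (cell a) f"
proof -
  have "compact (closure (cell a))" using bounded_cell by (simp add: compact_closure)
  then have "integrable lborel (\<lambda>x. indicat_real (closure (cell a)) x *\<^sub>R f x)"
    using continuous_on_subset[OF assms] by (intro borel_integrable_compact) auto
  then have "integrable lebesgue (\<lambda>x. indicat_real (closure (cell a)) x *\<^sub>R f x)"
    using integrable_completion borel_measurable_integrable by blast
  then have "set_integrable lebesgue (closure (cell a)) f" by (simp add: set_integrable_def)
  then show ?thesis by (rule set_integrable_subset[OF _ cell_lebesgue closure_subset])
qed

lemma set_integral_finite_sum:
  fixes f :: "'i \<Rightarrow> r3 \<Rightarrow> 'b::{banach, second_countable_topology}"
  assumes "\<And>i. i \<in> I \<Longrightarrow> set_integrable M A (f i)"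
  shows "(LINT x:A|M. (\<Sum>i\<in>I. f i x)) = (\<Sum>i\<in>I. LINT x:A|M. f i x)"
  using assms unfolding set_lebesgue_integral_def set_integrable_def scaleR_sum_right
  by (rule Bochner_Integration.integral_sum)

lemma unfold_wave:
  assumes psi: "continuous_on UNIV psi" "\<And>x. psi x \<noteq> 0 \<Longrightarrow> x \<in> slab"
  shows "(LINT x|lebesgue. wave m x * psi x) = (LINT x:cell a|lebesgue. wave m x * (\<Sum>k\<in>neighbours. psi (x + lattice_vec k)))"
proof -
  have c: "continuous_on UNIV (\<lambda>x. wave m x * psi x)" using continuous_wave psi by (intro continuous_intros)
  have i: "integrable lebesgue (\<lambda>x. wave m x * psi x)"
    by (rule integrable_compact_support[OF c compact_slab]) (use psi in auto)
  have c2: "continuous_on UNIV (\<lambda>x. wave m x * psi (x + lattice_vec k))" for k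
    by (intro continuous_intros continuous_wave continuous_on_compose2[OF psi(1)]) auto
  have "(LINT x|lebesgue. wave m x * psi x) = (\<Sum>k\<in>neighbours. LINT x:cell a|lebesgue. wave m (x + lattice_vec k) * psi (x + lattice_vec k))"
    by (rule unfold_integral[OF finite_neighbours _ i]) (use psi slab_cell_index in auto)
  also have "\<dots> = (LINT x:cell a|lebesgue. (\<Sum>k\<in>neighbours. wave m x * psi (x + lattice_vec k)))"
    unfolding wave_periodic
    by (rule set_integral_finite_sum[symmetric]) (use finite_neighbours set_integrable_continuous[OF c2] in auto)
  finally show ?thesis by (simp add: sum_distrib_left)
qed

lemma integral_wave_chi: "(LINT x|lebesgue. wave m x * chi x) = (LINT x:cell a|lebesgue. wave m x)"
proof -
  have "(LINT x|lebesgue. wave m x * chi x) = (LINT x:cell a|lebesgue. wave m x * (\<Sum>k\<in>neighbours. chi (x + lattice_vec k)))"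
    by (rule unfold_wave[OF Ck_continuous[OF Ck_chi[of 0]] chi_slab])
  also have "\<dots> = (LINT x:cell a|lebesgue. wave m x)"
    by (rule set_lebesgue_integral_cong) (auto simp: chi_partition)
  finally show ?thesis .
qed

text \<open>Integrate the derivative of \<open>wave m * chi\<close> over the whole space. The derivatives of the translates of
\<open>chi\<close> sum to zero, which leaves a multiple of \<open>dual_vec m $ j\<close> and the integral over the cell.\<close>

lemma integral_wave: "(LINT x:cell a|lebesgue. wave m x) = (if m = (\<lambda>i. 0) then of_real vol else 0)"
proof (cases "m = (\<lambda>i. 0)")
  case True
  then show ?thesis using cell_lmeasurable
    by (simp add: set_lebesgue_integral_def vol_def scaleR_conv_of_real fmeasurable_def)
next
  case False
  then have "dual_vec m \<noteq> 0" using dual_vec_inj[of m "\<lambda>i. 0"] by (simp add: dual_vec_def)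
  then obtain j where j: "dual_vec m $ j \<noteq> 0" by (auto simp: vec_eq_iff)
  have pdeq: "pd j (\<lambda>x. wave m x * chi x) = (\<lambda>x. wave m x * pd j chi x + \<i> * of_real (dual_vec m $ j) * (wave m x * chi x))"
    by (auto simp: pd_mult wave_differentiable chi_differentiable pd_wave)
  have cpd: "continuous_on UNIV (pd j chi)" using Ck_chi[of "Suc 0"] by simp
  have pslab: "x \<in> slab" if "pd j chi x \<noteq> 0" for x
  proof -
    have "x \<in> closure {x. chi x \<noteq> 0}" using pd_support[OF chi_differentiable that] .
    moreover have "closure {x. chi x \<noteq> 0} \<subseteq> slab"
      using chi_slab compact_slab by (intro closure_minimal) (auto simp: compact_imp_closed)
    ultimately show ?thesis by auto
  qed
  have c1: "continuous_on UNIV (\<lambda>x. wave m x * pd j chi x)" "continuous_on UNIV (\<lambda>x. wave m x * chi x)"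
    using continuous_wave cpd Ck_continuous[OF Ck_chi[of 0]] by (auto intro!: continuous_intros)
  have i1: "integrable lebesgue (\<lambda>x. wave m x * pd j chi x)" "integrable lebesgue (\<lambda>x. wave m x * chi x)"
    by (rule integrable_compact_support[OF c1(1) compact_slab], use pslab in force,
        rule integrable_compact_support[OF c1(2) compact_slab], use chi_slab in force)
  have "(LINT x|lebesgue. pd j (\<lambda>x. wave m x * chi x) x) = 0"
  proof (rule integral_pd_zero[OF _ _ compact_slab])
    show "(\<lambda>x. wave m x * chi x) differentiable at x" for x
      by (intro differentiable_mult wave_differentiable chi_differentiable)
    show "continuous_on UNIV (pd j (\<lambda>x. wave m x * chi x))"
      unfolding pdeq by (intro continuous_on_add continuous_on_mult_left c1)
  qed (use chi_slab in force)
  then have "(LINT x|lebesgue. wave m x * pd j chi x) + \<i> * of_real (dual_vec m $ j) * (LINT x|lebesgue. wave m x * chi x) = 0"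
    unfolding pdeq using i1 by simp
  moreover have "(LINT x|lebesgue. wave m x * pd j chi x) = 0"
  proof -
    have "(LINT x|lebesgue. wave m x * pd j chi x) = (LINT x:cell a|lebesgue. wave m x * (\<Sum>k\<in>neighbours. pd j chi (x + lattice_vec k)))"
      by (rule unfold_wave[OF cpd pslab])
    also have "\<dots> = 0" unfolding set_lebesgue_integral_def
    proof (rule integral_eq_zero_AE)
      show "AE x in lebesgue. indicat_real (cell a) x *\<^sub>R (wave m x * (\<Sum>k\<in>neighbours. pd j chi (x + lattice_vec k))) = 0"
        using AE_core by eventually_elim (auto simp: indicator_def sum_pd_chi)
    qed
    finally show ?thesis .
  qed
  ultimately show ?thesis using j False unfolding integral_wave_chi by simp
qed

lemma continuous_measurable_lebesgue:
  fixes f :: "r3 \<Rightarrow> 'b::topological_space"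
  shows "continuous_on UNIV f \<Longrightarrow> f \<in> borel_measurable lebesgue"
  by (rule measurable_completion) (simp add: borel_measurable_continuous_onI)

text \<open>The plane waves with constant polarisation along a coordinate axis, normalised on the cell.\<close>

definition E :: "(3 \<Rightarrow> int) \<times> 3 \<Rightarrow> field" where
  "E p = (\<lambda>x. axis (snd p) (wave (fst p) x / of_real (sqrt vol)))"

lemma measurable_wave: "wave m \<in> borel_measurable lebesgue"
  by (rule continuous_measurable_lebesgue[OF continuous_wave])

lemma norm_E: "(norm (E p x))\<^sup>2 = 1 / vol"
proof -
  have "(norm (E p x))\<^sup>2 = (\<Sum>i\<in>UNIV. if i = snd p then 1 / vol else 0)"
    unfolding norm_sq_vec using vol_pos
    by (intro sum.cong) (auto simp: E_def axis_def norm_divide power_divide)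
  then show ?thesis by simp
qed

lemma E_L2Q: "E p \<in> L2Q"
proof -
  have "continuous_on UNIV (E p)"
    unfolding E_def axis_def
  proof (rule continuous_on_vec_lambda)
    fix i
    show "continuous_on UNIV (\<lambda>x. if i = snd p then wave (fst p) x / of_real (sqrt vol) else 0)"
      using continuous_wave vol_pos by (cases "i = snd p") (auto intro!: continuous_intros)
  qed
  then have "E p \<in> borel_measurable lebesgue" by (rule continuous_measurable_lebesgue)
  moreover have "set_integrable lebesgue (cell a) (\<lambda>x. (norm (E p x))\<^sup>2)"
    unfolding norm_E set_integrable_def using cell_lmeasurable by (simp add: fmeasurable_def)
  ultimately show ?thesis by (simp add: L2Q_def)
qed

lemma hdot_E: "hdot z (E (m, i) x) = z $ i * cnj (wave m x) / of_real (sqrt vol)"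
  unfolding hdot_def E_def by (simp add: axis_def if_distrib cong: if_cong)

lemma coeff: "L2_inner a u (E (m, i)) = (LINT x:cell a|lebesgue. u x $ i * cnj (wave m x)) / of_real (sqrt vol)"
  unfolding L2_inner_def hdot_E by (rule set_integral_divide_zero)

lemma E_orthonormal: "L2_inner a (E p) (E q) = (if p = q then 1 else 0)"
proof -
  obtain m i l j where pq: "p = (m, i)" "q = (l, j)" by (metis surj_pair)
  show ?thesis
  proof (cases "i = j")
    case True
    have "L2_inner a (E p) (E q) = (LINT x:cell a|lebesgue. wave m x / of_real (sqrt vol) * cnj (wave l x)) / of_real (sqrt vol)"
      unfolding pq coeff using True by (simp add: E_def axis_def)
    also have "(LINT x:cell a|lebesgue. wave m x / of_real (sqrt vol) * cnj (wave l x))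
      = (LINT x:cell a|lebesgue. wave (\<lambda>i. m i + - l i) x / of_real (sqrt vol))"
      unfolding wave_add wave_minus by (simp add: mult.commute)
    also have "\<dots> = (if m = l then of_real vol else 0) / of_real (sqrt vol)"
      unfolding set_integral_divide_zero integral_wave by (auto simp: fun_eq_iff)
    finally show ?thesis using vol_pos True by (simp add: pq flip: of_real_mult)
  next
    case False
    then show ?thesis unfolding pq coeff by (simp add: E_def axis_def set_lebesgue_integral_def)
  qed
qed

end

section \<open>Completeness of the plane waves\<close>

context lattice_cell
begin

text \<open>The integrable functions whose Fourier coefficients all vanish; the aim is to show that they vanish
almost everywhere.\<close>

definition W :: "(r3 \<Rightarrow> complex) set" where
  "W = {w \<in> borel_measurable lebesgue. set_integrable lebesgue (cell a) w \<and>
      (\<forall>m. (LINT x:cell a|lebesgue. w x * wave m x) = 0)}"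

text \<open>The multipliers of \<open>W\<close> form an algebra that contains the plane waves, hence all trigonometric
polynomials.\<close>

definition stable :: "(r3 \<Rightarrow> complex) \<Rightarrow> bool" where
  "stable f \<longleftrightarrow> (\<forall>w\<in>W. (\<lambda>x. f x * w x) \<in> W)"

lemma integrable_bounded_mult:
  fixes w :: "r3 \<Rightarrow> complex"
  assumes w: "w \<in> borel_measurable lebesgue" "set_integrable lebesgue (cell a) w"
    and f: "f \<in> borel_measurable lebesgue" "\<And>x. cmod (f x) \<le> B"
  shows "set_integrable lebesgue (cell a) (\<lambda>x. f x * w x)"
proof (rule set_integrable_dominated[where g = "\<lambda>x. B * norm (w x)"])
  show "set_integrable lebesgue (cell a) (\<lambda>x. B * norm (w x))"
    using set_integrable_norm[OF w(2)] by simp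
  show "norm (f x * w x) \<le> B * norm (w x)" for x
    using f(2)[of x] by (simp add: norm_mult mult_right_mono)
qed (use w f in measurable)

lemma stable_wave: "stable (wave l)"
  unfolding stable_def
proof
  fix w assume w: "w \<in> W"
  then have m: "w \<in> borel_measurable lebesgue" "set_integrable lebesgue (cell a) w"
    and z: "\<And>m. (LINT x:cell a|lebesgue. w x * wave m x) = 0" by (auto simp: W_def)
  have "(LINT x:cell a|lebesgue. wave l x * w x * wave n x) = 0" for n
    using z[of "\<lambda>i. l i + n i"] unfolding wave_add by (simp add: algebra_simps)
  moreover have "set_integrable lebesgue (cell a) (\<lambda>x. wave l x * w x)"
    using integrable_bounded_mult[OF m measurable_wave, where B = 1] by simp
  moreover have "(\<lambda>x. wave l x * w x) \<in> borel_measurable lebesgue" using m measurable_wave by measurable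
  ultimately show "(\<lambda>x. wave l x * w x) \<in> W" by (simp add: W_def)
qed

lemma stable_mult: "stable f \<Longrightarrow> stable g \<Longrightarrow> stable (\<lambda>x. f x * g x)"
  unfolding stable_def by (simp add: mult.assoc)

lemma W_add: assumes "u \<in> W" "v \<in> W" shows "(\<lambda>x. u x + v x) \<in> W"
proof -
  have i: "set_integrable lebesgue (cell a) (\<lambda>x. u x * wave m x)" if "u \<in> W" for u m
    using integrable_bounded_mult[of u "wave m" 1] measurable_wave that by (simp add: W_def mult.commute)
  show ?thesis using assms
    by (auto simp: W_def distrib_right set_integral_add(1) set_integral_add(2)[OF i[OF assms(1)] i[OF assms(2)]])
qed

lemma stable_add: "stable f \<Longrightarrow> stable g \<Longrightarrow> stable (\<lambda>x. f x + g x)"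
  unfolding stable_def by (simp add: distrib_right W_add)

lemma stable_const: "stable (\<lambda>x. c)"
  unfolding stable_def by (auto simp: W_def mult.assoc)

lemma stable_sum: "(\<And>i. i \<in> I \<Longrightarrow> stable (f i)) \<Longrightarrow> stable (\<lambda>x. \<Sum>i\<in>I. f i x)"
  by (induction I rule: infinite_finite_induct) (auto intro: stable_const stable_add)

text \<open>The identification of the cell with a subset of a compact torus, where the theorem of Stone and
Weierstrass applies; the coordinates of this map are plane waves.\<close>

definition torus :: "r3 \<Rightarrow> complex^3" where "torus x = (\<chi> i. cis (2 * pi * (d i \<bullet> x)))"

lemma torus_wave: "torus x $ i = wave (\<lambda>j. if j = i then 1 else 0) x"
  unfolding torus_def wave_def dual_vec_def
  by (simp add: if_distrib[of of_int] if_distrib[of "\<lambda>c. c *\<^sub>R _"] cong: if_cong)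

lemma continuous_torus: "continuous_on UNIV torus"
proof -
  have "continuous_on UNIV (\<lambda>x. \<chi> i. wave (\<lambda>j. if j = i then 1 else 0) x)"
    by (intro continuous_on_vec_lambda continuous_wave)
  moreover have "torus = (\<lambda>x. \<chi> i. wave (\<lambda>j. if j = i then 1 else 0) x)"
    by (auto simp: vec_eq_iff torus_wave)
  ultimately show ?thesis by simp
qed

lemma torus_inj: "inj_on torus (cell a)"
proof
  fix x y assume x: "x \<in> cell a" and y: "y \<in> cell a" and eq: "torus x = torus y"
  have "d i \<bullet> x = d i \<bullet> y" for i
  proof -
    have "cis (2 * pi * (d i \<bullet> x)) = cis (2 * pi * (d i \<bullet> y))"
      using eq by (auto simp: torus_def vec_eq_iff)
    then have "sin (2 * pi * (d i \<bullet> x)) = sin (2 * pi * (d i \<bullet> y)) \<and> cos (2 * pi * (d i \<bullet> x)) = cos (2 * pi * (d i \<bullet> y))"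
      by (simp add: complex_eq_iff)
    then obtain n :: int where n: "2 * pi * (d i \<bullet> x) = 2 * pi * (d i \<bullet> y) + 2 * pi * of_int n"
      unfolding sin_cos_eq_iff by blast
    then have "2 * pi * (d i \<bullet> x) = 2 * pi * (d i \<bullet> y + of_int n)" by (simp add: algebra_simps)
    then have n: "d i \<bullet> x = d i \<bullet> y + of_int n" by simp
    moreover have "0 \<le> d i \<bullet> x" "d i \<bullet> x < 1" "0 \<le> d i \<bullet> y" "d i \<bullet> y < 1" using x y by (auto simp: cell_eq)
    ultimately have "of_int n < (1::real)" "of_int n > (-1::real)" by linarith+
    then have "n = 0" by linarith
    then show ?thesis using n by simp
  qed
  then show "x = y" using expand[of x] expand[of y] by simp
qed

lemma stable_polynomial:
  "real_polynomial_function p \<Longrightarrow> stable (\<lambda>x. of_real (p (torus x)))"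
proof (induction rule: real_polynomial_function.induct)
  case (linear f)
  interpret bounded_linear f by fact
  have fz: "f z = (\<Sum>i\<in>UNIV. Re (z $ i) * f (axis i 1) + Im (z $ i) * f (axis i \<i>))" for z :: "complex^3"
  proof -
    have "z = (\<Sum>i\<in>UNIV. Re (z $ i) *\<^sub>R axis i 1 + Im (z $ i) *\<^sub>R axis i \<i>)"
    proof (rule vec_eq_iff[THEN iffD2], rule allI)
      fix j
      have "(\<Sum>i\<in>UNIV. Re (z $ i) *\<^sub>R axis i 1 + Im (z $ i) *\<^sub>R axis i \<i>) $ j
        = (\<Sum>i\<in>UNIV. if i = j then of_real (Re (z $ j)) + of_real (Im (z $ j)) * \<i> else 0)"
        unfolding sum_component by (intro sum.cong) (auto simp: axis_def complex_eq_iff)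
      also have "\<dots> = z $ j" by (simp add: complex_eq_iff)
      finally show "z $ j = (\<Sum>i\<in>UNIV. Re (z $ i) *\<^sub>R axis i 1 + Im (z $ i) *\<^sub>R axis i \<i>) $ j" by simp
    qed
    then have "f z = f (\<Sum>i\<in>UNIV. Re (z $ i) *\<^sub>R axis i 1 + Im (z $ i) *\<^sub>R axis i \<i>)" by simp
    then show ?thesis by (simp add: sum add scaleR)
  qed
  have re: "of_real (Re w) = (1/2) * w + (1/2) * cnj w" and im: "of_real (Im w) = (-\<i>/2) * w + (\<i>/2) * cnj w" for w
    by (auto simp: complex_eq_iff)
  have "complex_of_real (f (torus x)) = (\<Sum>i\<in>UNIV.
      ((1/2) * torus x $ i + (1/2) * cnj (torus x $ i)) * of_real (f (axis i 1)) +
      ((-\<i>/2) * torus x $ i + (\<i>/2) * cnj (torus x $ i)) * of_real (f (axis i \<i>)))" for x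
    unfolding fz[of "torus x"] of_real_sum of_real_add of_real_mult re im ..
  then show ?case
    unfolding torus_wave wave_minus[symmetric]
    by (simp only:) (intro stable_sum stable_add stable_mult stable_const stable_wave)
next
  case (const c) then show ?case by (rule stable_const)
next
  case (add f g) then show ?case by (simp add: stable_add)
next
  case (mult f g) then show ?case by (simp add: stable_mult)
qed

lemma measurable_torus: "torus \<in> borel_measurable lebesgue"
  by (rule continuous_measurable_lebesgue[OF continuous_torus])

text \<open>Continuous functions on the torus are uniform limits of polynomials, which are \<open>stable\<close>.\<close>

lemma W_continuous:
  assumes w: "w \<in> W" and F: "continuous_on UNIV (F :: complex^3 \<Rightarrow> real)"
  shows "(LINT x:cell a|lebesgue. of_real (F (torus x)) * w x) = 0"
proof -
  have m: "w \<in> borel_measurable lebesgue" "set_integrable lebesgue (cell a) w" using w by (auto simp: W_def)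
  define T :: "(complex^3) set" where "T = {z. \<forall>i. cmod (z $ i) = 1}"
  have T: "compact T"
  proof -
    have "closed T"
    proof -
      have "T = (\<Inter>i. {z. cmod (z $ i) = 1})" unfolding T_def by auto
      then show ?thesis by (auto intro!: closed_INT closed_Collect_eq continuous_intros)
    qed
    moreover have "bounded T"
    proof (rule boundedI)
      fix z assume "z \<in> T"
      then have "(norm z)\<^sup>2 = 3" by (simp add: norm_sq_vec T_def)
      then have "(norm z)\<^sup>2 \<le> 2\<^sup>2" by simp
      then show "norm z \<le> 2" by (rule power2_le_imp_le) simp
    qed
    ultimately show ?thesis by (simp add: compact_eq_bounded_closed)
  qed
  have tT: "torus x \<in> T" for x by (simp add: T_def torus_wave)
  define I where "I = (LINT x:cell a|lebesgue. norm (w x))"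
  have I0: "I \<ge> 0" unfolding I_def set_lebesgue_integral_def by (rule integral_nonneg_AE) auto
  have bd: "cmod (LINT x:cell a|lebesgue. of_real (F (torus x)) * w x) \<le> e * I" if e: "e > 0" for e
  proof -
    obtain p where p: "real_polynomial_function p" "\<And>z. z \<in> T \<Longrightarrow> \<bar>F z - p z\<bar> < e"
      using Stone_Weierstrass_real_polynomial_function[OF T continuous_on_subset[OF F] e] by auto
    have Fm: "(\<lambda>x. F (torus x)) \<in> borel_measurable lebesgue"
      by (rule borel_measurable_continuous_on[OF F measurable_torus])
    have pc: "continuous_on UNIV p" using p(1) by (simp add: continuous_real_polymonial_function continuous_at_imp_continuous_on)
    have pm: "(\<lambda>x. p (torus x)) \<in> borel_measurable lebesgue"
      by (rule borel_measurable_continuous_on[OF pc measurable_torus])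
    have pW: "(\<lambda>x. of_real (p (torus x)) * w x) \<in> W" using stable_polynomial[OF p(1)] w by (simp add: stable_def)
    then have p0: "(LINT x:cell a|lebesgue. of_real (p (torus x)) * w x) = 0"
      unfolding W_def by (auto dest: spec[of _ "\<lambda>i. 0"])
    have pi: "set_integrable lebesgue (cell a) (\<lambda>x. of_real (p (torus x)) * w x)" using pW by (simp add: W_def)
    have di: "set_integrable lebesgue (cell a) (\<lambda>x. of_real (F (torus x) - p (torus x)) * w x)"
      using p(2)[OF tT] Fm pm by (intro integrable_bounded_mult[OF m, where B = e]) (auto simp: less_imp_le simp flip: of_real_diff)
    have "(LINT x:cell a|lebesgue. of_real (F (torus x)) * w x) =
      (LINT x:cell a|lebesgue. of_real (F (torus x) - p (torus x)) * w x + of_real (p (torus x)) * w x)"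
      by (simp add: algebra_simps)
    also have "\<dots> = (LINT x:cell a|lebesgue. of_real (F (torus x) - p (torus x)) * w x)"
      using set_integral_add(2)[OF di pi] p0 by simp
    finally have "cmod (LINT x:cell a|lebesgue. of_real (F (torus x)) * w x) =
      cmod (LINT x:cell a|lebesgue. of_real (F (torus x) - p (torus x)) * w x)" by simp
    also have "\<dots> \<le> (LINT x:cell a|lebesgue. norm (of_real (F (torus x) - p (torus x)) * w x))"
      by (rule set_integral_norm_bound[OF di])
    also have "\<dots> \<le> (LINT x:cell a|lebesgue. e * norm (w x))"
    proof (intro set_integral_mono set_integrable_norm[OF di] set_integrable_mult_right set_integrable_norm[OF m(2)])
      show "norm (of_real (F (torus x) - p (torus x)) * w x) \<le> e * norm (w x)" for x
        unfolding norm_mult norm_of_real using p(2)[OF tT[of x]] by (intro mult_right_mono) auto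
    qed
    also have "\<dots> = e * I" unfolding I_def by simp
    finally show ?thesis .
  qed
  have "cmod (LINT x:cell a|lebesgue. of_real (F (torus x)) * w x) \<le> 0 + e" if e: "e > 0" for e
  proof -
    have "e / (I + 1) * I \<le> e" using e I0 by (simp add: field_simps)
    moreover have "e / (I + 1) > 0" using e I0 by simp
    ultimately show ?thesis using bd[of "e / (I + 1)"] by linarith
  qed
  then have "cmod (LINT x:cell a|lebesgue. of_real (F (torus x)) * w x) \<le> 0" by (rule field_le_epsilon)
  then show ?thesis by simp
qed

text \<open>The indicator of a compact subset of the cell is a bounded pointwise limit of continuous functions
on the torus. The image of the subset is closed there, and on the cell \<open>torus\<close> is injective.\<close>

lemma W_compact:
  assumes w: "w \<in> W" and K: "compact K" "K \<subseteq> cell a"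
  shows "(LINT x|lebesgue. indicat_real K x *\<^sub>R w x) = 0"
proof (cases "K = {}")
  case False
  have m: "w \<in> borel_measurable lebesgue" "set_integrable lebesgue (cell a) w" using w by (auto simp: W_def)
  define C where "C = torus ` K"
  have C: "compact C" "C \<noteq> {}" unfolding C_def
    using False K(1) continuous_on_subset[OF continuous_torus] by (auto intro: compact_continuous_image)
  define F where "F n z = max 0 (1 - real n * infdist z C)" for n z
  have Fc: "continuous_on UNIV (F n)" for n unfolding F_def by (intro continuous_intros)
  have F1: "\<bar>F n z\<bar> \<le> 1" for n z unfolding F_def using infdist_nonneg[of z C] by (auto simp: abs_le_iff)
  have KC: "torus x \<in> C \<longleftrightarrow> x \<in> K" if "x \<in> cell a" for x
    unfolding C_def using inj_on_image_mem_iff[OF torus_inj that K(2)] .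
  have lim: "(\<lambda>n. indicat_real (cell a) x *\<^sub>R (of_real (F n (torus x)) * w x)) \<longlonglongrightarrow> indicat_real K x *\<^sub>R w x" for x
  proof (cases "x \<in> cell a")
    case True
    show ?thesis
    proof (cases "x \<in> K")
      case True
      then have "F n (torus x) = 1" for n using KC[of x] K(2) by (auto simp: F_def)
      then show ?thesis using True K(2) by (auto simp: indicator_def)
    next
      case False
      then have "torus x \<notin> C" using KC \<open>x \<in> cell a\<close> by simp
      then have pos: "infdist (torus x) C > 0"
        using C in_closed_iff_infdist_zero[of C "torus x"] infdist_nonneg[of "torus x" C] by (auto simp: compact_imp_closed order_less_le)
      obtain N :: nat where N: "real N * infdist (torus x) C > 1" using reals_Archimedean3[OF pos] by blast
      have "F n (torus x) = 0" if "n \<ge> N" for n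
      proof -
        have "real N * infdist (torus x) C \<le> real n * infdist (torus x) C" using that pos by (intro mult_right_mono) auto
        then show ?thesis using N by (simp add: F_def)
      qed
      then have "\<forall>\<^sub>F n in sequentially. indicat_real (cell a) x *\<^sub>R (of_real (F n (torus x)) * w x) = indicat_real K x *\<^sub>R w x"
        using False unfolding eventually_sequentially by (intro exI[of _ N]) (simp add: indicator_def)
      then show ?thesis by (rule tendsto_eventually)
    qed
  next
    case False
    then show ?thesis using K(2) by (auto simp: indicator_def)
  qed
  have Km: "K \<in> sets lebesgue" using K(1) by (simp add: borel_compact)
  have "(\<lambda>n. LINT x|lebesgue. indicat_real (cell a) x *\<^sub>R (of_real (F n (torus x)) * w x)) \<longlonglongrightarrow> (LINT x|lebesgue. indicat_real K x *\<^sub>R w x)"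
  proof (rule integral_dominated_convergence[where w = "\<lambda>x. indicat_real (cell a) x *\<^sub>R norm (w x)"])
    show "(\<lambda>x. indicat_real K x *\<^sub>R w x) \<in> borel_measurable lebesgue" using m Km by measurable
    have "(\<lambda>x. F n (torus x)) \<in> borel_measurable lebesgue" for n
      by (rule borel_measurable_continuous_on[OF Fc measurable_torus])
    then show "(\<lambda>x. indicat_real (cell a) x *\<^sub>R (of_real (F n (torus x)) * w x)) \<in> borel_measurable lebesgue" for n
      using m by measurable
    show "integrable lebesgue (\<lambda>x. indicat_real (cell a) x *\<^sub>R norm (w x))"
      using set_integrable_norm[OF m(2)] by (simp add: set_integrable_def)
    show "AE x in lebesgue. norm (indicat_real (cell a) x *\<^sub>R (of_real (F n (torus x)) * w x)) \<le> indicat_real (cell a) x *\<^sub>R norm (w x)" for n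
      using F1[of n] by (intro AE_I2) (auto simp: indicator_def norm_mult intro!: mult_left_le_one_le)
  qed (use lim in auto)
  moreover have "(LINT x|lebesgue. indicat_real (cell a) x *\<^sub>R (of_real (F n (torus x)) * w x)) = 0" for n
    using W_continuous[OF w Fc, of n] by (simp add: set_lebesgue_integral_def)
  ultimately show ?thesis by (simp add: LIMSEQ_const_iff)
qed simp

text \<open>If the set where \<open>h\<close> is positive had positive measure, inner regularity would provide a compact
subset of positive measure, over which the integral of \<open>h\<close> would be positive.\<close>

lemma positive_part_null:
  fixes h :: "r3 \<Rightarrow> real"
  assumes h: "h \<in> borel_measurable lebesgue" "set_integrable lebesgue (cell a) h"
    and K0: "\<And>K. compact K \<Longrightarrow> K \<subseteq> cell a \<Longrightarrow> (LINT x|lebesgue. indicat_real K x *\<^sub>R h x) = 0"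
  shows "AE x in lebesgue. x \<in> cell a \<longrightarrow> h x \<le> 0"
proof -
  define A where "A = {x \<in> cell a. h x > 0}"
  have Am: "A \<in> sets lebesgue"
  proof -
    have "A = cell a \<inter> (h -` {0<..} \<inter> space lebesgue)" by (auto simp: A_def)
    also have "\<dots> \<in> sets lebesgue" using measurable_sets[OF h(1), of "{0<..}"] cell_lebesgue by auto
    finally show ?thesis .
  qed
  have small: "emeasure lebesgue A \<le> 0 + ennreal e" if e: "e > 0" for e :: real
  proof -
    obtain T where T: "closed T" "T \<subseteq> A" "A - T \<in> lmeasurable" "emeasure lebesgue (A - T) < ennreal e"
      using sets_lebesgue_inner_closed[OF Am e] by blast
    have Tc: "T \<subseteq> cell a" using T(2) by (auto simp: A_def)
    have K: "compact T" using T(1) bounded_subset[OF bounded_cell Tc] by (simp add: compact_eq_bounded_closed)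
    have Tm: "T \<in> sets lebesgue" using K by (simp add: borel_compact)
    have ti: "integrable lebesgue (\<lambda>x. indicat_real T x *\<^sub>R h x)"
      using set_integrable_subset[OF h(2) Tm Tc] by (simp add: set_integrable_def)
    have nn: "AE x in lebesgue. 0 \<le> indicat_real T x *\<^sub>R h x"
      using T(2) by (intro AE_I2) (auto simp: indicator_def A_def)
    have "AE x in lebesgue. indicat_real T x *\<^sub>R h x = 0"
      using integral_nonneg_eq_0_iff_AE[OF ti nn] K0[OF K Tc] by simp
    then have "AE x in lebesgue. x \<notin> T" by eventually_elim (use T(2) in \<open>auto simp: A_def indicator_def\<close>)
    then have T0: "emeasure lebesgue T = 0"
      using Tm AE_iff_null_sets[of T lebesgue] by (auto simp: null_sets_def)
    have "emeasure lebesgue A \<le> emeasure lebesgue (T \<union> (A - T))" using T Am Tm by (intro emeasure_mono) auto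
    also have "\<dots> \<le> emeasure lebesgue T + emeasure lebesgue (A - T)" using Am Tm by (intro emeasure_subadditive) auto
    finally show ?thesis using T(4) T0 by (simp add: less_imp_le)
  qed
  have "emeasure lebesgue A \<le> 0" by (rule ennreal_le_epsilon) (rule small)
  then have "A \<in> null_sets lebesgue" using Am by auto
  then show ?thesis by (rule AE_I') (auto simp: A_def)
qed

text \<open>Apply \<open>positive_part_null\<close> to the real and imaginary parts and their negatives.\<close>

lemma W_null: assumes w: "w \<in> W" shows "AE x in lebesgue. x \<in> cell a \<longrightarrow> w x = 0"
proof -
  have m: "w \<in> borel_measurable lebesgue" "set_integrable lebesgue (cell a) w" using w by (auto simp: W_def)
  have *: "AE x in lebesgue. x \<in> cell a \<longrightarrow> L (w x) \<le> 0" if L: "bounded_linear (L :: complex \<Rightarrow> real)" for L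
  proof (rule positive_part_null)
    show "(\<lambda>x. L (w x)) \<in> borel_measurable lebesgue"
      using borel_measurable_continuous_on[OF linear_continuous_on[OF L] m(1)] .
    show "set_integrable lebesgue (cell a) (\<lambda>x. L (w x))"
      using integrable_bounded_linear[OF L m(2)[unfolded set_integrable_def]]
      by (simp add: set_integrable_def linear_cmul[OF bounded_linear.linear[OF L]])
    fix K assume K: "compact K" "K \<subseteq> cell a"
    have Km: "K \<in> sets lebesgue" using K(1) by (simp add: borel_compact)
    have "integrable lebesgue (\<lambda>x. indicat_real K x *\<^sub>R w x)"
      using set_integrable_subset[OF m(2) Km K(2)] by (simp add: set_integrable_def)
    from integral_bounded_linear[OF L this]
    show "(LINT x|lebesgue. indicat_real K x *\<^sub>R L (w x)) = 0"
      using W_compact[OF w K] linear_0[OF bounded_linear.linear[OF L]]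
      by (simp add: linear_cmul[OF bounded_linear.linear[OF L]])
  qed
  have "AE x in lebesgue. x \<in> cell a \<longrightarrow> Re (w x) \<le> 0" by (rule *[OF bounded_linear_Re])
  moreover have "AE x in lebesgue. x \<in> cell a \<longrightarrow> Im (w x) \<le> 0" by (rule *[OF bounded_linear_Im])
  moreover have "AE x in lebesgue. x \<in> cell a \<longrightarrow> - Re (w x) \<le> 0" by (rule *[OF bounded_linear_minus[OF bounded_linear_Re]])
  moreover have "AE x in lebesgue. x \<in> cell a \<longrightarrow> - Im (w x) \<le> 0" by (rule *[OF bounded_linear_minus[OF bounded_linear_Im]])
  ultimately show ?thesis by eventually_elim (auto simp: complex_eq_iff)
qed

lemma component_integrable: assumes "u \<in> L2Q" shows "set_integrable lebesgue (cell a) (\<lambda>x. u x $ i)"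
proof (rule set_integrable_dominated[where g = "\<lambda>x. 1 + (norm (u x))\<^sup>2"])
  have "set_integrable lebesgue (cell a) (\<lambda>x. 1::real)"
    using cell_lmeasurable by (simp add: set_integrable_def fmeasurable_def)
  then show "set_integrable lebesgue (cell a) (\<lambda>x. 1 + (norm (u x))\<^sup>2)"
    using assms by (intro set_integral_add) (auto simp: L2Q_def)
  show "cmod (u x $ i) \<le> 1 + (norm (u x))\<^sup>2" for x
  proof -
    have "cmod (u x $ i) \<le> norm (u x)" by (rule Finite_Cartesian_Product.norm_nth_le)
    moreover have "2 * norm (u x) \<le> 1 + (norm (u x))\<^sup>2" using sum_squares_bound[of 1 "norm (u x)"] by simp
    moreover have "0 \<le> norm (u x)" by simp
    ultimately show ?thesis by linarith
  qed
qed (use assms in \<open>auto intro: borel_measurable_component dest: L2Q_D\<close>)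

lemma E_total:
  assumes u: "u \<in> L2Q" and z: "\<And>p. L2_inner a u (E p) = 0"
  shows "Q.nrm u = 0"
proof -
  have "AE x in lebesgue. x \<in> cell a \<longrightarrow> u x $ i = 0" for i
  proof (rule W_null)
    have "(LINT x:cell a|lebesgue. u x $ i * wave m x) = 0" for m
    proof -
      have "(LINT x:cell a|lebesgue. u x $ i * cnj (wave (\<lambda>j. - m j) x)) = 0"
        using z[of "(\<lambda>j. - m j, i)"] vol_pos unfolding coeff by simp
      then show ?thesis by (simp add: wave_minus[symmetric])
    qed
    then show "(\<lambda>x. u x $ i) \<in> W"
      using component_integrable[OF u] borel_measurable_component[OF L2Q_D(1)[OF u]] by (simp add: W_def)
  qed
  then have "AE x in lebesgue. \<forall>i. x \<in> cell a \<longrightarrow> u x $ i = 0" by (subst AE_all_countable) blast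
  then have "AE x in lebesgue. x \<in> cell a \<longrightarrow> u x = 0" by eventually_elim (auto simp: vec_eq_iff)
  then show ?thesis using Qnull[OF u] by simp
qed

sublocale Q: orthonormal_basis cscale L2Q "L2_inner a" E
  by standard (auto simp: E_L2Q E_orthonormal intro: E_total)

end

section \<open>Distributions and Fourier coefficients\<close>

lemma test_function_Ck: "\<phi> \<in> test_functions \<Longrightarrow> Ck k \<phi>"
  by (simp add: test_functions_def)

lemma test_functionsI:
  assumes "\<And>k. Ck k \<phi>" "compact K" "\<And>x. \<phi> x \<noteq> 0 \<Longrightarrow> x \<in> K"
  shows "\<phi> \<in> test_functions"
proof -
  have "bounded {x. \<phi> x \<noteq> 0}"
    by (rule bounded_subset[OF compact_imp_bounded[OF assms(2)]]) (use assms(3) in auto)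
  then have "compact (closure {x. \<phi> x \<noteq> 0})" by (simp only: compact_closure)
  then show ?thesis using assms(1) by (simp add: test_functions_def)
qed

lemma test_function_props:
  assumes "\<phi> \<in> test_functions"
  shows "continuous_on UNIV \<phi>" "\<And>x. \<phi> differentiable (at x)" "pd j \<phi> \<in> test_functions"
    "compact (closure {x. \<phi> x \<noteq> 0})" "\<And>x. \<phi> x \<noteq> 0 \<Longrightarrow> x \<in> closure {x. \<phi> x \<noteq> 0}"
proof -
  show "continuous_on UNIV \<phi>" using Ck_continuous[OF test_function_Ck[OF assms, of 0]] .
  show d: "\<phi> differentiable (at x)" for x using test_function_Ck[OF assms, of 1] by simp
  show c: "compact (closure {x. \<phi> x \<noteq> 0})" using assms by (simp add: test_functions_def)
  show "x \<in> closure {x. \<phi> x \<noteq> 0}" if "\<phi> x \<noteq> 0" for x by (rule subsetD[OF closure_subset]) (simp add: that)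
  show "pd j \<phi> \<in> test_functions"
  proof (rule test_functionsI[OF _ c])
    show "Ck k (pd j \<phi>)" for k using test_function_Ck[OF assms, of "Suc k"] by simp
  qed (rule pd_support[OF d])
qed

lemma L2_loc_integrable:
  assumes w: "w \<in> L2_loc" and p: "continuous_on UNIV \<phi>" "compact K" "\<And>x. \<phi> x \<noteq> 0 \<Longrightarrow> x \<in> K"
  shows "integrable lebesgue (\<lambda>x. w x $ i * \<phi> x)"
proof -
  obtain B where B: "B \<ge> 0" "\<And>x. cmod (\<phi> x) \<le> B" using bounded_compact_support[OF p] by blast
  have wm: "w \<in> borel_measurable lebesgue" using w by (simp add: L2_loc_def)
  have pm: "\<phi> \<in> borel_measurable lebesgue"
    by (rule measurable_completion) (simp add: borel_measurable_continuous_onI p)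
  have "set_integrable lebesgue K (\<lambda>x. (norm (w x))\<^sup>2)" using w p(2) by (simp add: L2_loc_def)
  moreover have "set_integrable lebesgue K (\<lambda>x. 1::real)"
    using lmeasurable_compact[OF p(2)]
    by (auto simp: set_integrable_def fmeasurable_def intro!: integrable_real_indicator)
  ultimately have "set_integrable lebesgue K (\<lambda>x. B * (1 + (norm (w x))\<^sup>2))"
    by (intro set_integrable_mult_right set_integral_add)
  then show ?thesis unfolding set_integrable_def
  proof (rule Bochner_Integration.integrable_bound)
    show "(\<lambda>x. w x $ i * \<phi> x) \<in> borel_measurable lebesgue"
      using borel_measurable_component[OF wm] pm by measurable
    show "AE x in lebesgue. norm (w x $ i * \<phi> x) \<le> norm (indicat_real K x *\<^sub>R (B * (1 + (norm (w x))\<^sup>2)))"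
    proof (intro AE_I2)
      fix x
      have "cmod (w x $ i) \<le> norm (w x)" by (rule Finite_Cartesian_Product.norm_nth_le)
      moreover have "2 * norm (w x) \<le> 1 + (norm (w x))\<^sup>2" using sum_squares_bound[of 1 "norm (w x)"] by simp
      moreover have "0 \<le> norm (w x)" by simp
      ultimately have 1: "cmod (w x $ i) \<le> 1 + (norm (w x))\<^sup>2" by linarith
      have "norm (w x $ i * \<phi> x) \<le> (1 + (norm (w x))\<^sup>2) * B"
        unfolding norm_mult using 1 B by (intro mult_mono) auto
      then show "norm (w x $ i * \<phi> x) \<le> norm (indicat_real K x *\<^sub>R (B * (1 + (norm (w x))\<^sup>2)))"
        using p(3)[of x] B(1) by (cases "x \<in> K") (auto simp: mult.commute abs_mult)
    qed
  qed
qed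

context lattice_cell
begin

text \<open>A smooth function that is nonzero exactly in the interior of the cell. Its products with plane waves
are test functions, by which the completeness of the plane waves yields the fundamental lemma of the
calculus of variations.\<close>

definition core_bump :: "r3 \<Rightarrow> complex" where "core_bump x = (\<Prod>i\<in>UNIV. of_real (bump1 (d i \<bullet> x)))"

lemma core_bump_core: "core_bump x \<noteq> 0 \<longleftrightarrow> x \<in> core"
  unfolding core_bump_def core_def by (simp add: prod_zero_iff bump1_pos)

lemma Ck_core_bump_shift: "Ck k (\<lambda>x. core_bump (x - lattice_vec l))"
proof -
  have "Ck k (\<lambda>x. complex_of_real (bump1 (1 * (d i \<bullet> x) + - of_int (l i))))" for i
    by (rule Ck_ridge[OF smooth1_of_real[OF smooth1_affine[OF smooth1_bump1]]])
  then show ?thesis unfolding core_bump_def by (intro Ck_prod) (simp add: inner_diff_right)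
qed

text \<open>Multiply the difference by a translate of \<open>core_bump\<close>. Since test functions annihilate it, all
Fourier coefficients of this product on the cell vanish, hence so does the product, and
\<open>core_bump\<close> is nonzero almost everywhere on the cell. This makes the choice of representatives in \<^const>\<open>weak_pd\<close> and \<^const>\<open>wcurl\<close> immaterial.\<close>

lemma distributions_determine:
  assumes u: "u \<in> L2_loc" "v \<in> L2_loc" and eq: "\<And>i. reg u i \<simeq> reg v i"
  shows "AE x in lebesgue. u x = v x"
proof -
  have key: "AE x in lebesgue. x \<in> cell a \<longrightarrow> u (x + lattice_vec k) $ i = v (x + lattice_vec k) $ i" for k i
  proof -
    define K where "K = closure (cell a)"
    have K: "compact ((\<lambda>x. x + lattice_vec k) ` K)" unfolding K_def using bounded_cell
      by (intro compact_continuous_image continuous_intros) (simp add: compact_closure)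
    have supp: "x \<in> (\<lambda>x. x + lattice_vec k) ` K" if "core_bump (x - lattice_vec k) * wave m x \<noteq> 0" for x m
    proof -
      have "x - lattice_vec k \<in> core" using that core_bump_core by auto
      then have "x - lattice_vec k \<in> K" unfolding K_def using core_subset closure_subset by blast
      then show ?thesis by (rule image_eqI[rotated]) simp
    qed
    have T: "(\<lambda>x. core_bump (x - lattice_vec k) * wave m x) \<in> test_functions" for m
      by (rule test_functionsI[OF Ck_mult[OF Ck_core_bump_shift Ck_wave] K supp])
    define D where "D x = u (x + lattice_vec k) $ i - v (x + lattice_vec k) $ i" for x
    have int: "integrable lebesgue (\<lambda>x. w x $ i * (core_bump (x - lattice_vec k) * wave m x))" if "w \<in> L2_loc" for w m
      using L2_loc_integrable[OF that test_function_props(1)[OF T] K supp] .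
    have int': "integrable lebesgue (\<lambda>x. w (x + lattice_vec k) $ i * (core_bump x * wave m x))"
       "(LINT x|lebesgue. w (x + lattice_vec k) $ i * (core_bump x * wave m x)) = reg w i (\<lambda>x. core_bump (x - lattice_vec k) * wave m x)"
      if "w \<in> L2_loc" for w m
    proof -
      show "integrable lebesgue (\<lambda>x. w (x + lattice_vec k) $ i * (core_bump x * wave m x))"
        using integrable_translate[OF int[OF that, of m], of "lattice_vec k"] by (simp add: wave_periodic)
      show "(LINT x|lebesgue. w (x + lattice_vec k) $ i * (core_bump x * wave m x)) = reg w i (\<lambda>x. core_bump (x - lattice_vec k) * wave m x)"
        unfolding reg_def using integral_translate[OF borel_measurable_integrable[OF int[OF that, of m]], of "lattice_vec k"]
        by (simp add: wave_periodic)
    qed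
    have Di: "integrable lebesgue (\<lambda>x. D x * core_bump x * wave m x)" for m
      using Bochner_Integration.integrable_diff[OF int'(1)[OF u(1), of m] int'(1)[OF u(2), of m]]
      unfolding D_def by (simp add: algebra_simps)
    have D0: "(LINT x|lebesgue. D x * core_bump x * wave m x) = 0" for m
    proof -
      have "(LINT x|lebesgue. D x * core_bump x * wave m x) =
        (LINT x|lebesgue. u (x + lattice_vec k) $ i * (core_bump x * wave m x) - v (x + lattice_vec k) $ i * (core_bump x * wave m x))"
        unfolding D_def by (simp add: algebra_simps)
      also have "\<dots> = reg u i (\<lambda>x. core_bump (x - lattice_vec k) * wave m x) - reg v i (\<lambda>x. core_bump (x - lattice_vec k) * wave m x)"
        using int'[OF u(1)] int'[OF u(2)] by simp
      also have "\<dots> = 0" using eq[of i] T unfolding distrib_eq_def by simp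
      finally show ?thesis .
    qed
    have cellind: "indicat_real (cell a) x *\<^sub>R (D x * core_bump x * wave m x) = D x * core_bump x * wave m x" for x m
      using core_bump_core[of x] core_subset by (auto simp: indicator_def)
    have "(\<lambda>x. D x * core_bump x) \<in> W"
    proof -
      have i0: "integrable lebesgue (\<lambda>x. D x * core_bump x)" using Di[of "\<lambda>i. 0"] by simp
      have "set_integrable lebesgue (cell a) (\<lambda>x. D x * core_bump x)"
        unfolding set_integrable_def using cellind[of _ "\<lambda>i. 0"] i0 by simp
      moreover have "(LINT x:cell a|lebesgue. D x * core_bump x * wave m x) = 0" for m
        unfolding set_lebesgue_integral_def cellind by (rule D0)
      ultimately show ?thesis using borel_measurable_integrable[OF i0] by (simp add: W_def)
    qed
    from W_null[OF this] AE_core show ?thesis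
      by eventually_elim (use core_bump_core in \<open>auto simp: D_def\<close>)
  qed
  have "AE x in lebesgue. cell_index x = k \<longrightarrow> u x = v x" for k
  proof -
    have "AE x in lebesgue. \<forall>i. x \<in> cell a \<longrightarrow> u (x + lattice_vec k) $ i = v (x + lattice_vec k) $ i"
      using key by (subst AE_all_countable) blast
    from AE_translate[OF this, of "- lattice_vec k"] show ?thesis
      by eventually_elim (use diff_lattice_vec_cell[of _ k] in \<open>auto simp: vec_eq_iff\<close>)
  qed
  then have "AE x in lebesgue. \<forall>k. cell_index x = k \<longrightarrow> u x = v x" by (subst AE_all_countable) blast
  then show ?thesis by eventually_elim auto
qed

definition fcoeff :: "field \<Rightarrow> (3 \<Rightarrow> int) \<Rightarrow> 3 \<Rightarrow> complex" where "fcoeff u m i = L2_inner a u (E (m, i))"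

text \<open>The Fourier transform of a test function at a point of the reciprocal lattice; equivalently, a
Fourier coefficient of its periodisation.\<close>

definition test_coeff :: "(r3 \<Rightarrow> complex) \<Rightarrow> (3 \<Rightarrow> int) \<Rightarrow> complex" where
  "test_coeff \<phi> m = (LINT x|lebesgue. \<phi> x * wave m x) / of_real (sqrt vol)"

text \<open>The distribution with Fourier coefficients \<open>c\<close>: its value at a test function is given by Parseval's
identity.\<close>

definition fourier_rep :: "distrib \<Rightarrow> ((3 \<Rightarrow> int) \<Rightarrow> complex) \<Rightarrow> bool" where
  "fourier_rep T c \<longleftrightarrow> (\<forall>\<phi>\<in>test_functions. ((\<lambda>m. c m * test_coeff \<phi> m) has_sum T \<phi>) UNIV)"

lemma per_shift: assumes "v \<in> L2_per a" shows "AE x in lebesgue. v (x + lattice_vec k) = v x"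
  using assms by (auto simp: L2_per_def lattice_eq)

text \<open>Unfolding the integral over the whole space moves all translates of the test function to the cell.
Their sum \<open>\<Phi>\<close> is the periodisation, and Parseval's identity applies to the pairing of \<open>v\<close> with it.\<close>

lemma fourier_rep_reg:
  assumes v: "v \<in> L2_per a" shows "fourier_rep (reg v i) (\<lambda>m. fcoeff v m i)"
  unfolding fourier_rep_def
proof
  fix \<phi> assume "\<phi> \<in> test_functions"
  note t = test_function_props[OF this]
  define K where "K = closure {x. \<phi> x \<noteq> 0}"
  define S where "S = cell_index ` K"
  have K: "compact K" "\<And>x. \<phi> x \<noteq> 0 \<Longrightarrow> x \<in> K" using t(4,5) by (auto simp: K_def)
  have S: "finite S" unfolding S_def using finite_cell_index compact_imp_bounded K by blast
  have vQ: "v \<in> L2Q" using v L2_per_L2Q by blast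
  have vm: "v \<in> borel_measurable lebesgue" using vQ by (rule L2Q_D)
  have vloc: "v \<in> L2_loc" using v by (simp add: L2_per_def)
  define \<Phi> where "\<Phi> x = (\<Sum>k\<in>S. \<phi> (x + lattice_vec k))" for x
  have cs: "continuous_on UNIV (\<lambda>x. \<phi> (x + lattice_vec k))" for k
    by (intro continuous_on_compose2[OF t(1)] continuous_intros) auto
  have \<Phi>c: "continuous_on UNIV \<Phi>" unfolding \<Phi>_def using cs by (intro continuous_on_sum)
  have bs: "\<exists>B. \<forall>x. cmod (\<phi> x) \<le> B" using bounded_compact_support[OF t(1) K] by metis
  then obtain B where B: "\<And>x. cmod (\<phi> x) \<le> B" by blast
  have msh: "(\<lambda>x. \<phi> (x + lattice_vec k)) \<in> borel_measurable lebesgue" for k by (rule continuous_measurable_lebesgue[OF cs])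
  have vi: "set_integrable lebesgue (cell a) (\<lambda>x. v x $ i * \<phi> (x + lattice_vec k))" for k
    using integrable_bounded_mult[OF borel_measurable_component[OF vm, of i] component_integrable[OF vQ, of i] msh B]
    by (simp add: mult.commute)
  have "reg v i \<phi> = (\<Sum>k\<in>S. LINT x:cell a|lebesgue. v (x + lattice_vec k) $ i * \<phi> (x + lattice_vec k))"
    unfolding reg_def
    by (rule unfold_integral[OF S _ L2_loc_integrable[OF vloc t(1) K]]) (use K in \<open>auto simp: S_def\<close>)
  also have "\<dots> = (\<Sum>k\<in>S. LINT x:cell a|lebesgue. v x $ i * \<phi> (x + lattice_vec k))"
  proof (rule sum.cong[OF refl])
    fix k
    have "(\<lambda>x. v (x + lattice_vec k)) \<in> borel_measurable lebesgue"
      by (rule measurable_compose[OF translate_measurable vm])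
    then show "(LINT x:cell a|lebesgue. v (x + lattice_vec k) $ i * \<phi> (x + lattice_vec k)) = (LINT x:cell a|lebesgue. v x $ i * \<phi> (x + lattice_vec k))"
      unfolding set_lebesgue_integral_def using per_shift[OF v, of k] vm msh[of k]
      by (intro integral_cong_AE borel_measurable_scaleR borel_measurable_times borel_measurable_component)
         (auto elim!: eventually_mono)
  qed
  also have "\<dots> = (LINT x:cell a|lebesgue. v x $ i * \<Phi> x)"
    unfolding \<Phi>_def sum_distrib_left by (rule set_integral_finite_sum[symmetric]) (rule vi)
  finally have r: "reg v i \<phi> = (LINT x:cell a|lebesgue. v x $ i * \<Phi> x)" .
  define \<Psi> :: field where "\<Psi> x = axis i (cnj (\<Phi> x))" for x
  have \<Psi>c: "continuous_on UNIV \<Psi>" unfolding \<Psi>_def axis_def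
  proof (rule continuous_on_vec_lambda)
    show "continuous_on UNIV (\<lambda>x. if j = i then cnj (\<Phi> x) else 0)" for j
      using \<Phi>c by (cases "j = i") (auto intro!: continuous_intros)
  qed
  have n\<Psi>: "(norm (\<Psi> x))\<^sup>2 \<le> (real (card S) * B)\<^sup>2" for x
  proof -
    have "cmod (\<Phi> x) \<le> (\<Sum>k\<in>S. B)" unfolding \<Phi>_def by (rule order_trans[OF norm_sum]) (intro sum_mono B)
    then have "(cmod (\<Phi> x))\<^sup>2 \<le> (real (card S) * B)\<^sup>2" by (intro power_mono) auto
    moreover have "(norm (\<Psi> x))\<^sup>2 = (\<Sum>j\<in>UNIV. if j = i then (cmod (\<Phi> x))\<^sup>2 else 0)"
      unfolding norm_sq_vec \<Psi>_def by (intro sum.cong) (auto simp: axis_def)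
    ultimately show ?thesis by simp
  qed
  have \<Psi>m: "\<Psi> \<in> borel_measurable lebesgue" by (rule continuous_measurable_lebesgue[OF \<Psi>c])
  have \<Psi>Q: "\<Psi> \<in> L2Q"
  proof -
    have "set_integrable lebesgue (cell a) (\<lambda>x. (real (card S) * B)\<^sup>2)"
      using cell_lmeasurable by (simp add: set_integrable_def fmeasurable_def)
    then have "set_integrable lebesgue (cell a) (\<lambda>x. (norm (\<Psi> x))\<^sup>2)"
      by (rule set_integrable_dominated) (use \<Psi>m n\<Psi> in auto)
    then show ?thesis using \<Psi>m by (simp add: L2Q_def)
  qed
  have hd: "hdot z (\<Psi> x) = z $ i * \<Phi> x" for z x
    unfolding hdot_def \<Psi>_def by (simp add: axis_def if_distrib cong: if_cong)
  have "L2_inner a v \<Psi> = reg v i \<phi>" unfolding r L2_inner_def hd ..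
  then have P: "((\<lambda>p. L2_inner a v (E p) * cnj (L2_inner a \<Psi> (E p))) has_sum reg v i \<phi>) UNIV"
    using Q.parseval[OF vQ \<Psi>Q] by simp
  have c0: "L2_inner a \<Psi> (E (m, j)) = 0" if "j \<noteq> i" for m j
    unfolding coeff using that by (simp add: \<Psi>_def axis_def set_lebesgue_integral_def)
  have c1: "cnj (L2_inner a \<Psi> (E (m, i))) = test_coeff \<phi> m" for m
  proof -
    have wc: "continuous_on UNIV (\<lambda>x. \<phi> x * wave m x)" using t(1) continuous_wave by (intro continuous_intros)
    have "(LINT x|lebesgue. \<phi> x * wave m x) = (\<Sum>k\<in>S. LINT x:cell a|lebesgue. \<phi> (x + lattice_vec k) * wave m (x + lattice_vec k))"
      by (rule unfold_integral[OF S]) (use K integrable_compact_support[OF wc K(1)] in \<open>auto simp: S_def\<close>)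
    also have "\<dots> = (LINT x:cell a|lebesgue. (\<Sum>k\<in>S. \<phi> (x + lattice_vec k) * wave m x))"
      unfolding wave_periodic
      by (rule set_integral_finite_sum[symmetric]) (intro set_integrable_continuous continuous_intros cs continuous_wave)
    finally have 1: "(LINT x|lebesgue. \<phi> x * wave m x) = (LINT x:cell a|lebesgue. \<Phi> x * wave m x)"
      by (simp add: \<Phi>_def sum_distrib_right)
    have "(LINT x:cell a|lebesgue. \<Psi> x $ i * cnj (wave m x)) = (LINT x:cell a|lebesgue. cnj (\<Phi> x * wave m x))"
      by (simp add: \<Psi>_def axis_def)
    also have "\<dots> = cnj (LINT x:cell a|lebesgue. \<Phi> x * wave m x)"
    proof -
      have "(\<lambda>x. indicat_real (cell a) x *\<^sub>R cnj (\<Phi> x * wave m x)) = (\<lambda>x. cnj (indicat_real (cell a) x *\<^sub>R (\<Phi> x * wave m x)))"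
        by auto
      then show ?thesis unfolding set_lebesgue_integral_def by (simp only: Bochner_Integration.integral_cnj)
    qed
    finally show ?thesis unfolding coeff test_coeff_def 1 by simp
  qed
  have "((\<lambda>p. L2_inner a v (E p) * cnj (L2_inner a \<Psi> (E p))) has_sum reg v i \<phi>) ((\<lambda>m. (m, i)) ` UNIV)"
    by (rule has_sum_cong_neutral[THEN iffD1, OF _ _ _ P]) (use c0 in auto)
  then have "((\<lambda>p. L2_inner a v (E p) * cnj (L2_inner a \<Psi> (E p))) \<circ> (\<lambda>m. (m, i)) has_sum reg v i \<phi>) UNIV"
    by (subst (asm) has_sum_reindex) (auto intro: inj_onI)
  then show "((\<lambda>m. fcoeff v m i * test_coeff \<phi> m) has_sum reg v i \<phi>) UNIV"
    by (simp add: o_def fcoeff_def c1)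
qed

lemma test_coeff_pd: assumes "\<phi> \<in> test_functions" shows "test_coeff (pd j \<phi>) m = - \<i> * of_real (dual_vec m $ j) * test_coeff \<phi> m"
proof -
  note t = test_function_props[OF assms]
  note t' = test_function_props[OF t(3)[of j]]
  define K where "K = closure {x. \<phi> x \<noteq> 0}"
  have K: "compact K" "\<And>x. \<phi> x \<noteq> 0 \<Longrightarrow> x \<in> K" "\<And>x. pd j \<phi> x \<noteq> 0 \<Longrightarrow> x \<in> K"
    using t(4,5) pd_support[OF t(2)] by (auto simp: K_def)
  have c: "continuous_on UNIV (\<lambda>x. \<phi> x * wave m x)" "continuous_on UNIV (\<lambda>x. pd j \<phi> x * wave m x)"
    using t(1) t'(1) continuous_wave by (auto intro!: continuous_intros)
  have i: "integrable lebesgue (\<lambda>x. \<phi> x * wave m x)" "integrable lebesgue (\<lambda>x. pd j \<phi> x * wave m x)"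
    by (rule integrable_compact_support[OF c(1) K(1)], use K in force, rule integrable_compact_support[OF c(2) K(1)], use K in force)
  have eq: "pd j (\<lambda>x. \<phi> x * wave m x) = (\<lambda>x. \<i> * of_real (dual_vec m $ j) * (\<phi> x * wave m x) + pd j \<phi> x * wave m x)"
    by (auto simp: pd_mult t(2) wave_differentiable pd_wave)
  have "(LINT x|lebesgue. pd j (\<lambda>x. \<phi> x * wave m x) x) = 0"
  proof (rule integral_pd_zero[OF _ _ K(1)])
    show "(\<lambda>x. \<phi> x * wave m x) differentiable at x" for x by (intro differentiable_mult t wave_differentiable)
    show "continuous_on UNIV (pd j (\<lambda>x. \<phi> x * wave m x))"
      unfolding eq by (intro continuous_on_add continuous_on_mult_left c)
  qed (use K in force)
  then have "\<i> * of_real (dual_vec m $ j) * (LINT x|lebesgue. \<phi> x * wave m x) + (LINT x|lebesgue. pd j \<phi> x * wave m x) = 0"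
    unfolding eq using i by simp
  then have "(LINT x|lebesgue. pd j \<phi> x * wave m x) = - \<i> * of_real (dual_vec m $ j) * (LINT x|lebesgue. \<phi> x * wave m x)"
    by (simp add: eq_neg_iff_add_eq_0 add.commute)
  then show ?thesis unfolding test_coeff_def by simp
qed

definition wavevec :: "r3 \<Rightarrow> (3 \<Rightarrow> int) \<Rightarrow> 3 \<Rightarrow> real" where "wavevec \<xi> m j = dual_vec m $ j + \<xi> $ j"

lemma fourier_rep_nabla:
  assumes "fourier_rep T c"
  shows "fourier_rep (nabla \<xi> j T) (\<lambda>m. \<i> * of_real (wavevec \<xi> m j) * c m)"
  unfolding fourier_rep_def
proof
  fix \<phi> assume p: "\<phi> \<in> test_functions"
  have 1: "((\<lambda>m. c m * test_coeff \<phi> m) has_sum T \<phi>) UNIV" "((\<lambda>m. c m * test_coeff (pd j \<phi>) m) has_sum T (pd j \<phi>)) UNIV"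
    using assms p test_function_props(3)[OF p] by (auto simp: fourier_rep_def)
  have "((\<lambda>m. - (c m * test_coeff (pd j \<phi>) m) + \<i> * of_real (\<xi> $ j) * (c m * test_coeff \<phi> m)) has_sum nabla \<xi> j T \<phi>) UNIV"
    unfolding nabla_def by (intro has_sum_add has_sum_cmult_right 1 has_sum_uminusI)
  moreover have "- (c m * test_coeff (pd j \<phi>) m) + \<i> * of_real (\<xi> $ j) * (c m * test_coeff \<phi> m) = \<i> * of_real (wavevec \<xi> m j) * c m * test_coeff \<phi> m" for m
    unfolding test_coeff_pd[OF p] wavevec_def by (simp add: algebra_simps)
  ultimately show "((\<lambda>m. \<i> * of_real (wavevec \<xi> m j) * c m * test_coeff \<phi> m) has_sum nabla \<xi> j T \<phi>) UNIV" by simp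
qed

lemma fourier_rep_diff:
  "fourier_rep T c \<Longrightarrow> fourier_rep S e \<Longrightarrow> fourier_rep (\<lambda>\<phi>. T \<phi> - S \<phi>) (\<lambda>m. c m - e m)"
  unfolding fourier_rep_def left_diff_distrib unfolding diff_conv_add_uminus
  by (intro ballI has_sum_add has_sum_uminusI) auto

lemma fourier_rep_zero: "fourier_rep (\<lambda>\<phi>. 0) (\<lambda>m. 0)"
  unfolding fourier_rep_def by simp

lemma fourier_rep_add:
  "fourier_rep T c \<Longrightarrow> fourier_rep S e \<Longrightarrow> fourier_rep (\<lambda>\<phi>. T \<phi> + S \<phi>) (\<lambda>m. c m + e m)"
  unfolding fourier_rep_def distrib_right by (auto intro!: has_sum_add)

lemma fourier_rep_sum:
  "finite I \<Longrightarrow> (\<And>i. i \<in> I \<Longrightarrow> fourier_rep (T i) (c i)) \<Longrightarrow> fourier_rep (\<lambda>\<phi>. \<Sum>i\<in>I. T i \<phi>) (\<lambda>m. \<Sum>i\<in>I. c i m)"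
  by (induction I rule: finite_induct) (auto intro: fourier_rep_zero fourier_rep_add)

text \<open>The Fourier transform of this test function vanishes at all points of the reciprocal lattice but one,
since multiplication by \<open>chi\<close> turns integrals over space into integrals over the cell. It
extracts a single Fourier coefficient from a distribution.\<close>

definition probe :: "(3 \<Rightarrow> int) \<Rightarrow> r3 \<Rightarrow> complex" where "probe m x = chi x * wave (\<lambda>i. - m i) x"

lemma probe_test: "probe m \<in> test_functions"
  by (rule test_functionsI[OF _ compact_slab]) (auto simp: probe_def[abs_def] intro: Ck_mult Ck_chi Ck_wave chi_slab)

lemma test_coeff_probe: "test_coeff (probe m) l = (if l = m then of_real (sqrt vol) else 0)"
proof -
  have "(LINT x|lebesgue. probe m x * wave l x) = (LINT x|lebesgue. wave (\<lambda>i. l i + - m i) x * chi x)"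
    unfolding probe_def wave_add by (simp add: algebra_simps)
  also have "\<dots> = (if l = m then of_real vol else 0)"
    unfolding integral_wave_chi integral_wave by (auto simp: fun_eq_iff)
  finally show ?thesis unfolding test_coeff_def using vol_pos
    by (auto simp: field_simps simp flip: of_real_mult)
qed

lemma fourier_rep_probe:
  assumes "fourier_rep T c" shows "T (probe m) = c m * of_real (sqrt vol)"
proof -
  have "((\<lambda>l. c l * test_coeff (probe m) l) has_sum T (probe m)) UNIV"
    using assms probe_test by (simp add: fourier_rep_def)
  then have "((\<lambda>l. c l * test_coeff (probe m) l) has_sum T (probe m)) {m}"
    by (rule has_sum_cong_neutral[THEN iffD1, rotated 3]) (auto simp: test_coeff_probe)
  then have "T (probe m) = c m * test_coeff (probe m) m" by (simp add: has_sum_finite_iff)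
  then show ?thesis by (simp add: test_coeff_probe)
qed

text \<open>The probes separate coefficients. With this lemma, identities between distributions become identities
between coefficients; the weak derivatives, the curl and the divergence are instances.\<close>

lemma fourier_rep_eq:
  assumes T: "fourier_rep T c" and S: "fourier_rep S e"
  shows "T \<simeq> S \<longleftrightarrow> (\<forall>m. c m = e m)"
proof
  assume eq: "T \<simeq> S"
  show "\<forall>m. c m = e m"
  proof
    fix m
    have "T (probe m) = S (probe m)" using eq probe_test by (simp add: distrib_eq_def)
    then show "c m = e m" unfolding fourier_rep_probe[OF T] fourier_rep_probe[OF S] using vol_pos by simp
  qed
next
  assume "\<forall>m. c m = e m"
  then have "c = e" by auto
  then show "T \<simeq> S" using T S unfolding distrib_eq_def fourier_rep_def by (metis has_sum_unique)
qed

lemma weak_pd_iff: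
  assumes "v \<in> L2_per a" "w \<in> L2_per a"
  shows "is_weak_pd j v w \<longleftrightarrow> (\<forall>m i. fcoeff w m i = \<i> * of_real (dual_vec m $ j) * fcoeff v m i)"
proof -
  have "is_weak_pd j v w \<longleftrightarrow> (\<forall>i m. \<i> * of_real (wavevec 0 m j) * fcoeff v m i = fcoeff w m i)"
    unfolding is_weak_pd_def using fourier_rep_eq[OF fourier_rep_nabla[OF fourier_rep_reg] fourier_rep_reg] assms by blast
  then show ?thesis by (auto simp: wavevec_def)
qed

lemma wcurl_iff:
  assumes "v \<in> L2_per a" "w \<in> L2_per a"
  shows "is_wcurl \<xi> v w \<longleftrightarrow> (\<forall>m i. fcoeff w m i = \<i> * of_real (wavevec \<xi> m (i + 1)) * fcoeff v m (i + 2) - \<i> * of_real (wavevec \<xi> m (i + 2)) * fcoeff v m (i + 1))"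
proof -
  have "is_wcurl \<xi> v w \<longleftrightarrow> (\<forall>i m. \<i> * of_real (wavevec \<xi> m (i + 1)) * fcoeff v m (i + 2) - \<i> * of_real (wavevec \<xi> m (i + 2)) * fcoeff v m (i + 1) = fcoeff w m i)"
    unfolding is_wcurl_def nabla_cross_def
    using fourier_rep_eq[OF fourier_rep_diff[OF fourier_rep_nabla[OF fourier_rep_reg] fourier_rep_nabla[OF fourier_rep_reg]] fourier_rep_reg] assms by blast
  then show ?thesis by metis
qed

lemma nabla_dot_iff:
  assumes "v \<in> L2_per a"
  shows "nabla_dot \<xi> (reg v) \<simeq> (\<lambda>\<phi>. 0) \<longleftrightarrow> (\<forall>m. (\<Sum>j\<in>UNIV. of_real (wavevec \<xi> m j) * fcoeff v m j) = 0)"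
proof -
  have "fourier_rep (nabla_dot \<xi> (reg v)) (\<lambda>m. \<Sum>j\<in>UNIV. \<i> * of_real (wavevec \<xi> m j) * fcoeff v m j)"
    unfolding nabla_dot_def by (intro fourier_rep_sum fourier_rep_nabla fourier_rep_reg assms) simp
  from fourier_rep_eq[OF this fourier_rep_zero] show ?thesis
    by (simp add: mult.assoc flip: sum_distrib_left)
qed

end

section \<open>Fourier series of periodic fields\<close>

lemma sum3: "(\<Sum>i\<in>UNIV. f i) = f 1 + f 2 + f (3::3)" by (rule sum_3)

text \<open>The symbol of the curl, that is, the cross product with \<open>\<i> k\<close>.\<close>

definition crossc :: "(3 \<Rightarrow> real) \<Rightarrow> (3 \<Rightarrow> complex) \<Rightarrow> 3 \<Rightarrow> complex" where
  "crossc k c i = \<i> * of_real (k (i + 1)) * c (i + 2) - \<i> * of_real (k (i + 2)) * c (i + 1)"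

lemma idx3: "(1::3) + 1 = 2" "(1::3) + 2 = 3" "(2::3) + 1 = 3" "(2::3) + 2 = 1" "(3::3) + 1 = 1" "(3::3) + 2 = 2"
  by simp_all

lemma crossc_123: "crossc k c 1 = \<i> * of_real (k 2) * c 3 - \<i> * of_real (k 3) * c 2"
  "crossc k c 2 = \<i> * of_real (k 3) * c 1 - \<i> * of_real (k 1) * c 3"
  "crossc k c 3 = \<i> * of_real (k 1) * c 2 - \<i> * of_real (k 2) * c 1"
  unfolding crossc_def idx3 by (rule refl)+

lemma crossc_adjoint: "(\<Sum>i\<in>UNIV. p i * cnj (crossc k c i)) = (\<Sum>i\<in>UNIV. crossc k p i * cnj (c i))"
  unfolding sum3 crossc_123 by (simp only: complex_cnj_diff complex_cnj_mult complex_cnj_i complex_cnj_complex_of_real) algebra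

lemma div_crossc: "(\<Sum>j\<in>UNIV. of_real (k j) * crossc k c j) = 0"
  unfolding sum3 crossc_123 by algebra

text \<open>The identity of Lagrange, applied to real and imaginary parts. It is the reason why the curl of a
divergence-free field controls all first derivatives.\<close>

lemma crossc_norm:
  assumes div: "(\<Sum>j\<in>UNIV. of_real (k j) * c j) = 0"
  shows "(\<Sum>i\<in>UNIV. (cmod (crossc k c i))\<^sup>2) = (\<Sum>j\<in>UNIV. (k j)\<^sup>2) * (\<Sum>i\<in>UNIV. (cmod (c i))\<^sup>2)"
proof -
  have re: "k 1 * Re (c 1) + k 2 * Re (c 2) + k 3 * Re (c 3) = 0"
    using arg_cong[OF div, of Re] unfolding sum3 by simp
  have im: "k 1 * Im (c 1) + k 2 * Im (c 2) + k 3 * Im (c 3) = 0"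
    using arg_cong[OF div, of Im] unfolding sum3 by simp
  have alg: "(k2 * z - k3 * y)\<^sup>2 + (k3 * x - k1 * z)\<^sup>2 + (k1 * y - k2 * x)\<^sup>2 = (k1\<^sup>2 + k2\<^sup>2 + k3\<^sup>2) * (x\<^sup>2 + y\<^sup>2 + z\<^sup>2)"
    if "k1 * x + k2 * y + k3 * z = 0" for k1 k2 k3 x y z :: real
  proof -
    have "(k2 * z - k3 * y)\<^sup>2 + (k3 * x - k1 * z)\<^sup>2 + (k1 * y - k2 * x)\<^sup>2
      = (k1\<^sup>2 + k2\<^sup>2 + k3\<^sup>2) * (x\<^sup>2 + y\<^sup>2 + z\<^sup>2) - (k1 * x + k2 * y + k3 * z)\<^sup>2" by algebra
    then show ?thesis using that by simp
  qed
  have cm: "(cmod (\<i> * of_real s * z - \<i> * of_real t * w))\<^sup>2 = (s * Re z - t * Re w)\<^sup>2 + (s * Im z - t * Im w)\<^sup>2"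
    for s t z w by (simp add: cmod_power2 power2_commute[of "t * Im w"])
  show ?thesis
    unfolding sum3 crossc_123 cm unfolding cmod_power2
    using alg[OF re] alg[OF im] by algebra
qed

context semi_inner
begin

lemma lim_cong:
  assumes X: "\<And>n. X n \<in> H" and x: "x \<in> H" "y \<in> H" and l: "lim_to X x" and n: "nrm (x - y) = 0"
  shows "lim_to X y"
  unfolding lim_to_def
proof (rule Lim_null_comparison)
  show "(\<lambda>n. nrm (X n - x)) \<longlonglongrightarrow> 0" using l unfolding lim_to_def .
  have "nrm (X k - y) \<le> nrm (X k - x)" for k using nrm_triangle_diff[OF X x, of k] n by simp
  then show "\<forall>\<^sub>F k in sequentially. norm (nrm (X k - y)) \<le> nrm (X k - x)" using X x by simp
qed

lemma nrm_cong: "x \<in> H \<Longrightarrow> y \<in> H \<Longrightarrow> nrm (x - y) = 0 \<Longrightarrow> nrm x = nrm y"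
  using nrm_diff_bound[of x y] by simp

end

context lattice_cell
begin

lemma per_Q: "v \<in> L2_per a \<Longrightarrow> v \<in> L2Q" using L2_per_L2Q by blast

text \<open>A field that is periodic almost everywhere agrees almost everywhere with its periodic extension,
so that square integrability on the cell implies local square integrability.\<close>

lemma L2_perI:
  assumes w: "w \<in> L2Q" and p: "\<And>k. AE x in lebesgue. w (x + lattice_vec k) = w x"
  shows "w \<in> L2_per a"
proof -
  have e: "ext w \<in> L2_per a" using ext_L2_per[OF w] .
  have eq: "AE x in lebesgue. w x = ext w x"
  proof (rule AE_all_cells)
    show "AE x in lebesgue. x \<in> cell a \<longrightarrow> w x = ext w x" using ext_cell by (intro AE_I2) simp
    show "AE x in lebesgue. (w (x + lattice_vec k) = ext w (x + lattice_vec k)) \<longleftrightarrow> (w x = ext w x)" for k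
      using p[of k] by eventually_elim (simp add: ext_periodic)
  qed
  have wm: "w \<in> borel_measurable lebesgue" using w by (rule L2Q_D)
  have em: "ext w \<in> borel_measurable lebesgue" using per_Q[OF e] by (rule L2Q_D)
  have "set_integrable lebesgue C (\<lambda>x. (norm (w x))\<^sup>2)" if "compact C" for C
  proof -
    have "set_integrable lebesgue C (\<lambda>x. (norm (ext w x))\<^sup>2)" using e that by (simp add: L2_per_def L2_loc_def)
    moreover have "C \<in> sets lebesgue" using that by (simp add: borel_compact)
    moreover have "AE x\<in>C in lebesgue. (norm (w x))\<^sup>2 = (norm (ext w x))\<^sup>2" using eq by eventually_elim simp
    ultimately show ?thesis using wm em by (subst set_integrable_cong_AE) auto
  qed
  then show ?thesis using wm p by (auto simp: L2_per_def L2_loc_def lattice_eq)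
qed

lemma per_add: assumes "u \<in> L2_per a" "v \<in> L2_per a" shows "u + v \<in> L2_per a"
proof (rule L2_perI)
  show "u + v \<in> L2Q" using assms per_Q by auto
  show "AE x in lebesgue. (u + v) (x + lattice_vec k) = (u + v) x" for k
    using per_shift[OF assms(1), of k] per_shift[OF assms(2), of k] by eventually_elim simp
qed

lemma per_scale: assumes "u \<in> L2_per a" shows "cscale c u \<in> L2_per a"
proof (rule L2_perI)
  show "cscale c u \<in> L2Q" using assms per_Q by auto
  show "AE x in lebesgue. (cscale c u) (x + lattice_vec k) = (cscale c u) x" for k
    using per_shift[OF assms(1), of k] by eventually_elim (simp add: cscale_def)
qed

lemma per_zero: "0 \<in> L2_per a"
  by (rule L2_perI) (auto simp: Q.H_zero)

lemma per_null: assumes u: "u \<in> L2_per a" "v \<in> L2_per a"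
  shows "Q.nrm (u - v) = 0 \<longleftrightarrow> (AE x in lebesgue. u x = v x)"
proof
  assume "Q.nrm (u - v) = 0"
  then have "AE x in lebesgue. x \<in> cell a \<longrightarrow> u x = v x"
    using Qnull[of "u - v"] per_Q u by simp
  then show "AE x in lebesgue. u x = v x"
  proof (rule AE_all_cells)
    show "AE x in lebesgue. (u (x + lattice_vec k) = v (x + lattice_vec k)) \<longleftrightarrow> (u x = v x)" for k
      using per_shift[OF u(1), of k] per_shift[OF u(2), of k] by eventually_elim simp
  qed
next
  assume "AE x in lebesgue. u x = v x"
  then have "AE x in lebesgue. x \<in> cell a \<longrightarrow> (u - v) x = 0" by eventually_elim simp
  then show "Q.nrm (u - v) = 0" using Qnull[of "u - v"] per_Q u by blast
qed

lemma ext_null: "v \<in> L2Q \<Longrightarrow> Q.nrm (v - ext v) = 0"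
  using Qnull[of "v - ext v"] per_Q[OF ext_L2_per] ext_cell by auto

lemma fcoeff_add: "u \<in> L2Q \<Longrightarrow> v \<in> L2Q \<Longrightarrow> fcoeff (u + v) m i = fcoeff u m i + fcoeff v m i"
  unfolding fcoeff_def by (rule Q.ip_add[OF _ _ E_L2Q])
lemma fcoeff_diff: "u \<in> L2Q \<Longrightarrow> v \<in> L2Q \<Longrightarrow> fcoeff (u - v) m i = fcoeff u m i - fcoeff v m i"
  unfolding fcoeff_def by (rule Q.ip_diff[OF _ _ E_L2Q])
lemma fcoeff_scale: "u \<in> L2Q \<Longrightarrow> fcoeff (cscale c u) m i = c * fcoeff u m i"
  unfolding fcoeff_def by (rule Q.ip_scale[OF _ E_L2Q])

lemma null_fcoeff: "u \<in> L2Q \<Longrightarrow> Q.nrm u = 0 \<longleftrightarrow> (\<forall>m i. fcoeff u m i = 0)"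
  unfolding fcoeff_def using Q.null_iff_coeffs[of u] by auto

lemma null_diff_fcoeff: "u \<in> L2Q \<Longrightarrow> v \<in> L2Q \<Longrightarrow> Q.nrm (u - v) = 0 \<longleftrightarrow> (\<forall>m i. fcoeff u m i = fcoeff v m i)"
  using null_fcoeff[of "u - v"] by (auto simp: fcoeff_diff)

lemma from_coeffs:
  assumes "(\<lambda>p. (cmod (c p))\<^sup>2) summable_on UNIV"
  obtains u where "u \<in> L2_per a" "\<And>m i. fcoeff u m i = c (m, i)"
proof -
  obtain x where x: "x \<in> L2Q" "\<And>p. L2_inner a x (E p) = c p" using Q.riesz_fischer[OF assms] by metis
  have e: "ext x \<in> L2_per a" using ext_L2_per[OF x(1)] .
  have "fcoeff (ext x) m i = c (m, i)" for m i
    using ext_null[OF x(1)] null_diff_fcoeff[OF x(1) per_Q[OF e]] x(2) by (simp add: fcoeff_def)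
  then show thesis using that e by blast
qed

lemma parseval_modes:
  assumes "u \<in> L2Q" "v \<in> L2Q"
  shows "((\<lambda>m. \<Sum>i\<in>UNIV. fcoeff u m i * cnj (fcoeff v m i)) has_sum L2_inner a u v) UNIV"
proof (rule has_sum_SigmaD)
  show "((\<lambda>p. L2_inner a u (E p) * cnj (L2_inner a v (E p))) has_sum L2_inner a u v) (Sigma UNIV (\<lambda>_. UNIV))"
    using Q.parseval[OF assms] by simp
  show "((\<lambda>i. L2_inner a u (E (m, i)) * cnj (L2_inner a v (E (m, i)))) has_sum (\<Sum>i\<in>UNIV. fcoeff u m i * cnj (fcoeff v m i))) UNIV" for m
    unfolding fcoeff_def by (rule has_sum_finite) simp
qed

definition mode_energy :: "field \<Rightarrow> (3 \<Rightarrow> int) \<Rightarrow> real" where "mode_energy u m = (\<Sum>i\<in>UNIV. (cmod (fcoeff u m i))\<^sup>2)"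

lemma mode_energy_nonneg: "0 \<le> mode_energy u m" unfolding mode_energy_def by (simp add: sum_nonneg)

lemma norm_modes:
  assumes "u \<in> L2Q" shows "(mode_energy u has_sum (Q.nrm u)\<^sup>2) UNIV"
proof -
  have "((\<lambda>m. Re (\<Sum>i\<in>UNIV. fcoeff u m i * cnj (fcoeff u m i))) has_sum Re (L2_inner a u u)) UNIV"
    by (rule has_sum_Re[OF parseval_modes[OF assms assms]])
  moreover have "Re (\<Sum>i\<in>UNIV. fcoeff u m i * cnj (fcoeff u m i)) = mode_energy u m" for m
    unfolding mode_energy_def by (simp only: complex_norm_square[symmetric] of_real_sum[symmetric] Re_complex_of_real)
  ultimately show ?thesis using assms by (simp add: Q.nrm_sq)
qed

definition wavevec_sq :: "r3 \<Rightarrow> (3 \<Rightarrow> int) \<Rightarrow> real" where "wavevec_sq \<xi> m = (\<Sum>j\<in>UNIV. (wavevec \<xi> m j)\<^sup>2)"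

lemma wavevec_sq_norm: "wavevec_sq \<xi> m = (norm (dual_vec m + \<xi>))\<^sup>2"
  unfolding wavevec_sq_def wavevec_def by (simp add: norm_vec_def L2_set_def sum_nonneg)

text \<open>The scalar products with the lattice basis recover the integer coordinates of a reciprocal lattice vector.\<close>

lemma finite_wavevec_sq: "finite {m. wavevec_sq \<xi> m \<le> R}"
proof -
  define B where "B = Max (range (\<lambda>i. \<lceil>(sqrt R + norm \<xi>) * norm (a i)\<rceil>))"
  have "{m. wavevec_sq \<xi> m \<le> R} \<subseteq> {f. \<forall>i. (i \<in> UNIV \<longrightarrow> f i \<in> {-B..B}) \<and> (i \<notin> UNIV \<longrightarrow> f i = 0)}"
  proof
    fix m assume "m \<in> {m. wavevec_sq \<xi> m \<le> R}"
    then have "(norm (dual_vec m + \<xi>))\<^sup>2 \<le> R" by (simp add: wavevec_sq_norm)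
    then have "norm (dual_vec m + \<xi>) \<le> sqrt R" by (rule real_le_rsqrt)
    then have g: "norm (dual_vec m) \<le> sqrt R + norm \<xi>" using norm_triangle_ineq4[of "dual_vec m + \<xi>" \<xi>] by simp
    have "m i \<in> {-B..B}" for i
    proof -
      have "\<bar>real_of_int (m i)\<bar> \<le> 2 * pi * \<bar>real_of_int (m i)\<bar>" using mult_right_mono[of 1 "2 * pi" "\<bar>real_of_int (m i)\<bar>"] pi_ge_two by simp
      also have "\<dots> = \<bar>dual_vec m \<bullet> a i\<bar>" unfolding dual_vec_a by (simp add: abs_mult)
      also have "\<dots> \<le> norm (dual_vec m) * norm (a i)" by (rule Cauchy_Schwarz_ineq2)
      also have "\<dots> \<le> (sqrt R + norm \<xi>) * norm (a i)" using g by (intro mult_right_mono) auto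
      also have "\<dots> \<le> of_int \<lceil>(sqrt R + norm \<xi>) * norm (a i)\<rceil>" by (rule le_of_int_ceiling)
      also have "\<dots> \<le> of_int B" unfolding B_def of_int_le_iff by (intro Max_ge) auto
      finally have "\<bar>real_of_int (m i)\<bar> \<le> of_int B" .
      then have "\<bar>m i\<bar> \<le> B" by linarith
      then show ?thesis by auto
    qed
    then show "m \<in> {f. \<forall>i. (i \<in> UNIV \<longrightarrow> f i \<in> {-B..B}) \<and> (i \<notin> UNIV \<longrightarrow> f i = 0)}" by simp
  qed
  then show ?thesis by (rule finite_subset) (intro finite_set_of_finite_funs; simp)
qed

text \<open>The theorem of Tychonoff: a product of discs is compact, and for countably many factors it is metrisable.\<close>

lemma bounded_coeffs_subsequence:
  fixes c :: "nat \<Rightarrow> 'i::countable \<Rightarrow> complex"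
  assumes "\<And>k p. cmod (c k p) \<le> C"
  obtains r l where "strict_mono (r :: nat \<Rightarrow> nat)" "\<And>p. (\<lambda>k. c (r k) p) \<longlonglongrightarrow> l p"
proof -
  let ?P = "PiE UNIV (\<lambda>_. cball 0 C) :: ('i \<Rightarrow> complex) set"
  have "compactin (product_topology (\<lambda>i. euclidean) UNIV) ?P"
    unfolding compactin_PiE by simp
  then have "compact ?P" unfolding euclidean_product_topology by simp
  then have "seq_compact ?P" by (simp add: compact_eq_seq_compact_metric)
  moreover have "\<forall>k. c k \<in> ?P" using assms by auto
  ultimately obtain l r where r: "strict_mono (r :: nat \<Rightarrow> nat)" "(c \<circ> r) \<longlonglongrightarrow> l"
    unfolding seq_compact_def by blast
  have "(\<lambda>k. c (r k) p) \<longlonglongrightarrow> l p" for p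
  proof -
    have "isCont (\<lambda>x :: 'i \<Rightarrow> complex. x p) l"
    proof -
      have "continuous_on UNIV (\<lambda>x :: 'i \<Rightarrow> complex. x p)" by (rule continuous_on_product_coordinates)
      then show ?thesis unfolding continuous_on_eq_continuous_at[OF open_UNIV] by blast
    qed
    from isCont_tendsto_compose[OF this r(2)] show ?thesis by (simp add: o_def)
  qed
  then show thesis using that r(1) by blast
qed

text \<open>Compactness of the embedding. A subsequence has convergent Fourier coefficients; the modes with
\<open>wavevec_sq \<xi> m > R\<close> contribute at most \<open>1 / R\<close> times the energy, uniformly, and the remaining modes
are finite in number. In the application \<open>Y k\<close> is the curl of \<open>X k\<close>.\<close>

lemma rellich:
  assumes X: "\<And>k. X k \<in> L2Q" and Y: "\<And>k. Y k \<in> L2Q"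
    and XY: "\<And>k m. mode_energy (Y k) m = wavevec_sq \<xi> m * mode_energy (X k) m"
    and bX: "\<And>k. Q.nrm (X k) \<le> C" and bY: "\<And>k. Q.nrm (Y k) \<le> C"
  shows "\<exists>r. strict_mono (r :: nat \<Rightarrow> nat) \<and> Q.cauchy (X \<circ> r)"
proof -
  have C0: "C \<ge> 0" using bX[of 0] Q.nrm_nonneg[OF X, of 0] by linarith
  define c where "c k p = L2_inner a (X k) (E p)" for k p
  have nE: "Q.nrm (E p) = 1" for p unfolding Q.nrm_def E_orthonormal by simp
  have "cmod (c k p) \<le> C" for k p
    using Q.cauchy_schwarz[OF X E_L2Q, of k p] bX[of k] unfolding c_def nE by simp
  then obtain r l where r: "strict_mono (r :: nat \<Rightarrow> nat)" "\<And>p. (\<lambda>k. c (r k) p) \<longlonglongrightarrow> l p"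
    using bounded_coeffs_subsequence by blast
  have "Q.cauchy (X \<circ> r)" unfolding Q.cauchy_def
  proof (intro allI impI)
    fix e :: real assume e: "e > 0"
    \<comment> \<open>The cut-off is chosen so that the high modes contribute less than half of the square of e.\<close>
    define R where "R = 8 * C\<^sup>2 / e\<^sup>2 + 1"
    have Rp: "R > 0" unfolding R_def by (intro add_nonneg_pos) auto
    have "e\<^sup>2 * R = 8 * C\<^sup>2 + e\<^sup>2" using e by (simp add: R_def distrib_left)
    then have "4 * C\<^sup>2 < e\<^sup>2 / 2 * R" using e by simp
    then have R: "R > 0" "4 * C\<^sup>2 / R < e\<^sup>2 / 2" using Rp by (simp_all add: pos_divide_less_eq)
    define F where "F = {m. wavevec_sq \<xi> m \<le> R}"
    have F: "finite F" unfolding F_def by (rule finite_wavevec_sq)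
    define K where "K = real (card F) * 3 + 1"
    have K: "K > 0" by (simp add: K_def add_nonneg_pos)
    define \<delta> where "\<delta> = e\<^sup>2 / (8 * K)"
    have \<delta>: "\<delta> > 0" using e K by (simp add: \<delta>_def)
    have "\<forall>\<^sub>F k in sequentially. \<forall>p\<in>F \<times> UNIV. dist (c (r k) p) (l p) < sqrt \<delta>"
      using F r(2) \<delta> by (intro eventually_ball_finite) (auto simp: tendsto_iff)
    then obtain N where N: "\<And>k m i. k \<ge> N \<Longrightarrow> m \<in> F \<Longrightarrow> cmod (c (r k) (m, i) - l (m, i)) < sqrt \<delta>"
      unfolding eventually_sequentially dist_norm by auto
    have "Q.nrm ((X \<circ> r) j - (X \<circ> r) k) < e" if jk: "j \<ge> N" "k \<ge> N" for j k
    proof -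
      let ?x = "X (r j)" and ?y = "X (r k)"
      let ?D = "?x - ?y"
      have D: "?D \<in> L2Q" using X by auto
      have par: "mode_energy ?D m \<le> 2 * mode_energy ?x m + 2 * mode_energy ?y m" for m
      proof -
        have "(cmod (z - w))\<^sup>2 \<le> 2 * (cmod z)\<^sup>2 + 2 * (cmod w)\<^sup>2" for z w
        proof -
          have "(cmod (z - w))\<^sup>2 \<le> (cmod z + cmod w)\<^sup>2" by (intro power_mono norm_triangle_ineq4) auto
          also have "\<dots> \<le> 2 * (cmod z)\<^sup>2 + 2 * (cmod w)\<^sup>2"
            using sum_squares_bound[of "cmod z" "cmod w"] by (simp add: power2_sum)
          finally show ?thesis .
        qed
        then show ?thesis unfolding mode_energy_def sum_distrib_left sum.distrib[symmetric] fcoeff_diff[OF X X] by (intro sum_mono)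
      qed
      have inF: "mode_energy ?D m \<le> 12 * \<delta>" if m: "m \<in> F" for m
      proof -
        have "(cmod (fcoeff ?D m i))\<^sup>2 \<le> 4 * \<delta>" for i
        proof -
          have "fcoeff ?D m i = (c (r j) (m, i) - l (m, i)) - (c (r k) (m, i) - l (m, i))"
            unfolding fcoeff_diff[OF X X] by (simp add: fcoeff_def c_def)
          then have "cmod (fcoeff ?D m i) \<le> cmod (c (r j) (m, i) - l (m, i)) + cmod (c (r k) (m, i) - l (m, i))"
            by (metis norm_triangle_ineq4)
          also have "\<dots> \<le> 2 * sqrt \<delta>" using N[OF jk(1) m, of i] N[OF jk(2) m, of i] by simp
          finally have "(cmod (fcoeff ?D m i))\<^sup>2 \<le> (2 * sqrt \<delta>)\<^sup>2" by (intro power_mono) auto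
          then show ?thesis using \<delta> by (simp add: power_mult_distrib)
        qed
        then have "mode_energy ?D m \<le> (\<Sum>i\<in>(UNIV::3 set). 4 * \<delta>)" unfolding mode_energy_def by (intro sum_mono)
        then show ?thesis by simp
      qed
      have out: "mode_energy ?D m \<le> 2 / R * (mode_energy (Y (r j)) m + mode_energy (Y (r k)) m)" if m: "m \<notin> F" for m
      proof -
        have kR: "wavevec_sq \<xi> m > R" using m by (simp add: F_def)
        have "R * mode_energy (X q) m \<le> mode_energy (Y q) m" for q
          unfolding XY using kR mode_energy_nonneg by (intro mult_right_mono) auto
        then have "R * (2 * mode_energy ?x m + 2 * mode_energy ?y m) \<le> 2 * (mode_energy (Y (r j)) m + mode_energy (Y (r k)) m)"
          by (simp add: distrib_left)
             (metis add_mono mult.left_commute mult_le_cancel_left_pos zero_less_numeral)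
        then have "2 * mode_energy ?x m + 2 * mode_energy ?y m \<le> 2 / R * (mode_energy (Y (r j)) m + mode_energy (Y (r k)) m)"
          using R(1) by (simp add: field_simps)
        then show ?thesis using par[of m] by linarith
      qed
      have hF: "((\<lambda>m. if m \<in> F then mode_energy ?D m else 0) has_sum (\<Sum>m\<in>F. mode_energy ?D m)) UNIV"
      proof -
        have "((\<lambda>m. if m \<in> F then mode_energy ?D m else 0) has_sum (\<Sum>m\<in>F. if m \<in> F then mode_energy ?D m else 0)) F"
          by (rule has_sum_finite[OF F])
        then have "((\<lambda>m. if m \<in> F then mode_energy ?D m else 0) has_sum (\<Sum>m\<in>F. mode_energy ?D m)) F" by simp
        then show ?thesis by (rule has_sum_cong_neutral[THEN iffD1, rotated 3]) auto
      qed
      have hY: "((\<lambda>m. 2 / R * (mode_energy (Y (r j)) m + mode_energy (Y (r k)) m)) has_sum 2 / R * ((Q.nrm (Y (r j)))\<^sup>2 + (Q.nrm (Y (r k)))\<^sup>2)) UNIV"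
        by (intro has_sum_cmult_right has_sum_add norm_modes Y)
      have "(Q.nrm ?D)\<^sup>2 \<le> (\<Sum>m\<in>F. mode_energy ?D m) + 2 / R * ((Q.nrm (Y (r j)))\<^sup>2 + (Q.nrm (Y (r k)))\<^sup>2)"
      proof (rule has_sum_mono[OF norm_modes[OF D] has_sum_add[OF hF hY]])
        fix m
        have "0 \<le> 2 / R * (mode_energy (Y (r j)) m + mode_energy (Y (r k)) m)" using R mode_energy_nonneg by simp
        then show "mode_energy ?D m \<le> (if m \<in> F then mode_energy ?D m else 0) + 2 / R * (mode_energy (Y (r j)) m + mode_energy (Y (r k)) m)"
          using out[of m] by auto
      qed
      also have "(\<Sum>m\<in>F. mode_energy ?D m) \<le> (\<Sum>m\<in>F. 12 * \<delta>)" by (intro sum_mono inF)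
      also have "(\<Sum>m\<in>F. 12 * \<delta>) = 4 * (real (card F) * 3) * \<delta>" by simp
      also have "\<dots> \<le> 4 * K * \<delta>" using \<delta> by (intro mult_right_mono) (auto simp: K_def)
      also have "4 * K * \<delta> = e\<^sup>2 / 2" using K by (simp add: \<delta>_def)
      also have "2 / R * ((Q.nrm (Y (r j)))\<^sup>2 + (Q.nrm (Y (r k)))\<^sup>2) \<le> 2 / R * (C\<^sup>2 + C\<^sup>2)"
        using bY Q.nrm_nonneg[OF Y] R(1) by (intro mult_left_mono add_mono power_mono) auto
      also have "2 / R * (C\<^sup>2 + C\<^sup>2) = 4 * C\<^sup>2 / R" by simp
      finally have "(Q.nrm ?D)\<^sup>2 < e\<^sup>2" using R(2) by linarith
      then show ?thesis using e by (simp add: power2_less_imp_less)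
    qed
    then show "\<exists>N. \<forall>j\<ge>N. \<forall>k\<ge>N. Q.nrm ((X \<circ> r) j - (X \<circ> r) k) < e" by blast
  qed
  then show ?thesis using r(1) by blast
qed

text \<open>A single plane wave with amplitude vector \<open>c\<close>.\<close>

definition mode :: "(3 \<Rightarrow> int) \<Rightarrow> (3 \<Rightarrow> complex) \<Rightarrow> field" where
  "mode m c = (\<Sum>i\<in>UNIV. cscale (c i) (E (m, i)))"

lemma E_per: "E p \<in> L2_per a"
  by (rule L2_perI[OF E_L2Q]) (simp add: E_def wave_periodic)

lemma mode_per: "mode m c \<in> L2_per a"
proof -
  have "(\<Sum>i\<in>I. cscale (c i) (E (m, i))) \<in> L2_per a" for I
    by (induction I rule: infinite_finite_induct)
       (simp_all only: sum.infinite sum.empty sum.insert per_zero per_add per_scale E_per not_False_eq_True)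
  then show ?thesis by (simp add: mode_def)
qed

lemma fcoeff_mode: "fcoeff (mode m c) l i = (if l = m then c i else 0)"
proof -
  have "fcoeff (mode m c) l i = (\<Sum>j\<in>UNIV. c j * (if (m, j) = (l, i) then 1 else 0))"
    unfolding fcoeff_def mode_def using E_L2Q
    by (subst Q.ip_sum) (auto simp: Q.ip_scale E_orthonormal intro!: sum.cong)
  also have "\<dots> = (\<Sum>j\<in>UNIV. if j = i then (if l = m then c i else 0) else 0)"
    by (intro sum.cong) auto
  finally show ?thesis by simp
qed

lemma inner_mode: assumes u: "u \<in> L2Q" shows "L2_inner a u (mode m c) = (\<Sum>i\<in>UNIV. fcoeff u m i * cnj (c i))"
proof -
  have "((\<lambda>l. \<Sum>i\<in>UNIV. fcoeff u l i * cnj (fcoeff (mode m c) l i)) has_sum L2_inner a u (mode m c)) UNIV"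
    by (rule parseval_modes[OF u per_Q[OF mode_per]])
  then have "((\<lambda>l. \<Sum>i\<in>UNIV. fcoeff u l i * cnj (fcoeff (mode m c) l i)) has_sum L2_inner a u (mode m c)) {m}"
    by (rule has_sum_cong_neutral[THEN iffD1, rotated 3]) (auto simp: fcoeff_mode)
  then show ?thesis by (simp add: has_sum_finite_iff fcoeff_mode)
qed

end

section \<open>The form domain and the form\<close>

text \<open>The bounds on the refractive index \<open>n\<close> are parameters, since the form norm only sees \<open>n\<close> through
them. They hold almost everywhere, as for representatives of essentially bounded functions.\<close>

locale photonic = lattice_cell +
  fixes n :: "r3 \<Rightarrow> real" and \<xi> :: r3 and N c0 :: real
  assumes n_pos: "n x > 0" and n_per: "n (x + lattice_vec k) = n x" and n_meas: "n \<in> borel_measurable lebesgue"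
    and n_upper: "AE x in lebesgue. n x \<le> N" and n_lower: "AE x in lebesgue. c0 \<le> n x" and c0: "c0 > 0"
begin

abbreviation curl :: "field \<Rightarrow> field" where "curl \<equiv> wcurl \<xi>"
abbreviation "HS \<equiv> H_space a \<xi>"
abbreviation "VS \<equiv> V_space a \<xi>"

lemma HS_iff: "v \<in> HS \<longleftrightarrow> v \<in> L2_per a \<and> (\<forall>m. (\<Sum>j\<in>UNIV. of_real (wavevec \<xi> m j) * fcoeff v m j) = 0)"
  unfolding H_space_def using nabla_dot_iff by blast

lemma VS_iff: "v \<in> VS \<longleftrightarrow> v \<in> HS \<and> (\<exists>w\<in>L2_per a. \<forall>m i. fcoeff w m i = crossc (wavevec \<xi> m) (fcoeff v m) i)"
  unfolding V_space_def H_space_def crossc_def using wcurl_iff by blast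

lemma HS_per: "v \<in> HS \<Longrightarrow> v \<in> L2_per a" by (simp add: HS_iff)
lemma HS_Q: "v \<in> HS \<Longrightarrow> v \<in> L2Q" using HS_per per_Q by blast
lemma VS_HS: "v \<in> VS \<Longrightarrow> v \<in> HS" by (simp add: VS_iff)
lemma VS_Q: "v \<in> VS \<Longrightarrow> v \<in> L2Q" using VS_HS HS_Q by blast

text \<open>\<^const>\<open>wcurl\<close> chooses some locally square integrable representative. By \<open>distributions_determine\<close> it
agrees almost everywhere with the periodic one that membership in the form domain provides.\<close>

lemma curl: assumes v: "v \<in> VS"
  shows "curl v \<in> L2_per a" "fcoeff (curl v) m i = crossc (wavevec \<xi> m) (fcoeff v m) i"
proof -
  obtain w where w: "w \<in> L2_per a" "is_wcurl \<xi> v w" using v by (auto simp: V_space_def)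
  have wl: "w \<in> L2_loc" using w by (simp add: L2_per_def)
  have s: "curl v \<in> L2_loc \<and> is_wcurl \<xi> v (curl v)"
    unfolding wcurl_def by (rule someI[of _ w]) (use wl w in blast)
  have eq: "AE x in lebesgue. curl v x = w x"
  proof (rule distributions_determine)
    show "reg (curl v) i \<simeq> reg w i" for i
      using s w(2) unfolding is_wcurl_def distrib_eq_def by metis
  qed (use s wl in auto)
  show p: "curl v \<in> L2_per a"
  proof -
    have "AE x in lebesgue. curl v (x + lattice_vec k) = curl v x" for k
      using eq AE_translate[OF eq, of "lattice_vec k"] per_shift[OF w(1), of k] by eventually_elim simp
    then show ?thesis using s by (auto simp: L2_per_def lattice_eq)
  qed
  have "v \<in> L2_per a" using v VS_HS HS_per by blast
  then show "fcoeff (curl v) m i = crossc (wavevec \<xi> m) (fcoeff v m) i"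
    using wcurl_iff[OF _ p] s by (auto simp: crossc_def)
qed

lemma curl_Q: "v \<in> VS \<Longrightarrow> curl v \<in> L2Q" using curl(1) per_Q by blast

lemma VS_I: assumes "v \<in> HS" "w \<in> L2_per a" "\<And>m i. fcoeff w m i = crossc (wavevec \<xi> m) (fcoeff v m) i"
  shows "v \<in> VS" "Q.nrm (curl v - w) = 0"
proof -
  show v: "v \<in> VS" using assms VS_iff by blast
  show "Q.nrm (curl v - w) = 0" using null_diff_fcoeff[OF curl_Q[OF v] per_Q[OF assms(2)]] curl(2)[OF v] assms(3) by simp
qed

lemma crossc_add: "crossc k (\<lambda>i. c i + e i) i = crossc k c i + crossc k e i"
  by (simp add: crossc_def algebra_simps)
lemma crossc_scale: "crossc k (\<lambda>i. s * c i) i = s * crossc k c i"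
  by (simp add: crossc_def algebra_simps)
lemma HS_subspace: "cscale.subspace HS"
proof (rule cscale.subspaceI)
  show "0 \<in> HS" unfolding HS_iff using per_zero by (simp add: fcoeff_def E_L2Q)
  show "x + y \<in> HS" if "x \<in> HS" "y \<in> HS" for x y
    using that per_add per_Q unfolding HS_iff by (auto simp: fcoeff_add distrib_left sum.distrib)
  show "cscale c x \<in> HS" if "x \<in> HS" for c x
    using that per_scale per_Q unfolding HS_iff
    by (auto simp: fcoeff_scale mult.left_commute[of _ c] simp flip: sum_distrib_left)
qed

lemma VS_add: assumes "x \<in> VS" "y \<in> VS" shows "x + y \<in> VS" "Q.nrm (curl (x + y) - (curl x + curl y)) = 0"
proof -
  have h: "x + y \<in> HS" using assms VS_HS HS_subspace cscale.subspace_add by blast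
  have p: "curl x + curl y \<in> L2_per a" using assms curl(1) per_add by blast
  have "fcoeff (curl x + curl y) m i = crossc (wavevec \<xi> m) (fcoeff (x + y) m) i" for m i
  proof -
    have e: "fcoeff (x + y) m = (\<lambda>i. fcoeff x m i + fcoeff y m i)" using assms VS_Q by (auto simp: fcoeff_add)
    show ?thesis unfolding e crossc_add using assms by (simp add: fcoeff_add curl_Q curl(2))
  qed
  from VS_I[OF h p this] show "x + y \<in> VS" "Q.nrm (curl (x + y) - (curl x + curl y)) = 0" .
qed

lemma VS_scale: assumes "x \<in> VS" shows "cscale c x \<in> VS" "Q.nrm (curl (cscale c x) - cscale c (curl x)) = 0"
proof -
  have h: "cscale c x \<in> HS" using assms VS_HS HS_subspace cscale.subspace_scale by blast
  have p: "cscale c (curl x) \<in> L2_per a" using assms curl(1) per_scale by blast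
  have "fcoeff (cscale c (curl x)) m i = crossc (wavevec \<xi> m) (fcoeff (cscale c x) m) i" for m i
  proof -
    have e: "fcoeff (cscale c x) m = (\<lambda>i. c * fcoeff x m i)" using assms VS_Q by (auto simp: fcoeff_scale)
    show ?thesis unfolding e crossc_scale using assms by (simp add: fcoeff_scale curl_Q curl(2))
  qed
  from VS_I[OF h p this] show "cscale c x \<in> VS" "Q.nrm (curl (cscale c x) - cscale c (curl x)) = 0" .
qed

lemma HS_null_closed: assumes "x \<in> HS" "y \<in> L2_per a" "Q.nrm (x - y) = 0" shows "y \<in> HS"
  using assms null_diff_fcoeff[OF HS_Q[OF assms(1)] per_Q[OF assms(2)]] unfolding HS_iff by simp

lemma VS_null_closed: assumes "x \<in> VS" "y \<in> L2_per a" "Q.nrm (x - y) = 0"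
  shows "y \<in> VS" "Q.nrm (curl x - curl y) = 0"
proof -
  have h: "y \<in> HS" using HS_null_closed assms VS_HS by blast
  have e: "fcoeff x = fcoeff y" using null_diff_fcoeff[OF VS_Q[OF assms(1)] per_Q[OF assms(2)]] assms(3) by (auto simp: fun_eq_iff)
  have "fcoeff (curl x) m i = crossc (wavevec \<xi> m) (fcoeff y m) i" for m i using curl(2)[OF assms(1)] e by simp
  note * = VS_I[OF h curl(1)[OF assms(1)] this]
  show y: "y \<in> VS" by (rule *(1))
  show "Q.nrm (curl x - curl y) = 0"
    using *(2) Q.nrm_minus_commute[OF curl_Q[OF assms(1)] curl_Q[OF y]] by simp
qed

lemma VS_subspace: "cscale.subspace VS"
proof (rule cscale.subspaceI)
  have "0 \<in> HS" using HS_subspace cscale.subspace_0 by blast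
  then show "0 \<in> VS" unfolding VS_iff using per_zero by (intro conjI bexI[of _ 0]) (auto simp: fcoeff_def E_L2Q crossc_def)
qed (use VS_add(1) VS_scale(1) in auto)

lemma VS_diff: assumes "x \<in> VS" "y \<in> VS" shows "x - y \<in> VS" "Q.nrm (curl (x - y) - (curl x - curl y)) = 0"
proof -
  show d: "x - y \<in> VS" using assms VS_subspace cscale.subspace_diff by blast
  have "fcoeff (curl (x - y)) m i = fcoeff (curl x - curl y) m i" for m i
  proof -
    have e: "fcoeff (x - y) m = (\<lambda>i. fcoeff x m i - fcoeff y m i)" using assms VS_Q by (auto simp: fcoeff_diff)
    have "fcoeff (curl (x - y)) m i = crossc (wavevec \<xi> m) (\<lambda>i. fcoeff x m i - fcoeff y m i) i" unfolding curl(2)[OF d] e ..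
    also have "\<dots> = fcoeff (curl x) m i - fcoeff (curl y) m i"
      unfolding curl(2)[OF assms(1)] curl(2)[OF assms(2)] by (simp add: crossc_def algebra_simps)
    finally show ?thesis using assms by (simp add: fcoeff_diff curl_Q)
  qed
  then show "Q.nrm (curl (x - y) - (curl x - curl y)) = 0"
    using null_diff_fcoeff assms curl_Q d by (metis Q.H_diff)
qed

text \<open>For divergence-free fields the coefficients are orthogonal to the wave vector.\<close>

lemma curl_modes: assumes "v \<in> VS" shows "mode_energy (curl v) m = wavevec_sq \<xi> m * mode_energy v m"
proof -
  have "(\<Sum>j\<in>UNIV. of_real (wavevec \<xi> m j) * fcoeff v m j) = 0" using VS_HS[OF assms] by (simp add: HS_iff)
  from crossc_norm[OF this] show ?thesis unfolding mode_energy_def wavevec_sq_def curl(2)[OF assms] .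
qed

text \<open>Multiplication by \<open>1 / n\<^sup>2\<close>, a bounded and boundedly invertible positive operator.\<close>

definition weight :: "field \<Rightarrow> field" where "weight f = (\<lambda>x. complex_of_real (1 / (n x)\<^sup>2) *s f x)"

lemma weight_eq: "weight f = (\<lambda>x. (1 / (n x)\<^sup>2) *\<^sub>R f x)"
  by (simp add: weight_def fun_eq_iff vec_eq_iff complex_eq_iff)

lemma N_pos: "N > 0"
proof (rule ccontr)
  assume "\<not> N > 0"
  then have Nn: "N \<le> 0" by simp
  have "AE x in lebesgue. x \<notin> cell a"
    using n_upper n_lower by eventually_elim (use c0 Nn in linarith)
  then have "cell a \<in> null_sets lebesgue" using AE_iff_null_sets[OF cell_lebesgue] by simp
  then show False using vol_pos by (simp add: vol_def measure_def null_sets_def)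
qed

lemma weight_bounds: "AE x in lebesgue. 1 / N\<^sup>2 \<le> 1 / (n x)\<^sup>2 \<and> 1 / (n x)\<^sup>2 \<le> 1 / c0\<^sup>2"
  using n_upper n_lower
proof eventually_elim
  fix x assume "n x \<le> N" "c0 \<le> n x"
  then show "1 / N\<^sup>2 \<le> 1 / (n x)\<^sup>2 \<and> 1 / (n x)\<^sup>2 \<le> 1 / c0\<^sup>2"
    using n_pos[of x] c0 N_pos by (intro conjI divide_left_mono power_mono) auto
qed

lemma weight_meas: assumes "f \<in> L2Q" shows "weight f \<in> borel_measurable lebesgue"
  unfolding weight_eq using n_meas L2Q_D(1)[OF assms] by measurable

lemma weight_Q: assumes f: "f \<in> L2Q" shows "weight f \<in> L2Q"
proof -
  have "integrable lebesgue (\<lambda>x. (1 / c0\<^sup>2)\<^sup>2 * (indicat_real (cell a) x *\<^sub>R (norm (f x))\<^sup>2))"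
    using L2Q_D(2)[OF f] by (intro integrable_mult_right) (simp add: set_integrable_def)
  then have "integrable lebesgue (\<lambda>x. indicat_real (cell a) x *\<^sub>R (norm (weight f x))\<^sup>2)"
  proof (rule Bochner_Integration.integrable_bound)
    show "(\<lambda>x. indicat_real (cell a) x *\<^sub>R (norm (weight f x))\<^sup>2) \<in> borel_measurable lebesgue"
      using weight_meas[OF f] by measurable
    show "AE x in lebesgue. norm (indicat_real (cell a) x *\<^sub>R (norm (weight f x))\<^sup>2)
       \<le> norm ((1 / c0\<^sup>2)\<^sup>2 * (indicat_real (cell a) x *\<^sub>R (norm (f x))\<^sup>2))"
      using weight_bounds
    proof eventually_elim
      fix x assume b: "1 / N\<^sup>2 \<le> 1 / (n x)\<^sup>2 \<and> 1 / (n x)\<^sup>2 \<le> 1 / c0\<^sup>2"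
      have "norm (weight f x) = 1 / (n x)\<^sup>2 * norm (f x)" unfolding weight_eq by simp
      also have "\<dots> \<le> 1 / c0\<^sup>2 * norm (f x)" using b by (intro mult_right_mono) auto
      finally have "(norm (weight f x))\<^sup>2 \<le> (1 / c0\<^sup>2 * norm (f x))\<^sup>2" by (intro power_mono) auto
      then have "(norm (weight f x))\<^sup>2 \<le> (1 / c0\<^sup>2)\<^sup>2 * (norm (f x))\<^sup>2" by (simp only: power_mult_distrib)
      then show "norm (indicat_real (cell a) x *\<^sub>R (norm (weight f x))\<^sup>2)
       \<le> norm ((1 / c0\<^sup>2)\<^sup>2 * (indicat_real (cell a) x *\<^sub>R (norm (f x))\<^sup>2))"
        by (cases "x \<in> cell a") simp_all
    qed
  qed
  then show ?thesis using weight_meas[OF f] by (simp add: L2Q_def set_integrable_def)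
qed

lemma weight_per: assumes f: "f \<in> L2_per a" shows "weight f \<in> L2_per a"
proof (rule L2_perI)
  show "weight f \<in> L2Q" using weight_Q per_Q f by blast
  show "AE x in lebesgue. weight f (x + lattice_vec k) = weight f x" for k
    using per_shift[OF f, of k] by eventually_elim (simp add: weight_def n_per)
qed

lemma weight_null: assumes "f \<in> L2Q" "g \<in> L2Q" "Q.nrm (f - g) = 0" shows "Q.nrm (weight f - weight g) = 0"
proof -
  have "AE x in lebesgue. x \<in> cell a \<longrightarrow> (f - g) x = 0" using Qnull[of "f - g"] assms by auto
  then have "AE x in lebesgue. x \<in> cell a \<longrightarrow> (weight f - weight g) x = 0"
    by eventually_elim (simp add: weight_def)
  then show ?thesis using Qnull[of "weight f - weight g"] weight_Q assms by blast
qed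

lemma weight_add: "weight (f + g) = weight f + weight g"
  by (auto simp: weight_def vec_eq_iff algebra_simps)
lemma weight_scale: "weight (cscale c f) = cscale c (weight f)"
  by (auto simp: weight_def cscale_def vec_eq_iff)

lemma weight_symmetric: "L2_inner a (weight f) g = cnj (L2_inner a (weight g) f)"
proof -
  have "(\<lambda>x. indicat_real (cell a) x *\<^sub>R hdot (weight f x) (g x)) = (\<lambda>x. cnj (indicat_real (cell a) x *\<^sub>R hdot (weight g x) (f x)))"
    by (auto simp: weight_def hdot_scale hdot_sym[of "f _" "g _"])
  then show ?thesis
    unfolding L2_inner_def set_lebesgue_integral_def by (simp only: Bochner_Integration.integral_cnj)
qed

lemma weight_quadratic: assumes f: "f \<in> L2Q"
  shows "(Q.nrm f)\<^sup>2 \<le> N\<^sup>2 * Re (L2_inner a (weight f) f)" "Re (L2_inner a (weight f) f) \<le> 1 / c0\<^sup>2 * (Q.nrm f)\<^sup>2"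
    "Im (L2_inner a (weight f) f) = 0" "0 \<le> Re (L2_inner a (weight f) f)"
proof -
  let ?F = "\<lambda>x. indicat_real (cell a) x *\<^sub>R (norm (f x))\<^sup>2"
  let ?G = "\<lambda>x. indicat_real (cell a) x *\<^sub>R (1 / (n x)\<^sup>2 * (norm (f x))\<^sup>2)"
  have fi: "integrable lebesgue ?F" using L2Q_D(2)[OF f] by (simp add: set_integrable_def)
  have hd: "hdot (weight f x) (f x) = complex_of_real (1 / (n x)\<^sup>2 * (norm (f x))\<^sup>2)" for x
    unfolding weight_def hdot_scale hdot_self by simp
  have eq: "L2_inner a (weight f) f = of_real (LINT x:cell a|lebesgue. 1 / (n x)\<^sup>2 * (norm (f x))\<^sup>2)"
    unfolding L2_inner_def hd by (rule set_integral_complex_of_real)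
  have re: "Re (L2_inner a (weight f) f) = (LINT x|lebesgue. ?G x)"
    unfolding eq set_lebesgue_integral_def by simp
  have fm: "f \<in> borel_measurable lebesgue" using f by (rule L2Q_D)
  have gm: "?G \<in> borel_measurable lebesgue" using n_meas fm by measurable
  have b2: "AE x in lebesgue. ?G x \<le> 1 / c0\<^sup>2 * ?F x"
    using weight_bounds
  proof eventually_elim
    fix x assume "1 / N\<^sup>2 \<le> 1 / (n x)\<^sup>2 \<and> 1 / (n x)\<^sup>2 \<le> 1 / c0\<^sup>2"
    then have "1 / (n x)\<^sup>2 * (norm (f x))\<^sup>2 \<le> 1 / c0\<^sup>2 * (norm (f x))\<^sup>2" by (intro mult_right_mono) auto
    then show "?G x \<le> 1 / c0\<^sup>2 * ?F x" by (cases "x \<in> cell a") simp_all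
  qed
  have gi: "integrable lebesgue ?G"
  proof (rule Bochner_Integration.integrable_bound[OF integrable_mult_right[OF fi, of "1 / c0\<^sup>2"] gm])
    show "AE x in lebesgue. norm (?G x) \<le> norm (1 / c0\<^sup>2 * ?F x)"
      using b2 by eventually_elim (auto simp: indicator_def)
  qed
  have b1: "AE x in lebesgue. 1 / N\<^sup>2 * ?F x \<le> ?G x"
    using weight_bounds
  proof eventually_elim
    fix x assume "1 / N\<^sup>2 \<le> 1 / (n x)\<^sup>2 \<and> 1 / (n x)\<^sup>2 \<le> 1 / c0\<^sup>2"
    then have "1 / N\<^sup>2 * (norm (f x))\<^sup>2 \<le> 1 / (n x)\<^sup>2 * (norm (f x))\<^sup>2" by (intro mult_right_mono) auto
    then show "1 / N\<^sup>2 * ?F x \<le> ?G x" by (cases "x \<in> cell a") simp_all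
  qed
  have nq: "(Q.nrm f)\<^sup>2 = (LINT x|lebesgue. ?F x)" by (simp add: Qnrm_sq set_lebesgue_integral_def)
  have "1 / N\<^sup>2 * (Q.nrm f)\<^sup>2 \<le> Re (L2_inner a (weight f) f)"
    unfolding re nq integral_mult_right_zero[symmetric]
    by (rule integral_mono_AE[OF integrable_mult_right[OF fi] gi b1])
  then show "(Q.nrm f)\<^sup>2 \<le> N\<^sup>2 * Re (L2_inner a (weight f) f)" using N_pos by (simp add: field_simps)
  show "Re (L2_inner a (weight f) f) \<le> 1 / c0\<^sup>2 * (Q.nrm f)\<^sup>2"
    unfolding re nq integral_mult_right_zero[symmetric]
    by (rule integral_mono_AE[OF gi integrable_mult_right[OF fi] b2])
  show "Im (L2_inner a (weight f) f) = 0" unfolding eq by simp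
  show "0 \<le> Re (L2_inner a (weight f) f)" unfolding re by (rule integral_nonneg_AE) auto
qed

abbreviation form :: "field \<Rightarrow> field \<Rightarrow> complex" where "form \<equiv> a_form a n \<xi>"

lemma form_eq: "form u v = L2_inner a (weight (curl u)) (curl v)"
  unfolding a_form_def L2_inner_def weight_def hdot_scale ..

lemma form_add: assumes "x \<in> VS" "y \<in> VS" "z \<in> VS" shows "form (x + y) z = form x z + form y z"
proof -
  have q: "curl x \<in> L2Q" "curl y \<in> L2Q" "curl z \<in> L2Q" "curl (x + y) \<in> L2Q" using assms curl_Q VS_add(1) by auto
  have "Q.nrm (weight (curl (x + y)) - weight (curl x + curl y)) = 0"
    using weight_null[of "curl (x + y)" "curl x + curl y"] q VS_add(2)[OF assms(1,2)] by auto
  then have "form (x + y) z = L2_inner a (weight (curl x + curl y)) (curl z)"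
    unfolding form_eq using q weight_Q by (intro Q.null_ip_diff) auto
  also have "\<dots> = form x z + form y z" unfolding weight_add form_eq using q weight_Q by (intro Q.ip_add) auto
  finally show ?thesis .
qed

lemma form_scale: assumes "x \<in> VS" "z \<in> VS" shows "form (cscale c x) z = c * form x z"
proof -
  have q: "curl x \<in> L2Q" "curl z \<in> L2Q" "curl (cscale c x) \<in> L2Q" using assms curl_Q VS_scale(1) by auto
  have "Q.nrm (weight (curl (cscale c x)) - weight (cscale c (curl x))) = 0"
    using weight_null[of "curl (cscale c x)" "cscale c (curl x)"] q VS_scale(2)[OF assms(1)] by auto
  then have "form (cscale c x) z = L2_inner a (weight (cscale c (curl x))) (curl z)"
    unfolding form_eq using q weight_Q by (intro Q.null_ip_diff) auto
  also have "\<dots> = c * form x z" unfolding weight_scale form_eq using q weight_Q by (intro Q.ip_scale) auto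
  finally show ?thesis .
qed

lemma form_sym: "form y x = cnj (form x y)"
  unfolding form_eq by (rule weight_symmetric)

lemma form_bounds: assumes "v \<in> VS"
  shows "(Q.nrm (curl v))\<^sup>2 \<le> N\<^sup>2 * Re (form v v)" "Re (form v v) \<le> 1 / c0\<^sup>2 * (Q.nrm (curl v))\<^sup>2"
    "Im (form v v) = 0" "0 \<le> Re (form v v)"
  unfolding form_eq using weight_quadratic[OF curl_Q[OF assms]] by auto

text \<open>Limits are first taken on the cell and then extended periodically; the divergence condition passes to
the limit coefficient by coefficient.\<close>

interpretation HH: semi_hilbert cscale HS "L2_inner a"
proof
  show "module.subspace cscale HS" by (rule HS_subspace)
  fix X assume X: "\<And>k. X k \<in> HS" and c: "semi_inner.cauchy (L2_inner a) X"
  obtain x where x: "x \<in> L2Q" "Q.lim_to X x" using Q.complete[OF HS_Q[OF X] c] by blast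
  have e: "ext x \<in> L2_per a" using ext_L2_per[OF x(1)] .
  have l: "Q.lim_to X (ext x)" by (rule Q.lim_cong[OF HS_Q[OF X] x(1) per_Q[OF e] x(2) ext_null[OF x(1)]])
  have "(\<Sum>j\<in>UNIV. of_real (wavevec \<xi> m j) * fcoeff (ext x) m j) = 0" for m
  proof -
    have "(\<lambda>k. fcoeff (X k) m j) \<longlonglongrightarrow> fcoeff (ext x) m j" for j
      unfolding fcoeff_def using Q.lim_ip[OF HS_Q[OF X] per_Q[OF e] E_L2Q l] .
    then have "(\<lambda>k. \<Sum>j\<in>UNIV. of_real (wavevec \<xi> m j) * fcoeff (X k) m j) \<longlonglongrightarrow> (\<Sum>j\<in>UNIV. of_real (wavevec \<xi> m j) * fcoeff (ext x) m j)"
      by (intro tendsto_intros)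
    moreover have "(\<Sum>j\<in>UNIV. of_real (wavevec \<xi> m j) * fcoeff (X k) m j) = 0" for k using X[of k] by (simp add: HS_iff)
    ultimately show ?thesis by (simp add: LIMSEQ_const_iff)
  qed
  then show "\<exists>x\<in>HS. semi_inner.lim_to (L2_inner a) X x" using e l HS_iff by blast
next
  show "L2_inner a (x + y) z = L2_inner a x z + L2_inner a y z" if "x \<in> HS" "y \<in> HS" "z \<in> HS" for x y z
    using that by (intro Q.ip_add HS_Q)
  show "L2_inner a (cscale c x) z = c * L2_inner a x z" if "x \<in> HS" "z \<in> HS" for x z c
    using that by (intro Q.ip_scale HS_Q)
  show "L2_inner a y x = cnj (L2_inner a x y)" if "x \<in> HS" "y \<in> HS" for x y
    using that by (intro Q.ip_sym HS_Q)
  show "0 \<le> Re (L2_inner a x x)" if "x \<in> HS" for x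
    using that by (intro Q.ip_nonneg HS_Q)
qed

text \<open>The curl is a closed operator, because it is a multiplication on the level of coefficients.\<close>

lemma closure_in_V:
  assumes X: "\<And>k. X k \<in> VS" and cX: "Q.cauchy X" and cY: "Q.cauchy (\<lambda>k. curl (X k))"
  obtains x where "x \<in> VS" "Q.lim_to X x" "Q.lim_to (\<lambda>k. curl (X k)) (curl x)"
proof -
  obtain x where x: "x \<in> HS" "Q.lim_to X x" using HH.complete[of X] VS_HS[OF X] cX by blast
  obtain w where w: "w \<in> L2Q" "Q.lim_to (\<lambda>k. curl (X k)) w" using Q.complete[of "\<lambda>k. curl (X k)"] curl_Q[OF X] cY by blast
  have e: "ext w \<in> L2_per a" using ext_L2_per[OF w(1)] .
  have l: "Q.lim_to (\<lambda>k. curl (X k)) (ext w)"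
    using Q.lim_cong[OF _ w(1) per_Q[OF e] w(2) ext_null[OF w(1)]] curl_Q[OF X] by blast
  have "fcoeff (ext w) m i = crossc (wavevec \<xi> m) (fcoeff x m) i" for m i
  proof (rule LIMSEQ_unique)
    show "(\<lambda>k. fcoeff (curl (X k)) m i) \<longlonglongrightarrow> fcoeff (ext w) m i"
      unfolding fcoeff_def by (rule Q.lim_ip[OF _ per_Q[OF e] E_L2Q l]) (rule curl_Q[OF X])
    have "(\<lambda>k. fcoeff (X k) m j) \<longlonglongrightarrow> fcoeff x m j" for j
      unfolding fcoeff_def using Q.lim_ip[OF HS_Q[OF VS_HS[OF X]] HS_Q[OF x(1)] E_L2Q x(2)] .
    then show "(\<lambda>k. fcoeff (curl (X k)) m i) \<longlonglongrightarrow> crossc (wavevec \<xi> m) (fcoeff x m) i"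
      unfolding curl(2)[OF X] crossc_def by (intro tendsto_intros)
  qed
  note * = VS_I[OF x(1) e this]
  have "Q.nrm (ext w - curl x) = 0" using *(2) Q.nrm_minus_commute[OF per_Q[OF e] curl_Q[OF *(1)]] by simp
  then have "Q.lim_to (\<lambda>k. curl (X k)) (curl x)"
    using Q.lim_cong[OF _ per_Q[OF e] curl_Q[OF *(1)] l] curl_Q[OF X] by blast
  then show thesis using that *(1) x(2) by blast
qed

interpretation VV: semi_inner cscale VS "\<lambda>u v. form u v + L2_inner a u v"
proof
  show "module.subspace cscale VS" by (rule VS_subspace)
  show "0 \<le> Re (form x x + L2_inner a x x)" if "x \<in> VS" for x
    using form_bounds(4)[OF that] Q.ip_nonneg[OF VS_Q[OF that]] by simp
  show "form y x + L2_inner a y x = cnj (form x y + L2_inner a x y)" if "x \<in> VS" "y \<in> VS" for x y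
    using form_sym[of y x] Q.ip_sym[OF VS_Q VS_Q, OF that] by simp
qed (use VS_Q in \<open>auto simp: form_add form_scale Q.ip_add Q.ip_scale algebra_simps\<close>)

lemma VV_sq: "v \<in> VS \<Longrightarrow> (VV.nrm v)\<^sup>2 = Re (form v v) + (Q.nrm v)\<^sup>2"
  using VV.nrm_sq[of v] Q.nrm_sq[OF VS_Q, of v] by simp

lemma VV_bounds: assumes v: "v \<in> VS"
  shows "Q.nrm v \<le> VV.nrm v" "Q.nrm (curl v) \<le> N * VV.nrm v"
    "(VV.nrm v)\<^sup>2 \<le> 1 / c0\<^sup>2 * (Q.nrm (curl v))\<^sup>2 + (Q.nrm v)\<^sup>2"
proof -
  have p: "0 \<le> VV.nrm v" "0 \<le> Q.nrm v" using v VS_Q by auto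
  show "Q.nrm v \<le> VV.nrm v"
    by (rule power2_le_imp_le) (use VV_sq[OF v] form_bounds(4)[OF v] p in auto)
  show "Q.nrm (curl v) \<le> N * VV.nrm v"
  proof (rule power2_le_imp_le)
    have "(Q.nrm (curl v))\<^sup>2 \<le> N\<^sup>2 * Re (form v v)" by (rule form_bounds(1)[OF v])
    also have "\<dots> \<le> N\<^sup>2 * (VV.nrm v)\<^sup>2" using VV_sq[OF v] by (intro mult_left_mono) auto
    finally show "(Q.nrm (curl v))\<^sup>2 \<le> (N * VV.nrm v)\<^sup>2" by (simp add: power_mult_distrib)
    show "0 \<le> N * VV.nrm v" using p N_pos by simp
  qed
  show "(VV.nrm v)\<^sup>2 \<le> 1 / c0\<^sup>2 * (Q.nrm (curl v))\<^sup>2 + (Q.nrm v)\<^sup>2"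
    using VV_sq[OF v] form_bounds(2)[OF v] by simp
qed

lemma curl_diff_nrm: assumes "x \<in> VS" "y \<in> VS" shows "Q.nrm (curl (x - y)) = Q.nrm (curl x - curl y)"
  by (rule Q.nrm_cong[OF _ _ VS_diff(2)[OF assms]]) (use assms curl_Q VS_diff(1) in auto)

lemma VV_complete:
  assumes X: "\<And>k. X k \<in> VS" and c: "VV.cauchy X"
  shows "\<exists>x\<in>VS. VV.lim_to X x"
proof -
  have d: "X j - X k \<in> VS" for j k using X VS_diff(1) by blast
  have cX: "Q.cauchy X" unfolding Q.cauchy_def
  proof (intro allI impI)
    fix e :: real assume "e > 0"
    then obtain M where M: "\<forall>j\<ge>M. \<forall>k\<ge>M. VV.nrm (X j - X k) < e" using c unfolding VV.cauchy_def by blast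
    then show "\<exists>M. \<forall>j\<ge>M. \<forall>k\<ge>M. Q.nrm (X j - X k) < e" using VV_bounds(1)[OF d] le_less_trans by blast
  qed
  have cY: "Q.cauchy (\<lambda>k. curl (X k))" unfolding Q.cauchy_def
  proof (intro allI impI)
    fix e :: real assume "e > 0"
    then have "e / N > 0" using N_pos by simp
    then obtain M where M: "\<And>j k. j \<ge> M \<Longrightarrow> k \<ge> M \<Longrightarrow> VV.nrm (X j - X k) < e / N" using c unfolding VV.cauchy_def by blast
    have "Q.nrm (curl (X j) - curl (X k)) < e" if "j \<ge> M" "k \<ge> M" for j k
    proof -
      have "Q.nrm (curl (X j) - curl (X k)) \<le> N * VV.nrm (X j - X k)"
        using VV_bounds(2)[OF d[of j k]] unfolding curl_diff_nrm[OF X X] .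
      also have "\<dots> < N * (e / N)" using M[OF that] N_pos by (intro mult_strict_left_mono)
      finally show ?thesis using N_pos by simp
    qed
    then show "\<exists>M. \<forall>j\<ge>M. \<forall>k\<ge>M. Q.nrm (curl (X j) - curl (X k)) < e" by blast
  qed
  obtain x where x: "x \<in> VS" "Q.lim_to X x" "Q.lim_to (\<lambda>k. curl (X k)) (curl x)"
    using closure_in_V[OF X cX cY] by blast
  have "VV.lim_to X x" unfolding VV.lim_to_def
  proof (rule Lim_null_comparison)
    have dx: "X k - x \<in> VS" for k using X x VS_diff(1) by blast
    have "VV.nrm (X k - x) \<le> sqrt (1 / c0\<^sup>2 * (Q.nrm (curl (X k) - curl x))\<^sup>2 + (Q.nrm (X k - x))\<^sup>2)" for k
      using VV_bounds(3)[OF dx, of k] unfolding curl_diff_nrm[OF X x(1)] by (rule real_le_rsqrt)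
    then show "\<forall>\<^sub>F k in sequentially. norm (VV.nrm (X k - x)) \<le> sqrt (1 / c0\<^sup>2 * (Q.nrm (curl (X k) - curl x))\<^sup>2 + (Q.nrm (X k - x))\<^sup>2)"
      using VV.nrm_nonneg[OF dx] by simp
    have "(\<lambda>k. sqrt (1 / c0\<^sup>2 * (Q.nrm (curl (X k) - curl x))\<^sup>2 + (Q.nrm (X k - x))\<^sup>2)) \<longlonglongrightarrow> sqrt (1 / c0\<^sup>2 * 0\<^sup>2 + 0\<^sup>2)"
      by (intro tendsto_intros x(2,3)[unfolded Q.lim_to_def])
    then show "(\<lambda>k. sqrt (1 / c0\<^sup>2 * (Q.nrm (curl (X k) - curl x))\<^sup>2 + (Q.nrm (X k - x))\<^sup>2)) \<longlonglongrightarrow> 0" by simp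
  qed
  then show ?thesis using x(1) by blast
qed

lemma VV_hilbert: "semi_hilbert cscale VS (\<lambda>u v. form u v + L2_inner a u v)"
proof (rule semi_hilbert.intro[OF VV.semi_inner_axioms], rule semi_hilbert_axioms.intro)
  fix X :: "nat \<Rightarrow> field"
  assume X: "\<And>k. X k \<in> VS" "VV.cauchy X"
  show "\<exists>x\<in>VS. VV.lim_to X x" using X by (rule VV_complete)
qed

lemma mode_HS: "(\<Sum>j\<in>UNIV. of_real (wavevec \<xi> m j) * c j) = 0 \<Longrightarrow> mode m c \<in> HS"
proof -
  assume c: "(\<Sum>j\<in>UNIV. of_real (wavevec \<xi> m j) * c j) = 0"
  have "(\<Sum>j\<in>UNIV. of_real (wavevec \<xi> l j) * fcoeff (mode m c) l j) = 0" for l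
    using c by (cases "l = m") (simp_all add: fcoeff_mode)
  then show ?thesis unfolding HS_iff using mode_per by blast
qed

lemma mode_VS: assumes "(\<Sum>j\<in>UNIV. of_real (wavevec \<xi> m j) * c j) = 0"
  shows "mode m c \<in> VS" "Q.nrm (curl (mode m c) - mode m (crossc (wavevec \<xi> m) c)) = 0"
proof -
  have "fcoeff (mode m (crossc (wavevec \<xi> m) c)) l i = crossc (wavevec \<xi> l) (fcoeff (mode m c) l) i" for l i
    by (auto simp: fcoeff_mode crossc_def)
  from VS_I[OF mode_HS[OF assms] mode_per this]
  show "mode m c \<in> VS" "Q.nrm (curl (mode m c) - mode m (crossc (wavevec \<xi> m) c)) = 0" .
qed

text \<open>The plane orthogonal to a real vector contains a nonzero vector; for \<open>k\<close> on the third axis the first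
unit vector will do.\<close>

lemma transversal_exists: "\<exists>c :: 3 \<Rightarrow> complex. (\<Sum>j\<in>UNIV. of_real (k j) * c j) = 0 \<and> (\<exists>i. c i \<noteq> 0)"
proof (cases "k 1 = 0 \<and> k 2 = 0")
  case True
  then show ?thesis by (intro exI[of _ "\<lambda>i. if i = 1 then 1 else 0"]) (auto simp: sum3)
next
  case False
  then show ?thesis
    by (intro exI[of _ "\<lambda>i. if i = 1 then of_real (k 2) else if i = 2 then - of_real (k 1) else 0"])
       (auto simp: sum3 intro: exI[of _ 1] exI[of _ 2])
qed

text \<open>Compactness is \<open>rellich\<close>; plane waves with amplitudes orthogonal to their wave vectors are total and
provide infinitely many dimensions.\<close>

sublocale C: compact_form cscale HS "L2_inner a" VS form
proof -
  interpret V: semi_hilbert cscale VS "\<lambda>u v. form u v + L2_inner a u v" by (rule VV_hilbert)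
  show "compact_form cscale HS (L2_inner a) VS form"
  proof
    show "VS \<subseteq> HS" using VS_HS by blast
    show "0 \<le> Re (form u u)" if "u \<in> VS" for u using form_bounds(4)[OF that] .
    show "\<exists>r. strict_mono r \<and> HH.cauchy (X \<circ> r)"
      if X: "\<And>k. X k \<in> VS" and b: "\<And>k. VV.nrm (X k) \<le> B" for X :: "nat \<Rightarrow> field" and B
    proof (rule rellich[where Y = "\<lambda>k. curl (X k)" and \<xi> = \<xi> and C = "max B (N * B)"])
      show "X k \<in> L2Q" "curl (X k) \<in> L2Q" for k using X VS_Q curl_Q by auto
      show "mode_energy (curl (X k)) m = wavevec_sq \<xi> m * mode_energy (X k) m" for k m using curl_modes[OF X] .
      show "Q.nrm (X k) \<le> max B (N * B)" for k using VV_bounds(1)[OF X, of k] b[of k] by auto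
      show "Q.nrm (curl (X k)) \<le> max B (N * B)" for k
      proof -
        have "N * VV.nrm (X k) \<le> N * B" using b[of k] N_pos by (intro mult_left_mono) auto
        then show ?thesis using VV_bounds(2)[OF X, of k] by linarith
      qed
    qed
    show "y \<in> VS \<and> VV.nrm (x - y) = 0" if x: "x \<in> VS" and y: "y \<in> HS" and z: "HH.nrm (x - y) = 0" for x y
    proof
      show yV: "y \<in> VS" using VS_null_closed(1)[OF x HS_per[OF y] z] .
      have d: "x - y \<in> VS" using VS_diff(1)[OF x yV] .
      have "Q.nrm (curl (x - y)) = 0" using curl_diff_nrm[OF x yV] VS_null_closed(2)[OF x HS_per[OF y] z] by simp
      then have "(VV.nrm (x - y))\<^sup>2 \<le> 0" using VV_bounds(3)[OF d] z by simp
      then show "VV.nrm (x - y) = 0" by simp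
    qed
    show "HH.nrm h = 0" if h: "h \<in> HS" and o: "\<And>v. v \<in> VS \<Longrightarrow> L2_inner a h v = 0" for h
    proof -
      have "fcoeff h m i = 0" for m i
      proof -
        have "mode m (fcoeff h m) \<in> VS" using h by (intro mode_VS(1)) (simp add: HS_iff)
        then have "(\<Sum>i\<in>UNIV. fcoeff h m i * cnj (fcoeff h m i)) = 0" using o inner_mode[OF HS_Q[OF h]] by metis
        then have "Re (\<Sum>i\<in>UNIV. fcoeff h m i * cnj (fcoeff h m i)) = 0" by simp
        then have "(\<Sum>i\<in>UNIV. (cmod (fcoeff h m i))\<^sup>2) = 0"
          by (simp only: complex_norm_square[symmetric] of_real_sum[symmetric] Re_complex_of_real)
        then show ?thesis by (simp add: sum_nonneg_eq_0_iff)
      qed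
      then show ?thesis using null_fcoeff[OF HS_Q[OF h]] by blast
    qed
    show "\<exists>f. (\<forall>k::nat. f k \<in> VS \<and> HH.nrm (f k) \<noteq> 0) \<and> (\<forall>j k. j \<noteq> k \<longrightarrow> L2_inner a (f j) (f k) = 0)"
    proof -
      define M where "M k = (\<lambda>i::3. int k)" for k :: nat
      obtain c where c: "\<And>k. (\<Sum>j\<in>UNIV. of_real (wavevec \<xi> (M k) j) * c k j) = 0" "\<And>k. \<exists>i. c k i \<noteq> (0::complex)"
        using transversal_exists[of "wavevec \<xi> (M _)"] by metis
      have "Q.nrm (mode (M k) (c k)) \<noteq> 0" for k
        using null_fcoeff[OF per_Q[OF mode_per]] c(2)[of k] by (auto simp: fcoeff_mode)
      moreover have "L2_inner a (mode (M j) (c j)) (mode (M k) (c k)) = 0" if "j \<noteq> k" for j k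
        unfolding inner_mode[OF per_Q[OF mode_per]] fcoeff_mode using that by (auto simp: M_def fun_eq_iff)
      ultimately show ?thesis using mode_VS(1)[OF c(1)] by (intro exI[of _ "\<lambda>k. mode (M k) (c k)"]) auto
    qed
  qed
qed

end

section \<open>Regularity, Garding inequality and spectrum\<close>

context photonic
begin

lemma weak_pd_of_coeffs:
  assumes v: "v \<in> L2_per a" and w: "w \<in> L2_per a"
    and c: "\<And>m i. fcoeff w m i = \<i> * of_real (dual_vec m $ j) * fcoeff v m i"
  shows "w \<in> L2_loc \<and> is_weak_pd j v w" "L2_norm a (weak_pd j v) = Q.nrm w"
proof -
  show 1: "w \<in> L2_loc \<and> is_weak_pd j v w" using weak_pd_iff[OF v w] c w by (simp add: L2_per_def)
  have s: "weak_pd j v \<in> L2_loc \<and> is_weak_pd j v (weak_pd j v)"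
    unfolding weak_pd_def by (rule someI[of _ w]) (rule 1)
  have eq: "AE x in lebesgue. weak_pd j v x = w x"
  proof (rule distributions_determine)
    show "reg (weak_pd j v) i \<simeq> reg w i" for i
      using s 1 unfolding is_weak_pd_def distrib_eq_def by metis
  qed (use s 1 in auto)
  have p: "weak_pd j v \<in> L2_per a"
  proof -
    have "AE x in lebesgue. weak_pd j v (x + lattice_vec k) = weak_pd j v x" for k
      using eq AE_translate[OF eq, of "lattice_vec k"] per_shift[OF w, of k] by eventually_elim simp
    then show ?thesis using s by (auto simp: L2_per_def lattice_eq)
  qed
  have "Q.nrm (weak_pd j v - w) = 0" using per_null[OF p w] eq by simp
  then have "Q.nrm (weak_pd j v) = Q.nrm w" using Q.nrm_cong per_Q p w by blast
  then show "L2_norm a (weak_pd j v) = Q.nrm w" by (simp add: Qnrm)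
qed

lemma dual_vec_wavevec_sq: "(norm (dual_vec m))\<^sup>2 \<le> 2 * wavevec_sq \<xi> m + 2 * (norm \<xi>)\<^sup>2"
proof -
  have "(norm (dual_vec m))\<^sup>2 \<le> (norm (dual_vec m + \<xi>) + norm \<xi>)\<^sup>2"
    using norm_triangle_ineq4[of "dual_vec m + \<xi>" \<xi>] by (intro power_mono) auto
  also have "\<dots> \<le> 2 * (norm (dual_vec m + \<xi>))\<^sup>2 + 2 * (norm \<xi>)\<^sup>2"
    using sum_squares_bound[of "norm (dual_vec m + \<xi>)" "norm \<xi>"] by (simp add: power2_sum)
  finally show ?thesis by (simp add: wavevec_sq_norm)
qed

lemma norm_dual_vec: "(norm (dual_vec m))\<^sup>2 = (\<Sum>j\<in>UNIV. (dual_vec m $ j)\<^sup>2)"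
  by (simp add: norm_vec_def L2_set_def sum_nonneg)

text \<open>The candidate coefficients are square summable because \<open>|g|\<^sup>2 \<le> 2 |g + \<xi>|\<^sup>2 + 2 |\<xi>|\<^sup>2\<close> and the
curl accounts for the first term.\<close>

lemma weak_pd_exists:
  assumes v: "v \<in> VS"
  obtains w where "w \<in> L2_per a" "\<And>m i. fcoeff w m i = \<i> * of_real (dual_vec m $ j) * fcoeff v m i"
proof -
  have g: "((\<lambda>m. 2 * mode_energy (curl v) m + 2 * (norm \<xi>)\<^sup>2 * mode_energy v m) has_sum 2 * (Q.nrm (curl v))\<^sup>2 + 2 * (norm \<xi>)\<^sup>2 * (Q.nrm v)\<^sup>2) UNIV"
    by (intro has_sum_add has_sum_cmult_right norm_modes curl_Q VS_Q v)
  have le: "(dual_vec m $ j)\<^sup>2 * mode_energy v m \<le> 2 * mode_energy (curl v) m + 2 * (norm \<xi>)\<^sup>2 * mode_energy v m" for m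
  proof -
    have "(dual_vec m $ j)\<^sup>2 \<le> (norm (dual_vec m))\<^sup>2" unfolding norm_dual_vec by (rule member_le_sum) auto
    also have "\<dots> \<le> 2 * wavevec_sq \<xi> m + 2 * (norm \<xi>)\<^sup>2" by (rule dual_vec_wavevec_sq)
    finally have "(dual_vec m $ j)\<^sup>2 * mode_energy v m \<le> (2 * wavevec_sq \<xi> m + 2 * (norm \<xi>)\<^sup>2) * mode_energy v m"
      using mode_energy_nonneg by (intro mult_right_mono)
    then show ?thesis unfolding curl_modes[OF v] by (simp add: algebra_simps)
  qed
  have s: "(\<lambda>m. (dual_vec m $ j)\<^sup>2 * mode_energy v m) summable_on UNIV"
    by (rule summable_on_comparison_test[OF has_sum_imp_summable[OF g]]) (use le mode_energy_nonneg in auto)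
  have "(\<lambda>p. (cmod (\<i> * of_real (dual_vec (fst p) $ j) * fcoeff v (fst p) (snd p)))\<^sup>2) summable_on (Sigma UNIV (\<lambda>_. UNIV))"
  proof (rule summable_on_SigmaI[OF _ s])
    fix m
    have "((\<lambda>i. (cmod (\<i> * of_real (dual_vec m $ j) * fcoeff v m i))\<^sup>2) has_sum (\<Sum>i\<in>UNIV. (cmod (\<i> * of_real (dual_vec m $ j) * fcoeff v m i))\<^sup>2)) UNIV"
      by (rule has_sum_finite) simp
    moreover have "(\<Sum>i\<in>UNIV. (cmod (\<i> * of_real (dual_vec m $ j) * fcoeff v m i))\<^sup>2) = (dual_vec m $ j)\<^sup>2 * mode_energy v m"
      unfolding mode_energy_def by (simp add: norm_mult power_mult_distrib sum_distrib_left)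
    ultimately show "((\<lambda>i. (cmod (\<i> * of_real (dual_vec (fst (m, i)) $ j) * fcoeff v (fst (m, i)) (snd (m, i))))\<^sup>2) has_sum (dual_vec m $ j)\<^sup>2 * mode_energy v m) UNIV"
      by simp
  qed auto
  then have "(\<lambda>p. (cmod (\<i> * of_real (dual_vec (fst p) $ j) * fcoeff v (fst p) (snd p)))\<^sup>2) summable_on UNIV" by simp
  from from_coeffs[OF this] show thesis using that by auto
qed

lemma V_subset_H1: "VS \<subseteq> H1_per a"
proof
  fix v assume v: "v \<in> VS"
  have p: "v \<in> L2_per a" using v VS_HS HS_per by blast
  have "\<exists>w\<in>L2_loc. is_weak_pd j v w" for j
    using weak_pd_exists[OF v, of j] weak_pd_of_coeffs(1)[OF p] by metis
  then show "v \<in> H1_per a" using p by (auto simp: H1_per_def H1_loc_def L2_per_def)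
qed

lemma H1_norm_modes:
  assumes v: "v \<in> VS"
  shows "((\<lambda>m. (1 + (norm (dual_vec m))\<^sup>2) * mode_energy v m) has_sum (H1_norm a v)\<^sup>2) UNIV"
proof -
  have p: "v \<in> L2_per a" using v VS_HS HS_per by blast
  have j: "((\<lambda>m. (dual_vec m $ j)\<^sup>2 * mode_energy v m) has_sum (L2_norm a (weak_pd j v))\<^sup>2) UNIV" for j
  proof -
    obtain w where w: "w \<in> L2_per a" "\<And>m i. fcoeff w m i = \<i> * of_real (dual_vec m $ j) * fcoeff v m i"
      using weak_pd_exists[OF v, of j] by blast
    have "mode_energy w = (\<lambda>m. (dual_vec m $ j)\<^sup>2 * mode_energy v m)"
      unfolding mode_energy_def w(2) by (simp add: norm_mult power_mult_distrib sum_distrib_left)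
    then show ?thesis using norm_modes[OF per_Q[OF w(1)]] weak_pd_of_coeffs(2)[OF p w] by simp
  qed
  have "((\<lambda>m. mode_energy v m + ((dual_vec m $ 1)\<^sup>2 * mode_energy v m + (dual_vec m $ 2)\<^sup>2 * mode_energy v m + (dual_vec m $ 3)\<^sup>2 * mode_energy v m)) has_sum
     (Q.nrm v)\<^sup>2 + ((L2_norm a (weak_pd 1 v))\<^sup>2 + (L2_norm a (weak_pd 2 v))\<^sup>2 + (L2_norm a (weak_pd 3 v))\<^sup>2)) UNIV"
    by (intro has_sum_add j norm_modes VS_Q v)
  moreover have "(H1_norm a v)\<^sup>2 = (Q.nrm v)\<^sup>2 + ((L2_norm a (weak_pd 1 v))\<^sup>2 + (L2_norm a (weak_pd 2 v))\<^sup>2 + (L2_norm a (weak_pd 3 v))\<^sup>2)"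
    unfolding H1_norm_def sum3 Qnrm by simp
  moreover have "mode_energy v m + ((dual_vec m $ 1)\<^sup>2 * mode_energy v m + (dual_vec m $ 2)\<^sup>2 * mode_energy v m + (dual_vec m $ 3)\<^sup>2 * mode_energy v m) = (1 + (norm (dual_vec m))\<^sup>2) * mode_energy v m" for m
    unfolding norm_dual_vec sum3 by (simp only: distrib_right mult_1)
  ultimately show ?thesis by simp
qed

text \<open>The inequality holds mode by mode, with \<open>|\<xi>|\<^sup>2 + 1/2\<close> in place of \<open>3 |\<xi>|\<^sup>2 + 1\<close>, for the curl without
weight; the factor \<open>N\<^sup>2\<close> compensates the weight \<open>1 / n\<^sup>2\<close>.\<close>

lemma garding:
  assumes v: "v \<in> VS"
  shows "N\<^sup>2 * Re (form v v) + (3 * (norm \<xi>)\<^sup>2 + 1) * (L2_norm a v)\<^sup>2 \<ge> 1/2 * (H1_norm a v)\<^sup>2"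
proof -
  have "1/2 * (H1_norm a v)\<^sup>2 \<le> (Q.nrm (curl v))\<^sup>2 + (3 * (norm \<xi>)\<^sup>2 + 1) * (Q.nrm v)\<^sup>2"
  proof (rule has_sum_mono[OF has_sum_cmult_right[OF H1_norm_modes[OF v]]
        has_sum_add[OF norm_modes[OF curl_Q[OF v]] has_sum_cmult_right[OF norm_modes[OF VS_Q[OF v]]]]])
    fix m
    have "1/2 * (1 + (norm (dual_vec m))\<^sup>2) \<le> wavevec_sq \<xi> m + (3 * (norm \<xi>)\<^sup>2 + 1)"
    proof -
      have "1/2 * (1 + g) \<le> k + (3 * x + 1)" if "g \<le> 2 * k + 2 * x" "0 \<le> x" for g k x :: real
        using that by (simp add: field_simps)
      then show ?thesis using dual_vec_wavevec_sq[of m] zero_le_power2[of "norm \<xi>"] by blast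
    qed
    then have "1/2 * (1 + (norm (dual_vec m))\<^sup>2) * mode_energy v m \<le> (wavevec_sq \<xi> m + (3 * (norm \<xi>)\<^sup>2 + 1)) * mode_energy v m"
      using mode_energy_nonneg by (rule mult_right_mono)
    then show "1/2 * ((1 + (norm (dual_vec m))\<^sup>2) * mode_energy v m) \<le> mode_energy (curl v) m + (3 * (norm \<xi>)\<^sup>2 + 1) * mode_energy v m"
      unfolding curl_modes[OF v] by (simp only: distrib_right mult.assoc)
  qed
  then show ?thesis using form_bounds(1)[OF v] unfolding Qnrm by linarith
qed

lemma L_op_eq: "L_op a n \<xi> = C.G"
  unfolding L_op_def form_operator_def C.G_def ..

text \<open>The curl is formally self-adjoint, so by Parseval's identity the strong equation implies the weak one.
Conversely, at each mode the difference \<open>D\<close> of the two sides is orthogonal to the wave vector, hence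
the plane wave with amplitude \<open>D\<close> is an admissible test field and shows that \<open>D\<close> vanishes.\<close>

lemma L_op_strong:
  "C.G = {(u, f). u \<in> VS \<and> f \<in> HS \<and> is_wcurl \<xi> (\<lambda>x. (1 / (n x)\<^sup>2) *\<^sub>R curl u x) f}"
proof -
  have "(\<forall>v\<in>VS. form u v = L2_inner a f v) \<longleftrightarrow> is_wcurl \<xi> (weight (curl u)) f" if u: "u \<in> VS" and f: "f \<in> HS" for u f
  proof -
    let ?p = "weight (curl u)"
    have p: "?p \<in> L2_per a" using weight_per curl(1)[OF u] by blast
    have fp: "f \<in> L2_per a" using HS_per[OF f] .
    have iff: "is_wcurl \<xi> ?p f \<longleftrightarrow> (\<forall>m i. fcoeff f m i = crossc (wavevec \<xi> m) (fcoeff ?p m) i)"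
      using wcurl_iff[OF p fp] by (simp add: crossc_def)
    show ?thesis
    proof
      assume "is_wcurl \<xi> ?p f"
      then have e: "fcoeff f m i = crossc (wavevec \<xi> m) (fcoeff ?p m) i" for m i using iff by blast
      show "\<forall>v\<in>VS. form u v = L2_inner a f v"
      proof
        fix v assume v: "v \<in> VS"
        have 1: "((\<lambda>m. \<Sum>i\<in>UNIV. fcoeff ?p m i * cnj (fcoeff (curl v) m i)) has_sum form u v) UNIV"
          unfolding form_eq by (rule parseval_modes[OF per_Q[OF p] curl_Q[OF v]])
        have 2: "((\<lambda>m. \<Sum>i\<in>UNIV. fcoeff f m i * cnj (fcoeff v m i)) has_sum L2_inner a f v) UNIV"
          by (rule parseval_modes[OF per_Q[OF fp] VS_Q[OF v]])
        show "form u v = L2_inner a f v"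
          using 1 2 unfolding curl(2)[OF v] crossc_adjoint e by (rule has_sum_unique)
      qed
    next
      assume w: "\<forall>v\<in>VS. form u v = L2_inner a f v"
      have "fcoeff f m i = crossc (wavevec \<xi> m) (fcoeff ?p m) i" for m i
      proof -
        define D where "D i = crossc (wavevec \<xi> m) (fcoeff ?p m) i - fcoeff f m i" for i
        have div: "(\<Sum>j\<in>UNIV. of_real (wavevec \<xi> m j) * D j) = 0"
          unfolding D_def right_diff_distrib sum_subtractf div_crossc using f by (simp add: HS_iff)
        note md = mode_VS[OF div]
        have "form u (mode m D) = L2_inner a ?p (mode m (crossc (wavevec \<xi> m) D))"
          unfolding form_eq using md p per_Q mode_per curl_Q by (intro Q.null_ip_diff_right) auto
        also have "\<dots> = (\<Sum>i\<in>UNIV. crossc (wavevec \<xi> m) (fcoeff ?p m) i * cnj (D i))"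
          unfolding inner_mode[OF per_Q[OF p]] crossc_adjoint ..
        finally have 1: "form u (mode m D) = (\<Sum>i\<in>UNIV. crossc (wavevec \<xi> m) (fcoeff ?p m) i * cnj (D i))" .
        have 2: "L2_inner a f (mode m D) = (\<Sum>i\<in>UNIV. fcoeff f m i * cnj (D i))"
          by (rule inner_mode[OF per_Q[OF fp]])
        have "(\<Sum>i\<in>UNIV. D i * cnj (D i)) = form u (mode m D) - L2_inner a f (mode m D)"
          unfolding 1 2 by (subst (1) D_def) (simp add: left_diff_distrib sum_subtractf)
        then have "Re (\<Sum>i\<in>UNIV. D i * cnj (D i)) = 0" using w md(1) by simp
        then have "(\<Sum>i\<in>UNIV. (cmod (D i))\<^sup>2) = 0"
          by (simp only: complex_norm_square[symmetric] of_real_sum[symmetric] Re_complex_of_real)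
        then have "D i = 0" by (simp add: sum_nonneg_eq_0_iff)
        then show ?thesis by (simp add: D_def)
      qed
      then show "is_wcurl \<xi> ?p f" using iff by blast
    qed
  qed
  then show ?thesis unfolding C.G_def weight_eq by blast
qed

lemma C_null: assumes "u \<in> HS" "v \<in> HS" shows "Q.nrm (u - v) = 0 \<longleftrightarrow> (AE x in lebesgue. u x = v x)"
  using per_null HS_per assms by blast

lemma L2_norm_diff: "L2_norm a (\<lambda>x. u x - v x) = Q.nrm (u - v)"
  unfolding Qnrm fun_diff_def ..

lemma self_adjoint_G: "self_adjoint a HS C.G"
  unfolding self_adjoint_def
proof (intro conjI)
  show "linear_operator HS C.G"
    unfolding linear_operator_def
  proof (intro conjI)
    show "C.G \<subseteq> HS \<times> HS" using C.G_mem VS_HS by auto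
    show "((\<lambda>x. 0), (\<lambda>x. 0)) \<in> C.G" using C.G_zero by (simp add: zero_fun_def)
    show "\<forall>(u, f)\<in>C.G. \<forall>(v, g)\<in>C.G. \<forall>c. (\<lambda>x. c *s u x + v x, \<lambda>x. c *s f x + g x) \<in> C.G"
      using C.G_linear unfolding cscale_def plus_fun_def by blast
    show "\<forall>(u, f)\<in>C.G. \<forall>(v, g)\<in>C.G. (AE x in lebesgue. u x = v x) \<longrightarrow> (AE x in lebesgue. f x = g x)"
    proof -
      have "AE x in lebesgue. f x = g x"
        if uf: "(u, f) \<in> C.G" "(v, g) \<in> C.G" and eq: "AE x in lebesgue. u x = v x" for u f v g
      proof -
      have m: "u \<in> HS" "v \<in> HS" "f \<in> HS" "g \<in> HS" using C.G_mem uf VS_HS by blast+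
      have "Q.nrm (u - v) = 0" using C_null[OF m(1,2)] eq by blast
      then have "Q.nrm (f - g) = 0" using C.G_functional[OF uf] by blast
      then show "AE x in lebesgue. f x = g x" using C_null[OF m(3,4)] by blast
      qed
      then show ?thesis by blast
    qed
  qed
  show "densely_defined a HS C.G"
    unfolding densely_defined_def L2_norm_diff using C.G_domain_dense by blast
  show "adjoint_op a HS C.G = C.G"
  proof (intro equalityI subsetI)
    fix p assume "p \<in> adjoint_op a HS C.G"
    then obtain v g where p: "p = (v, g)" "v \<in> HS" "g \<in> HS" "\<forall>(u, f)\<in>C.G. L2_inner a f v = L2_inner a u g"
      unfolding adjoint_op_def by blast
    then show "p \<in> C.G" using C.G_adjoint[OF p(2,3)] by blast
  next
    fix p assume "p \<in> C.G"
    then obtain v g where p: "p = (v, g)" "(v, g) \<in> C.G" by (cases p) auto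
    then have "v \<in> HS" "g \<in> HS" using C.G_mem VS_HS by blast+
    moreover have "\<forall>(u, f)\<in>C.G. L2_inner a f v = L2_inner a u g" using C.G_symmetric p(2) by blast
    ultimately show "p \<in> adjoint_op a HS C.G" unfolding adjoint_op_def p(1) by blast
  qed
qed

lemma eig_HS: "u \<in> C.eig z \<Longrightarrow> u \<in> HS" unfolding C.eig_def using VS_HS by blast

lemma eigenspace_eq: "eigenspace C.G z = C.eig z"
proof -
  have "(AE x in lebesgue. f x = z *s u x) \<longleftrightarrow> Q.nrm (f - cscale z u) = 0" if "(u, f) \<in> C.G" for u f
  proof -
    have "u \<in> HS" "f \<in> HS" using C.G_mem[OF that] VS_HS by blast+
    then show ?thesis using C_null[of f "cscale z u"] C.H_scale[of u z] by (simp add: cscale_def)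
  qed
  then show ?thesis unfolding eigenspace_def using C.eig_G' by blast
qed

lemma is_eigenvalue_iff: "is_eigenvalue C.G z \<longleftrightarrow> (\<exists>u\<in>C.eig z. Q.nrm u \<noteq> 0)"
proof -
  have "(AE x in lebesgue. u x = 0) \<longleftrightarrow> Q.nrm u = 0" if "u \<in> C.eig z" for u
    using C_null[OF eig_HS[OF that] C.H_zero] by simp
  then show ?thesis unfolding is_eigenvalue_def eigenspace_eq by blast
qed

lemma is_eigenvalue_eigenvalues: "is_eigenvalue C.G z \<longleftrightarrow> z \<in> complex_of_real ` C.eigenvalues"
proof
  assume "is_eigenvalue C.G z"
  then obtain u where u: "u \<in> C.eig z" "Q.nrm u \<noteq> 0" using is_eigenvalue_iff by blast
  have z: "z = of_real (Re z)" using C.eig_real(1)[OF u] .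
  have "Re z \<in> C.eigenvalues" unfolding C.eigenvalues_def using u z by auto
  then show "z \<in> complex_of_real ` C.eigenvalues" using z by blast
next
  assume "z \<in> complex_of_real ` C.eigenvalues"
  then show "is_eigenvalue C.G z" unfolding is_eigenvalue_iff C.eigenvalues_def by blast
qed

lemma resolvent_iff: "z \<in> resolvent_set a HS C.G \<longleftrightarrow> \<not> is_eigenvalue C.G z"
proof
  assume "z \<in> resolvent_set a HS C.G"
  then obtain K where K: "\<forall>(u, f)\<in>C.G. L2_norm a u \<le> K * L2_norm a (\<lambda>x. f x - z *s u x)"
    unfolding resolvent_set_def by blast
  have "Q.nrm u = 0" if u: "u \<in> C.eig z" for u
  proof -
    have "(u, cscale z u) \<in> C.G" using u C.eig_G by blast
    then have "Q.nrm u \<le> K * L2_norm a (\<lambda>x. cscale z u x - z *s u x)" using K unfolding Qnrm by blast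
    also have "L2_norm a (\<lambda>x. cscale z u x - z *s u x) = 0" by (simp add: cscale_def L2_norm_def set_lebesgue_integral_def)
    finally show ?thesis using Q.nrm_nonneg[OF HS_Q[OF eig_HS[OF u]]] by simp
  qed
  then show "\<not> is_eigenvalue C.G z" unfolding is_eigenvalue_iff by blast
next
  assume "\<not> is_eigenvalue C.G z"
  then have ne: "\<And>u. u \<in> C.eig z \<Longrightarrow> Q.nrm u = 0" unfolding is_eigenvalue_iff by blast
  have sub: "(\<lambda>x. f x - z *s u x) = f - cscale z u" for f u by (auto simp: cscale_def)
  show "z \<in> resolvent_set a HS C.G"
    unfolding resolvent_set_def
  proof (intro CollectI conjI ballI)
    fix h assume "h \<in> HS"
    then obtain u f where uf: "(u, f) \<in> C.G" "f - cscale z u = h" using C.resolvent_onto[OF ne] by blast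
    have "AE x in lebesgue. f x - z *s u x = h x" using fun_cong[OF uf(2)] by (simp add: cscale_def)
    then show "\<exists>(u, f)\<in>C.G. AE x in lebesgue. f x - z *s u x = h x" using uf(1) by blast
  next
    show "\<exists>K. \<forall>(u, f)\<in>C.G. L2_norm a u \<le> K * L2_norm a (\<lambda>x. f x - z *s u x)"
      unfolding sub Qnrm[symmetric] using C.resolvent_bounded[OF ne] by blast
  qed
qed

lemma spectrum_eq: "op_spectrum a HS C.G = complex_of_real ` C.eigenvalues"
  unfolding op_spectrum_def using resolvent_iff is_eigenvalue_eigenvalues by blast

lemma finite_multiplicity_G: "finite_multiplicity C.G z"
proof -
  obtain S where S: "finite S" "S \<subseteq> C.eig z"
    "\<And>u. u \<in> C.eig z \<Longrightarrow> \<exists>c. Q.nrm (u - (\<Sum>s\<in>S. cscale (c s) s)) = 0"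
    using C.finite_multiplicity_abs by blast
  have app: "(\<Sum>s\<in>S. cscale (c s) s) x = (\<Sum>s\<in>S. c s *s s x)" for c x
    using S(1) by (induction S rule: finite_induct) (auto simp: cscale_def)
  have "\<exists>c. AE x in lebesgue. u x = (\<Sum>s\<in>S. c s *s s x)" if u: "u \<in> C.eig z" for u
  proof -
    obtain c where c: "Q.nrm (u - (\<Sum>s\<in>S. cscale (c s) s)) = 0" using S(3)[OF u] by blast
    have "(\<Sum>s\<in>S. cscale (c s) s) \<in> HS" using S(2) eig_HS by (intro C.H_sum C.H_scale) blast
    then have "AE x in lebesgue. u x = (\<Sum>s\<in>S. cscale (c s) s) x" using C_null eig_HS[OF u] c by blast
    then show ?thesis unfolding app by blast
  qed
  then show ?thesis unfolding finite_multiplicity_def eigenspace_eq using S(1,2) by blast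
qed

text \<open>Only finitely many eigenvalues lie below any bound, so a ball around one of them contains finitely many.\<close>

lemma discrete_eigenvalues: "discrete (complex_of_real ` C.eigenvalues)"
proof (rule discreteI)
  let ?S = "complex_of_real ` C.eigenvalues"
  fix z assume z: "z \<in> ?S"
  then obtain r where r: "z = of_real r" "r \<in> C.eigenvalues" by auto
  have "?S \<inter> ball z 1 \<subseteq> complex_of_real ` {s \<in> C.eigenvalues. s \<le> r + 1}"
  proof
    fix y assume "y \<in> ?S \<inter> ball z 1"
    then obtain s where s: "y = of_real s" "s \<in> C.eigenvalues" "dist z y < 1" by auto
    have "dist r s < 1" using s(3) unfolding r s by simp
    then have "s \<le> r + 1" by (auto simp: dist_real_def)
    then show "y \<in> complex_of_real ` {s \<in> C.eigenvalues. s \<le> r + 1}" using s by auto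
  qed
  then have fin: "finite (?S \<inter> ball z 1)" using C.finite_eigenvalues_below by (meson finite_imageI finite_subset)
  define T where "T = ball z 1 - (?S \<inter> ball z 1 - {z})"
  have "open T" unfolding T_def using fin by (intro open_Diff finite_imp_closed) auto
  moreover have "T \<inter> ?S = {z}" using z unfolding T_def by auto
  ultimately show "z isolated_in ?S" using z unfolding isolated_in_def by blast
qed

lemma discrete_spectrum_G: "discrete_spectrum a HS C.G"
  unfolding discrete_spectrum_def spectrum_eq using discrete_eigenvalues finite_multiplicity_G is_eigenvalue_eigenvalues by blast

end

text \<open>The essential supremum is not \<open>-\<infinity>\<close> since the space is not a null set; this makes the conversion to a
real number harmless.\<close>

lemma Linf_AE: assumes "f \<in> Linf" shows "AE x in lebesgue. \<bar>f x\<bar> \<le> Linf_norm f"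
proof -
  let ?s = "esssup lebesgue (\<lambda>x. ereal \<bar>f x\<bar>)"
  have ae: "AE x in lebesgue. ereal \<bar>f x\<bar> \<le> ?s" by (rule esssup_AE)
  have "?s \<noteq> -\<infinity>"
  proof
    assume "?s = -\<infinity>"
    then have "AE x in lebesgue. x \<notin> (UNIV :: r3 set)" using ae by simp
    then have "(UNIV :: r3 set) \<in> null_sets lebesgue"
      by (rule AE_iff_null_sets[THEN iffD2, rotated]) simp
    then have "negligible (UNIV :: r3 set)" by (simp add: negligible_iff_null_sets)
    then show False using open_not_negligible[of "UNIV :: r3 set"] by simp
  qed
  then have "ereal (Linf_norm f) = ?s" using assms unfolding Linf_norm_def Linf_def
    by (cases ?s) auto
  then show ?thesis using ae by (metis (mono_tags, lifting) eventually_mono ereal_less_eq(3))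
qed

lemma Linf_I: assumes "f \<in> borel_measurable lebesgue" "AE x in lebesgue. \<bar>f x\<bar> \<le> B" shows "f \<in> Linf"
proof -
  have "esssup lebesgue (\<lambda>x. ereal \<bar>f x\<bar>) \<le> ereal B"
    by (rule esssup_I) (use assms in \<open>auto elim: eventually_mono\<close>)
  then have "esssup lebesgue (\<lambda>x. ereal \<bar>f x\<bar>) < \<infinity>" using le_less_trans by fastforce
  then show ?thesis using assms(1) by (simp add: Linf_def)
qed

theorem theorem3p1:
  fixes a :: "3 \<Rightarrow> real^3"
    and \<mu> \<epsilon> n :: "real^3 \<Rightarrow> real"
    and \<mu>0 \<epsilon>0 :: real
    and \<xi> :: "real^3"
  assumes lattice_basis: "inj a" "independent (range a)"
    and mu: "\<And>x. \<mu> x = \<mu>0"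
    and eps_per: "\<And>x k. k \<in> lattice a \<Longrightarrow> \<epsilon> (x + k) = \<epsilon> x"
    and eps_pos: "\<And>x. \<epsilon> x > 0"
    and eps_Linf: "\<epsilon> \<in> Linf" "(\<lambda>x. inverse (\<epsilon> x)) \<in> Linf"
    and eps0: "\<epsilon>0 > 0"
    and n: "\<And>x. n x > 0" "\<And>x. \<epsilon> x = \<epsilon>0 * (n x)\<^sup>2"
    and xi: "\<xi> \<in> brillouin a"
  shows "V_space a \<xi> \<subseteq> H1_per a \<and>
    (\<forall>v\<in>V_space a \<xi>.
       a_form a n \<xi> v v \<in> \<real> \<and>
       (Linf_norm n)\<^sup>2 * Re (a_form a n \<xi> v v) + (3 * (norm \<xi>)\<^sup>2 + 1) * (L2_norm a v)\<^sup>2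
         \<ge> 1/2 * (H1_norm a v)\<^sup>2) \<and>
    self_adjoint a (H_space a \<xi>) (L_op a n \<xi>) \<and>
    L_op a n \<xi> =
      {(u, f). u \<in> V_space a \<xi> \<and> f \<in> H_space a \<xi> \<and>
               is_wcurl \<xi> (\<lambda>x. (1 / (n x)\<^sup>2) *\<^sub>R wcurl \<xi> u x) f} \<and>
    discrete_spectrum a (H_space a \<xi>) (L_op a n \<xi>) \<and>
    (\<exists>ev :: nat \<Rightarrow> real. inj ev \<and>
       (\<forall>j. ev j \<ge> 0 \<and> is_eigenvalue (L_op a n \<xi>) (complex_of_real (ev j))) \<and>
       op_spectrum a (H_space a \<xi>) (L_op a n \<xi>) = range (\<lambda>j. complex_of_real (ev j)))"
proof -
  obtain d where d: "lattice_cell a d" using dual_basis_exists[OF lattice_basis] by blast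
  interpret lattice_cell a d by (rule d)
  have n_eq: "n x = sqrt (\<epsilon> x / \<epsilon>0)" for x using n[of x] eps0 by (simp add: real_sqrt_unique less_imp_le)
  have em: "\<epsilon> \<in> borel_measurable lebesgue" using eps_Linf(1) by (simp add: Linf_def)
  have nm: "n \<in> borel_measurable lebesgue" unfolding n_eq[abs_def] using em by measurable
  have ub: "AE x in lebesgue. \<bar>n x\<bar> \<le> sqrt (Linf_norm \<epsilon> / \<epsilon>0)"
    using Linf_AE[OF eps_Linf(1)]
  proof eventually_elim
    fix x assume "\<bar>\<epsilon> x\<bar> \<le> Linf_norm \<epsilon>"
    then have "sqrt (\<epsilon> x / \<epsilon>0) \<le> sqrt (Linf_norm \<epsilon> / \<epsilon>0)"
      using eps0 by (intro real_sqrt_le_mono divide_right_mono) auto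
    then show "\<bar>n x\<bar> \<le> sqrt (Linf_norm \<epsilon> / \<epsilon>0)" using n(1)[of x] n_eq[of x] by simp
  qed
  have up: "AE x in lebesgue. n x \<le> Linf_norm n"
    using Linf_AE[OF Linf_I[OF nm ub]] by eventually_elim simp
  define K where "K = max 1 (Linf_norm (\<lambda>x. inverse (\<epsilon> x)))"
  have K: "K > 0" by (simp add: K_def)
  have low: "AE x in lebesgue. sqrt (1 / (K * \<epsilon>0)) \<le> n x"
    using Linf_AE[OF eps_Linf(2)]
  proof eventually_elim
    fix x assume "\<bar>inverse (\<epsilon> x)\<bar> \<le> Linf_norm (\<lambda>x. inverse (\<epsilon> x))"
    then have "inverse (\<epsilon> x) \<le> K" unfolding K_def by linarith
    then have "1 / K \<le> \<epsilon> x" using eps_pos[of x] K by (simp add: field_simps)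
    then have "1 / K / \<epsilon>0 \<le> \<epsilon> x / \<epsilon>0" using eps0 by (intro divide_right_mono) auto
    then show "sqrt (1 / (K * \<epsilon>0)) \<le> n x" unfolding n_eq[of x] by (intro real_sqrt_le_mono) simp
  qed
  have per: "n (x + lattice_vec k) = n x" for x k
    unfolding n_eq using eps_per[of "lattice_vec k" x] by (simp add: lattice_eq)
  interpret photonic a d n \<xi> "Linf_norm n" "sqrt (1 / (K * \<epsilon>0))"
    by unfold_locales (use n(1) per nm up low K eps0 in auto)
  obtain ev :: "nat \<Rightarrow> real" where ev: "inj ev" "range ev = C.eigenvalues" using C.eigenvalues_enumeration by blast
  have evj: "ev j \<in> C.eigenvalues" for j using ev(2) by blast
  show ?thesis
    unfolding L_op_eq
  proof (intro conjI ballI)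
    show "VS \<subseteq> H1_per a" by (rule V_subset_H1)
    show "form v v \<in> \<real>" if "v \<in> VS" for v using form_bounds(3)[OF that] by (simp add: complex_is_Real_iff)
    show "(Linf_norm n)\<^sup>2 * Re (form v v) + (3 * (norm \<xi>)\<^sup>2 + 1) * (L2_norm a v)\<^sup>2 \<ge> 1/2 * (H1_norm a v)\<^sup>2"
      if "v \<in> VS" for v by (rule garding[OF that])
    show "self_adjoint a HS C.G" by (rule self_adjoint_G)
    show "C.G = {(u, f). u \<in> VS \<and> f \<in> HS \<and> is_wcurl \<xi> (\<lambda>x. (1 / (n x)\<^sup>2) *\<^sub>R wcurl \<xi> u x) f}" by (rule L_op_strong)
    show "discrete_spectrum a HS C.G" by (rule discrete_spectrum_G)
    show "\<exists>ev :: nat \<Rightarrow> real. inj ev \<and> (\<forall>j. ev j \<ge> 0 \<and> is_eigenvalue C.G (complex_of_real (ev j))) \<and>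
       op_spectrum a HS C.G = range (\<lambda>j. complex_of_real (ev j))"
    proof (intro exI[of _ ev] conjI allI)
      show "inj ev" by (rule ev(1))
      show "ev j \<ge> 0" for j using C.eigenvalues_nonneg[OF evj] .
      show "is_eigenvalue C.G (complex_of_real (ev j))" for j using is_eigenvalue_eigenvalues evj by blast
      show "op_spectrum a HS C.G = range (\<lambda>j. complex_of_real (ev j))"
        unfolding spectrum_eq ev(2)[symmetric] by (simp add: image_image)
    qed
  qed
qed

end
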